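(* Let $z_j^{(2n)}\in\mathbb{C}$, $n>0$, $j=0,\ldots,2n$, be a family of (not necessarily distinct) interpolation points, put $\rho_n=\max\{|z_j^{(2n)}|: j=0,\ldots,2n\}$, and assume that there are constants $0<\alpha\le 1$ and $c>0$, independent of $n$, such that $\rho_n\le c\,n^{1-\alpha}$ for all $n\in\mathbb{N}$. Let $\omega_{2n+1}(z)=\prod_{j=0}^{2n}(z-z_j^{(2n)})$. For each $n$, let $p_n,q_n$ be polynomials, not both identically zero, with $\deg p_n\le n$, $\deg q_n\le n$ and $$p_n(z)e^{-z/2}+q_n(z)e^{z/2}=\mathcal{O}(\omega_{2n+1}(z)),\qquad z\to z_j^{(2n)},\quad j=0,\ldots,2n.$$ Then the following three assertions hold. (i) All the zeros and poles of $r_n=p_n/q_n$ tend to infinity as $n$ becomes large and, more precisely, for $n$ large no zeros and poles of $r_n$ lie in the disk $\{z:|z|\le\rho_n\}$. In particular, $r_n$ is a rational interpolant to $-e^z$ satisfying $$e^z+r_n(z)=\mathcal{O}(\omega_{2n+1}(z)),\qquad z\to z_j^{(2n)},\quad j=0,\ldots,2n.$$ (ii) As $n\to\infty$, $$p_n(z)\to -e^{z/2},\qquad q_n(z)\to e^{-z/2},\qquad r_n(z)\to -e^{z},$$ locally uniformly in $\mathbb{C}$, where the pair $(p_n,q_n)$ is normalized so that $q_n(0)=1$. (iii) For $n$ large, $$e^z+r_n(z)=(-1)^n\left(\frac{e\,c_n}{4n}\right)^{2n+1}\omega_{2n+1}(z)\,e^{z-1}\left(1+\mathcal{O}\left(\frac{1}{n^{\alpha}}\right)\right),$$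 locally uniformly in $\mathbb{C}$, where $c_n$ is a constant that depends only on the interpolation points $z_j^{(2n)}$ and such that $$c_n=1+\mathcal{O}\left(\left(\frac{\rho_n}{n}\right)^2\right),\qquad n\to\infty.$$ In particular, if $\rho_n=\epsilon(n)\sqrt{n}$ with $\epsilon(n)\to0$ as $n\to\infty$, then this can be rewritten as $$e^z+r_n(z)=(-1)^n\left(\frac{e}{4n}\right)^{2n+1}\omega_{2n+1}(z)\,e^{z-1}\left(1+\mathcal{O}(\epsilon^2(n))+\mathcal{O}\left(\frac{1}{n^{\alpha}}\right)\right).$$
   Context: Interpolation points may coincide. The condition $f(z)=\mathcal{O}(\omega_{2n+1}(z))$ as $z\to z_j^{(2n)}$, $j=0,\ldots,2n$, means that $f/\omega_{2n+1}$ is bounded near each $z_j^{(2n)}$, i.e. $f$ vanishes at each interpolation point to at least the order with which that point occurs in the list $z_0^{(2n)},\ldots,z_{2n}^{(2n)}$. Nontrivial pairs $(p_n,q_n)$ satisfying the degree and interpolation conditions always exist (they are solutions of a homogeneous linear system with $2n+1$ equations and $2n+2$ unknowns). The number $e$ in (iii) is Euler's number. *)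

theory Defs
  imports
    "HOL-Complex_Analysis.Complex_Analysis"
    "HOL-Library.Landau_Symbols"
begin

text \<open>
  A family of interpolation points is a function \<open>z\<close>, where \<open>z n j\<close> with \<open>j \<le> 2 * n\<close> are the
  points of level \<open>n > 0\<close>.  All other values of \<open>z\<close> are irrelevant.
\<close>

definition rho :: "(nat \<Rightarrow> nat \<Rightarrow> complex) \<Rightarrow> nat \<Rightarrow> real" where
  "rho z n = Max ((\<lambda>j. cmod (z n j)) ` {0..2 * n})"

definition omega :: "(nat \<Rightarrow> nat \<Rightarrow> complex) \<Rightarrow> nat \<Rightarrow> complex \<Rightarrow> complex" where
  "omega z n w = (\<Prod>j = 0..2 * n. (w - z n j))"

definition level_points :: "(nat \<Rightarrow> nat \<Rightarrow> complex) \<Rightarrow> nat \<Rightarrow> complex list" where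
  "level_points z n = map (z n) [0..<2 * n + 1]"

text \<open>
  The filter \<open>nhds (z n j)\<close>, rather than \<open>at (z n j)\<close>, includes the point \<open>z n j\<close> itself, so that
  the function is also required to take the value 0 there.  For continuous functions both
  filters give the same condition.
\<close>

definition big_O_omega :: "(nat \<Rightarrow> nat \<Rightarrow> complex) \<Rightarrow> nat \<Rightarrow> (complex \<Rightarrow> complex) \<Rightarrow> bool" where
  "big_O_omega z n f \<longleftrightarrow> (\<forall>j\<in>{0..2 * n}. f \<in> O[nhds (z n j)](omega z n))"

definition exp_interpolation_pair ::
    "(nat \<Rightarrow> nat \<Rightarrow> complex) \<Rightarrow> nat \<Rightarrow> complex poly \<Rightarrow> complex poly \<Rightarrow> bool" where
  "exp_interpolation_pair z n p q \<longleftrightarrow>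
     \<not> (p = 0 \<and> q = 0) \<and> degree p \<le> n \<and> degree q \<le> n \<and>
     big_O_omega z n (\<lambda>w. poly p w * exp (- w / 2) + poly q w * exp (w / 2))"

definition rat_fun :: "complex poly \<Rightarrow> complex poly \<Rightarrow> complex \<Rightarrow> complex" where
  "rat_fun p q w = poly p w / poly q w"

definition locally_uniform_limit ::
    "(nat \<Rightarrow> complex \<Rightarrow> complex) \<Rightarrow> (complex \<Rightarrow> complex) \<Rightarrow> bool" where
  "locally_uniform_limit f g \<longleftrightarrow> (\<forall>K. compact K \<longrightarrow> uniform_limit K f g sequentially)"

text \<open>
  \<open>F n w = A n w * (1 + O(err n))\<close> for \<open>n\<close> large, locally uniformly in \<open>w\<close>: the threshold for \<open>n\<close>
  and the constant in the \<open>O\<close>-term depend only on the compact set \<open>K\<close>.  In particular \<open>F n w\<close>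
  vanishes wherever \<open>A n w\<close> does.
\<close>

definition locally_uniform_asymp ::
    "(nat \<Rightarrow> complex \<Rightarrow> complex) \<Rightarrow> (nat \<Rightarrow> complex \<Rightarrow> complex) \<Rightarrow> (nat \<Rightarrow> real) \<Rightarrow> bool" where
  "locally_uniform_asymp F A err \<longleftrightarrow>
     (\<forall>K. compact K \<longrightarrow>
       (\<exists>M. \<forall>\<^sub>F n in sequentially. \<forall>w\<in>K.
          \<exists>\<delta>. cmod \<delta> \<le> M * err n \<and> F n w = A n w * (1 + \<delta>)))"

end

theory Submission
  imports Defs "HOL-Computational_Algebra.Computational_Algebra" "HOL-Real_Asymp.Real_Asymp"
begin

text \<open>
  Scale the nodes and the variable by \<open>n\<close>: then \<open>e^(n s) Q(s) + P(s) = \<Omega>(s) H(s)\<close> with \<open>H\<close> entire, \<open>\<Omega>\<close> the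
  node polynomial and nodes tending to 0. The degree and interpolation conditions say that the circle mean of
  \<open>Q(s) e^(n s y)/\<Omega>(s)\<close>, as a function of \<open>y\<close>, vanishes to order \<open>n\<close> at 0 and at 1, so it is
  \<open>(y (y - 1))^n u(y)\<close>. If \<open>Q\<close> and \<open>u\<close> have no zeros in certain fixed disks, a saddle point estimate gives the
  size of the mean on a large circle; by Borel-Caratheodory, \<open>ln u\<close> is nearly constant, and inverting the
  transform by two more saddle point estimates shows that \<open>Q\<close> has no zeros in the closed disk either and
  that \<open>H\<close> has none near 0. This property is therefore open and closed along the nodes \<open>t \<zeta>\<^sub>j\<close>,
  \<open>0 \<le> t \<le> 1\<close>, and it holds for the Pade approximant at \<open>t = 0\<close>.

  Zero-freeness implies uniqueness, so the normalized solution depends holomorphically on complex \<open>t\<close> in a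
  disk of radius proportional to \<open>n/\<rho>\<^sub>n\<close>. Schwarz-type estimates in \<open>t\<close>, starting from the explicit case \<open>t = 0\<close>,
  give \<open>Q(s) = exp (- n s/2 + \<dots>)\<close> and \<open>H(s) = H(0) exp (n s/2 + \<dots>)\<close>. The symmetry \<open>s \<mapsto> - s\<close> shows that
  \<open>ln H(0)\<close> has no linear term in \<open>t\<close>, which is where the exponent 2 in the error term of \<open>c\<^sub>n\<close> comes from.
\<close>

section \<open>Auxiliary facts of complex analysis\<close>

text \<open>The obstacle is a circle: a saddle point estimate of the mean requires control of the
  zeros of Q, which are what has to be located, and for arbitrary complex nodes no positivity or
  orthogonality locates them. Therefore the zero-free disks, for Q about s = 0 and for u about y =
  0, are assumed open and recovered closed with the same radii. All errors are measured against n in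
  the logarithm, so generous constants independent of n suffice. The three saddle points have
  explicit models: s^(-2n) e^(2ns) on a circle, a Taylor coefficient of the exponential; t^(2n)
  e^(-2nt) on a ray, a Gamma integrand; (t (1 - t))^n on [0, 1], a Beta integrand. The true
  integrands differ from them by a factor e^E with E small compared with the quadratic decay of the
  model. The finer orders come from the variable t: a logarithm of size O(n) on a disk of radius T,
  proportional to n/\<rho>, varies by O(n/T) = O(\<rho>) between t = 0 and t = 1, and by O(n/T^2) =
  O(\<rho>^2/n) if its derivative at t = 0 vanishes.\<close>

lemma entire_quotient_of_bigo:
  fixes f :: "complex \<Rightarrow> complex" and m :: nat
  assumes f: "f holomorphic_on UNIV"
    and "\<And>j. j < m \<Longrightarrow> f \<in> O[nhds (a j)](\<lambda>w. \<Prod>j<m. (w - a j))"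
  obtains h where "h holomorphic_on UNIV" "\<And>w. f w = (\<Prod>j<m. (w - a j)) * h w"
proof -
  define \<Omega> where "\<Omega> = (\<lambda>w::complex. \<Prod>j<m. (w - a j))"
  define A where "A = a ` {..<m}"
  have finA: "finite A" by (simp add: A_def)
  have nz: "\<Omega> w \<noteq> 0" if "w \<notin> A" for w
    using that by (auto simp: \<Omega>_def A_def)
  have hol\<Omega>: "\<Omega> holomorphic_on S" for S
    unfolding \<Omega>_def by (intro holomorphic_intros)
  \<comment> \<open>Near a zero of the product the quotient is bounded by assumption, whatever the
    multiplicity of that zero, so its singularity is removable. At the zeros themselves the
    factorization then follows by continuity.\<close>
  have "\<exists>g. g holomorphic_on UNIV \<and> (\<forall>z\<in>UNIV - A. g z = f z / \<Omega> z)"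
  proof (rule removable_singularities)
    show "(\<lambda>z. f z / \<Omega> z) holomorphic_on UNIV - A"
      by (intro holomorphic_intros hol\<Omega> holomorphic_on_subset[OF f]) (use nz in auto)
    fix z assume "z \<in> A"
    then obtain j where j: "j < m" "z = a j" by (auto simp: A_def)
    from assms(2)[OF j(1)] have "f \<in> O[at z](\<Omega>)"
      unfolding \<Omega>_def j(2) using landau_o.big.filter_mono'[of "at (a j)" "nhds (a j)"]
      by (simp add: at_within_def) blast
    then obtain c where c: "c > 0" "eventually (\<lambda>w. norm (f w) \<le> c * norm (\<Omega> w)) (at z)"
      by (auto elim!: landau_o.bigE)
    have "eventually (\<lambda>w. w \<notin> A - {z}) (at z)"
    proof -
      have "open (- (A - {z}))" using finA by (intro open_Compl finite_imp_closed) auto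
      then have "eventually (\<lambda>w. w \<in> - (A - {z})) (nhds z)"
        by (intro eventually_nhds_in_open) auto
      then show ?thesis unfolding eventually_at_filter by (rule eventually_mono) auto
    qed
    moreover have "eventually (\<lambda>w. w \<noteq> z) (at z)" by (simp add: eventually_neq_at_within)
    ultimately have "eventually (\<lambda>w. norm (f w / \<Omega> w) \<le> c * norm (1::complex)) (at z)"
      using c(2)
    proof eventually_elim
      case (elim w)
      then have "\<Omega> w \<noteq> 0" using nz by auto
      then show ?case using elim by (simp add: norm_divide divide_simps)
    qed
    then show "(\<lambda>z. f z / \<Omega> z) \<in> O[at z](\<lambda>_. 1)"
      by (intro landau_o.bigI) (use c in auto)
  qed (use finA in auto)
  then obtain g where g: "g holomorphic_on UNIV" "\<And>z. z \<notin> A \<Longrightarrow> g z = f z / \<Omega> z" by auto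
  have "f w = \<Omega> w * g w" for w
  proof (cases "w \<in> A")
    case False
    then show ?thesis using nz g(2) by auto
  next
    case True
    have "continuous_on UNIV (\<lambda>w. f w - \<Omega> w * g w)"
      by (intro continuous_intros holomorphic_on_imp_continuous_on f hol\<Omega> g)
    then have "isCont (\<lambda>w. f w - \<Omega> w * g w) w"
      by (simp add: continuous_on_eq_continuous_at)
    then have lim: "(\<lambda>w. f w - \<Omega> w * g w) \<midarrow>w\<rightarrow> f w - \<Omega> w * g w"
      by (simp add: isCont_def)
    have "open (- (A - {w}))" using finA by (intro open_Compl finite_imp_closed) auto
    then have "eventually (\<lambda>x. x \<in> - (A - {w})) (nhds w)"
      by (intro eventually_nhds_in_open) auto
    then have "eventually (\<lambda>x. f x - \<Omega> x * g x = 0) (at w)"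
      unfolding eventually_at_filter by (rule eventually_mono) (use nz g(2) in auto)
    then have "(\<lambda>w. f w - \<Omega> w * g w) \<midarrow>w\<rightarrow> 0"
      by (simp add: tendsto_eventually)
    then have "f w - \<Omega> w * g w = 0" using lim by (rule LIM_unique[rotated])
    then show ?thesis by simp
  qed
  then show ?thesis using that g(1) unfolding \<Omega>_def by blast
qed

lemma poly_prod_inverse_roots:
  fixes q :: "complex poly"
  assumes "poly q 0 \<noteq> 0"
  obtains \<xi> where "\<And>z. poly q z = poly q 0*(\<Prod>i<degree q. 1 - \<xi> i * z)"
    "\<And>i. i < degree q \<Longrightarrow> \<xi> i \<noteq> 0 \<and> poly q (1 / \<xi> i) = 0"
proof -
  obtain r where r: "smult (lead_coeff q) (\<Prod>i<degree q. [:- r i, 1:]) = q"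
    by (rule complex_poly_decompose')
  have "poly q z = poly (smult (lead_coeff q) (\<Prod>i<degree q. [:- r i, 1:])) z" for z
    by (rule arg_cong[where f = "\<lambda>p. poly p z"]) (rule r[symmetric])
  then have eq: "poly q z = lead_coeff q*(\<Prod>i<degree q. z - r i)" for z
    by (simp add: poly_prod)
  have root: "r i \<noteq> 0 \<and> poly q (r i) = 0" if "i < degree q" for i
  proof -
    have "(\<Prod>j<degree q. r i - r j) = 0" using that by auto
    then have "poly q (r i) = 0" by (simp add: eq)
    then show ?thesis using assms by auto
  qed
  show ?thesis
  proof (rule that[of "\<lambda>i. inverse (r i)"])
    show "inverse (r i) \<noteq> 0 \<and> poly q (1/inverse (r i)) = 0" if "i < degree q" for i
      using root[OF that] by (simp add: divide_inverse)
    fix z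
    have "(\<Prod>i<degree q. z - r i) = (\<Prod>i<degree q. (0 - r i)*(1 - inverse (r i) * z))"
      using root by (intro prod.cong refl) (auto simp: field_simps)
    then show "poly q z = poly q 0*(\<Prod>i<degree q. 1 - inverse (r i) * z)"
      by (simp add: eq flip: prod.distrib)
  qed
qed

text \<open>A zero-free disk turns into a uniform bound for the reciprocal roots. With factors 1 - x
  z, a drop of the degree means fewer factors instead of roots at infinity.\<close>

lemma poly_zero_free_factor:
  fixes Q :: "complex poly"
  assumes e: "0 < e" and Qnz: "\<And>s. cmod s < e \<Longrightarrow> poly Q s \<noteq> 0"
  obtains x where "\<And>z. poly Q z = poly Q 0*(\<Prod>i<degree Q. 1 - x i * z)"
    "\<And>i. i < degree Q \<Longrightarrow> cmod (x i) \<le> 1/e"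
proof -
  have "poly Q 0 \<noteq> 0" using Qnz[of 0] e by simp
  then obtain x where x: "\<And>z. poly Q z = poly Q 0*(\<Prod>i<degree Q. 1 - x i * z)"
    "\<And>i. i < degree Q \<Longrightarrow> x i \<noteq> 0 \<and> poly Q (1/x i) = 0"
    using poly_prod_inverse_roots by blast
  have "cmod (x i) \<le> 1/e" if "i < degree Q" for i
  proof -
    have "e \<le> cmod (1/x i)" using Qnz[of "1/x i"] x(2)[OF that] by force
    then show ?thesis using x(2)[OF that] e by (simp add: norm_divide field_simps)
  qed
  with x(1) show thesis using that by blast
qed

lemma norm_exp_minus_one_le: "cmod (exp z - 1) \<le> cmod z*exp (cmod z)"
proof -
  have "norm (exp z - (\<Sum>i\<le>0. z^i/fact i)) \<le> exp \<bar>Re z\<bar>*(norm z)^Suc 0/fact 0"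
    by (rule Taylor_exp)
  then have "cmod (exp z - 1) \<le> exp \<bar>Re z\<bar>*cmod z" by simp
  also have "\<dots> \<le> exp (cmod z)*cmod z"
    by (intro mult_right_mono) (auto simp: abs_Re_le_cmod)
  finally show ?thesis by (simp add: mult.commute)
qed

text \<open>The arctangent is a primitive, so the bound \<pi>/k holds on every interval. These
  profiles dominate the Gaussian errors of the saddle point estimates.\<close>

lemma integral_lorentz_le:
  fixes a b x0 k :: real
  assumes "k > 0" "a \<le> b"
  shows "(\<lambda>x. 1/(1 + k\<^sup>2*(x - x0)\<^sup>2)) integrable_on {a..b}"
    "integral {a..b} (\<lambda>x. 1/(1 + k\<^sup>2*(x - x0)\<^sup>2)) \<le> pi/k"
proof -
  have "((\<lambda>x. 1/(1 + k\<^sup>2*(x - x0)\<^sup>2)) has_integral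
      arctan (k*(b - x0))/k - arctan (k*(a - x0))/k) {a..b}"
    using assms
    by (intro fundamental_theorem_of_calculus)
       (auto intro!: derivative_eq_intros simp: power_mult_distrib divide_simps
         simp flip: has_real_derivative_iff_has_vector_derivative)
  moreover have "arctan (k*(b - x0))/k - arctan (k*(a - x0))/k \<le> pi/k"
  proof -
    have "arctan (k*(b - x0)) - arctan (k*(a - x0)) \<le> pi"
      using arctan_ubound[of "k*(b - x0)"] arctan_lbound[of "k*(a - x0)"] by linarith
    then show ?thesis using assms by (simp add: divide_right_mono flip: diff_divide_distrib)
  qed
  ultimately show "(\<lambda>x. 1/(1 + k\<^sup>2*(x - x0)\<^sup>2)) integrable_on {a..b}"
    "integral {a..b} (\<lambda>x. 1/(1 + k\<^sup>2*(x - x0)\<^sup>2)) \<le> pi/k"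
    by (auto simp: has_integral_iff)
qed

text \<open>Here \<open>w\<close> is the model integrand and \<open>f\<close> the perturbed one. The
  error weight is dominated by a Lorentz profile of width of order 1/sqrt m about the saddle
  \<open>x0\<close>, which produces the factor 1/sqrt m.\<close>

lemma saddle_compare:
  fixes f w :: "real \<Rightarrow> complex"
  assumes cont: "continuous_on {a..b} f" "continuous_on {a..b} w"
    and "a \<le> b" "m > 0" "0 < c" "c \<le> 2" "\<eta> \<ge> 0"
    and bd: "\<And>x. x \<in> {a..b} \<Longrightarrow>
      cmod (f x - w x) \<le> \<eta>*(m*(x - x0)\<^sup>2 + 1)*exp (- c*(m*(x - x0)\<^sup>2))"
  shows "cmod (integral {a..b} f - integral {a..b} w) \<le> \<eta>*(2/c) * pi * sqrt (2/c)/sqrt m"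
proof -
  define k where "k = sqrt (c * m/2)"
  have k: "k > 0" "k\<^sup>2 = c * m/2" using assms by (auto simp: k_def)
  \<comment> \<open>The exponential is split into two equal factors, each at most 1/(1 + c v/2). One
    of them absorbs v + 1, where \<open>c \<le> 2\<close> enters, and the other is the profile to be
    integrated.\<close>
  have key: "(v + 1)*exp (- c * v) \<le> (2/c)*(1/(1 + c * v / 2))" if "v \<ge> 0" for v
  proof -
    have p: "0 < 1 + c * v / 2" using assms that by (simp add: add_pos_nonneg)
    have e: "exp (- (c * v / 2)) \<le> 1/(1 + c * v / 2)"
      using exp_ge_add_one_self[of "c * v / 2"] p
      unfolding exp_minus inverse_eq_divide by (intro divide_left_mono) auto
    have "exp (- c * v) = exp (- (c * v / 2))*exp (- (c * v / 2))"
      by (simp flip: exp_add)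
    also have "\<dots> \<le> (1/(1 + c * v / 2))*(1/(1 + c * v / 2))"
      using e p by (intro mult_mono) auto
    finally have "(v + 1)*exp (- c * v) \<le> (v + 1)*((1/(1 + c * v / 2))*(1/(1 + c * v / 2)))"
      using that by (intro mult_left_mono) auto
    also have "\<dots> \<le> ((2/c)*(1 + c * v / 2))*((1/(1 + c * v / 2))*(1/(1 + c * v / 2)))"
    proof (intro mult_right_mono)
      show "v + 1 \<le> (2/c)*(1 + c * v / 2)" using assms by (simp add: field_simps)
    qed (use p in auto)
    also have "\<dots> = (2/c)*(1/(1 + c * v / 2))"
    proof -
      have "a * p*(1/p*(1/p)) = a*(1/p)" if "p > 0" for a p :: real using that by simp
      from this[OF p, of "2/c"] show ?thesis .
    qed
    finally show ?thesis .
  qed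
  have int: "f integrable_on {a..b}" "w integrable_on {a..b}"
    using cont by (auto intro: integrable_continuous_interval)
  have "cmod (integral {a..b} (\<lambda>x. f x - w x))
      \<le> integral {a..b} (\<lambda>x. \<eta>*(2/c)*(1/(1 + k\<^sup>2*(x - x0)\<^sup>2)))"
  proof (rule integral_norm_bound_integral)
    show "(\<lambda>x. f x - w x) integrable_on {a..b}" using int by (rule integrable_diff)
    show "(\<lambda>x. \<eta>*(2/c)*(1/(1 + k\<^sup>2*(x - x0)\<^sup>2))) integrable_on {a..b}"
      using integral_lorentz_le(1)[OF k(1) assms(3), of x0] by (rule integrable_on_mult_right)
    fix x assume "x \<in> {a..b}"
    then have "cmod (f x - w x) \<le> \<eta>*((m*(x - x0)\<^sup>2 + 1)*exp (- c*(m*(x - x0)\<^sup>2)))"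
      using bd by (simp add: mult.assoc)
    also have "\<dots> \<le> \<eta>*((2/c)*(1/(1 + c*(m*(x - x0)\<^sup>2)/2)))"
      using assms by (intro mult_left_mono key) auto
    also have "\<dots> = \<eta>*(2/c)*(1/(1 + k\<^sup>2*(x - x0)\<^sup>2))" by (simp add: k(2) field_simps)
    finally show "cmod (f x - w x) \<le> \<eta>*(2/c)*(1/(1 + k\<^sup>2*(x - x0)\<^sup>2))" .
  qed
  also have "\<dots> = \<eta>*(2/c) * integral {a..b} (\<lambda>x. 1/(1 + k\<^sup>2*(x - x0)\<^sup>2))"
    by (rule integral_mult_right)
  also have "\<dots> \<le> \<eta>*(2/c)*(pi/k)"
    using assms by (intro mult_left_mono integral_lorentz_le k) auto
  also have "\<dots> = \<eta>*(2/c) * pi * sqrt (2/c)/sqrt m"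
    using assms by (simp add: k_def real_sqrt_mult real_sqrt_divide field_simps)
  finally show ?thesis using int by (simp add: integral_diff)
qed

text \<open>The model decays twice as fast as the bound that is claimed; the surplus e^(-c v) pays
  for the factor e^(cmod E) in |e^E - 1| \<le> |E| e^|E|.\<close>

lemma saddle_exp_compare:
  assumes "cmod w \<le> exp (- (2*c * v))" "cmod E \<le> \<eta> * v" "\<eta> \<le> c" "0 \<le> \<eta>" "0 \<le> v"
  shows "cmod (w*exp E - w) \<le> \<eta> * v * exp (- c * v)"
proof -
  have "cmod (w*exp E - w) = cmod w*cmod (exp E - 1)"
    by (simp flip: norm_mult add: algebra_simps)
  also have "\<dots> \<le> exp (- (2*c * v))*((\<eta> * v)*exp (c * v))"
  proof (intro mult_mono assms order.trans[OF norm_exp_minus_one_le])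
    have "cmod E \<le> c * v" using assms by (meson mult_right_mono order.trans)
    then show "exp (cmod E) \<le> exp (c * v)" by simp
  qed (use assms in auto)
  also have "\<dots> = \<eta> * v * exp (- c * v)" by (simp flip: exp_add)
  finally show ?thesis .
qed

text \<open>With g(\<zeta>) = f(R \<zeta>) - f(0) and Re g < M, the function g/(2 M - g) maps the
  unit disk into itself and fixes 0, so Schwarz's lemma applies; solving for g gives the
  bound.\<close>

lemma Borel_Caratheodory_two_sided:
  assumes hol: "f holomorphic_on ball 0 R" and "R > 0" "B > 0"
    and bd: "\<And>z. cmod z < R \<Longrightarrow> \<bar>Re (f z) - k\<bar> \<le> B" and z: "cmod z < R"
  shows "cmod (f z - f 0) \<le> 6*B*cmod z/(R - cmod z)"
proof -
  \<comment> \<open>Re g is at most 2 B; the value 3 B makes the inequality Re g < M strict.\<close>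
  define M where "M = 3*B"
  define g where "g = (\<lambda>\<zeta>. f (of_real R * \<zeta>) - f 0)"
  define \<psi> where "\<psi> = (\<lambda>\<zeta>. g \<zeta>/(2 * of_real M - g \<zeta>))"
  have Re_g: "Re (g \<zeta>) < M" if "cmod \<zeta> < 1" for \<zeta>
  proof -
    have "cmod (of_real R * \<zeta>) < R" using that assms by (simp add: norm_mult)
    from bd[OF this] have "Re (f (of_real R * \<zeta>)) \<le> k + B" by linarith
    moreover have "\<bar>Re (f 0) - k\<bar> \<le> B" using bd[of 0] assms(2) by simp
    then have "Re (f 0) \<ge> k - B" by linarith
    ultimately show ?thesis using assms by (simp add: g_def M_def)
  qed
  have holg: "g holomorphic_on ball 0 1"
  proof -
    have "(f \<circ> (\<lambda>\<zeta>. of_real R * \<zeta>)) holomorphic_on ball 0 1"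
      by (rule holomorphic_on_compose_gen[OF _ hol])
         (use assms in \<open>auto intro!: holomorphic_intros simp: norm_mult\<close>)
    then show ?thesis unfolding g_def o_def by (intro holomorphic_intros)
  qed
  have nz: "2 * of_real M - g \<zeta> \<noteq> 0" if "cmod \<zeta> < 1" for \<zeta>
  proof
    assume "2 * of_real M - g \<zeta> = 0"
    then have "Re (g \<zeta>) = 2*M" by (metis Re_complex_of_real of_real_mult of_real_numeral right_minus_eq)
    then show False using Re_g[OF that] assms by (simp add: M_def)
  qed
  define \<zeta> where "\<zeta> = z/of_real R"
  have \<zeta>: "cmod \<zeta> < 1" "of_real R * \<zeta> = z" "cmod \<zeta> = cmod z/R"
    using assms by (auto simp: \<zeta>_def norm_divide)
  have "cmod (\<psi> \<zeta>) \<le> cmod \<zeta>"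
  proof (rule Schwarz_Lemma(1))
    show "\<psi> holomorphic_on ball 0 1"
      unfolding \<psi>_def by (intro holomorphic_intros holg) (use nz in auto)
    show "\<psi> 0 = 0" by (simp add: \<psi>_def g_def)
    show "cmod (\<psi> \<zeta>) < 1" if z: "cmod \<zeta> < 1" for \<zeta>
    proof -
      have "(cmod (g \<zeta>))\<^sup>2 < (cmod (2 * of_real M - g \<zeta>))\<^sup>2"
      proof -
        have "(cmod (2 * of_real M - g \<zeta>))\<^sup>2 - (cmod (g \<zeta>))\<^sup>2 = 4*M*(M - Re (g \<zeta>))"
          unfolding cmod_power2 by (simp add: power2_eq_square algebra_simps)
        also have "\<dots> > 0" using Re_g[OF z] assms by (intro mult_pos_pos) (auto simp: M_def)
        finally show ?thesis by simp
      qed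
      then have "cmod (g \<zeta>) < cmod (2 * of_real M - g \<zeta>)" by (rule power2_less_imp_less) auto
      then show ?thesis using nz[OF z] by (simp add: \<psi>_def norm_divide)
    qed
  qed (fact \<zeta>)
  moreover have "g \<zeta>*(1 + \<psi> \<zeta>) = 2 * of_real M * \<psi> \<zeta>"
    using nz[OF \<zeta>(1)] by (simp add: \<psi>_def field_simps)
  ultimately have "cmod (g \<zeta>)*(1 - cmod \<zeta>) \<le> 2*M*cmod \<zeta>"
  proof -
    assume a: "cmod (\<psi> \<zeta>) \<le> cmod \<zeta>" and b: "g \<zeta>*(1 + \<psi> \<zeta>) = 2 * of_real M * \<psi> \<zeta>"
    have "1 - cmod \<zeta> \<le> cmod (1 + \<psi> \<zeta>)"
      using norm_diff_ineq[of 1 "\<psi> \<zeta>"] a by simp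
    then have "cmod (g \<zeta>)*(1 - cmod \<zeta>) \<le> cmod (g \<zeta>)*cmod (1 + \<psi> \<zeta>)"
      by (intro mult_left_mono) auto
    also have "\<dots> = cmod (2 * of_real M * \<psi> \<zeta>)" by (simp flip: norm_mult add: b)
    also have "\<dots> \<le> 2*M*cmod \<zeta>"
      using a assms by (simp add: norm_mult M_def)
    finally show ?thesis .
  qed
  then have "R*(cmod (g \<zeta>)*(1 - cmod \<zeta>)) \<le> R*(2*M*cmod \<zeta>)"
    using assms by (intro mult_left_mono) auto
  moreover have "R*(cmod (g \<zeta>)*(1 - cmod \<zeta>)) = cmod (g \<zeta>)*(R - cmod z)"
    "R*(2*M*cmod \<zeta>) = 6*B*cmod z"
    using assms unfolding \<zeta>(3) M_def by (simp_all add: field_simps)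
  ultimately have "cmod (g \<zeta>)*(R - cmod z) \<le> 6*B*cmod z" by simp
  then show ?thesis
    using \<zeta>(2) assms unfolding g_def by (simp add: pos_le_divide_eq)
qed

text \<open>The circle of radius R/4 about z stays in the disk of radius 3 R/4, where f - f(0) is at
  most 18 B. Cauchy's inequality then gives 18 * 4 = 72 and 2 * 18 * 16 = 576.\<close>

lemma deriv_bounds_of_Re_bound:
  assumes hol: "f holomorphic_on ball 0 R" and "R > 0" "B > 0"
    and bd: "\<And>z. cmod z < R \<Longrightarrow> \<bar>Re (f z) - k\<bar> \<le> B" and z: "cmod z \<le> R/2"
  shows "cmod (deriv f z) \<le> 72*B/R" "cmod (deriv (deriv f) z) \<le> 576*B/R\<^sup>2"
proof -
  define g where "g = (\<lambda>x. f x - f 0)"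
  have sub: "cball z (R/4) \<subseteq> ball 0 R"
  proof
    fix x assume "x \<in> cball z (R/4)"
    then have "cmod x \<le> cmod z + R/4" using norm_triangle_sub[of x z] by (auto simp: dist_norm norm_minus_commute)
    then show "x \<in> ball 0 R" using z assms by auto
  qed
  have holg: "g holomorphic_on ball 0 R" unfolding g_def by (intro holomorphic_intros hol)
  have gb: "cmod (g x) \<le> 18*B" if "cmod (z - x) = R/4" for x
  proof -
    have "cmod x \<le> cmod z + cmod (z - x)" using norm_triangle_sub[of x z] by (simp add: norm_minus_commute)
    then have x: "cmod x \<le> 3 * R/4" using that z by linarith
    have "cmod (f x - f 0) \<le> 6*B*cmod x/(R - cmod x)"
      by (rule Borel_Caratheodory_two_sided[OF hol]) (use x assms in auto)
    also have "\<dots> \<le> 18*B"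
    proof -
      have "6*B*cmod x \<le> 18*B*(R - cmod x)" using x assms by (simp add: algebra_simps)
      then show ?thesis using x assms by (subst pos_divide_le_eq) auto
    qed
    finally show ?thesis by (simp add: g_def)
  qed
  have C: "cmod ((deriv ^^ n) g z) \<le> fact n*(18*B)/(R/4)^n" for n
    by (rule Cauchy_inequality)
       (use gb assms sub ball_subset_cball[of z "R/4"] in \<open>auto intro!: holomorphic_on_subset[OF holg]
          holomorphic_on_imp_continuous_on\<close>)
  have d: "deriv g x = deriv f x" if "x \<in> ball 0 R" for x
  proof -
    have "f field_differentiable at x" using hol that by (auto intro: holomorphic_on_imp_differentiable_at)
    then show ?thesis unfolding g_def by simp
  qed
  have zR: "z \<in> ball 0 R" using z assms by auto
  have "eventually (\<lambda>x. x \<in> ball 0 R) (nhds z)" using zR by (intro eventually_nhds_in_open) auto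
  then have "eventually (\<lambda>x. deriv g x = deriv f x) (nhds z)" by eventually_elim (rule d)
  then have d2: "deriv (deriv g) z = deriv (deriv f) z" by (intro deriv_cong_ev) auto
  show "cmod (deriv f z) \<le> 72*B/R" using C[of 1] d[OF zR] assms by simp
  show "cmod (deriv (deriv f) z) \<le> 576*B/R\<^sup>2" using C[of 2] d2 assms
    by (simp add: numeral_2_eq_2 power_divide field_simps)
qed

lemma norm_linear_Taylor_le:
  assumes "f holomorphic_on S" "open S" "convex S"
    "\<And>x. x \<in> S \<Longrightarrow> cmod (deriv (deriv f) x) \<le> B" "w \<in> S" "z \<in> S"
  shows "cmod (f z - f w - deriv f w*(z - w)) \<le> B*(cmod (z - w))\<^sup>2"
proof -
  define F where "F = (\<lambda>i::nat. if i = 0 then f else if i = 1 then deriv f else deriv (deriv f))"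
  have "cmod (F 0 z - (\<Sum>i\<le>1::nat. F i w*(z - w)^i/fact i)) \<le> B*cmod (z - w)^Suc 1/fact 1"
  proof (rule complex_Taylor[OF assms(3)])
    fix i x assume x: "x \<in> S" and "i \<le> (1::nat)"
    then consider "i = 0" | "i = 1" by linarith
    then show "(F i has_field_derivative F (Suc i) x) (at x within S)"
    proof cases
      case 1
      then show ?thesis using assms x
        by (auto simp: F_def intro!: DERIV_subset[OF holomorphic_derivI])
    next
      case 2
      have "deriv f holomorphic_on S" using assms by (intro holomorphic_deriv) auto
      then show ?thesis using assms x 2
        by (auto simp: F_def intro!: DERIV_subset[OF holomorphic_derivI])
    qed
  qed (use assms in \<open>auto simp: F_def\<close>)
  then show ?thesis by (simp add: F_def power2_eq_square algebra_simps)
qed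

section \<open>Circle means\<close>

text \<open>The normalization returns the sum of the residues inside the circle; it is the average
  of s g(s), not of g(s), whence the factor R in \<open>norm_cmean_le\<close>.\<close>

definition cmean :: "real \<Rightarrow> (complex \<Rightarrow> complex) \<Rightarrow> complex" where
  "cmean R g = contour_integral (circlepath 0 R) g/(2 * of_real pi * \<i>)"

lemma circle_integrable:
  assumes "0 < R" "continuous_on (sphere 0 R) g"
  shows "g contour_integrable_on circlepath 0 R"
  using assms by (intro contour_integrable_continuous_circlepath) simp

lemma cmean_cong:
  assumes "0 < R" "\<And>s. cmod s = R \<Longrightarrow> f s = g s"
  shows "cmean R f = cmean R g"
  unfolding cmean_def using assms by (subst contour_integral_eq[of _ f g]) auto

lemma cmean_add:
  assumes "0 < R" "continuous_on (sphere 0 R) f" "continuous_on (sphere 0 R) g"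
  shows "cmean R (\<lambda>s. f s + g s) = cmean R f + cmean R g"
  unfolding cmean_def using assms
  by (subst contour_integral_add) (auto intro: circle_integrable simp: add_divide_distrib)

lemma cmean_cmult:
  assumes "0 < R" "continuous_on (sphere 0 R) f"
  shows "cmean R (\<lambda>s. c * f s) = c * cmean R f"
  unfolding cmean_def using assms
  by (subst contour_integral_lmul) (auto intro: circle_integrable)

lemma cmean_diff:
  assumes "0 < R" "continuous_on (sphere 0 R) f" "continuous_on (sphere 0 R) g"
  shows "cmean R (\<lambda>s. f s - g s) = cmean R f - cmean R g"
  unfolding cmean_def using assms
  by (subst contour_integral_diff) (auto intro: circle_integrable simp: diff_divide_distrib)

lemma cmean_sum:
  assumes "0 < R" "finite I" "\<And>i. i \<in> I \<Longrightarrow> continuous_on (sphere 0 R) (f i)"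
  shows "cmean R (\<lambda>s. \<Sum>i\<in>I. f i s) = (\<Sum>i\<in>I. cmean R (f i))"
  unfolding cmean_def using assms
  by (subst contour_integral_sum) (auto intro: circle_integrable simp: sum_divide_distrib)

lemma norm_cmean_le:
  assumes "0 < R" "continuous_on (sphere 0 R) f" "\<And>s. cmod s = R \<Longrightarrow> cmod (f s) \<le> B"
  shows "cmod (cmean R f) \<le> B * R"
proof -
  have "cmod (of_real R) = R" using assms by simp
  then have "cmod (f (of_real R)) \<le> B" by (rule assms(3))
  then have "B \<ge> 0" using norm_ge_zero order.trans by blast
  have "cmod (contour_integral (circlepath 0 R) f) \<le> B*(2 * pi * R)"
    using assms \<open>B \<ge> 0\<close> has_contour_integral_bound_circlepath[OF
        has_contour_integral_integral[OF circle_integrable[OF assms(1,2)]]]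
    by auto
  then show ?thesis by (simp add: cmean_def norm_divide norm_mult field_simps)
qed

lemma cmean_holomorphic:
  assumes "0 < R" "f holomorphic_on cball 0 R"
  shows "cmean R f = 0"
proof -
  have "(f has_contour_integral 0) (circlepath 0 R)"
    by (rule Cauchy_theorem_convex_simple[OF assms(2)]) (use assms in auto)
  then show ?thesis by (simp add: cmean_def contour_integral_unique)
qed

lemma cmean_Cauchy:
  assumes "f holomorphic_on cball 0 R" "cmod z < R"
  shows "cmean R (\<lambda>s. f s/(s - z)) = f z"
  using contour_integral_unique[OF Cauchy_integral_circlepath_simple[OF assms(1)], of z] assms(2)
  by (simp add: cmean_def)

lemma cmean_radius:
  assumes "0 < r" "r \<le> R" "open S" "\<And>s. r \<le> cmod s \<Longrightarrow> cmod s \<le> R \<Longrightarrow> s \<in> S" "g holomorphic_on S"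
  shows "cmean r g = cmean R g"
proof -
  have "homotopic_loops S (circlepath 0 r) (circlepath 0 R)"
  proof (rule homotopic_loops_linear)
    fix t :: real
    show "closed_segment (circlepath 0 r t) (circlepath 0 R t) \<subseteq> S"
    proof
      fix x assume "x \<in> closed_segment (circlepath 0 r t) (circlepath 0 R t)"
      then obtain u where u: "0 \<le> u" "u \<le> 1"
        "x = (1 - u) *\<^sub>R circlepath 0 r t + u *\<^sub>R circlepath 0 R t"
        by (auto simp: closed_segment_def)
      have "x = of_real ((1 - u) * r + u * R)*exp (2 * of_real pi * \<i> * of_real t)"
        by (simp add: u(3) circlepath scaleR_conv_of_real algebra_simps)
      then have "cmod x = \<bar>(1 - u) * r + u * R\<bar>"
        by (simp add: norm_mult del: of_real_add of_real_mult of_real_diff)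
      moreover have "(1 - u) * r + u * R \<ge> 0" using u assms by auto
      moreover have "(1 - u) * r + u * R \<ge> r" using mult_nonneg_nonneg[OF u(1), of "R - r"] assms
        by (simp add: algebra_simps)
      moreover have "(1 - u) * r + u * R \<le> R" using mult_nonneg_nonneg[of "1 - u" "R - r"] u assms
        by (simp add: algebra_simps)
      ultimately show "x \<in> S" using assms(4) by auto
    qed
  qed auto
  then have "contour_integral (circlepath 0 r) g = contour_integral (circlepath 0 R) g"
    by (rule Cauchy_theorem_homotopic_loops) (use assms in auto)
  then show ?thesis by (simp add: cmean_def)
qed

text \<open>The base point s may be any point of the circle, so that a critical point of the
  integrand can be placed at u = 0, in the middle of the interval of integration.\<close>

lemma cmean_eq_integral:
  assumes "0 < R" "continuous_on (sphere 0 R) g" "cmod s = R"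
  shows "cmean R g = integral {-pi..pi} (\<lambda>u. g (s * cis u)*(s * cis u))/(2 * of_real pi)"
proof -
  \<comment> \<open>The arc starts at the antipode of s and therefore has s as its midpoint.\<close>
  define \<alpha> where "\<alpha> = Arg2pi (- s)"
  define a where "a = \<alpha>/(2 * pi)"
  have \<alpha>: "0 \<le> \<alpha>" "\<alpha> < 2 * pi" using Arg2pi_ge_0 Arg2pi_lt_2pi by (auto simp: \<alpha>_def)
  have a: "a \<in> {0..1}" using \<alpha> by (auto simp: a_def)
  have s: "- s = of_real R * cis \<alpha>"
    using Arg2pi_eq[of "- s"] assms by (simp add: \<alpha>_def cis_conv_exp)
  have "shiftpath a (circlepath 0 R) = part_circlepath 0 R \<alpha> (\<alpha> + 2 * pi)"
  proof
    fix x :: real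
    have "exp (2 * of_real pi * \<i>*(of_real (a + x - 1))) = exp (2 * of_real pi * \<i> * of_real (a + x))"
      by (simp add: ring_distribs exp_diff)
    moreover have "exp (2 * of_real pi * \<i> * of_real (a + x))
        = exp (\<i> * complex_of_real (linepath \<alpha> (\<alpha> + 2 * pi) x))"
      by (rule arg_cong[where f = exp]) (simp add: a_def linepath_def algebra_simps)
    ultimately show "shiftpath a (circlepath 0 R) x = part_circlepath 0 R \<alpha> (\<alpha> + 2 * pi) x"
      unfolding shiftpath_def circlepath part_circlepath_def by (simp only: if_cancel)
  qed
  then have "contour_integral (circlepath 0 R) g
      = contour_integral (part_circlepath 0 R \<alpha> (\<alpha> + 2 * pi)) g"
    using contour_integral_shiftpath[of "circlepath 0 R" a g] a by simp
  also have "\<dots> = integral {\<alpha>..\<alpha> + 2 * pi} (\<lambda>t. g (0 + of_real R * cis t) * of_real R * \<i> * cis t)"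
    by (rule contour_integral_part_circlepath_eq) simp
  also have "\<dots> = integral {-pi..pi} ((\<lambda>t. g (0 + of_real R * cis t) * of_real R * \<i> * cis t)
      \<circ> (\<lambda>x. x + (\<alpha> + pi)))"
    by (subst integral_shift)
       (auto intro!: continuous_intros continuous_on_compose2[OF assms(2)] simp: norm_mult assms
         algebra_simps less_imp_le)
  also have "\<dots> = integral {-pi..pi} (\<lambda>u. \<i>*(g (s * cis u)*(s * cis u)))"
  proof (rule integral_cong)
    fix x
    have "of_real R * cis (x + (\<alpha> + pi)) = s * cis x"
    proof -
      have "cis (x + (\<alpha> + pi)) = cis x*(cis \<alpha> * cis pi)" by (simp only: cis_mult)
      then have "of_real R * cis (x + (\<alpha> + pi)) = - (of_real R * cis \<alpha>) * cis x" by simp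
      then show ?thesis by (simp flip: s)
    qed
    then show "((\<lambda>t. g (0 + of_real R * cis t) * of_real R * \<i> * cis t) \<circ> (\<lambda>x. x + (\<alpha> + pi))) x
        = \<i>*(g (s * cis x)*(s * cis x))"
      by (simp add: mult_ac)
  qed
  also have "\<dots> = \<i> * integral {-pi..pi} (\<lambda>u. g (s * cis u)*(s * cis u))"
    by (rule integral_mult_right)
  finally show ?thesis by (simp add: cmean_def)
qed

lemma cmean_has_field_derivative:
  assumes "0 < R" "open U" "convex U" "t0 \<in> U"
    and F: "\<And>t s. t \<in> U \<Longrightarrow> cmod s = R \<Longrightarrow> ((\<lambda>t. F t s) has_field_derivative F' t s) (at t)"
    and F'c: "continuous_on (U \<times> sphere 0 R) (\<lambda>(t, s). F' t s)"
    and Fc: "\<And>t. t \<in> U \<Longrightarrow> continuous_on (sphere 0 R) (F t)"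
  shows "((\<lambda>t. cmean R (F t)) has_field_derivative cmean R (F' t0)) (at t0)"
proof -
  define g where "g = (\<lambda>u. of_real R * cis u)"
  have g: "cmod (g u) = R" for u using assms by (simp add: g_def norm_mult)
  have cR: "cmod (of_real R) = R" using assms by simp
  have gc: "continuous_on S g" for S unfolding g_def by (intro continuous_intros)
  have Fc': "continuous_on (sphere 0 R) (F' t)" if "t \<in> U" for t
  proof -
    have "continuous_on (sphere 0 R) (\<lambda>x. case (t, x) of (t, s) \<Rightarrow> F' t s)"
    proof (rule continuous_on_compose2[OF F'c])
      show "continuous_on (sphere 0 R) (\<lambda>x::complex. (t, x))"
        by (intro continuous_on_Pair continuous_on_const continuous_on_id)
    qed (use that in auto)
    then show ?thesis by simp
  qed
  have "((\<lambda>t. integral (cbox (-pi) pi) (\<lambda>u. F t (g u) * g u)) has_field_derivative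
      integral (cbox (-pi) pi) (\<lambda>u. F' t0 (g u) * g u)) (at t0 within U)"
  proof (rule leibniz_rule_field_derivative)
    fix t u assume "t \<in> U"
    then show "((\<lambda>t. F t (g u) * g u) has_field_derivative F' t (g u) * g u) (at t within U)"
      by (intro DERIV_cmult_right has_field_derivative_at_within[OF F] g)
  next
    fix t assume t: "t \<in> U"
    have "continuous_on (cbox (-pi) pi) (\<lambda>u. F t (g u))"
      by (rule continuous_on_compose2[OF Fc[OF t] gc]) (auto simp: g)
    then show "(\<lambda>u. F t (g u) * g u) integrable_on cbox (-pi) pi"
      by (intro integrable_continuous continuous_intros gc)
  next
    have gs: "continuous_on (U \<times> cbox (-pi) pi) (\<lambda>x. g (snd x))"
      unfolding g_def by (intro continuous_intros)
    have "continuous_on (U \<times> cbox (-pi) pi)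
        (\<lambda>x. case (fst x, g (snd x)) of (t, s) \<Rightarrow> F' t s)"
    proof (rule continuous_on_compose2[OF F'c])
      show "continuous_on (U \<times> cbox (-pi) pi) (\<lambda>x. (fst x, g (snd x)))"
        by (intro continuous_on_Pair gs continuous_on_fst continuous_on_id)
    qed (auto simp: g)
    then have "continuous_on (U \<times> cbox (-pi) pi) (\<lambda>x. F' (fst x) (g (snd x)) * g (snd x))"
      by (intro continuous_intros gs) simp
    then show "continuous_on (U \<times> cbox (-pi) pi) (\<lambda>(x, t). F' x (g t) * g t)"
      by (simp add: split_beta)
  qed (use assms in auto)
  then have D: "((\<lambda>t. integral (cbox (-pi) pi) (\<lambda>u. F t (g u) * g u)) has_field_derivative
      integral (cbox (-pi) pi) (\<lambda>u. F' t0 (g u) * g u)) (at t0)"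
    unfolding at_within_open[OF assms(4,2)] .
  have eq: "cmean R (F t) = integral (cbox (-pi) pi) (\<lambda>u. F t (g u) * g u)/(2 * of_real pi)"
    if "t \<in> U" for t
    using cmean_eq_integral[OF assms(1) Fc[OF that] cR] by (simp add: g_def)
  have eq': "cmean R (F' t0) = integral (cbox (-pi) pi) (\<lambda>u. F' t0 (g u) * g u)/(2 * of_real pi)"
    using cmean_eq_integral[OF assms(1) Fc'[OF assms(4)] cR] by (simp add: g_def)
  have "((\<lambda>t. integral (cbox (-pi) pi) (\<lambda>u. F t (g u) * g u)/(2 * of_real pi)) has_field_derivative
      cmean R (F' t0)) (at t0)"
    unfolding eq' by (rule DERIV_cdivide[OF D])
  then show ?thesis
    by (rule has_field_derivative_transform_within_open[OF _ assms(2,4)]) (simp add: eq)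
qed

lemma cmean_exp_has_field_derivative:
  assumes "0 < R" "continuous_on (sphere 0 R) g"
  shows "((\<lambda>y. cmean R (\<lambda>s. g s*exp (c * s * y))) has_field_derivative
     cmean R (\<lambda>s. g s*(c * s)*exp (c * s * y))) (at y)"
proof (rule cmean_has_field_derivative[where U = UNIV])
  show "continuous_on (UNIV \<times> sphere 0 R) (\<lambda>(y, s). g s*(c * s)*exp (c * s * y))"
  proof -
    have "continuous_on (UNIV \<times> sphere 0 R) (\<lambda>x. g (snd x))"
      by (rule continuous_on_compose2[OF assms(2)]) (auto intro: continuous_on_snd continuous_on_id)
    then show ?thesis
      unfolding split_beta by (intro continuous_intros)
  qed
next
  fix y s :: complex
  show "((\<lambda>y. g s*exp (c * s * y)) has_field_derivative g s*(c * s)*exp (c * s * y)) (at y)"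
    by (rule derivative_eq_intros refl | simp)+
next
  show "continuous_on (sphere 0 R) (\<lambda>s. g s*exp (c * s * y))" for y
    by (intro continuous_intros assms)
qed (use assms in auto)

lemma cmean_exp_power:
  assumes "0 < R"
  shows "cmean R (\<lambda>s. exp (c * s) / s^Suc k) = c^k/fact k"
proof -
  have d: "(deriv ^^ k) (\<lambda>s. exp (c * s)) = (\<lambda>s. c^k*exp (c * s))"
  proof (induction k)
    case (Suc k)
    have "deriv (\<lambda>s. c^k*exp (c * s)) s = c^Suc k*exp (c * s)" for s
      by (rule DERIV_imp_deriv) (auto intro!: derivative_eq_intros)
    then show ?case using Suc by auto
  qed simp
  have "((\<lambda>u. exp (c * u)/(u - 0)^Suc k) has_contour_integral
       complex_of_real (2 * pi) * \<i>/fact k*(deriv ^^ k) (\<lambda>s. exp (c * s)) 0) (circlepath 0 R)"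
    by (rule Cauchy_has_contour_integral_higher_derivative_circlepath)
       (use assms in \<open>auto intro!: continuous_intros holomorphic_intros\<close>)
  then show ?thesis by (simp add: cmean_def contour_integral_unique d)
qed

text \<open>The integrand is O(|s|^(-2)) at infinity, and the mean does not change when the radius
  grows, so it equals its limit 0.\<close>

lemma cmean_decay:
  assumes R: "0 < R" "\<And>j. j < N \<Longrightarrow> cmod (a j) < R" and deg: "degree p + 2 \<le> N"
  shows "cmean R (\<lambda>s. poly p s/(\<Prod>j<N. s - a j)) = 0"
proof -
  define g where "g = (\<lambda>s. poly p s/(\<Prod>j<N. s - a j))"
  obtain r where r: "0 < r" "r < R" "\<And>j. j < N \<Longrightarrow> cmod (a j) < r"
  proof -
    \<comment> \<open>A radius strictly between all the \<open>a j\<close> and R, so that the circle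
      of radius R lies in an open set on which the quotient is holomorphic.\<close>
    define r where "r = Max (insert (R/2) ((\<lambda>j. (cmod (a j) + R)/2) ` {..<N}))"
    have "r < R" unfolding r_def using R by (subst Max_less_iff) auto
    moreover have "R/2 \<le> r" unfolding r_def by (rule Max_ge) auto
    moreover have "cmod (a j) < r" if "j < N" for j
    proof -
      have "(cmod (a j) + R)/2 \<le> r" unfolding r_def using that by (intro Max_ge) auto
      then show ?thesis using R(2)[OF that] by argo
    qed
    ultimately show ?thesis using that[of r] R by auto
  qed
  define S where "S = - cball (0::complex) r"
  have S: "open S" by (simp add: S_def open_Compl)
  have hol: "g holomorphic_on S"
    unfolding g_def S_def
  proof (intro holomorphic_intros)
    fix s :: complex assume "s \<in> - cball 0 r"
    then have "s \<noteq> a j" if "j < N" for j using r(3)[OF that] by auto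
    then show "(\<Prod>j<N. s - a j) \<noteq> 0" by auto
  qed
  have eq: "cmean R g = cmean R' g" if "R \<le> R'" for R'
    by (rule cmean_radius[OF R(1) that S _ hol]) (use r in \<open>auto simp: S_def\<close>)
  have degN: "degree (\<Prod>j<N. [:- a j, 1:]) = N"
    by (subst degree_prod_eq_sum_degree) auto
  have "((\<lambda>x. poly ([:0, 1:] * p) x/poly (\<Prod>j<N. [:- a j, 1:]) x) \<longlongrightarrow> 0) at_infinity"
  proof (rule poly_divide_tendsto_0_at_infinity)
    have "degree ([:0, 1:] * p) \<le> 1 + degree p" using degree_mult_le[of "[:0, 1:]" p] by simp
    then show "degree ([:0, 1:] * p) < degree (\<Prod>j<N. [:- a j, 1:])"
      using deg unfolding degN by linarith
  qed
  then have lim: "((\<lambda>x. x * g x) \<longlongrightarrow> 0) at_infinity"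
    by (simp add: g_def poly_prod)
  have "cmod (cmean R g) \<le> e" if "e > 0" for e
  proof -
    have "eventually (\<lambda>x. cmod (x * g x) < e) at_infinity"
      using tendstoD[OF lim that] by simp
    then obtain b where b: "\<And>x. b \<le> cmod x \<Longrightarrow> cmod (x * g x) < e"
      unfolding eventually_at_infinity by blast
    define R' where "R' = max R b"
    have R': "R' \<ge> R" "R' \<ge> b" "R' > 0" using R by (auto simp: R'_def)
    have "cmod (cmean R' g) \<le> (e/R') * R'"
    proof (rule norm_cmean_le)
      show "continuous_on (sphere 0 R') g"
        using r R' by (intro holomorphic_on_imp_continuous_on holomorphic_on_subset[OF hol])
          (auto simp: S_def)
      show "cmod (g s) \<le> e/R'" if "cmod s = R'" for s
        using b[of s] R' that by (simp add: norm_mult pos_le_divide_eq mult.commute)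
    qed (use R' in auto)
    then show ?thesis using eq[OF R'(1)] R' by simp
  qed
  then have "cmod (cmean R g) \<le> 0 + e" if "e > 0" for e using that by simp
  then have "cmod (cmean R g) \<le> 0" by (rule field_le_epsilon)
  then show ?thesis by (simp add: g_def)
qed

section \<open>Stirling bounds\<close>

text \<open>The remainder in Stirling's formula, with limit ln (sqrt (2 \<pi>)). In the difference
  of its values at n and 2 n, which enters the asymptotics of the remainder, this limit
  cancels.\<close>

definition stirling_rest :: "nat \<Rightarrow> real" where
  "stirling_rest m = ln (fact m) + real m - (real m + 1/2)*ln (real m)"

text \<open>The decrement is (m + 1/2) ln (1 + 1/m) - 1. The midpoint and the trapezoidal rule for
  the integral of 1/x over [m, m + 1] enclose it between 0 and a telescoping term.\<close>

lemma stirling_rest_step: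
  assumes "m \<ge> 1"
  shows "stirling_rest (Suc m) \<le> stirling_rest m"
    "stirling_rest m - stirling_rest (Suc m) \<le> (1/real m - 1/real (Suc m))/4"
proof -
  define x where "x = real m"
  have x: "x \<ge> 1" using assms by (simp add: x_def)
  have "ln (fact (Suc m)) = ln (x + 1) + ln (fact m)"
    by (simp add: ln_mult x_def add.commute)
  then have eq: "stirling_rest m - stirling_rest (Suc m) = (x + 1/2)*(ln (x + 1) - ln x) - 1"
    by (simp add: stirling_rest_def x_def add.commute algebra_simps)
  have "2*(x + 1 - x)/(x + (x + 1)) \<le> ln (x + 1) - ln x"
    by (rule ln_inverse_approx_ge) (use x in auto)
  then have "(x + 1/2)*(2*(x + 1 - x)/(x + (x + 1))) \<le> (x + 1/2)*(ln (x + 1) - ln x)"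
    using x by (intro mult_left_mono) auto
  moreover have "(x + 1/2)*(2*(x + 1 - x)/(x + (x + 1))) = 1" using x by (simp add: field_simps)
  ultimately show "stirling_rest (Suc m) \<le> stirling_rest m" using eq by linarith
  have "ln (x + 1) - ln x \<le> 1*(inverse x + inverse (x + 1))/2"
    by (rule ln_inverse_approx_le) (use x in auto)
  then have "(x + 1/2)*(ln (x + 1) - ln x) \<le> (x + 1/2)*(1*(inverse x + inverse (x + 1))/2)"
    using x by (intro mult_left_mono) auto
  also have "\<dots> = 1 + (1/x - 1/(x + 1))/4" using x by (simp add: divide_simps) (simp add: algebra_simps)
  finally have le: "(x + 1/2)*(ln (x + 1) - ln x) \<le> 1 + (1/x - 1/(x + 1))/4" .
  show "stirling_rest m - stirling_rest (Suc m) \<le> (1/real m - 1/real (Suc m))/4"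
  proof -
    have "real (Suc m) = x + 1" by (simp add: x_def)
    then have "(1/real m - 1/real (Suc m))/4 = (1/x - 1/(x + 1))/4" by (simp add: x_def)
    then show ?thesis using eq le by linarith
  qed
qed

lemma stirling_rest_antimono:
  assumes "1 \<le> m" "m \<le> k"
  shows "stirling_rest k \<le> stirling_rest m" "stirling_rest m - stirling_rest k \<le> 1/(4*real m)"
proof -
  from assms(2) have "stirling_rest k \<le> stirling_rest m \<and>
      stirling_rest m - stirling_rest k \<le> (1/real m - 1/real k)/4"
  proof (induction k rule: dec_induct)
    case (step k)
    then show ?case using stirling_rest_step[of k] assms by auto
  qed simp
  moreover have "(1/real m - 1/real k)/4 \<le> 1/(4*real m)" using assms by (simp add: field_simps)
  ultimately show "stirling_rest k \<le> stirling_rest m" "stirling_rest m - stirling_rest k \<le> 1/(4*real m)"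
    by linarith+
qed

lemma stirling_rest_le_1: "1 \<le> m \<Longrightarrow> stirling_rest m \<le> 1"
  using stirling_rest_antimono(1)[of 1 m] by (simp add: stirling_rest_def)

lemma stirling_rest_nonneg: "1 \<le> m \<Longrightarrow> 0 \<le> stirling_rest m"
  using stirling_rest_antimono(2)[of 1 m] by (simp add: stirling_rest_def)

lemma power_div_fact_eq:
  assumes "1 \<le> m"
  shows "real m^m*exp (- real m)/fact m = exp (- stirling_rest m)/sqrt (real m)"
proof -
  have "fact m = exp (ln (fact m :: real))" by simp
  also have "ln (fact m) = stirling_rest m - real m + (real m + 1/2)*ln (real m)"
    by (simp add: stirling_rest_def)
  also have "exp \<dots> = exp (stirling_rest m)*exp (- real m)*(real m powr (real m + 1/2))"
    using assms by (simp add: powr_def algebra_simps flip: exp_add)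
  also have "real m powr (real m + 1/2) = real m^m * sqrt (real m)"
    using assms by (simp add: powr_add powr_realpow powr_half_sqrt)
  finally show ?thesis using assms by (simp add: exp_minus field_simps)
qed

lemma power_div_fact_ge:
  assumes "1 \<le> m"
  shows "1/(exp 1 * sqrt (real m)) \<le> real m^m*exp (- real m)/fact m"
proof -
  have "exp (- 1)/sqrt (real m) \<le> exp (- stirling_rest m)/sqrt (real m)"
    using stirling_rest_le_1[OF assms] by (intro divide_right_mono) auto
  moreover have "1/(exp 1 * sqrt (real m)) = exp (- 1)/sqrt (real m)"
    by (simp add: exp_minus divide_inverse)
  ultimately show ?thesis by (simp only: power_div_fact_eq[OF assms])
qed

section \<open>The saddle point on a circle\<close>

text \<open>Concavity of the sine gives sin (t/2) \<ge> t/\<pi> for t between 0 and \<pi>, hence the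
  lower bound 2 t^2/\<pi>^2, and \<pi>^2 \<le> 10.\<close>

lemma one_minus_cos_ge:
  assumes "\<bar>t\<bar> \<le> pi"
  shows "t\<^sup>2/5 \<le> 1 - cos t"
proof -
  have conc: "concave_on {0..pi/2} sin"
    unfolding concave_on_def
  proof (rule f''_ge0_imp_convex)
    show "((\<lambda>x. - sin x) has_real_derivative - cos x) (at x)"
      "((\<lambda>x. - cos x) has_real_derivative sin x) (at x)" for x :: real
      by (auto intro!: derivative_eq_intros)
    show "0 \<le> sin x" if "x \<in> {0..pi/2}" for x :: real
      using that by (intro sin_ge_zero) auto
  qed auto
  define s where "s = \<bar>t\<bar>/pi"
  have s: "0 \<le> s" "s \<le> 1" using assms by (auto simp: s_def)
  have "(1 - s) * sin 0 + s * sin (pi/2) \<le> sin ((1 - s) *\<^sub>R 0 + s *\<^sub>R (pi/2))"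
    using s by (intro concave_onD[OF conc]) auto
  then have "s \<le> sin (\<bar>t\<bar>/2)" by (simp add: s_def)
  then have "s\<^sup>2 \<le> (sin (\<bar>t\<bar>/2))\<^sup>2" using s by (intro power_mono) auto
  moreover have "1 - cos t = 2*(sin (\<bar>t\<bar>/2))\<^sup>2"
    using cos_double_sin[of "\<bar>t\<bar>/2"] by simp
  moreover have "t\<^sup>2/5 \<le> 2 * s\<^sup>2"
  proof -
    have "pi * pi \<le> 3.15*3.15" using pi_approx by (intro mult_mono) auto
    then have "pi\<^sup>2 \<le> 10" by (simp add: power2_eq_square)
    then have "t\<^sup>2 * pi\<^sup>2 \<le> t\<^sup>2*10" by (intro mult_left_mono) auto
    then show ?thesis by (simp add: s_def power_divide field_simps)
  qed
  ultimately show ?thesis by linarith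
qed

lemma cis_minus_one_le: "cmod (cis t - 1) \<le> \<bar>t\<bar>"
proof -
  have "(cmod (cis t - 1))\<^sup>2 = 2*(1 - cos t)"
    using sin_cos_squared_add[of t] unfolding cmod_power2 by (simp add: power2_eq_square algebra_simps)
  also have "\<dots> = (2 * sin (t/2))\<^sup>2"
    using cos_double_sin[of "t/2"] by (simp add: power2_eq_square)
  also have "\<dots> \<le> \<bar>t\<bar>\<^sup>2"
    using abs_sin_x_le_abs_x[of "t/2"] by (intro power2_le_iff_abs_le[THEN iffD2]) (auto simp: abs_mult)
  finally show ?thesis by (rule power2_le_imp_le) simp
qed

text \<open>Along the circle through the critical point a factor 1 - a turns into 1 - a e^(it) for a
  zero of Q and into 1 - a e^(-it) for a node. Its logarithm relative to t = 0 is linear in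
  \<open>u\<close>, respectively \<open>u'\<close>, up to O(\<mu> t^2). The critical point equation
  offers linear terms in \<open>u\<close> only; for nodes \<open>- u'\<close> is exchanged for
  \<open>u\<close>, at the cost of u + u' = 2 (cos t - 1), which is again of order t^2.\<close>

lemma saddle_term_bounds:
  fixes a :: complex and t :: real
  assumes "cmod a \<le> \<mu>" "\<mu> \<le> 1/32"
  defines "u \<equiv> cis t - 1" and "u' \<equiv> cis (- t) - 1"
  shows "1 - a \<noteq> 0" "1 - a * cis t = (1 - a)*exp (Ln (1 - a * u/(1 - a)))"
    "cmod (Ln (1 - a * u/(1 - a)) + a * u/(1 - a)) \<le> \<mu> * t\<^sup>2"
    "cmod (a * u/(1 - a) - Ln (1 - a * u'/(1 - a))) \<le> 3 * \<mu> * t\<^sup>2"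
    "1 - a * cis (- t) = (1 - a)*exp (Ln (1 - a * u'/(1 - a)))"
    "cmod (a/(1 - a)) \<le> 2 * \<mu>" "\<mu> \<ge> 0"
proof -
  have k: "1/2 \<le> cmod (1 - a)"
    using norm_triangle_ineq2[of 1 a] assms by simp
  then show nz: "1 - a \<noteq> 0" by auto
  show \<mu>: "\<mu> \<ge> 0" using assms norm_ge_zero order.trans by blast
  have q: "cmod (a/(1 - a)) \<le> 2 * \<mu>"
  proof -
    have "cmod a \<le> 2 * \<mu>*(1/2)" using assms by simp
    also have "\<dots> \<le> 2 * \<mu>*cmod (1 - a)" using k \<mu> by (intro mult_left_mono) auto
    finally show ?thesis using nz by (simp add: norm_divide divide_simps)
  qed
  then show "cmod (a/(1 - a)) \<le> 2 * \<mu>" .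
  have main: "1 - a*(1 + w) = (1 - a)*exp (Ln (1 - a * w/(1 - a)))
      \<and> cmod (Ln (1 - a * w/(1 - a)) + a * w/(1 - a)) \<le> \<mu> * t\<^sup>2"
    if w: "cmod w \<le> 2" "cmod w \<le> \<bar>t\<bar>" for w
  proof -
    define v where "v = a/(1 - a) * w"
    have v1: "cmod v \<le> 2 * \<mu>*cmod w"
      unfolding v_def norm_mult by (intro mult_right_mono q) auto
    also have "\<dots> \<le> 2 * \<mu>*2" using w \<mu> by (intro mult_left_mono) auto
    finally have v2: "cmod v \<le> 1/2" using assms by simp
    have "1 - v \<noteq> 0" using v2 by auto
    then have "exp (Ln (1 - v)) = 1 - v" by simp
    moreover have "1 - a*(1 + w) = (1 - a)*(1 - v)" using nz by (simp add: v_def field_simps)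
    moreover have "cmod (Ln (1 - v) + v) \<le> \<mu> * t\<^sup>2"
    proof -
      have "cmod (Ln (1 + - v) - - v) \<le> cmod (- v)^2/(1 - cmod (- v))"
        by (rule Ln_approx_linear) (use v2 in auto)
      also have "\<dots> \<le> (cmod v)\<^sup>2/(1/2)" using v2 by (intro divide_mono) auto
      also have "\<dots> \<le> (2 * \<mu>*cmod w)\<^sup>2/(1/2)"
        using v1 by (intro divide_right_mono power_mono) auto
      also have "\<dots> \<le> (2 * \<mu> * \<bar>t\<bar>)\<^sup>2/(1/2)"
        using w \<mu> by (intro divide_right_mono power_mono mult_left_mono) auto
      also have "\<dots> = 8 * \<mu>*(\<mu> * t\<^sup>2)" by (simp add: power_mult_distrib power2_eq_square)
      also have "\<dots> \<le> 1*(\<mu> * t\<^sup>2)" using assms \<mu> by (intro mult_right_mono) auto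
      finally show ?thesis by simp
    qed
    moreover have "a * w/(1 - a) = v" by (simp add: v_def)
    ultimately show ?thesis by simp
  qed
  have u: "cmod u \<le> 2" "cmod u \<le> \<bar>t\<bar>" "cmod u' \<le> 2" "cmod u' \<le> \<bar>t\<bar>"
    using norm_triangle_ineq4[of "cis t" 1] norm_triangle_ineq4[of "cis (-t)" 1]
      cis_minus_one_le[of t] cis_minus_one_le[of "-t"] by (auto simp: u_def u'_def)
  show "1 - a * cis t = (1 - a)*exp (Ln (1 - a * u/(1 - a)))"
    "cmod (Ln (1 - a * u/(1 - a)) + a * u/(1 - a)) \<le> \<mu> * t\<^sup>2"
    using main[OF u(1,2)] by (simp_all add: u_def)
  show "1 - a * cis (- t) = (1 - a)*exp (Ln (1 - a * u'/(1 - a)))"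
    using main[OF u(3,4)] by (simp add: u'_def)
  have "u + u' = of_real (2*(cos t - 1))"
    by (simp add: u_def u'_def complex_eq_iff)
  then have "cmod (u + u') = 2*(1 - cos t)" by (simp only: norm_of_real) simp
  also have "\<dots> \<le> t\<^sup>2"
    using cos_double_sin[of "t/2"] abs_sin_x_le_abs_x[of "t/2"]
      power2_le_iff_abs_le[of "\<bar>t/2\<bar>" "sin (t/2)"] by (simp add: power_divide)
  finally have uu: "cmod (u + u') \<le> t\<^sup>2" .
  have "a * u/(1 - a) - Ln (1 - a * u'/(1 - a))
      = a/(1 - a)*(u + u') - (Ln (1 - a * u'/(1 - a)) + a * u'/(1 - a))"
    by (simp add: distrib_left)
  also have "cmod \<dots> \<le> cmod (a/(1 - a))*cmod (u + u') + \<mu> * t\<^sup>2"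
    using main[OF u(3,4)]
    by (intro order.trans[OF norm_triangle_ineq4] add_mono order.refl[THEN order.trans, OF eq_refl[OF norm_mult]]) auto
  also have "\<dots> \<le> 2 * \<mu> * t\<^sup>2 + \<mu> * t\<^sup>2"
    using q uu \<mu> by (intro add_mono mult_mono) auto
  finally show "cmod (a * u/(1 - a) - Ln (1 - a * u'/(1 - a))) \<le> 3 * \<mu> * t\<^sup>2" by simp
qed

text \<open>This is Cauchy's formula for the m-th Taylor coefficient of e^(m s) on the unit circle,
  which passes through the saddle s = 1. It evaluates the model integral exactly.\<close>

lemma integral_circle_weight:
  assumes "1 \<le> m"
  shows "integral {-pi..pi} (\<lambda>t. exp (of_nat m*(cis t - 1 - \<i> * of_real t)))
    = of_real (2 * pi*(real m^m*exp (- real m)/fact m))"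
proof -
  have "cmean 1 (\<lambda>s. exp (of_nat m * s) / s^Suc m)
      = integral {-pi..pi} (\<lambda>t. exp (of_nat m*(1 * cis t))/(1 * cis t)^Suc m*(1 * cis t))
        / (2 * of_real pi)"
  proof (rule cmean_eq_integral)
    show "continuous_on (sphere 0 1) (\<lambda>s::complex. exp (of_nat m * s) / s^Suc m)"
      by (intro continuous_intros) auto
  qed auto
  also have "(\<lambda>t. exp (of_nat m*(1 * cis t))/(1 * cis t)^Suc m*(1 * cis t))
      = (\<lambda>t. of_real (exp (real m))*exp (of_nat m*(cis t - 1 - \<i> * of_real t)))"
  proof
    fix t
    have "exp (of_nat m*(cis t - 1 - \<i> * of_real t))
        = exp (of_nat m * cis t)/of_real (exp (real m))/exp (of_nat m*(\<i> * of_real t))"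
    proof -
      have "of_nat m*(cis t - 1 - \<i> * of_real t)
          = of_nat m * cis t - of_real (real m) - of_nat m*(\<i> * of_real t)"
        by (simp add: algebra_simps)
      then show ?thesis by (simp only: exp_diff exp_of_real)
    qed
    also have "exp (of_nat m*(\<i> * of_real t)) = cis t^m"
      by (simp add: cis_conv_exp exp_of_nat_mult)
    finally show "exp (of_nat m*(1 * cis t))/(1 * cis t)^Suc m*(1 * cis t)
      = of_real (exp (real m))*exp (of_nat m*(cis t - 1 - \<i> * of_real t))" by simp
  qed
  finally have eq: "of_nat m^m/fact m = of_real (exp (real m)) *
      integral {-pi..pi} (\<lambda>t. exp (of_nat m*(cis t - 1 - \<i> * of_real t)))/(2 * of_real pi)"
    unfolding cmean_exp_power[OF zero_less_one] by (simp only: integral_mult_right times_divide_eq_right)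
  have "I = of_real (2 * pi*(M*exp (- x)/F))"
    if "of_real M/of_real F = of_real (exp x) * I/(2 * of_real pi)" for I :: complex and M F x :: real
    using that by (cases "F = 0") (simp_all add: exp_minus divide_simps mult_ac)
  from this[of "real m^m" "fact m" "real m"] eq show ?thesis by simp
qed

text \<open>The hypothesis \<open>sad\<close> makes \<open>u\<close> a critical point of the logarithm of \<open>s * F y s\<close>.\<close>

lemma circle_saddle:
  fixes x \<zeta> :: "nat \<Rightarrow> complex" and n d :: nat
  defines "F \<equiv> \<lambda>y s. (\<Prod>i<d. 1 - x i * s)/(\<Prod>j<2*n+1. s - \<zeta> j)*exp (of_nat n * s * y)"
  assumes n: "1 \<le> n" "d \<le> n" and u: "u \<noteq> 0" and \<mu>: "\<mu> \<le> 1/2000"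
    and kx: "\<And>i. i < d \<Longrightarrow> cmod (x i * u) \<le> \<mu>"
    and kz: "\<And>j. j < 2*n+1 \<Longrightarrow> cmod (\<zeta> j / u) \<le> \<mu>"
    and sad: "of_nat n * u * y = 2 * of_nat n + (\<Sum>i<d. x i * u/(1 - x i * u))
      + (\<Sum>j<2*n+1. (\<zeta> j / u)/(1 - \<zeta> j / u))"
  shows "\<exists>J. cmean (cmod u) (F y) = F y u * u * J \<and> 1/(8 * sqrt n) \<le> cmod J \<and> cmod J \<le> 1"
proof -
  define \<kappa> where "\<kappa> = (\<lambda>i. x i * u)"
  define \<kappa>' where "\<kappa>' = (\<lambda>j. \<zeta> j / u)"
  have \<mu>': "\<mu> \<le> 1/32" using \<mu> by simp
  have k: "cmod (\<kappa> i) \<le> \<mu>" if "i < d" for i using kx[OF that] by (simp add: \<kappa>_def)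
  have k': "cmod (\<kappa>' j) \<le> \<mu>" if "j < 2*n+1" for j using kz[OF that] by (simp add: \<kappa>'_def)
  note kb = saddle_term_bounds[OF k \<mu>']
  note kb' = saddle_term_bounds[OF k' \<mu>']
  have \<mu>0: "\<mu> \<ge> 0" using kb'(7)[of 0] by simp
  have node: "u*c - \<zeta> j = u*c*(1 - \<kappa>' j * inverse c)" if "c \<noteq> 0" for c j
    using u that by (simp add: \<kappa>'_def field_simps)
  define L where "L = (\<lambda>t i. Ln (1 - \<kappa> i*(cis t - 1)/(1 - \<kappa> i)))"
  define L' where "L' = (\<lambda>t j. Ln (1 - \<kappa>' j*(cis (- t) - 1)/(1 - \<kappa>' j)))"
  \<comment> \<open>The linear terms put in here are the ones that \<open>sad\<close> contributes to
    the exponent n u y (cis t - 1), so what is left is of second order in t.\<close>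
  define E where "E = (\<lambda>t. (\<Sum>i<d. L t i + \<kappa> i*(cis t - 1)/(1 - \<kappa> i))
      + (\<Sum>j<2*n+1. \<kappa>' j*(cis t - 1)/(1 - \<kappa>' j) - L' t j))"
  \<comment> \<open>The 2 n + 1 node factors give cis (- (2 n + 1) t), the measure gives one factor
    cis t back, and n u y is 2 n to leading order: this is the weight with m = 2 n.\<close>
  define w where "w = (\<lambda>t. exp (of_nat (2*n)*(cis t - 1 - \<i> * of_real t)))"
  have nodes_nz: "(\<Prod>j<2*n+1. u - \<zeta> j) \<noteq> 0"
  proof -
    have "u - \<zeta> j \<noteq> 0" if "j < 2*n+1" for j
      using node[of 1 j] kb'(1)[OF that] u by simp
    then show ?thesis by (simp only: prod_zero_iff finite_lessThan) auto
  qed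
  have num_nz: "(\<Prod>i<d. 1 - x i * u) \<noteq> 0"
    using kb(1) unfolding \<kappa>_def by (simp only: prod_zero_iff finite_lessThan) auto
  have Fu: "F y u * u \<noteq> 0" using nodes_nz num_nz u by (simp add: F_def)
  have f_eq: "F y (u * cis t)*(u * cis t) = F y u * u*(w t*exp (E t))" for t
  proof -
    have "(\<Prod>i<d. 1 - x i*(u * cis t)) = (\<Prod>i<d. (1 - x i * u)*exp (L t i))"
      using kb(2) by (intro prod.cong refl) (auto simp: \<kappa>_def L_def mult.assoc)
    also have "\<dots> = (\<Prod>i<d. 1 - x i * u)*exp (\<Sum>i<d. L t i)"
      by (simp only: prod.distrib exp_sum finite_lessThan)
    finally have 1: "(\<Prod>i<d. 1 - x i*(u * cis t)) = (\<Prod>i<d. 1 - x i * u)*exp (\<Sum>i<d. L t i)" .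
    have "(\<Prod>j<2*n+1. u * cis t - \<zeta> j) = (\<Prod>j<2*n+1. (u - \<zeta> j) * cis t*exp (L' t j))"
    proof (intro prod.cong refl)
      fix j assume "j \<in> {..<2*n+1}"
      then have j: "j < 2*n+1" by simp
      have "u * cis t - \<zeta> j = u * cis t*(1 - \<kappa>' j * cis (- t))"
        using node[of "cis t" j] by (simp flip: cis_inverse)
      also have "1 - \<kappa>' j * cis (- t) = (1 - \<kappa>' j)*exp (L' t j)"
        unfolding L'_def by (rule kb'(5)[OF j])
      also have "u * cis t*((1 - \<kappa>' j)*exp (L' t j)) = (u*(1 - \<kappa>' j)) * cis t*exp (L' t j)"
        by (simp only: mult_ac)
      also have "u*(1 - \<kappa>' j) = u - \<zeta> j" using node[of 1 j] by simp
      finally show "u * cis t - \<zeta> j = (u - \<zeta> j) * cis t*exp (L' t j)" .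
    qed
    also have "\<dots> = (\<Prod>j<2*n+1. u - \<zeta> j) * cis t^(2*n+1)*exp (\<Sum>j<2*n+1. L' t j)"
      by (simp only: prod.distrib exp_sum finite_lessThan prod_constant card_lessThan)
    finally have 2: "(\<Prod>j<2*n+1. u * cis t - \<zeta> j)
        = (\<Prod>j<2*n+1. u - \<zeta> j) * cis t^(2*n+1)*exp (\<Sum>j<2*n+1. L' t j)" .
    have "of_nat n*(u * cis t) * y = of_nat n * u * y + of_nat n * u * y*(cis t - 1)"
      by (simp add: algebra_simps)
    also have "of_nat n * u * y*(cis t - 1) = of_nat (2*n)*(cis t - 1)
       + ((\<Sum>i<d. \<kappa> i*(cis t - 1)/(1 - \<kappa> i)) + (\<Sum>j<2*n+1. \<kappa>' j*(cis t - 1)/(1 - \<kappa>' j)))"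
      unfolding sad \<kappa>_def \<kappa>'_def
      by (simp only: distrib_right sum_distrib_right of_nat_mult of_nat_numeral add.assoc)
         (simp add: times_divide_eq_left)
    also have "of_nat (2*n)*(cis t - 1) + ((\<Sum>i<d. \<kappa> i*(cis t - 1)/(1 - \<kappa> i))
         + (\<Sum>j<2*n+1. \<kappa>' j*(cis t - 1)/(1 - \<kappa>' j)))
       = of_nat (2*n)*(cis t - 1 - \<i> * of_real t) + of_nat (2*n)*(\<i> * of_real t)
          + E t - (\<Sum>i<d. L t i) + (\<Sum>j<2*n+1. L' t j)"
      unfolding E_def sum.distrib sum_subtractf by (simp only: right_diff_distrib) (simp only: algebra_simps)
    finally have "exp (of_nat n*(u * cis t) * y) = exp (of_nat n * u * y)*(w t
        * exp (of_nat (2*n)*(\<i> * of_real t))*exp (E t)/exp (\<Sum>i<d. L t i)*exp (\<Sum>j<2*n+1. L' t j))"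
      by (simp only: exp_add exp_diff w_def)
    moreover have "exp (of_nat (2*n)*(\<i> * of_real t)) = cis t^(2*n)"
      by (simp only: cis_conv_exp exp_of_nat_mult)
    ultimately have 3: "exp (of_nat n*(u * cis t) * y) = exp (of_nat n * u * y)*(w t
        * cis t^(2*n)*exp (E t)/exp (\<Sum>i<d. L t i)*exp (\<Sum>j<2*n+1. L' t j))"
      by (simp only:)
    have "a * e1/(b*(c^(2*n+1)) * e2)*(ex*(W*c^(2*n) * E1/e1 * e2))*(u*c)
        = a/b * ex * u*(W * E1)"
      if "e1 \<noteq> 0" "e2 \<noteq> 0" "b \<noteq> 0" "c \<noteq> 0" for a b c e1 e2 ex W E1 :: complex
      using that by (simp add: field_simps)
    note this[of "exp (\<Sum>i<d. L t i)" "exp (\<Sum>j<2*n+1. L' t j)" "\<Prod>j<2*n+1. u - \<zeta> j" "cis t"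
        "\<Prod>i<d. 1 - x i * u" "exp (of_nat n * u * y)" "w t" "exp (E t)"]
    then show ?thesis unfolding F_def 1 2 3 using nodes_nz by simp
  qed
  have Eb: "cmod (E t) \<le> (10 * \<mu>)*(real n * t\<^sup>2)" for t
  proof -
    have "cmod (E t) \<le> (\<Sum>i<d. \<mu> * t\<^sup>2) + (\<Sum>j<2*n+1. 3 * \<mu> * t\<^sup>2)"
      unfolding E_def L_def L'_def
      by (intro order.trans[OF norm_triangle_ineq] add_mono sum_norm_le kb(3) kb'(4)) auto
    also have "\<dots> = (real d + 3*(2*real n + 1))*(\<mu> * t\<^sup>2)" by (simp add: algebra_simps)
    also have "\<dots> \<le> (10*real n)*(\<mu> * t\<^sup>2)" using n \<mu>0 by (intro mult_right_mono) auto
    finally show ?thesis by (simp add: mult_ac)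
  qed
  have wb: "cmod (w t) \<le> exp (- (2*(1/5)*(real n * t\<^sup>2)))" if "t \<in> {-pi..pi}" for t
  proof -
    have "cmod (w t) = exp (- (2*real n*(1 - cos t)))" by (simp add: w_def algebra_simps)
    moreover have "2*real n*(t\<^sup>2/5) \<le> 2*real n*(1 - cos t)"
      using that by (intro mult_left_mono one_minus_cos_ge) auto
    ultimately show ?thesis by simp
  qed
  have contF: "continuous_on (sphere 0 (cmod u)) (F y)"
  proof -
    have "s - \<zeta> j \<noteq> 0" if "s \<in> sphere 0 (cmod u)" "j < 2*n+1" for s j
    proof
      assume "s - \<zeta> j = 0"
      then have "cmod (\<kappa>' j) = 1" using that u by (simp add: \<kappa>'_def norm_divide)
      then show False using k'[OF that(2)] \<mu> by simp
    qed
    then have "(\<Prod>j<2*n+1. s - \<zeta> j) \<noteq> 0" if "s \<in> sphere 0 (cmod u)" for s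
      using that by (simp only: prod_zero_iff finite_lessThan) auto
    then show ?thesis unfolding F_def by (intro continuous_intros) auto
  qed
  have contE: "continuous_on {-pi..pi} (\<lambda>t. w t*exp (E t))"
  proof -
    have "continuous_on {-pi..pi} (\<lambda>t. F y (u * cis t))"
      by (rule continuous_on_compose2[OF contF]) (auto intro!: continuous_on_mult continuous_on_const continuous_on_cis continuous_on_id simp: norm_mult)
    then have "continuous_on {-pi..pi} (\<lambda>t. F y (u * cis t)*(u * cis t)/(F y u * u))"
      by (intro continuous_intros) (use Fu in auto)
    moreover have "(\<lambda>t. F y (u * cis t)*(u * cis t)/(F y u * u)) = (\<lambda>t. w t*exp (E t))"
      using Fu by (intro ext) (subst f_eq, simp)
    ultimately show ?thesis by (simp only:)
  qed
  define I where "I = integral {-pi..pi} (\<lambda>t. w t*exp (E t))"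
  have "cmean (cmod u) (F y) = integral {-pi..pi} (\<lambda>t. F y (u * cis t)*(u * cis t))/(2 * of_real pi)"
    by (rule cmean_eq_integral) (use u contF in auto)
  also have "\<dots> = F y u * u*(I/(2 * of_real pi))"
    unfolding f_eq I_def by (simp add: integral_mult_right)
  finally have eq: "cmean (cmod u) (F y) = F y u * u*(I/(2 * of_real pi))" .
  have \<eta>: "10 * \<mu> \<le> 1/5" "0 \<le> 10 * \<mu>" using \<mu> \<mu>0 by auto
  have "cmod (I - integral {-pi..pi} w) \<le> (10 * \<mu>)*(2/(1/5)) * pi * sqrt (2/(1/5))/sqrt (real n)"
    unfolding I_def
  proof (rule saddle_compare[where ?x0.0 = 0])
    fix t :: real assume t: "t \<in> {-pi..pi}"
    have "cmod (w t*exp (E t) - w t) \<le> (10 * \<mu>)*(real n * t\<^sup>2)*exp (- (1/5)*(real n * t\<^sup>2))"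
      by (rule saddle_exp_compare[OF wb[OF t] Eb \<eta>]) auto
    also have "\<dots> \<le> (10 * \<mu>)*(real n * t\<^sup>2 + 1)*exp (- (1/5)*(real n * t\<^sup>2))"
      using \<mu>0 by (intro mult_right_mono mult_left_mono) auto
    finally show "cmod (w t*exp (E t) - w t)
        \<le> (10 * \<mu>)*(real n*(t - 0)\<^sup>2 + 1)*exp (- (1/5)*(real n*(t - 0)\<^sup>2))" by simp
  qed (use contE n \<eta> in \<open>auto intro!: continuous_intros simp: w_def\<close>)
  \<comment> \<open>Budget in units of 1/sqrt n: the model integral is at least 1.3, the
    perturbation at most 0.51, and the remaining 0.79 divided by 2 \<pi> exceeds 1/8.\<close>
  also have "\<dots> \<le> 51/100/sqrt (real n)"
  proof (rule divide_right_mono)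
    have "sqrt 10 \<le> 16/5" by (rule real_le_lsqrt) (auto simp: power2_eq_square)
    moreover have "pi \<le> 63/20" using pi_approx by simp
    ultimately have "10 * \<mu>*10 * pi * sqrt 10 \<le> (10*(1/2000))*10*(63/20)*(16/5)"
      using \<mu> \<mu>0 by (intro mult_mono) auto
    then show "(10 * \<mu>)*(2/(1/5)) * pi * sqrt (2/(1/5)) \<le> 51/100" by simp
  qed auto
  finally have diff: "cmod (I - integral {-pi..pi} w) \<le> 51/100/sqrt (real n)" .
  have "cmod (integral {-pi..pi} w) = 2 * pi*(real (2*n)^(2*n)*exp (- real (2*n))/fact (2*n))"
  proof -
    have eqw: "integral {-pi..pi} w = of_real (2 * pi*(real (2*n)^(2*n)*exp (- real (2*n))/fact (2*n)))"
      unfolding w_def by (rule integral_circle_weight) (use n in auto)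
    show ?thesis unfolding eqw norm_of_real by (rule abs_of_nonneg) simp
  qed
  also have "\<dots> \<ge> 2 * pi*(1/(exp 1 * sqrt (real (2*n))))"
    by (intro mult_left_mono power_div_fact_ge) (use n in auto)
  moreover have "13/10/sqrt (real n) \<le> 2 * pi*(1/(exp 1 * sqrt (real (2*n))))"
  proof -
    have "exp 1 * sqrt 2 \<le> 14/5*(3/2::real)"
    proof (rule mult_mono)
      show "exp (1::real) \<le> 14/5" using e_less_272 by simp
      show "sqrt 2 \<le> 3/2" by (rule real_le_lsqrt) (auto simp: power2_eq_square)
    qed auto
    then have "13/10*(exp 1 * sqrt 2) \<le> 2 * pi" using pi_gt3 by linarith
    then show ?thesis using n by (simp add: real_sqrt_mult field_simps)
  qed
  ultimately have Iw: "13/10/sqrt (real n) \<le> cmod (integral {-pi..pi} w)" by linarith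
  have "cmod (integral {-pi..pi} w) \<le> cmod I + 51/100/sqrt (real n)"
    using diff norm_triangle_ineq2[of "integral {-pi..pi} w" I] by (simp add: norm_minus_commute)
  then have "79/100/sqrt (real n) \<le> cmod I" using Iw by (simp add: field_simps)
  then have "79/100/sqrt (real n)/(2 * pi) \<le> cmod (I/(2 * of_real pi))"
    unfolding norm_divide by (intro divide_mono) (auto simp: norm_mult)
  moreover have "1/(8 * sqrt (real n)) \<le> 79/100/sqrt (real n)/(2 * pi)"
  proof -
    have "pi \<le> 63/20" using pi_approx by simp
    then show ?thesis using n by (simp add: field_simps)
  qed
  moreover have "cmod I \<le> 1*(pi - (- pi))"
    unfolding I_def
  proof (rule integral_bound)
    fix t :: real assume t: "t \<in> {-pi..pi}"
    have "cmod (E t) \<le> (1/5)*(real n * t\<^sup>2)"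
      using Eb[of t] mult_right_mono[OF \<eta>(1), of "real n * t\<^sup>2"] by simp
    moreover have "0 \<le> real n * t\<^sup>2" by simp
    ultimately have "Re (E t) \<le> 2*(1/5)*(real n * t\<^sup>2)"
      using complex_Re_le_cmod[of "E t"] by linarith
    then have "cmod (w t)*cmod (exp (E t)) \<le> exp (- (2*(1/5)*(real n * t\<^sup>2)))*exp (2*(1/5)*(real n * t\<^sup>2))"
      by (intro mult_mono wb[OF t]) auto
    then show "cmod (w t*exp (E t)) \<le> 1" by (simp only: norm_mult flip: exp_add) simp
  qed (use contE in auto)
  then have "cmod (I/(2 * of_real pi)) \<le> 1" by (simp add: norm_divide)
  ultimately show ?thesis using eq by (intro exI[of _ "I/(2 * of_real pi)"]) simp
qed

lemma abs_ln_cmod_one_plus_le: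
  assumes "cmod z < 1/2"
  shows "\<bar>ln (cmod (1 + z))\<bar> \<le> 2*cmod z"
proof -
  have "1 + z \<noteq> 0"
  proof
    assume "1 + z = 0"
    then have "z = - 1" by (metis add_eq_0_iff)
    then show False using assms by simp
  qed
  then have "\<bar>ln (cmod (1 + z))\<bar> = \<bar>Re (Ln (1 + z))\<bar>" by simp
  also have "\<dots> \<le> cmod (Ln (1 + z))" by (rule abs_Re_le_cmod)
  also have "\<dots> \<le> 2*cmod z" using assms by (rule norm_Ln_le)
  finally show ?thesis .
qed

section \<open>The spline of a polynomial\<close>

definition node_poly :: "nat \<Rightarrow> (nat \<Rightarrow> complex) \<Rightarrow> complex \<Rightarrow> complex" where
  "node_poly n \<zeta> s = (\<Prod>j<2*n+1. s - \<zeta> j)"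

lemma node_poly_holomorphic [holomorphic_intros]: "node_poly n \<zeta> holomorphic_on S"
  unfolding node_poly_def by (intro holomorphic_intros)

lemma node_poly_continuous [continuous_intros]: "continuous_on S (node_poly n \<zeta>)"
  by (intro holomorphic_on_imp_continuous_on node_poly_holomorphic)

lemma node_poly_nonzero:
  assumes "\<And>j. j < 2*n+1 \<Longrightarrow> cmod (\<zeta> j) \<le> \<delta>" "\<delta> < cmod s"
  shows "node_poly n \<zeta> s \<noteq> 0"
proof -
  have "s \<noteq> \<zeta> j" if "j < 2*n+1" for j using assms(1)[OF that] assms(2) by auto
  then show ?thesis unfolding node_poly_def by (simp only: prod_zero_iff finite_lessThan) auto
qed

definition node_mean :: "nat \<Rightarrow> (nat \<Rightarrow> complex) \<Rightarrow> real \<Rightarrow> (complex \<Rightarrow> complex) \<Rightarrow> complex" where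
  "node_mean n \<zeta> R g = cmean R (\<lambda>s. g s/node_poly n \<zeta> s)"

text \<open>\<open>spline\<close> is the inverse Laplace transform of \<open>Q/node_poly\<close>, an exponential polynomial
  annihilated by the differential operator whose symbol is \<open>node_poly\<close>.\<close>

definition spline :: "nat \<Rightarrow> (nat \<Rightarrow> complex) \<Rightarrow> real \<Rightarrow> complex poly \<Rightarrow> complex \<Rightarrow> complex" where
  "spline n \<zeta> R Q y = node_mean n \<zeta> R (\<lambda>s. poly Q s*exp (of_nat n * s * y))"

lemma node_quotient_continuous:
  assumes "\<And>j. j < 2*n+1 \<Longrightarrow> cmod (\<zeta> j) \<le> \<delta>" "\<delta> < R" "continuous_on (sphere 0 R) g"
  shows "continuous_on (sphere 0 R) (\<lambda>s. g s/node_poly n \<zeta> s)"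
  by (intro continuous_intros assms(3)) (use node_poly_nonzero[OF assms(1)] assms(2) in auto)

lemma node_mean_radius:
  assumes \<zeta>: "\<And>j. j < 2*n+1 \<Longrightarrow> cmod (\<zeta> j) \<le> \<delta>" and "0 \<le> \<delta>" "\<delta> < r" "\<delta> < R"
    and g: "g holomorphic_on - cball 0 \<delta>"
  shows "node_mean n \<zeta> r g = node_mean n \<zeta> R g"
proof -
  have *: "node_mean n \<zeta> r g = node_mean n \<zeta> R g" if "\<delta> < r" "r \<le> R" for r R
    unfolding node_mean_def
  proof (rule cmean_radius[where S = "- cball 0 \<delta>"])
    show "(\<lambda>s. g s/node_poly n \<zeta> s) holomorphic_on - cball 0 \<delta>"
    proof (intro holomorphic_intros g)
      fix s :: complex assume "s \<in> - cball 0 \<delta>"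
      then show "node_poly n \<zeta> s \<noteq> 0" by (intro node_poly_nonzero[OF \<zeta>]) simp_all
    qed
    show "0 < r" "r \<le> R" using that \<open>0 \<le> \<delta>\<close> by linarith+
    show "x \<in> - cball 0 \<delta>" if "r \<le> cmod x" for x using that \<open>\<delta> < r\<close> by simp
  qed (simp add: open_Compl)
  show ?thesis
  proof (cases "r \<le> R")
    case True
    show ?thesis by (rule *[OF \<open>\<delta> < r\<close> True])
  next
    case False
    then show ?thesis by (intro *[OF \<open>\<delta> < R\<close>, symmetric]) simp
  qed
qed

lemma spline_radius:
  assumes "\<And>j. j < 2*n+1 \<Longrightarrow> cmod (\<zeta> j) \<le> \<delta>" "0 \<le> \<delta>" "\<delta> < r" "\<delta> < R"
  shows "spline n \<zeta> r Q y = spline n \<zeta> R Q y"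
  unfolding spline_def by (rule node_mean_radius[OF assms]) (assumption | intro holomorphic_intros)+

text \<open>For constant Q and nodes 0 the integrand is s^(-2n-1) e^(n s y), with saddle 2/y and
  size (y/2)^(2n) e^(2n). The condition \<open>3/cmod y \<le> \<mu> * \<epsilon>\<close> places the
  saddle deep inside the zero-free disk of Q, and \<open>\<delta>*cmod y \<le> \<mu>\<close> places
  the nodes deep inside the circle through the saddle, so each factor is perturbed by a relative
  amount of order \<mu>.\<close>

lemma spline_size:
  fixes n :: nat and Q :: "complex poly"
  assumes n: "1 \<le> n" and deg: "degree Q \<le> n" and "0 < \<epsilon>"
    and Qnz: "\<And>s. cmod s < \<epsilon> \<Longrightarrow> poly Q s \<noteq> 0"
    and \<mu>: "0 < \<mu>" "\<mu> \<le> 1/2000"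
    and \<zeta>: "\<And>j. j < 2*n+1 \<Longrightarrow> cmod (\<zeta> j) \<le> \<delta>" and \<delta>: "0 \<le> \<delta>" "\<delta> < R"
    and y: "3/cmod y \<le> \<mu> * \<epsilon>" "\<delta>*cmod y \<le> \<mu>" "y \<noteq> 0"
  shows "spline n \<zeta> R Q y \<noteq> 0"
    "\<bar>ln (cmod (spline n \<zeta> R Q y)) - (ln (cmod (poly Q 0)) + 2*real n*ln (cmod y/2) + 2*real n)\<bar>
       \<le> 32 * \<mu>*real n + ln (8 * sqrt (real n))"
proof -
  have Q0: "poly Q 0 \<noteq> 0" using Qnz[of 0] \<open>0 < \<epsilon>\<close> by simp
  obtain x where x: "\<And>z. poly Q z = poly Q 0*(\<Prod>i<degree Q. 1 - x i * z)"
    "\<And>i. i < degree Q \<Longrightarrow> cmod (x i) \<le> 1 / \<epsilon>"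
    using poly_zero_free_factor[OF \<open>0 < \<epsilon>\<close> Qnz] by blast
  define d where "d = degree Q"
  have d: "d \<le> n" using deg by (simp add: d_def)
  have xb: "cmod (x i) \<le> 1 / \<epsilon>" if "i < d" for i using x(2) that by (simp add: d_def)
  define S where "S = (\<lambda>w. (\<Sum>i<d. x i * w/(1 - x i * w))
      + (\<Sum>j<2*n+1. (\<zeta> j / w)/(1 - \<zeta> j / w)))"
  define D where "D = cball (2/y) (1/cmod y)"
  have D: "1/cmod y \<le> cmod w" "cmod w \<le> 3/cmod y" "w \<noteq> 0" if "w \<in> D" for w
  proof -
    have "cmod (2/y - w) \<le> 1/cmod y" using that by (simp add: D_def dist_norm)
    moreover have "cmod (2/y) = 2/cmod y" by (simp add: norm_divide)
    ultimately show "1/cmod y \<le> cmod w" "cmod w \<le> 3/cmod y"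
      using norm_triangle_ineq2[of "2/y" w] norm_triangle_ineq3[of "2/y" w]
      by (simp_all add: abs_le_iff diff_divide_distrib field_simps)
    then show "w \<noteq> 0" using y by auto
  qed
  have kx: "cmod (x i * w) \<le> \<mu>" if "i < d" "w \<in> D" for i w
  proof -
    have "cmod (x i * w) \<le> (1 / \<epsilon>)*(\<mu> * \<epsilon>)"
      unfolding norm_mult using xb[OF that(1)] D[OF that(2)] y \<open>0 < \<epsilon>\<close> by (intro mult_mono) auto
    then show ?thesis using \<open>0 < \<epsilon>\<close> by simp
  qed
  have kz: "cmod (\<zeta> j / w) \<le> \<mu>" if "j < 2*n+1" "w \<in> D" for j w
  proof -
    have "cmod (\<zeta> j / w) \<le> \<delta>/(1/cmod y)"
      unfolding norm_divide using \<zeta>[OF that(1)] D[OF that(2)] y \<delta> by (intro frac_le) auto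
    then show ?thesis using y by simp
  qed
  have \<mu>': "\<mu> \<le> 1/32" using \<mu> by simp
  have Sb: "cmod (S w) \<le> 8 * \<mu>*real n" if "w \<in> D" for w
  proof -
    have "cmod (S w) \<le> (\<Sum>i<d. 2 * \<mu>) + (\<Sum>j<2*n+1. 2 * \<mu>)"
      unfolding S_def
      by (intro order.trans[OF norm_triangle_ineq] add_mono sum_norm_le
            saddle_term_bounds(6)[OF kx \<mu>'] saddle_term_bounds(6)[OF kz \<mu>']) (use that in auto)
    also have "\<dots> = (real d + (2*real n + 1))*(2 * \<mu>)" by (simp add: algebra_simps)
    also have "\<dots> \<le> (4*real n)*(2 * \<mu>)" using d n \<mu> by (intro mult_right_mono) auto
    finally show ?thesis by (simp add: mult_ac)
  qed
  \<comment> \<open>A fixed point of \<open>g\<close> is a critical point of the full integrand. As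
    \<open>S\<close> is O(\<mu> n), \<open>g\<close> maps the disk about 2/y into itself and
    Brouwer's theorem provides the point, whose modulus is then the radius of the contour.\<close>
  define g where "g = (\<lambda>w. (2 * of_nat n + S w)/(of_nat n * y))"
  have ypos: "0 < 1/cmod y" using y(3) by simp
  have gcont: "continuous_on (cball (2/y) (1/cmod y)) g"
  proof -
    have "continuous_on D S"
      unfolding S_def
    proof (rule continuous_on_add)
      show "continuous_on D (\<lambda>w. \<Sum>i<d. x i * w/(1 - x i * w))"
      proof (rule continuous_on_sum)
        fix i assume "i \<in> {..<d}"
        then have "\<forall>w\<in>D. 1 - x i * w \<noteq> 0" using saddle_term_bounds(1)[OF kx \<mu>'] by blast
        then show "continuous_on D (\<lambda>w. x i * w/(1 - x i * w))" by (intro continuous_intros)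
      qed
      show "continuous_on D (\<lambda>w. \<Sum>j<2*n+1. (\<zeta> j / w)/(1 - \<zeta> j / w))"
      proof (rule continuous_on_sum)
        fix j assume "j \<in> {..<2*n+1}"
        then have "\<forall>w\<in>D. 1 - \<zeta> j / w \<noteq> 0" using saddle_term_bounds(1)[OF kz \<mu>'] by blast
        moreover have "\<forall>w\<in>D. w \<noteq> 0" using D(3) by blast
        ultimately show "continuous_on D (\<lambda>w. (\<zeta> j / w)/(1 - \<zeta> j / w))" by (intro continuous_intros)
      qed
    qed
    moreover have "of_nat n * y \<noteq> 0" using n y(3) by simp
    ultimately show ?thesis unfolding g_def D_def by (intro continuous_intros) auto
  qed
  have gmap: "g \<in> cball (2/y) (1/cmod y) \<rightarrow> cball (2/y) (1/cmod y)"
    proof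
      fix w assume "w \<in> cball (2/y) (1/cmod y)"
      then have s: "cmod (S w) \<le> 8 * \<mu>*real n" using Sb by (simp add: D_def)
      have "2/y - g w = - S w/(of_nat n * y)" using n y by (simp add: g_def field_simps)
      then have "cmod (2/y - g w) = cmod (S w)/(real n*cmod y)"
        by (simp add: norm_divide norm_mult)
      also have "\<dots> \<le> (1*real n)/(real n*cmod y)"
      proof (rule divide_right_mono)
        have "8 * \<mu>*real n \<le> 1*real n" using \<mu> by (intro mult_right_mono) auto
        then show "cmod (S w) \<le> 1*real n" using s by linarith
      qed auto
      finally show "g w \<in> cball (2/y) (1/cmod y)" using n by (simp add: dist_norm)
    qed
  obtain w where w: "w \<in> D" "g w = w"
    using brouwer_ball[OF ypos gcont gmap] unfolding D_def by metis
  note Dw = D[OF w(1)]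
  have sad: "of_nat n * w * y = 2 * of_nat n + S w"
    using arg_cong[OF w(2), of "\<lambda>u. of_nat n * u * y"] n y by (simp add: g_def)
  define F where "F = (\<lambda>y s. (\<Prod>i<d. 1 - x i * s)/(\<Prod>j<2*n+1. s - \<zeta> j)*exp (of_nat n * s * y))"
  obtain J where J: "cmean (cmod w) (F y) = F y w * w * J" "1/(8 * sqrt n) \<le> cmod J" "cmod J \<le> 1"
    using circle_saddle[where x = x and \<zeta> = \<zeta> and d = d, OF n d Dw(3) \<mu>(2) kx[OF _ w(1)] kz[OF _ w(1)],
        of y] sad unfolding F_def S_def by (auto simp: add.assoc)
  have "\<delta> < cmod w"
  proof -
    have "\<delta> < 1/cmod y" using y \<mu> by (simp add: field_simps)
    then show ?thesis using Dw(1) by linarith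
  qed
  then have "spline n \<zeta> R Q y = spline n \<zeta> (cmod w) Q y"
    by (intro spline_radius[OF \<zeta>] \<delta>)
  also have "\<dots> = cmean (cmod w) (\<lambda>s. poly Q 0 * F y s)"
    unfolding spline_def node_mean_def
  proof (rule cmean_cong)
    fix s
    show "poly Q s*exp (of_nat n * s * y)/node_poly n \<zeta> s = poly Q 0 * F y s"
      unfolding F_def node_poly_def d_def by (subst x(1)) simp
  qed (use Dw in simp)
  also have "\<dots> = poly Q 0 * cmean (cmod w) (F y)"
  proof (rule cmean_cmult)
    have "continuous_on (sphere 0 (cmod w)) (\<lambda>s. ((\<Prod>i<d. 1 - x i * s)*exp (of_nat n * s * y))/node_poly n \<zeta> s)"
      by (rule node_quotient_continuous[OF \<zeta> \<open>\<delta> < cmod w\<close>]) (auto intro!: continuous_intros)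
    then show "continuous_on (sphere 0 (cmod w)) (F y)" by (simp add: F_def node_poly_def)
  qed (use Dw in simp)
  finally have eq: "spline n \<zeta> R Q y = poly Q 0*(F y w * w * J)" by (simp only: J)
  have prodj: "(\<Prod>j<2*n+1. w - \<zeta> j) = w^(2*n+1)*(\<Prod>j<2*n+1. 1 - \<zeta> j / w)"
  proof -
    have "(\<Prod>j<2*n+1. w - \<zeta> j) = (\<Prod>j<2*n+1. w*(1 - \<zeta> j / w))"
      using Dw(3) by (intro prod.cong refl) (simp add: field_simps)
    then show ?thesis by (simp only: prod.distrib prod_constant card_lessThan)
  qed
  define px where "px = (\<Prod>i<d. cmod (1 - x i * w))"
  define pz where "pz = (\<Prod>j<2*n+1. cmod (1 - \<zeta> j / w))"
  have nz1: "1 - x i * w \<noteq> 0" if "i < d" for i using saddle_term_bounds(1)[OF kx \<mu>'] that w(1) by auto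
  have nz2: "1 - \<zeta> j / w \<noteq> 0" if "j < 2*n+1" for j using saddle_term_bounds(1)[OF kz \<mu>'] that w(1) by auto
  have px: "px > 0" "\<bar>ln px\<bar> \<le> 2 * \<mu>*real n"
  proof -
    show "px > 0" unfolding px_def using nz1 by (intro prod_pos) auto
    have "ln px = (\<Sum>i<d. ln (cmod (1 - x i * w)))"
      unfolding px_def by (subst ln_prod) (use nz1 in auto)
    also have "\<bar>\<dots>\<bar> \<le> (\<Sum>i<d. 2 * \<mu>)"
    proof (rule order.trans[OF sum_abs sum_mono])
      fix i assume i: "i \<in> {..<d}"
      have "\<bar>ln (cmod (1 + - (x i * w)))\<bar> \<le> 2*cmod (- (x i * w))"
        by (rule abs_ln_cmod_one_plus_le) (use kx[of i w] i w \<mu> in auto)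
      then show "\<bar>ln (cmod (1 - x i * w))\<bar> \<le> 2 * \<mu>" using kx[of i w] i w by auto
    qed
    also have "\<dots> \<le> 2 * \<mu>*real n" using d \<mu> by simp
    finally show "\<bar>ln px\<bar> \<le> 2 * \<mu>*real n" .
  qed
  have pz: "pz > 0" "\<bar>ln pz\<bar> \<le> 6 * \<mu>*real n"
  proof -
    show "pz > 0" unfolding pz_def using nz2 by (intro prod_pos) auto
    have "ln pz = (\<Sum>j<2*n+1. ln (cmod (1 - \<zeta> j / w)))"
      unfolding pz_def by (subst ln_prod) (use nz2 in auto)
    also have "\<bar>\<dots>\<bar> \<le> (\<Sum>j<2*n+1. 2 * \<mu>)"
    proof (rule order.trans[OF sum_abs sum_mono])
      fix i assume i: "i \<in> {..<2*n+1}"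
      have "\<bar>ln (cmod (1 + - (\<zeta> i / w)))\<bar> \<le> 2*cmod (- (\<zeta> i / w))"
        by (rule abs_ln_cmod_one_plus_le) (use kz[of i w] i w \<mu> in auto)
      then show "\<bar>ln (cmod (1 - \<zeta> i / w))\<bar> \<le> 2 * \<mu>" using kz[of i w] i w by auto
    qed
    also have "\<dots> = (2*real n + 1)*(2 * \<mu>)" by (simp add: algebra_simps)
    also have "\<dots> \<le> (3*real n)*(2 * \<mu>)" using n \<mu> by (intro mult_right_mono) auto
    finally show "\<bar>ln pz\<bar> \<le> 6 * \<mu>*real n" by (simp add: mult_ac)
  qed
  have Fn: "cmod (F y w * w) = px/pz/cmod w^(2*n)*exp (Re (of_nat n * w * y))"
  proof -
    have "cmod (F y w * w) = px/(cmod w^(2*n+1) * pz)*exp (Re (of_nat n * w * y))*cmod w"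
      unfolding F_def prodj px_def pz_def
      by (simp only: norm_mult norm_divide norm_power norm_exp_eq_Re prod_norm[symmetric])
    then show ?thesis using Dw(3) by (simp add: field_simps)
  qed
  have sJ: "1/(8 * sqrt n) > 0" using n by simp
  have Jpos: "cmod J > 0" using J(2) sJ by linarith
  have Fpos: "cmod (F y w * w) > 0" unfolding Fn using px pz Dw(3) by (intro mult_pos_pos divide_pos_pos) auto
  show "spline n \<zeta> R Q y \<noteq> 0" using eq Q0 Jpos Fpos by auto
  have lnF: "ln (cmod (F y w * w)) = ln px - ln pz - 2*real n*ln (cmod w) + Re (of_nat n * w * y)"
    unfolding Fn using px pz Dw(3) by (simp add: ln_mult ln_div ln_realpow divide_pos_pos)
  have lnsp: "ln (cmod (spline n \<zeta> R Q y)) = ln (cmod (poly Q 0)) + (ln (cmod (F y w * w)) + ln (cmod J))"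
  proof -
    have "ln (a*(b*c)) = ln a + (ln b + ln c)" if "a > 0" "b > 0" "c > 0" for a b c :: real
      using that by (simp add: ln_mult)
    from this[OF _ Fpos Jpos, of "cmod (poly Q 0)"] Q0 show ?thesis
      unfolding eq norm_mult[of "poly Q 0"] norm_mult[of _ J] by simp
  qed
  have re: "\<bar>Re (of_nat n * w * y) - 2*real n\<bar> \<le> 8 * \<mu>*real n"
    unfolding sad using abs_Re_le_cmod[of "S w"] Sb[OF w(1)] by simp
  have ls: "\<bar>ln (cmod w) + ln (cmod y/2)\<bar> \<le> 8 * \<mu>"
  proof -
    have e: "w * y/2 = 1 + S w/(2 * of_nat n)"
      using arg_cong[OF sad, of "\<lambda>u. u/(2 * of_nat n)"] n by (simp add: add_divide_distrib)
    have Sn: "cmod (S w/(2 * of_nat n)) \<le> 4 * \<mu>"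
      using Sb[OF w(1)] n by (simp add: norm_divide norm_mult field_simps)
    have "\<bar>ln (cmod (w * y/2))\<bar> \<le> 2*cmod (S w/(2 * of_nat n))"
      unfolding e by (rule abs_ln_cmod_one_plus_le) (use Sn \<mu> in linarith)
    also have "\<dots> \<le> 2*(4 * \<mu>)" by (intro mult_left_mono Sn) simp
    finally have "\<bar>ln (cmod (w * y/2))\<bar> \<le> 2*(4 * \<mu>)" .
    moreover have "ln (cmod (w * y/2)) = ln (cmod w) + ln (cmod y/2)"
    proof -
      have "cmod (w * y/2) = cmod w*(cmod y/2)" by (simp add: norm_mult norm_divide)
      then show ?thesis using Dw(3) y by (simp only:) (subst ln_mult, auto)
    qed
    ultimately show ?thesis by simp
  qed
  have "\<bar>2*real n*(ln (cmod w) + ln (cmod y/2))\<bar> \<le> 16 * \<mu>*real n"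
  proof -
    have "\<bar>2*real n*(ln (cmod w) + ln (cmod y/2))\<bar> = 2*real n * \<bar>ln (cmod w) + ln (cmod y/2)\<bar>"
      by (subst abs_mult) simp
    also have "\<dots> \<le> 2*real n*(8 * \<mu>)" by (intro mult_left_mono ls) simp
    finally show ?thesis by (simp add: mult_ac)
  qed
  moreover have "ln (cmod J) \<le> 0" "- ln (8 * sqrt n) \<le> ln (cmod J)"
  proof -
    show "ln (cmod J) \<le> 0" using J Jpos by simp
    have "ln (1/(8 * sqrt n)) \<le> ln (cmod J)" using J sJ by (subst ln_le_cancel_iff) auto
    then show "- ln (8 * sqrt n) \<le> ln (cmod J)" using n by (simp add: ln_div)
  qed
  moreover have "0 \<le> ln (8 * sqrt n)" using n by (intro ln_ge_zero) (simp add: order.trans[of 1 "8*1"])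
  ultimately show "\<bar>ln (cmod (spline n \<zeta> R Q y)) - (ln (cmod (poly Q 0)) + 2*real n*ln (cmod y/2) + 2*real n)\<bar>
       \<le> 32 * \<mu>*real n + ln (8 * sqrt (real n))"
    unfolding lnsp lnF using re px pz by (simp add: distrib_left abs_le_iff)
qed

section \<open>Zeros of the denominator\<close>

lemma node_mean_add:
  assumes "\<And>j. j < 2*n+1 \<Longrightarrow> cmod (\<zeta> j) \<le> \<delta>" "0 \<le> \<delta>" "\<delta> < R"
    "continuous_on (sphere 0 R) f" "continuous_on (sphere 0 R) g"
  shows "node_mean n \<zeta> R (\<lambda>s. f s + g s) = node_mean n \<zeta> R f + node_mean n \<zeta> R g"
proof -
  have "cmean R (\<lambda>s. f s/node_poly n \<zeta> s + g s/node_poly n \<zeta> s)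
      = cmean R (\<lambda>s. f s/node_poly n \<zeta> s) + cmean R (\<lambda>s. g s/node_poly n \<zeta> s)"
    by (rule cmean_add) (use assms node_quotient_continuous[OF assms(1,3)] in auto)
  then show ?thesis by (simp add: node_mean_def add_divide_distrib)
qed

lemma node_mean_cmult:
  assumes "\<And>j. j < 2*n+1 \<Longrightarrow> cmod (\<zeta> j) \<le> \<delta>" "0 \<le> \<delta>" "\<delta> < R" "continuous_on (sphere 0 R) f"
  shows "node_mean n \<zeta> R (\<lambda>s. c * f s) = c*node_mean n \<zeta> R f"
proof -
  have "cmean R (\<lambda>s. c*(f s/node_poly n \<zeta> s)) = c * cmean R (\<lambda>s. f s/node_poly n \<zeta> s)"
    by (rule cmean_cmult) (use assms node_quotient_continuous[OF assms(1,3)] in auto)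
  then show ?thesis by (simp add: node_mean_def)
qed

lemma node_mean_cong:
  assumes "0 < R" "\<And>s. cmod s = R \<Longrightarrow> f s = g s"
  shows "node_mean n \<zeta> R f = node_mean n \<zeta> R g"
  unfolding node_mean_def by (rule cmean_cong) (use assms in auto)

lemma norm_node_mean_le:
  assumes "\<And>j. j < 2*n+1 \<Longrightarrow> cmod (\<zeta> j) \<le> \<delta>" "0 \<le> \<delta>" "\<delta> < R" "continuous_on (sphere 0 R) f"
    "\<And>s. cmod s = R \<Longrightarrow> cmod (f s) \<le> B"
  shows "cmod (node_mean n \<zeta> R f) \<le> B/(R - \<delta>)^(2*n+1) * R"
  unfolding node_mean_def
proof (rule norm_cmean_le)
  have "cmod (of_real R) = R" using assms by simp
  then have "cmod (f (of_real R)) \<le> B" by (rule assms(5))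
  then have B: "B \<ge> 0" using norm_ge_zero order.trans by blast
  fix s :: complex assume s: "cmod s = R"
  have "(R - \<delta>)^(2*n+1) = (\<Prod>j<2*n+1. R - \<delta>)" by simp
  also have "\<dots> \<le> (\<Prod>j<2*n+1. cmod (s - \<zeta> j))"
  proof (rule prod_mono)
    fix j assume "j \<in> {..<2*n+1}"
    then have "cmod (\<zeta> j) \<le> \<delta>" using assms(1) by simp
    then show "0 \<le> R - \<delta> \<and> R - \<delta> \<le> cmod (s - \<zeta> j)"
      using norm_triangle_ineq2[of s "\<zeta> j"] s assms(3) by linarith
  qed
  also have "\<dots> = cmod (node_poly n \<zeta> s)" by (simp only: node_poly_def prod_norm)
  finally have le: "(R - \<delta>)^(2*n+1) \<le> cmod (node_poly n \<zeta> s)" .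
  have "0 < (R - \<delta>)^(2*n+1)" using assms(3) by simp
  then show "cmod (f s/node_poly n \<zeta> s) \<le> B/(R - \<delta>)^(2*n+1)"
    unfolding norm_divide using assms(5)[OF s] le B by (intro frac_le) auto
qed (use assms node_quotient_continuous[OF assms(1,3,4)] in auto)

text \<open>Differentiation in y multiplies the integrand by n s, so the operator d/dy - n a
  produces the factor n (s - a); e^(- n a y) is its integrating factor. Division of the integrand by
  s - a thus amounts to solving a first order equation.\<close>

lemma node_mean_exp_first_order:
  fixes a :: complex
  assumes \<zeta>: "\<And>j. j < 2*n+1 \<Longrightarrow> cmod (\<zeta> j) \<le> \<delta>" "0 \<le> \<delta>" "\<delta> < R"
    and g: "continuous_on (sphere 0 R) g"
  shows "((\<lambda>y. node_mean n \<zeta> R (\<lambda>s. g s*exp (of_nat n * s * y))*exp (- of_nat n * a * y))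
    has_field_derivative of_nat n*node_mean n \<zeta> R (\<lambda>s. (s - a) * g s*exp (of_nat n * s * y))
      * exp (- of_nat n * a * y)) (at y)"
proof -
  define \<Phi> where "\<Phi> = (\<lambda>y. node_mean n \<zeta> R (\<lambda>s. g s*exp (of_nat n * s * y)))"
  define \<Psi> where "\<Psi> = node_mean n \<zeta> R (\<lambda>s. of_nat n*((s - a) * g s*exp (of_nat n * s * y)))"
  have R: "0 < R" using assms by simp
  have gq: "continuous_on (sphere 0 R) (\<lambda>s. g s/node_poly n \<zeta> s)"
    by (rule node_quotient_continuous[OF \<zeta>(1,3) g])
  have D: "(\<Phi> has_field_derivative \<Psi> + of_nat n * a * \<Phi> y) (at y)"
  proof -
    have "((\<lambda>y. cmean R (\<lambda>s. g s/node_poly n \<zeta> s*exp (of_nat n * s * y))) has_field_derivative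
       cmean R (\<lambda>s. g s/node_poly n \<zeta> s*(of_nat n * s)*exp (of_nat n * s * y))) (at y)"
      by (rule cmean_exp_has_field_derivative[OF R gq])
    moreover have "(\<lambda>y. cmean R (\<lambda>s. g s/node_poly n \<zeta> s*exp (of_nat n * s * y))) = \<Phi>"
      by (simp add: \<Phi>_def node_mean_def)
    moreover have "cmean R (\<lambda>s. g s/node_poly n \<zeta> s*(of_nat n * s)*exp (of_nat n * s * y))
        = \<Psi> + of_nat n * a * \<Phi> y"
    proof -
      have "of_nat n * a * \<Phi> y = node_mean n \<zeta> R (\<lambda>s. of_nat n * a*(g s*exp (of_nat n * s * y)))"
        unfolding \<Phi>_def by (rule node_mean_cmult[OF \<zeta>, symmetric]) (assumption | intro continuous_intros g)+
      then have "\<Psi> + of_nat n * a * \<Phi> y = node_mean n \<zeta> R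
          (\<lambda>s. of_nat n*((s - a) * g s*exp (of_nat n * s * y)) + of_nat n * a*(g s*exp (of_nat n * s * y)))"
        unfolding \<Psi>_def
        by (simp only:, intro node_mean_add[OF \<zeta>, symmetric]) (assumption | intro continuous_intros g)+
      also have "\<dots> = cmean R (\<lambda>s. g s/node_poly n \<zeta> s*(of_nat n * s)*exp (of_nat n * s * y))"
        unfolding node_mean_def by (rule cmean_cong[OF R]) (simp add: algebra_simps)
      finally show ?thesis by simp
    qed
    ultimately show ?thesis by simp
  qed
  have E: "((\<lambda>y. exp (- of_nat n * a * y)) has_field_derivative - of_nat n * a*exp (- of_nat n * a * y)) (at y)"
    by (rule derivative_eq_intros refl | simp)+
  have "\<Psi> = of_nat n*node_mean n \<zeta> R (\<lambda>s. (s - a) * g s*exp (of_nat n * s * y))"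
    unfolding \<Psi>_def by (rule node_mean_cmult[OF \<zeta>]) (assumption | intro continuous_intros g)+
  then have eq: "(\<Psi> + of_nat n * a * \<Phi> y)*exp (- of_nat n * a * y) + (- of_nat n * a*exp (- of_nat n * a * y)) * \<Phi> y
      = of_nat n*node_mean n \<zeta> R (\<lambda>s. (s - a) * g s*exp (of_nat n * s * y))*exp (- of_nat n * a * y)"
    by (simp add: algebra_simps)
  show ?thesis using DERIV_mult[OF D E] unfolding eq unfolding \<Phi>_def .
qed

lemma node_mean_poly_decay:
  assumes \<zeta>: "\<And>j. j < 2*n+1 \<Longrightarrow> cmod (\<zeta> j) \<le> \<delta>" "0 \<le> \<delta>" "\<delta> < R" and "degree p + 2 \<le> 2*n+1"
  shows "node_mean n \<zeta> R (poly p) = 0"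
proof -
  have "cmod (\<zeta> j) < R" if "j < 2*n+1" for j using \<zeta>(1)[OF that] \<zeta>(3) by linarith
  then show ?thesis
    unfolding node_mean_def node_poly_def using assms by (intro cmean_decay) auto
qed

text \<open>The function ln t - (t - 1) + (t - 1)^2/12 has derivative (1 - t) (6 - t)/(6 t), so it
  is maximal at t = 1 on (0, 6]. The constant 1/12 is thus matched to the interval [0, 6] on which
  the weight is integrated.\<close>

lemma gamma_weight_bounds:
  fixes t :: real
  assumes "0 < t"
  shows "t \<le> 6 \<Longrightarrow> t^(2*n)*exp (- (2*real n*(t - 1))) \<le> exp (- (2*(1/12)*(real n*(t - 1)\<^sup>2)))"
    "\<bar>t - 1\<bar> \<le> 1/2 \<Longrightarrow> exp (- (4*real n*(t - 1)\<^sup>2)) \<le> t^(2*n)*exp (- (2*real n*(t - 1)))"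
proof -
  have eq: "t^(2*n)*exp (- (2*real n*(t - 1))) = exp (2*real n*(ln t - (t - 1)))"
  proof -
    have "t^(2*n) = exp (real (2*n)*ln t)" using assms by (simp only: exp_of_nat_mult exp_ln)
    then show ?thesis by (simp add: algebra_simps flip: exp_add)
  qed
  show "t^(2*n)*exp (- (2*real n*(t - 1))) \<le> exp (- (2*(1/12)*(real n*(t - 1)\<^sup>2)))"
    if t: "t \<le> 6"
  proof -
    define f where "f = (\<lambda>t::real. ln t - (t - 1) + (t - 1)\<^sup>2/12)"
    have f': "(f has_real_derivative (1 - x)*(6 - x)/(6 * x)) (at x)" if "0 < x" for x
      unfolding f_def using that
      by (auto intro!: derivative_eq_intros) (simp add: field_simps power2_eq_square)
    have "f t \<le> f 1"
    proof (cases "t \<le> 1")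
      case True
      show ?thesis
      proof (rule DERIV_nonneg_imp_nondecreasing[of t 1 f])
        fix x assume x: "t \<le> x" "x \<le> 1"
        have "0 \<le> (1 - x)*(6 - x)/(6 * x)"
          using x assms by (intro divide_nonneg_pos mult_nonneg_nonneg) auto
        then show "\<exists>y. (f has_real_derivative y) (at x) \<and> 0 \<le> y" using f'[of x] x assms by auto
      qed (use True in auto)
    next
      case False
      show ?thesis
      proof (rule DERIV_nonpos_imp_nonincreasing[of 1 t f])
        fix x assume x: "1 \<le> x" "x \<le> t"
        have "(1 - x)*(6 - x)/(6 * x) \<le> 0"
          using x t by (intro divide_nonpos_pos mult_nonpos_nonneg) auto
        then show "\<exists>y. (f has_real_derivative y) (at x) \<and> y \<le> 0" using f'[of x] x by auto
      qed (use False in auto)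
    qed
    then have "ln t - (t - 1) \<le> - ((t - 1)\<^sup>2/12)" by (simp add: f_def)
    then have "2*real n*(ln t - (t - 1)) \<le> 2*real n*(- ((t - 1)\<^sup>2/12))"
      by (intro mult_left_mono) auto
    then show ?thesis unfolding eq by (simp add: mult_ac)
  qed
  show "exp (- (4*real n*(t - 1)\<^sup>2)) \<le> t^(2*n)*exp (- (2*real n*(t - 1)))"
    if t: "\<bar>t - 1\<bar> \<le> 1/2"
  proof -
    have "\<bar>ln (1 + (t - 1)) - (t - 1)\<bar> \<le> 2*(t - 1)\<^sup>2"
      using t by (rule abs_ln_one_plus_x_minus_x_bound)
    then have "- (2*(t - 1)\<^sup>2) \<le> ln t - (t - 1)" by simp
    then have "2*real n*(- (2*(t - 1)\<^sup>2)) \<le> 2*real n*(ln t - (t - 1))"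
      by (intro mult_left_mono) auto
    then show ?thesis unfolding eq by simp
  qed
qed

text \<open>A truncated Gamma integral with saddle t = 1. The logarithmic correction degenerates as
  t tends to 0, so that part is only bounded in size. In units of 1/sqrt n: the window of half width
  1/(2 sqrt n), where the weight is at least 1/e, contributes 0.36, the perturbation removes 0.1,
  and 0.26 exceeds 1/4.\<close>

lemma gamma_saddle:
  fixes g E :: "real \<Rightarrow> complex" and n :: nat
  assumes n: "1 \<le> n" and g: "continuous_on {0..6} g"
    and mid: "\<And>t. 1/4 \<le> t \<Longrightarrow> t \<le> 6 \<Longrightarrow>
      g t = of_real (t^(2*n)*exp (- (2*real n*(t - 1))))*exp (E t)
      \<and> cmod (E t) \<le> \<eta>*(real n*(t - 1)\<^sup>2)"
    and \<eta>: "0 \<le> \<eta>" "\<eta> \<le> 1/4000"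
    and low: "\<And>t. 0 \<le> t \<Longrightarrow> t \<le> 1/4 \<Longrightarrow> cmod (g t) \<le> (7/10)^n"
  shows "1/(4 * sqrt n) - (7/10)^n \<le> cmod (integral {0..6} g)"
proof -
  define w0 where "w0 = (\<lambda>t. t^(2*n)*exp (- (2*real n*(t - 1))))"
  have w0c: "continuous_on S w0" for S unfolding w0_def by (intro continuous_intros)
  have gc: "continuous_on {1/4..6} g" "continuous_on {0..1/4} g"
    by (rule continuous_on_subset[OF g]; simp)+
  have "cmod (integral {1/4..6} g - integral {1/4..6} (\<lambda>t. of_real (w0 t)))
      \<le> \<eta>*(2/(1/12)) * pi * sqrt (2/(1/12))/sqrt (real n)"
  proof (rule saddle_compare[where ?x0.0 = 1])
    fix t :: real assume "t \<in> {1/4..6}"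
    then have t: "1/4 \<le> t" "t \<le> 6" by auto
    have w0n: "cmod (complex_of_real (w0 t)) \<le> exp (- (2*(1/12)*(real n*(t - 1)\<^sup>2)))"
    proof -
      have "0 \<le> w0 t" using t by (simp add: w0_def)
      moreover have "w0 t \<le> exp (- (2*(1/12)*(real n*(t - 1)\<^sup>2)))"
        unfolding w0_def by (rule gamma_weight_bounds(1)) (use t in auto)
      ultimately show ?thesis by simp
    qed
    have "cmod (of_real (w0 t)*exp (E t) - of_real (w0 t))
        \<le> \<eta>*(real n*(t - 1)\<^sup>2)*exp (- (1/12)*(real n*(t - 1)\<^sup>2))"
      by (rule saddle_exp_compare[OF w0n]) (use mid[OF t] \<eta> in auto)
    also have "\<dots> \<le> \<eta>*(real n*(t - 1)\<^sup>2 + 1)*exp (- (1/12)*(real n*(t - 1)\<^sup>2))"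
      using \<eta> by (intro mult_right_mono mult_left_mono) auto
    finally show "cmod (g t - of_real (w0 t)) \<le> \<eta>*(real n*(t - 1)\<^sup>2 + 1)*exp (- (1/12)*(real n*(t - 1)\<^sup>2))"
      using mid[OF t] by (simp add: w0_def)
  next
    show "continuous_on {1/4..6} (\<lambda>t. complex_of_real (w0 t))" by (intro continuous_intros w0c)
  qed (use gc n \<eta> in auto)
  also have "\<dots> \<le> (1/10)/sqrt (real n)"
  proof (rule divide_right_mono)
    have "sqrt 24 \<le> 5" by (rule real_le_lsqrt) auto
    moreover have "pi \<le> 63/20" using pi_approx by simp
    ultimately have "\<eta>*24 * pi * sqrt 24 \<le> (1/4000)*24*(63/20)*5"
      using \<eta> by (intro mult_mono) auto
    then show "\<eta>*(2/(1/12)) * pi * sqrt (2/(1/12)) \<le> 1/10" by (simp add: mult_ac)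
  qed auto
  finally have diff: "cmod (integral {1/4..6} g - integral {1/4..6} (\<lambda>t. of_real (w0 t))) \<le> (1/10)/sqrt (real n)" .
  have w0int: "(36/100)/sqrt (real n) \<le> integral {1/4..6} w0"
  proof -
    define h where "h = 1/(2 * sqrt (real n))"
    have h: "0 < h" "h \<le> 1/2" "h\<^sup>2 = 1/(4*real n)"
      using n by (auto simp: h_def power_mult_distrib power_divide)
    have "(36/100)/sqrt (real n) \<le> 2 * h*exp (- 1)"
    proof -
      have "36/100*exp 1 \<le> (1::real)" using e_less_272 by simp
      then have "36/100 \<le> exp (- 1 :: real)" by (simp add: exp_minus field_simps)
      then have "36/100/sqrt (real n) \<le> exp (- 1)/sqrt (real n)" by (intro divide_right_mono) auto
      then show ?thesis by (simp add: h_def)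
    qed
    also have "\<dots> = integral {1 - h..1 + h} (\<lambda>_. exp (- 1))" using h by simp
    also have "\<dots> \<le> integral {1 - h..1 + h} w0"
    proof (rule integral_le)
      fix t assume "t \<in> {1 - h..1 + h}"
      then have t: "\<bar>t - 1\<bar> \<le> h" by auto
      then have "(t - 1)\<^sup>2 \<le> h\<^sup>2" using power_mono[OF t, of 2] by simp
      then have "4*real n*(t - 1)\<^sup>2 \<le> 1" using n h by (simp add: field_simps)
      then have "exp (- 1) \<le> exp (- (4*real n*(t - 1)\<^sup>2))" by simp
      also have "\<dots> \<le> w0 t"
        unfolding w0_def by (rule gamma_weight_bounds(2)) (use t h in auto)
      finally show "exp (- 1) \<le> w0 t" .
    qed (auto intro!: integrable_continuous_interval w0c)
    also have "\<dots> \<le> integral {1/4..6} w0"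
    proof (rule integral_subset_le)
      show "\<forall>t\<in>{1/4..6}. 0 \<le> w0 t" by (auto simp: w0_def)
      show "{1 - h..1 + h} \<subseteq> {1/4..6}" using h by auto
    qed (intro integrable_continuous_interval w0c)+
    finally show ?thesis .
  qed
  have "integral {1/4..6} (\<lambda>t. complex_of_real (w0 t)) = of_real (integral {1/4..6} w0)"
    by (intro integral_unique has_integral_of_real integrable_integral integrable_continuous_interval w0c)
  then have "(36/100)/sqrt (real n) \<le> cmod (integral {1/4..6} (\<lambda>t. complex_of_real (w0 t)))"
    using w0int by simp
  then have m: "(26/100)/sqrt (real n) \<le> cmod (integral {1/4..6} g)"
    using diff norm_triangle_ineq3[of "integral {1/4..6} g" "integral {1/4..6} (\<lambda>t. complex_of_real (w0 t))"]
    by (simp add: abs_le_iff)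
  have "cmod (integral {0..1/4} g) \<le> (7/10)^n*(1/4 - 0)"
    by (rule integral_bound) (use gc low in auto)
  also have "\<dots> \<le> (7/10)^n" by simp
  finally have l: "cmod (integral {0..1/4} g) \<le> (7/10)^n" .
  have "integral {0..6} g = integral {0..1/4} g + integral {1/4..6} g"
    using g by (intro Henstock_Kurzweil_Integration.integral_combine[symmetric] integrable_continuous_interval) auto
  moreover have "1/(4 * sqrt n) \<le> (26/100)/sqrt (real n)" using n by (simp add: field_simps)
  ultimately show ?thesis
    using m l norm_diff_ineq[of "integral {1/4..6} g" "integral {0..1/4} g"] by (simp add: add.commute)
qed

text \<open>Each factor 1 - x s has modulus between 1 - |s|/e and 1 + |s|/e. Being non-strict
  inequalities, these bounds survive limits of the coefficients, which is how zero-freeness is later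
  seen to be a closed condition.\<close>

lemma norm_poly_zero_free:
  fixes Q :: "complex poly"
  assumes e: "0 < e" and Qnz: "\<And>s. cmod s < e \<Longrightarrow> poly Q s \<noteq> 0" and deg: "degree Q \<le> n"
  shows norm_poly_zero_free_le: "cmod (poly Q s) \<le> cmod (poly Q 0)*(1 + cmod s/e)^n"
    and norm_poly_zero_free_ge: "cmod s \<le> e \<Longrightarrow> cmod (poly Q 0)*(1 - cmod s/e)^n \<le> cmod (poly Q s)"
proof -
  obtain x where x: "\<And>z. poly Q z = poly Q 0*(\<Prod>i<degree Q. 1 - x i * z)"
    "\<And>i. i < degree Q \<Longrightarrow> cmod (x i) \<le> 1/e"
    using poly_zero_free_factor[OF e Qnz] by blast
  have xs: "cmod (x i * s) \<le> cmod s/e" if "i < degree Q" for i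
    using mult_right_mono[OF x(2)[OF that], of "cmod s"] by (simp add: norm_mult)
  have "(\<Prod>i<degree Q. cmod (1 - x i * s)) \<le> (\<Prod>i<degree Q. 1 + cmod s/e)"
  proof (rule prod_mono)
    fix i assume "i \<in> {..<degree Q}"
    then show "0 \<le> cmod (1 - x i * s) \<and> cmod (1 - x i * s) \<le> 1 + cmod s/e"
      using xs[of i] norm_triangle_ineq4[of 1 "x i * s"] by simp
  qed
  also have "\<dots> \<le> (1 + cmod s/e)^n" using e deg by (simp add: power_increasing)
  finally show "cmod (poly Q s) \<le> cmod (poly Q 0)*(1 + cmod s/e)^n"
    unfolding x(1)[of s] norm_mult prod_norm[symmetric] by (intro mult_left_mono) auto
  assume "cmod s \<le> e"
  then have se: "cmod s/e \<le> 1" using e by simp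
  then have "(1 - cmod s/e)^n \<le> (1 - cmod s/e)^degree Q" using deg e by (intro power_decreasing) auto
  also have "\<dots> = (\<Prod>i<degree Q. 1 - cmod s/e)" by simp
  also have "\<dots> \<le> (\<Prod>i<degree Q. cmod (1 - x i * s))"
  proof (rule prod_mono)
    fix i assume "i \<in> {..<degree Q}"
    then show "0 \<le> 1 - cmod s/e \<and> 1 - cmod s/e \<le> cmod (1 - x i * s)"
      using xs[of i] norm_triangle_ineq2[of 1 "x i * s"] se by simp
  qed
  finally show "cmod (poly Q 0)*(1 - cmod s/e)^n \<le> cmod (poly Q s)"
    unfolding x(1)[of s] norm_mult prod_norm[symmetric] by (intro mult_left_mono) auto
qed

text \<open>If \<open>Q u = 0\<close>, the mean of \<open>Q(s) e^(n s y)/((s - u) \<Omega>(s))\<close> can be taken over a circle of radius \<open>e/2\<close>, so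
  its product with \<open>e^(- n u y)\<close> is small at \<open>y = 6 * y1\<close>, where \<open>y1\<close> is the saddle point. On the other hand it
  solves a first order differential equation in \<open>y\<close> with right-hand side \<open>n * spline\<close>, and \<open>gamma_saddle\<close>
  bounds this product from below.\<close>

lemma poly_zero_free_on_circle:
  fixes n :: nat and Q :: "complex poly" and v :: "complex \<Rightarrow> complex"
  assumes n: "1 \<le> n" and deg: "degree Q \<le> n" and e: "0 < e" "e \<le> 1/100000"
    and large: "(7/10)^n + 2*(1/2)^n < 1/(4 * sqrt n)"
    and Qnz: "\<And>s. cmod s < e \<Longrightarrow> poly Q s \<noteq> 0"
    and \<zeta>: "\<And>j. j < 2*n+1 \<Longrightarrow> cmod (\<zeta> j) \<le> \<delta>" and \<delta>: "0 \<le> \<delta>" "\<delta> \<le> e/100" "\<delta> < R"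
    and \<nu>: "0 \<le> \<nu>" "\<nu> \<le> 1/100000"
    and v: "v holomorphic_on ball 0 (30/e)"
    and sp: "\<And>y. cmod y < 30/e \<Longrightarrow> spline n \<zeta> R Q y = (y*(y - 1))^n*exp (v y)"
    and v0: "\<And>y. cmod y < 30/e \<Longrightarrow>
       \<bar>Re (v y) - (ln (cmod (poly Q 0)) + 2*real n - 2*real n*ln 2)\<bar> \<le> \<nu>*real n"
    and v1: "\<And>y. cmod y < 30/e \<Longrightarrow> cmod (deriv v y) \<le> \<nu>*real n * e"
    and v2: "\<And>y. cmod y < 30/e \<Longrightarrow> cmod (deriv (deriv v) y) \<le> \<nu>*real n * e\<^sup>2"
    and u: "cmod u = e"
  shows "poly Q u \<noteq> 0"
proof

  \<comment> \<open>The first order equation obtained by removing the zero\<close>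
  assume "poly Q u = 0"
  then obtain Q' where Q': "Q = [:- u, 1:]*Q'" by (auto simp: poly_eq_0_iff_dvd elim: dvdE)
  have Q0: "poly Q 0 \<noteq> 0" using Qnz[of 0] e by simp
  then have Q'0: "Q' \<noteq> 0" using Q' by auto
  have degQ': "degree Q' + 1 \<le> n" using deg Q'0 unfolding Q' by (subst (asm) degree_mult_eq) auto
  have u0: "u \<noteq> 0" using u e by auto
  define r where "r = e/2"
  have r: "\<delta> < r" "0 < r" using e \<delta> by (auto simp: r_def)
  define \<Phi> where "\<Phi> = (\<lambda>y. spline n \<zeta> r Q' y)"
  have \<Phi>0: "\<Phi> 0 = 0"
    using node_mean_poly_decay[OF \<zeta> \<delta>(1) r(1), where p = Q'] degQ' by (simp add: \<Phi>_def spline_def)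
  have D: "((\<lambda>y. \<Phi> y*exp (- of_nat n * u * y)) has_field_derivative
      of_nat n * spline n \<zeta> R Q y*exp (- of_nat n * u * y)) (at y)" for y
  proof -
    have "node_mean n \<zeta> r (\<lambda>s. (s - u)*poly Q' s*exp (of_nat n * s * y)) = spline n \<zeta> r Q y"
      unfolding spline_def by (rule node_mean_cong[OF r(2)]) (simp add: Q' algebra_simps)
    also have "\<dots> = spline n \<zeta> R Q y" by (rule spline_radius[OF \<zeta> \<delta>(1) r(1) \<delta>(3)])
    finally have eq: "node_mean n \<zeta> r (\<lambda>s. (s - u)*poly Q' s*exp (of_nat n * s * y)) = spline n \<zeta> R Q y" .
    have "((\<lambda>y. node_mean n \<zeta> r (\<lambda>s. poly Q' s*exp (of_nat n * s * y))*exp (- of_nat n * u * y))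
    has_field_derivative of_nat n*node_mean n \<zeta> r (\<lambda>s. (s - u)*poly Q' s*exp (of_nat n * s * y))
      * exp (- of_nat n * u * y)) (at y)"
    proof (rule node_mean_exp_first_order[OF _ \<delta>(1) r(1)])
      show "continuous_on (sphere 0 r) (\<lambda>s. poly Q' s)" by (intro continuous_intros)
    qed (rule \<zeta>)
    then show ?thesis unfolding eq unfolding \<Phi>_def spline_def .
  qed

  \<comment> \<open>The critical point in y\<close>
  define U where "U = ball (0::complex) (30/e)"
  have U: "open U" "convex U" by (auto simp: U_def)
  \<comment> \<open>The centre 2/u is the critical point of the leading part y^(2n) e^(- n u
    y).\<close>
  define Y where "Y = cball (2 / u) (1/(10 * e))"
  have Yb: "19/(10 * e) \<le> cmod y" "cmod y \<le> 21/(10 * e)" if "y \<in> Y" for y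
  proof -
    have "cmod (2 / u - y) \<le> 1/(10 * e)" using that by (simp add: Y_def dist_norm)
    moreover have "cmod (2 / u) = 20/(10 * e)" using u by (simp add: norm_divide)
    moreover have "20/(10 * e) - 1/(10 * e) = 19/(10 * e)" "20/(10 * e) + 1/(10 * e) = 21/(10 * e)"
      by (simp_all add: field_simps)
    ultimately show "19/(10 * e) \<le> cmod y" "cmod y \<le> 21/(10 * e)"
      using norm_triangle_ineq2[of "2 / u" y] norm_triangle_ineq3[of "2 / u" y] by linarith+
  qed
  have inv1: "cmod (1/(y - 1)) \<le> e" "y \<noteq> 1" "y \<noteq> 0" "18/(10 * e) \<le> cmod (y - 1)" if "y \<in> Y" for y
  proof -
    have "1 \<le> 1/(10 * e)" using e by simp
    moreover have "19/(10 * e) - 1/(10 * e) = 18/(10 * e)" by (simp add: field_simps)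
    ultimately show *: "18/(10 * e) \<le> cmod (y - 1)"
      using Yb[OF that] norm_triangle_ineq2[of y 1] by simp
    have "1/e \<le> 18/(10 * e)" using e by (simp add: field_simps)
    then have ey: "1/e \<le> cmod (y - 1)" using * by linarith
    have e0: "0 < 1/e" using e by simp
    with ey have "1/cmod (y - 1) \<le> 1/(1/e)" by (intro frac_le) auto
    then show "cmod (1/(y - 1)) \<le> e" by (simp add: norm_divide)
    show "y \<noteq> 1" using ey e0 by auto
    have "0 < 19/(10 * e)" using e by simp
    then show "y \<noteq> 0" using Yb(1)[OF that] by auto
  qed
  have YU: "of_real t * y \<in> U" if "y \<in> Y" "0 \<le> t" "t \<le> 6" for y t
  proof -
    have "cmod (of_real t * y) \<le> 6*(21/(10 * e))"
      unfolding norm_mult using that Yb by (intro mult_mono) auto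
    also have "\<dots> < 30/e" using e by (simp add: field_simps)
    finally show ?thesis by (simp add: U_def)
  qed
  have YU1: "y \<in> U" if "y \<in> Y" for y using YU[OF that, of 1] by simp
  have holv: "v holomorphic_on U" using v by (simp add: U_def)
  have corr: "cmod (1/(y - 1) + y * deriv v y/of_nat n) \<le> e + 3 * \<nu>" if "y \<in> Y" for y
  proof -
    have "cmod (deriv v y) \<le> \<nu>*real n * e" using v1 YU1[OF that] by (simp add: U_def)
    then have "cmod y*cmod (deriv v y)/real n \<le> 21/(10 * e)*(\<nu>*real n * e)/real n"
      using Yb[OF that] e by (intro divide_right_mono mult_mono) auto
    also have "\<dots> \<le> 3 * \<nu>" using e n \<nu> by (simp add: field_simps)
    finally have "cmod (y * deriv v y/of_nat n) \<le> 3 * \<nu>" by (simp add: norm_mult norm_divide)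
    then show ?thesis using inv1(1)[OF that] norm_triangle_ineq[of "1/(y - 1)" "y * deriv v y/of_nat n"] by linarith
  qed
  \<comment> \<open>The critical point equation of (y (y - 1))^n e^(v(y) - n u y) is n/y + n/(y - 1)
    + v'(y) = n u; multiplied by y/n and divided by u it becomes y = G(y).\<close>
  define G where "G = (\<lambda>y. (2 + (1/(y - 1) + y * deriv v y/of_nat n)) / u)"
  have derc: "continuous_on Y (deriv v)"
  proof -
    have "deriv v holomorphic_on U" by (rule holomorphic_deriv[OF holv U(1)])
    then have "continuous_on U (deriv v)" by (rule holomorphic_on_imp_continuous_on)
    then show ?thesis by (rule continuous_on_subset) (use YU1 in blast)
  qed
  have ypos: "0 < 1/(10 * e)" using e by simp
  have "continuous_on Y (\<lambda>y. 1/(y - 1))"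
  proof (intro continuous_intros ballI)
    fix y assume "y \<in> Y" then show "y - 1 \<noteq> 0" using inv1(2) by auto
  qed
  moreover have "\<forall>y\<in>Y. complex_of_nat n \<noteq> 0" "\<forall>y\<in>Y. u \<noteq> 0" "\<forall>y\<in>Y. y - 1 \<noteq> 0"
    using n u0 inv1(2) by auto
  ultimately have "continuous_on Y G"
    using derc unfolding G_def by (intro continuous_intros)
  then have Gc: "continuous_on (cball (2 / u) (1/(10 * e))) G" by (simp add: Y_def)
  have Gm: "G \<in> cball (2 / u) (1/(10 * e)) \<rightarrow> cball (2 / u) (1/(10 * e))"
  proof
    fix y assume "y \<in> cball (2 / u) (1/(10 * e))"
    then have y: "y \<in> Y" by (simp add: Y_def)
    have "2 / u - G y = - ((1/(y - 1) + y * deriv v y/of_nat n) / u)"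
      unfolding G_def add_divide_distrib[of 2] by simp
    then have "cmod (2 / u - G y) = cmod ((1/(y - 1) + y * deriv v y/of_nat n) / u)"
      by (simp only: norm_minus_cancel)
    also have "\<dots> = cmod (1/(y - 1) + y * deriv v y/of_nat n)/e"
      by (simp only: norm_divide[of _ u] u)
    also have "\<dots> \<le> (1/10)/e"
      using corr[OF y] e \<nu> by (intro divide_right_mono) auto
    finally show "G y \<in> cball (2 / u) (1/(10 * e))" by (simp add: dist_norm)
  qed
  obtain y1 where y1: "y1 \<in> Y" "G y1 = y1"
    using brouwer_ball[OF ypos Gc Gm] unfolding Y_def by metis
  define z1 where "z1 = u * y1"
  have z1: "z1 - 2 = 1/(y1 - 1) + y1 * deriv v y1/of_nat n"
  proof -
    have "u * G y1 = 2 + (1/(y1 - 1) + y1 * deriv v y1/of_nat n)" using u0 by (simp add: G_def)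
    then show ?thesis by (simp only: y1(2) z1_def) simp
  qed
  have z1b: "cmod (z1 - 2) \<le> 1/1000" unfolding z1 using corr[OF y1(1)] e \<nu> by linarith
  have Rez1: "2 - 1/1000 \<le> Re z1" "Re z1 \<le> 2 + 1/1000" "cmod z1 \<le> 2 + 1/1000"
    using abs_Re_le_cmod[of "z1 - 2"] norm_triangle_sub[of z1 2] z1b by auto
  note y1b = Yb[OF y1(1)] inv1[OF y1(1)]

  \<comment> \<open>Lower bound for the integral along the ray through the critical point\<close>
  define A where "A = spline n \<zeta> R Q y1*exp (- of_nat n * z1)"
  have spy: "spline n \<zeta> R Q y = (y*(y - 1))^n*exp (v y)" if "y \<in> U" for y
    using sp that by (simp add: U_def)
  have A0: "A \<noteq> 0" unfolding A_def spy[OF YU1[OF y1(1)]] using y1b by simp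
  define g where "g = (\<lambda>t. spline n \<zeta> R Q (of_real t * y1)*exp (- of_nat n * u*(of_real t * y1))/A)"
  have gt: "g t = of_real t^n*((of_real t * y1 - 1)/(y1 - 1))^n*exp (v (of_real t * y1) - v y1)
      * exp (- of_nat n * z1*(of_real t - 1))" if "0 \<le> t" "t \<le> 6" for t
  proof -
    have "T * Y1^n * P^n * E1 * X1/(Y1^n * P1^n * E2 * X2) = T*(P/P1)^n*(E1/E2)*(X1/X2)"
      if "Y1 \<noteq> 0" "P1 \<noteq> 0" for T Y1 P P1 E1 E2 X1 X2 :: complex
      using that by (simp add: power_divide mult.assoc)
    from this[of y1 "y1 - 1" "of_real t^n" "of_real t * y1 - 1" "exp (v (of_real t * y1))"
       "exp (- of_nat n * u*(of_real t * y1))" "exp (v y1)" "exp (- of_nat n * z1)"]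
    have "g t = of_real t^n*((of_real t * y1 - 1)/(y1 - 1))^n*(exp (v (of_real t * y1))/exp (v y1))
      * (exp (- of_nat n * u*(of_real t * y1))/exp (- of_nat n * z1))"
      unfolding g_def A_def spy[OF YU[OF y1(1) that]] spy[OF YU1[OF y1(1)]] using y1b
      by (simp add: power_mult_distrib)
    also have "- of_nat n * u*(of_real t * y1) = - of_nat n * z1*(of_real t - 1) + - of_nat n * z1"
      by (simp add: z1_def algebra_simps)
    finally show ?thesis by (simp only: exp_diff exp_add) simp
  qed
  have "continuous_on {0..6} (\<lambda>t. spline n \<zeta> R Q (of_real t * y1))"
  proof -
    have "continuous_on {0..6} (\<lambda>t. v (of_real t * y1))"
      by (rule continuous_on_compose2[OF holomorphic_on_imp_continuous_on[OF holv]])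
         (use YU[OF y1(1)] in \<open>auto intro!: continuous_on_mult continuous_on_of_real continuous_on_id continuous_on_const\<close>)
    then have "continuous_on {0..6} (\<lambda>t. ((of_real t * y1)*(of_real t * y1 - 1))^n*exp (v (of_real t * y1)))"
      by (intro continuous_intros)
    then show ?thesis by (rule continuous_on_eq) (use spy[OF YU[OF y1(1)]] in simp)
  qed
  then have gc: "continuous_on {0..6} g"
    unfolding g_def by (intro continuous_intros) (use A0 in auto)
  \<comment> \<open>Three second order remainders: of the logarithm, of replacing (t - 1)/t by t -
    1, and of \<open>v\<close>. By the choice of \<open>y1\<close> the corresponding linear parts
    and - n z1 (t - 1) add up to the model exponent - 2 n (t - 1).\<close>
  define E where "E = (\<lambda>t. of_nat n*(Ln (1 + (of_real t - 1)/(of_real t*(y1 - 1))) - (of_real t - 1)/(of_real t*(y1 - 1)))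
      + of_nat n*((of_real t - 1)/(of_real t*(y1 - 1)) - (of_real t - 1)/(y1 - 1))
      + (v (of_real t * y1) - v y1 - deriv v y1*(of_real t * y1 - y1)))"
  define \<eta> where "\<eta> = 5 * e + 5 * \<nu>"
  \<comment> \<open>For t up to 1/4 the n-th root of the modulus is at most 1/4 (from t) times 3/10
    (from the quotient) times slightly more than e^2 (from the exponentials), which is below
    7/10.\<close>
  have low: "cmod (g t) \<le> (7/10)^n" if t: "0 \<le> t" "t \<le> 1/4" for t
  proof -
    have t6: "t \<le> 6" using t by simp
    have a: "cmod ((of_real t * y1 - 1)/(y1 - 1)) \<le> 3/10"
    proof -
      have "cmod (of_real t * y1) \<le> 1/4*(21/(10 * e))"
        unfolding norm_mult using t y1b by (intro mult_mono) auto
      then have "cmod (of_real t * y1 - 1) \<le> 1/4*(21/(10 * e)) + 1"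
        using norm_triangle_ineq4[of "of_real t * y1" 1] by simp
      also have "\<dots> \<le> 3/10*(18/(10 * e))" using e by (simp add: field_simps)
      also have "\<dots> \<le> 3/10*cmod (y1 - 1)" using y1b by (intro mult_left_mono) auto
      finally show ?thesis using y1b by (simp add: norm_divide pos_divide_le_eq)
    qed
    have b: "cmod (exp (v (of_real t * y1) - v y1)) \<le> exp (2 * \<nu>)^n"
    proof -
      have "Re (v (of_real t * y1) - v y1) \<le> 2*(\<nu>*real n)"
        using v0[of "of_real t * y1"] v0[of y1] YU[OF y1(1) t(1) t6] YU1[OF y1(1)]
        by (simp add: U_def abs_le_iff)
      also have "\<dots> = real n*(2 * \<nu>)" by simp
      finally show ?thesis by (simp only: norm_exp_eq_Re exp_of_nat_mult[symmetric] exp_le_cancel_iff)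
    qed
    have c: "cmod (exp (- of_nat n * z1*(of_real t - 1))) \<le> exp (2001/1000)^n"
    proof -
      have "Re (- of_nat n * z1*(of_real t - 1)) = real n*(Re z1*(1 - t))" by (simp add: algebra_simps)
      also have "\<dots> \<le> real n*((2001/1000)*1)"
        using Rez1 t by (intro mult_left_mono mult_mono) auto
      finally have "Re (- of_nat n * z1*(of_real t - 1)) \<le> real n*(2001/1000)" by simp
      then show ?thesis by (simp only: norm_exp_eq_Re exp_of_nat_mult[symmetric] exp_le_cancel_iff)
    qed
    have "cmod (g t) = cmod (of_real t)^n*cmod ((of_real t * y1 - 1)/(y1 - 1))^n
        * cmod (exp (v (of_real t * y1) - v y1))*cmod (exp (- of_nat n * z1*(of_real t - 1)))"
      by (simp only: gt[OF t(1) t6] norm_mult norm_power)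
    also have "\<dots> \<le> (1/4)^n*(3/10)^n*exp (2 * \<nu>)^n*exp (2001/1000)^n"
      using t a by (intro mult_mono power_mono b c) auto
    also have "\<dots> = (3/40*exp (2 * \<nu> + 2001/1000))^n"
      by (simp add: exp_add mult.assoc flip: power_mult_distrib)
    also have "\<dots> \<le> (7/10)^n"
    proof (rule power_mono)
      have "99/100 \<le> exp (- (1/100) :: real)" using exp_ge_add_one_self[of "- (1/100) :: real"] by simp
      then have e1: "exp (1/100 :: real) \<le> 100/99" by (simp add: exp_minus field_simps)
      have "exp (2 * \<nu> + 2001/1000) \<le> exp (1 + 1 + 1/100)" using \<nu> by simp
      also have "\<dots> = exp 1*exp 1*exp (1/100 :: real)" by (simp only: exp_add)
      also have "\<dots> \<le> 272/100*(272/100)*(100/99)"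
        using e_less_272 e1 by (intro mult_mono) auto
      finally show "3/40*exp (2 * \<nu> + 2001/1000) \<le> 7/10" by simp
    qed simp
    finally show ?thesis .
  qed
  have mid: "g t = of_real (t^(2*n)*exp (- (2*real n*(t - 1))))*exp (E t)
      \<and> cmod (E t) \<le> \<eta>*(real n*(t - 1)\<^sup>2)" if t: "1/4 \<le> t" "t \<le> 6" for t
  proof
    have t0: "0 \<le> t" using t by simp
    define a where "a = (of_real t - 1)/(of_real t*(y1 - 1))"
    have tnz: "complex_of_real t \<noteq> 0" using t by auto
    have q: "1/cmod (y1 - 1) \<le> e" using y1b by (simp add: norm_divide)
    have tm1: "cmod (of_real t - 1) = \<bar>t - 1\<bar>" by (metis norm_of_real of_real_1 of_real_diff)
    have a1: "cmod a \<le> 4 * e * \<bar>t - 1\<bar>"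
    proof -
      have "cmod a = \<bar>t - 1\<bar>*(1/t)*(1/cmod (y1 - 1))"
        using t by (simp add: a_def norm_divide norm_mult tm1)
      also have "\<dots> \<le> \<bar>t - 1\<bar>*4 * e"
        using t q by (intro mult_mono) (auto simp: field_simps)
      finally show ?thesis by (simp add: mult_ac)
    qed
    also have "\<dots> \<le> 4 * e*5" using t e by (intro mult_left_mono) auto
    finally have a2: "cmod a \<le> 1/2" using e by simp
    have "1 + a \<noteq> 0"
    proof
      assume "1 + a = 0"
      then have "a = - 1" by (metis add_eq_0_iff)
      then show False using a2 by simp
    qed
    then have L: "exp (Ln (1 + a)) = 1 + a" by simp
    have "(of_real t * y1 - 1)/(y1 - 1) = of_real t*exp (Ln (1 + a))"
      unfolding L using y1b tnz by (simp add: a_def field_simps)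
    then have g1: "g t = of_real t^n*(of_real t*exp (Ln (1 + a)))^n*exp (v (of_real t * y1) - v y1)
      * exp (- of_nat n * z1*(of_real t - 1))" by (simp only: gt[OF t0 t(2)])
    also have "\<dots> = of_real (t^(2*n))*exp (of_nat n * Ln (1 + a) + (v (of_real t * y1) - v y1)
        + - of_nat n * z1*(of_real t - 1))"
      by (simp only: power_mult_distrib exp_add exp_of_nat_mult mult_2 power_add of_real_mult of_real_power)
         (simp only: mult_ac)
    also have "of_nat n * Ln (1 + a) + (v (of_real t * y1) - v y1) + - of_nat n * z1*(of_real t - 1)
        = of_real (- (2*real n*(t - 1))) + E t"
    proof -
      have "of_nat n*(z1 - 2) = of_nat n*(1/(y1 - 1)) + y1 * deriv v y1"
        unfolding z1 using n by (simp add: distrib_left)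
      then have "of_nat n * z1 = 2 * of_nat n + of_nat n*(1/(y1 - 1)) + y1 * deriv v y1"
        by (simp add: algebra_simps)
      then have "- of_nat n * z1*(of_real t - 1) = - (2 * of_nat n*(of_real t - 1))
         - of_nat n*((of_real t - 1)/(y1 - 1)) - deriv v y1*(of_real t * y1 - y1)"
        by (simp add: algebra_simps diff_divide_distrib)
      then show ?thesis
        unfolding E_def a_def[symmetric] by (simp add: algebra_simps)
    qed
    also have "exp (of_real (- (2*real n*(t - 1))) + E t) = of_real (exp (- (2*real n*(t - 1))))*exp (E t)"
      by (simp only: exp_add exp_of_real)
    finally show "g t = of_real (t^(2*n)*exp (- (2*real n*(t - 1))))*exp (E t)" by simp
    have sq: "\<bar>t - 1\<bar>\<^sup>2 = (t - 1)\<^sup>2" by simp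
    have E1: "cmod (of_nat n*(Ln (1 + a) - a)) \<le> real n*(32 * e * e*(t - 1)\<^sup>2)"
    proof -
      have "cmod (Ln (1 + a) - a) \<le> cmod a^2/(1 - cmod a)" by (rule Ln_approx_linear) (use a2 in simp)
      also have "\<dots> \<le> (4 * e * \<bar>t - 1\<bar>)^2/(1/2)"
        using a1 a2 by (intro frac_le power_mono) auto
      also have "\<dots> = 32 * e * e*(t - 1)\<^sup>2" by (simp add: power_mult_distrib power2_eq_square)
      finally show ?thesis unfolding norm_mult norm_of_nat by (intro mult_left_mono) auto
    qed
    have E2: "cmod (of_nat n*(a - (of_real t - 1)/(y1 - 1))) \<le> real n*(4 * e*(t - 1)\<^sup>2)"
    proof -
      have "a - (of_real t - 1)/(y1 - 1) = - ((of_real t - 1)\<^sup>2/(of_real t*(y1 - 1)))"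
      proof -
        have "(T - 1)/(T * Y) - (T - 1)/Y = - ((T - 1)\<^sup>2/(T * Y))" if "T \<noteq> 0" "Y \<noteq> 0" for T Y :: complex
          using that by (simp add: divide_simps) (simp add: power2_eq_square algebra_simps)
        then show ?thesis using tnz y1b by (simp add: a_def)
      qed
      then have "cmod (a - (of_real t - 1)/(y1 - 1)) = (t - 1)\<^sup>2*(1/t)*(1/cmod (y1 - 1))"
        using t by (simp add: norm_divide norm_mult norm_power tm1)
      also have "\<dots> \<le> (t - 1)\<^sup>2*4 * e"
        using t q by (intro mult_mono) (auto simp: field_simps)
      finally show ?thesis unfolding norm_mult norm_of_nat by (intro mult_left_mono) (auto simp: mult_ac)
    qed
    have E3: "cmod (v (of_real t * y1) - v y1 - deriv v y1*(of_real t * y1 - y1)) \<le> real n*(5 * \<nu>*(t - 1)\<^sup>2)"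
    proof -
      have "cmod (v (of_real t * y1) - v y1 - deriv v y1*(of_real t * y1 - y1))
          \<le> (\<nu>*real n * e\<^sup>2)*(cmod (of_real t * y1 - y1))\<^sup>2"
        by (rule norm_linear_Taylor_le[OF holv U]) (use v2 YU[OF y1(1) t0 t(2)] YU1[OF y1(1)] in \<open>auto simp: U_def\<close>)
      also have "cmod (of_real t * y1 - y1) = \<bar>t - 1\<bar>*cmod y1"
      proof -
        have "of_real t * y1 - y1 = (of_real t - 1) * y1" by (simp add: algebra_simps)
        then show ?thesis by (simp only: norm_mult tm1)
      qed
      also have "(\<nu>*real n * e\<^sup>2)*(\<bar>t - 1\<bar>*cmod y1)\<^sup>2 = \<nu>*real n*(t - 1)\<^sup>2*(e*cmod y1)\<^sup>2"
        by (simp add: power_mult_distrib mult_ac)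
      also have "\<dots> \<le> \<nu>*real n*(t - 1)\<^sup>2*5"
      proof (rule mult_left_mono)
        have "e*cmod y1 \<le> e*(21/(10 * e))" using y1b e by (intro mult_left_mono) auto
        then have "e*cmod y1 \<le> 21/10" using e by simp
        then have "(e*cmod y1)\<^sup>2 \<le> (21/10)\<^sup>2" using e by (intro power_mono) auto
        then show "(e*cmod y1)\<^sup>2 \<le> 5" by (simp add: power2_eq_square)
      qed (use \<nu> in auto)
      finally show ?thesis by (simp add: mult_ac)
    qed
    have "cmod (E t) \<le> real n*(32 * e * e*(t - 1)\<^sup>2) + real n*(4 * e*(t - 1)\<^sup>2) + real n*(5 * \<nu>*(t - 1)\<^sup>2)"
      unfolding E_def a_def[symmetric]
      by (intro order.trans[OF norm_triangle_ineq] add_mono E1 E2 E3)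
    also have "\<dots> = (32 * e * e + 4 * e + 5 * \<nu>)*(real n*(t - 1)\<^sup>2)" by (simp add: algebra_simps)
    also have "\<dots> \<le> \<eta>*(real n*(t - 1)\<^sup>2)"
    proof (rule mult_right_mono)
      have "32 * e * e \<le> 1 * e" using e by (intro mult_right_mono) auto
      then show "32 * e * e + 4 * e + 5 * \<nu> \<le> \<eta>" by (simp add: \<eta>_def)
    qed simp
    finally show "cmod (E t) \<le> \<eta>*(real n*(t - 1)\<^sup>2)" .
  qed
  have lower: "1/(4 * sqrt n) - (7/10)^n \<le> cmod (integral {0..6} g)"
    by (rule gamma_saddle[OF n gc mid]) (use low e \<nu> in \<open>auto simp: \<eta>_def\<close>)
  have "((\<lambda>t. of_nat n * spline n \<zeta> R Q (of_real t * y1)*exp (- of_nat n * u*(of_real t * y1)) * y1)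
     has_integral \<Phi> (of_real 6 * y1)*exp (- of_nat n * u*(of_real 6 * y1)) - \<Phi> (of_real 0 * y1)*exp (- of_nat n * u*(of_real 0 * y1))) {0..6}"
  proof (rule fundamental_theorem_of_calculus)
    fix t :: real
    have "((\<lambda>t. of_real t * y1) has_vector_derivative y1) (at t within {0..6})"
      by (auto intro!: derivative_eq_intros)
    from field_vector_diff_chain_within[OF this has_field_derivative_at_within[OF D]]
    show "((\<lambda>t. \<Phi> (of_real t * y1)*exp (- of_nat n * u*(of_real t * y1))) has_vector_derivative
       of_nat n * spline n \<zeta> R Q (of_real t * y1)*exp (- of_nat n * u*(of_real t * y1)) * y1) (at t within {0..6})"
      by (simp add: o_def mult_ac)
  qed simp
  then have int: "integral {0..6} g*(of_nat n * y1 * A) = \<Phi> (6 * y1)*exp (- of_nat n*(6 * z1))"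
  proof -
    assume h: "((\<lambda>t. of_nat n * spline n \<zeta> R Q (of_real t * y1)*exp (- of_nat n * u*(of_real t * y1)) * y1)
     has_integral \<Phi> (of_real 6 * y1)*exp (- of_nat n * u*(of_real 6 * y1)) - \<Phi> (of_real 0 * y1)*exp (- of_nat n * u*(of_real 0 * y1))) {0..6}"
    have "(\<lambda>t. of_nat n * spline n \<zeta> R Q (of_real t * y1)*exp (- of_nat n * u*(of_real t * y1)) * y1)
       = (\<lambda>t. g t*(of_nat n * y1 * A))"
      using A0 by (intro ext) (simp add: g_def)
    moreover have "\<Phi> (of_real 6 * y1)*exp (- of_nat n * u*(of_real 6 * y1)) - \<Phi> (of_real 0 * y1)
        * exp (- of_nat n * u*(of_real 0 * y1)) = \<Phi> (6 * y1)*exp (- of_nat n*(6 * z1))"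
      by (simp add: \<Phi>0 z1_def mult_ac)
    ultimately have "((\<lambda>t. g t*(of_nat n * y1 * A)) has_integral \<Phi> (6 * y1)*exp (- of_nat n*(6 * z1))) {0..6}"
      using h by (simp only:)
    then have "integral {0..6} (\<lambda>t. g t*(of_nat n * y1 * A)) = \<Phi> (6 * y1)*exp (- of_nat n*(6 * z1))"
      by (rule integral_unique)
    then show ?thesis by (simp only: integral_mult_left)
  qed

  \<comment> \<open>Exponential smallness at the end point 6 y1\<close>
  have upper: "cmod (\<Phi> (6 * y1)*exp (- of_nat n*(6 * z1))) \<le> 2*(1/2)^n*cmod (of_nat n * y1 * A)"
  proof -
    define K where "K = cmod (poly Q 0)"
    have K: "K > 0" using Q0 by (simp add: K_def)
    have "cmod (\<Phi> (6 * y1)) \<le> (K*(3/2)^n/r*exp (63/10)^n)/(r - \<delta>)^(2*n+1) * r"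
      unfolding \<Phi>_def spline_def
    proof (rule norm_node_mean_le[OF _ \<delta>(1) r(1)])
      show "continuous_on (sphere 0 r) (\<lambda>s. poly Q' s*exp (of_nat n * s*(6 * y1)))"
        by (intro continuous_intros)
      fix s :: complex assume s: "cmod s = r"
      have "cmod (s - u) \<ge> r" using norm_triangle_ineq2[of u s] u s by (simp add: norm_minus_commute r_def)
      then have "cmod (poly Q' s) * r \<le> cmod (poly Q' s)*cmod (s - u)" by (intro mult_left_mono) auto
      also have "\<dots> = cmod (poly Q s)" by (simp add: Q' norm_mult[symmetric] algebra_simps)
      also have "\<dots> \<le> K*(1 + r/e)^n"
        unfolding K_def s[symmetric] using norm_poly_zero_free_le[OF e(1) Qnz deg] by simp
      also have "1 + r/e = 3/2" using e by (simp add: r_def)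
      finally have q: "cmod (poly Q' s) \<le> K*(3/2)^n/r" using r by (simp add: pos_le_divide_eq)
      have "Re (of_nat n * s*(6 * y1)) \<le> real n*(63/10)"
      proof -
        have "Re (of_nat n * s*(6 * y1)) \<le> cmod (of_nat n * s*(6 * y1))" by (rule complex_Re_le_cmod)
        also have "\<dots> = real n*(r*(6*cmod y1))" by (simp add: norm_mult s)
        also have "\<dots> \<le> real n*(r*(6*(21/(10 * e))))"
          using y1b r by (intro mult_left_mono) auto
        also have "\<dots> = real n*(63/10)" using e by (simp add: r_def)
        finally show ?thesis .
      qed
      then have "cmod (exp (of_nat n * s*(6 * y1))) \<le> exp (63/10)^n"
        by (simp only: norm_exp_eq_Re exp_of_nat_mult[symmetric] exp_le_cancel_iff)
      then show "cmod (poly Q' s*exp (of_nat n * s*(6 * y1))) \<le> K*(3/2)^n/r*exp (63/10)^n"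
        unfolding norm_mult using q K r by (intro mult_mono) auto
    qed (rule \<zeta>)
    also have "\<dots> = K*(3/2)^n*exp (63/10)^n/(r - \<delta>)^(2*n+1)" using r by simp
    also have "\<dots> \<le> K*(3/2)^n*exp (63/10)^n/(49/100 * e)^(2*n+1)"
    proof -
      have "49/100 * e \<le> r - \<delta>" using \<delta> by (simp add: r_def)
      then have "(49/100 * e)^(2*n+1) \<le> (r - \<delta>)^(2*n+1)" using e by (intro power_mono) auto
      moreover have "0 < (49/100 * e)^(2*n+1)" using e by simp
      ultimately show ?thesis using K by (intro divide_left_mono mult_pos_pos) auto
    qed
    finally have 1: "cmod (\<Phi> (6 * y1)) \<le> K*(3/2)^n*exp (63/10)^n/(49/100 * e)^(2*n+1)" .
    have "Re (- of_nat n*(6 * z1)) = real n*(- 6 * Re z1)" by simp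
    also have "\<dots> \<le> real n*(- 6*(1999/1000))" by (rule mult_left_mono) (use Rez1 in auto)
    finally have 2: "cmod (exp (- of_nat n*(6 * z1))) \<le> exp (- 6*(1999/1000))^n"
      by (simp only: norm_exp_eq_Re exp_of_nat_mult[symmetric] exp_le_cancel_iff)
    \<comment> \<open>L is the growth rate of the upper bound, M one half of the growth rate of the
      lower bound for |A|; both are proportional to e^(-2), so only numbers remain to be compared.
      At y = 6 y1 the circle of radius e/2 yields the exponent 6.3 against nearly - 12 from e^(- n u
      y), a total below - 5.\<close>
    define L where "L = 3/2*exp (63/10)*exp (- 6*(1999/1000))/(49/100 * e)\<^sup>2"
    define M where "M = 1/2*(19/(10 * e)*(18/(10 * e)))*(1/4)*exp (2 - \<nu> - 2001/1000)"
    have "cmod (\<Phi> (6 * y1)*exp (- of_nat n*(6 * z1)))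
        \<le> K*(3/2)^n*exp (63/10)^n/(49/100 * e)^(2*n+1)*exp (- 6*(1999/1000))^n"
      unfolding norm_mult[of "\<Phi> _"] using 1 2 K e by (intro mult_mono) auto
    also have "\<dots> = K/(49/100 * e) * L^n"
    proof -
      have "K * b^n * E^n/a^(2*n+1) * X^n = K/a*(b * E * X/a\<^sup>2)^n" for b E a X :: real
        by (simp add: power_mult_distrib power_divide power_mult)
      then show ?thesis unfolding L_def .
    qed
    also have "\<dots> \<le> K/(49/100 * e)*M^n"
    proof (intro mult_left_mono power_mono)
      have "exp (63/10)*exp (- 6*(1999/1000)) = exp (63/10 - 6*(1999/1000) :: real)"
        by (simp flip: exp_add)
      also have "\<dots> \<le> exp (- 5)" by simp
      also have "\<dots> = inverse (exp 1)^5" by (simp add: exp_minus power_inverse flip: exp_of_nat_mult)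
      also have "\<dots> \<le> (1/2)^5"
        using exp_ge_add_one_self[of "1::real"] by (intro power_mono) (auto simp: field_simps)
      finally have x: "exp (63/10)*exp (- 6*(1999/1000)) \<le> (1/32 :: real)" by (simp add: power_divide)
      have "L = 3/2*(exp (63/10)*exp (- 6*(1999/1000)))/(49/100)\<^sup>2/e\<^sup>2"
        unfolding L_def power_mult_distrib by (simp only: divide_divide_eq_left mult.assoc)
      also have "\<dots> \<le> 3/2*(1/32)/(49/100)\<^sup>2/e\<^sup>2"
        using x by (intro divide_right_mono mult_left_mono) auto
      also have "\<dots> \<le> (1/2*(19/10*(18/10))*(1/4)*(9/10))/e\<^sup>2"
        by (intro divide_right_mono) (auto simp: power2_eq_square)
      also have "\<dots> \<le> (1/2*(19/10*(18/10))*(1/4)*exp (2 - \<nu> - 2001/1000))/e\<^sup>2"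
      proof (intro divide_right_mono mult_left_mono)
        show "9/10 \<le> exp (2 - \<nu> - 2001/1000)"
          using exp_ge_add_one_self[of "2 - \<nu> - 2001/1000"] \<nu> by linarith
      qed auto
      also have "\<dots> = M" by (simp add: M_def power2_eq_square)
      finally show "L \<le> M" .
    qed (use K e in \<open>auto simp: L_def\<close>)
    also have "\<dots> \<le> K*(real n*(19/(10 * e))*2)*M^n"
    proof (rule mult_right_mono)
      have "1/(49/100 * e) \<le> 1*(19/(10 * e))*2" using e by (simp add: field_simps)
      also have "\<dots> \<le> real n*(19/(10 * e))*2" using n e by (intro mult_right_mono) auto
      finally have "K*(1/(49/100 * e)) \<le> K*(real n*(19/(10 * e))*2)"
        using K by (intro mult_left_mono) auto
      then show "K/(49/100 * e) \<le> K*(real n*(19/(10 * e))*2)" by simp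
    qed (use e in \<open>simp add: M_def\<close>)
    also have "\<dots> = 2*(1/2)^n*(real n*(19/(10 * e))*((19/(10 * e))^n*(18/(10 * e))^n
        * (K*(1/4)^n*exp (2 - \<nu>)^n)*exp (- (2001/1000))^n))"
    proof -
      have "M = 1/2*(19/(10 * e)*(18/(10 * e)))*(1/4)*(exp (2 - \<nu>)*exp (- (2001/1000)))"
        by (simp only: M_def flip: exp_add) simp
      then have "M^n = (1/2)^n*((19/(10 * e))^n*(18/(10 * e))^n)*(1/4)^n*(exp (2 - \<nu>)^n*exp (- (2001/1000))^n)"
        by (simp only: power_mult_distrib)
      then show ?thesis by (simp only:) (simp only: mult_ac)
    qed
    also have "\<dots> \<le> 2*(1/2)^n*(real n*cmod y1*(cmod y1^n*cmod (y1 - 1)^n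
        * exp (Re (v y1))*exp (Re (- of_nat n * z1))))"
    proof (intro mult_left_mono mult_mono power_mono y1b)
      have e4: "exp (2*ln 2) = (4::real)"
      proof -
        have "exp (2*ln 2) = exp (ln 2)*exp (ln (2::real))" by (simp only: mult_2 exp_add)
        then show ?thesis by simp
      qed
      have "K*(1/4)^n*exp (2 - \<nu>)^n = exp (ln K)*exp (real n*(2 - \<nu>))/exp (real n*(2*ln 2))"
        unfolding exp_of_nat_mult e4 using K by (simp add: power_one_over)
      also have "\<dots> = exp (ln K + real n*(2 - \<nu>) - real n*(2*ln 2))" by (simp only: exp_add exp_diff)
      also have "\<dots> \<le> exp (Re (v y1))"
      proof -
        have "ln K + 2*real n - 2*real n*ln 2 \<le> Re (v y1) + \<nu>*real n"
          using v0[of y1] YU1[OF y1(1)] by (simp add: U_def K_def abs_le_iff)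
        then show ?thesis by (simp add: algebra_simps)
      qed
      finally show "K*(1/4)^n*exp (2 - \<nu>)^n \<le> exp (Re (v y1))" .
      have "real n*(- (2001/1000)) \<le> Re (- of_nat n * z1)"
      proof -
        have "real n * Re z1 \<le> real n*(2001/1000)" using Rez1 by (intro mult_left_mono) auto
        then show ?thesis by simp
      qed
      then show "exp (- (2001/1000))^n \<le> exp (Re (- of_nat n * z1))"
        by (simp only: exp_of_nat_mult[symmetric] exp_le_cancel_iff)
    qed (use e K in auto)
    also have "\<dots> = 2*(1/2)^n*cmod (of_nat n * y1 * A)"
      unfolding A_def spy[OF YU1[OF y1(1)]]
      by (simp only: norm_mult norm_power norm_exp_eq_Re norm_of_nat power_mult_distrib mult_ac)
    finally show ?thesis .
  qed
  have "cmod (of_nat n * y1 * A) > 0" using n y1b A0 by simp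
  moreover have "cmod (integral {0..6} g)*cmod (of_nat n * y1 * A) \<le> 2*(1/2)^n*cmod (of_nat n * y1 * A)"
    using upper unfolding int[symmetric] norm_mult[of "integral _ _"] .
  ultimately have "cmod (integral {0..6} g) \<le> 2*(1/2)^n" by (simp only: mult_le_cancel_right_pos)
  then show False using lower large by linarith
qed

section \<open>The remainder\<close>

definition solution ::
    "nat \<Rightarrow> (nat \<Rightarrow> complex) \<Rightarrow> complex poly \<Rightarrow> complex poly \<Rightarrow> (complex \<Rightarrow> complex) \<Rightarrow> bool" where
  "solution n \<zeta> P Q H \<longleftrightarrow> degree P \<le> n \<and> degree Q \<le> n \<and> \<not> (P = 0 \<and> Q = 0) \<and> H holomorphic_on UNIV \<and>
     (\<forall>s. exp (of_nat n * s)*poly Q s + poly P s = node_poly n \<zeta> s*H s)"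

text \<open>The pole z counts as one more node, which makes 2 n + 2 linear factors and hence the
  decay required at infinity.\<close>

lemma node_mean_poly_pole_decay:
  assumes \<zeta>: "\<And>j. j < 2*n+1 \<Longrightarrow> cmod (\<zeta> j) \<le> \<delta>" and \<delta>: "0 \<le> \<delta>" "\<delta> < R"
    and "degree p \<le> 2*n" "cmod z < R"
  shows "node_mean n \<zeta> R (\<lambda>s. poly p s/(s - z)) = 0"
proof -
  define a where "a = (\<lambda>j. if j < 2*n+1 then \<zeta> j else z)"
  have aR: "cmod (a j) < R" for j
  proof (cases "j < 2*n+1")
    case True
    from \<zeta>[OF this] \<delta> True show ?thesis by (simp add: a_def)
  qed (use assms in \<open>simp add: a_def\<close>)
  have "cmean R (\<lambda>s. poly p s/(\<Prod>j<2*n+2. s - a j)) = 0"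
    by (rule cmean_decay) (use aR assms in auto)
  moreover have "(\<Prod>j<2*n+2. s - a j) = node_poly n \<zeta> s*(s - z)" for s
  proof -
    have "(\<Prod>j<2*n+2. s - a j) = (\<Prod>j<2*n+1. s - a j)*(s - a (2*n+1))"
      using prod.lessThan_Suc[of "\<lambda>j. s - a j" "2*n+1"] by simp
    also have "(\<Prod>j<2*n+1. s - a j) = node_poly n \<zeta> s"
      unfolding node_poly_def by (rule prod.cong) (auto simp: a_def)
    finally show ?thesis by (simp add: a_def)
  qed
  ultimately show ?thesis unfolding node_mean_def by (simp add: mult.commute)
qed

text \<open>Cauchy's formula for H on a circle around all nodes: after division of the defining
  equation by the node polynomial and by s - z, the part with P is rational, decays like |s|^(-2) at
  least, and has mean 0.\<close>

lemma solution_remainder_eq: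
  assumes sol: "solution n \<zeta> P Q H"
    and \<zeta>: "\<And>j. j < 2*n+1 \<Longrightarrow> cmod (\<zeta> j) \<le> \<delta>" and \<delta>: "0 \<le> \<delta>" "\<delta> < R" and z: "cmod z < R"
  shows "H z = node_mean n \<zeta> R (\<lambda>s. poly Q s/(s - z)*exp (of_nat n * s))"
proof -
  have R: "0 < R" using \<delta> by simp
  have nz: "s - z \<noteq> 0" if "s \<in> sphere 0 R" for s using that z by auto
  have c1: "continuous_on (sphere 0 R) (\<lambda>s. poly Q s/(s - z)*exp (of_nat n * s))"
    "continuous_on (sphere 0 R) (\<lambda>s. poly P s/(s - z))"
    by (intro continuous_intros; use nz in blast)+
  have "H z = cmean R (\<lambda>s. H s/(s - z))"
    by (rule cmean_Cauchy[symmetric])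
       (use sol z in \<open>auto simp: solution_def intro: holomorphic_on_subset\<close>)
  also have "\<dots> = node_mean n \<zeta> R (\<lambda>s. poly Q s/(s - z)*exp (of_nat n * s) + poly P s/(s - z))"
    unfolding node_mean_def
  proof (rule cmean_cong[OF R])
    fix s :: complex assume s: "cmod s = R"
    have "node_poly n \<zeta> s \<noteq> 0" by (rule node_poly_nonzero[OF \<zeta>]) (use s \<delta> in auto)
    moreover have "H s = (exp (of_nat n * s)*poly Q s + poly P s)/node_poly n \<zeta> s"
      using sol calculation by (simp add: solution_def)
    ultimately show "H s/(s - z)
        = (poly Q s/(s - z)*exp (of_nat n * s) + poly P s/(s - z))/node_poly n \<zeta> s"
      by (simp add: add_divide_distrib mult_ac)
  qed
  also have "\<dots> = node_mean n \<zeta> R (\<lambda>s. poly Q s/(s - z)*exp (of_nat n * s))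
      + node_mean n \<zeta> R (\<lambda>s. poly P s/(s - z))"
    by (rule node_mean_add[OF \<zeta> \<delta>]) (assumption | rule c1)+
  also have "node_mean n \<zeta> R (\<lambda>s. poly P s/(s - z)) = 0"
    by (rule node_mean_poly_pole_decay[OF \<zeta> \<delta>])
       (assumption | use sol z in \<open>simp add: solution_def\<close>)+
  finally show ?thesis by simp
qed

text \<open>A Beta integral with saddle t = 1/2; the factor 1 + 4 b - 8 b t is the derivative of the
  curved path on which it arises. In units of 1/sqrt n: the window of half width 1/(4 sqrt n), where
  Bernoulli's inequality keeps the weight above 3/4, contributes 3/8, and the perturbation removes
  at most 1/10.\<close>

lemma beta_saddle:
  fixes f E :: "real \<Rightarrow> complex" and n :: nat and b :: complex
  assumes n: "1 \<le> n" and f: "continuous_on {0..1} f"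
    and eq: "\<And>t. 0 < t \<Longrightarrow> t < 1 \<Longrightarrow> f t = of_real ((4 * t*(1 - t))^n)*exp (E t)*(1 + 4 * b - 8 * b * of_real t)"
    and E: "\<And>t. 0 \<le> t \<Longrightarrow> t \<le> 1 \<Longrightarrow> cmod (E t) \<le> \<eta>*(real n*(t - 1/2)\<^sup>2)"
    and b: "4*cmod b \<le> \<eta>" and \<eta>: "\<eta> \<le> 1/40"
  shows "1/(4 * sqrt n) \<le> cmod (integral {0..1} f)" "cmod (integral {0..1} f) \<le> 2"
proof -
  define w0 where "w0 = (\<lambda>t::real. (4 * t*(1 - t))^n)"
  have w0c: "continuous_on S w0" for S unfolding w0_def by (intro continuous_intros)
  have \<eta>0: "0 \<le> \<eta>" using b norm_ge_zero[of b] by linarith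
  have eq4: "4 * t*(1 - t) = 1 - 4*(t - 1/2)\<^sup>2" for t :: real
    by (simp add: power2_eq_square algebra_simps)
  have f_eq: "f t = of_real (w0 t)*exp (E t)*(1 + 4 * b - 8 * b * of_real t)" if t: "0 < t" "t < 1" for t
    unfolding w0_def by (rule eq[OF t])
  have w0n: "cmod (complex_of_real (w0 t)) \<le> exp (- (2*2*(real n*(t - 1/2)\<^sup>2)))"
    if t: "0 \<le> t" "t \<le> 1" for t
  proof -
    have nn: "0 \<le> 4 * t*(1 - t)" using t by simp
    have "1 - 4*(t - 1/2)\<^sup>2 \<le> exp (- (4*(t - 1/2)\<^sup>2))"
      using exp_ge_add_one_self[of "- (4*(t - 1/2)\<^sup>2)"] by simp
    then have "(4 * t*(1 - t))^n \<le> exp (- (4*(t - 1/2)\<^sup>2))^n"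
      using nn unfolding eq4 by (intro power_mono) auto
    then have "w0 t \<le> exp (- (2*2*(real n*(t - 1/2)\<^sup>2)))"
      unfolding w0_def exp_of_nat_mult[symmetric] by (simp add: mult_ac)
    moreover have "0 \<le> w0 t" using nn by (simp add: w0_def)
    ultimately show ?thesis by simp
  qed
  have fb: "cmod (f t - of_real (w0 t)) \<le> \<eta>*(real n*(t - 1/2)\<^sup>2 + 1)*exp (- 2*(real n*(t - 1/2)\<^sup>2))
      \<and> cmod (f t) \<le> 2" if t: "0 < t" "t < 1" for t
  proof -
    define v where "v = real n*(t - 1/2)\<^sup>2"
    have v0: "0 \<le> v" by (simp add: v_def)
    have t': "0 \<le> t" "t \<le> 1" using t by auto
    have Ev: "cmod (E t) \<le> \<eta> * v" using E[OF t'] by (simp add: v_def)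
    have wv: "cmod (complex_of_real (w0 t)) \<le> exp (- (2*2 * v))" using w0n[OF t'] by (simp add: v_def)
    have 1: "cmod (of_real (w0 t)*exp (E t) - of_real (w0 t)) \<le> \<eta> * v * exp (- 2 * v)"
      by (rule saddle_exp_compare[OF wv Ev]) (use \<eta> \<eta>0 v0 in auto)
    have 2: "cmod (of_real (w0 t)*exp (E t)) \<le> exp (- 2 * v)"
    proof -
      have "Re (E t) \<le> 2 * v"
        using complex_Re_le_cmod[of "E t"] Ev mult_right_mono[OF \<eta> v0] v0 by linarith
      then have "cmod (complex_of_real (w0 t))*cmod (exp (E t)) \<le> exp (- (2*2 * v))*exp (2 * v)"
        by (intro mult_mono wv) auto
      then show ?thesis by (simp only: norm_mult flip: exp_add) simp
    qed
    have 3: "cmod (4 * b - 8 * b * of_real t) \<le> \<eta>"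
    proof -
      have "4 * b - 8 * b * of_real t = 4 * b * of_real (1 - 2 * t)" by (simp add: algebra_simps)
      then have "cmod (4 * b - 8 * b * of_real t) = 4*cmod b * \<bar>1 - 2 * t\<bar>"
        by (simp only: norm_mult norm_of_real) simp
      also have "\<dots> \<le> 4*cmod b*1" using t by (intro mult_left_mono) auto
      finally show ?thesis using b by simp
    qed
    have "f t - of_real (w0 t) = (of_real (w0 t)*exp (E t) - of_real (w0 t))
        + of_real (w0 t)*exp (E t)*(4 * b - 8 * b * of_real t)"
      by (simp add: f_eq[OF t] algebra_simps)
    also have "cmod \<dots> \<le> \<eta> * v * exp (- 2 * v) + exp (- 2 * v) * \<eta>"
      by (intro order.trans[OF norm_triangle_ineq] add_mono 1)
         (subst norm_mult, intro mult_mono 2 3, auto)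
    finally have "cmod (f t - of_real (w0 t)) \<le> \<eta>*(v + 1)*exp (- 2 * v)" by (simp add: algebra_simps)
    moreover have "cmod (f t) \<le> 2"
    proof -
      have "1 + 4 * b - 8 * b * of_real t = 1 + (4 * b - 8 * b * of_real t)" by simp
      then have "cmod (1 + 4 * b - 8 * b * of_real t) \<le> 1 + cmod (4 * b - 8 * b * of_real t)"
        using norm_triangle_ineq[of 1 "4 * b - 8 * b * of_real t"] by (simp only:) simp
      also have "\<dots> \<le> 2" using 3 \<eta> by linarith
      finally have 4: "cmod (1 + 4 * b - 8 * b * of_real t) \<le> 2" .
      have "exp (- 2 * v) \<le> 1" using v0 by simp
      then have "cmod (f t) \<le> 1*2"
        unfolding f_eq[OF t] norm_mult[of "_*exp _"]
        by (intro mult_mono order.trans[OF 2] 4) auto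
      then show ?thesis by simp
    qed
    ultimately show ?thesis by (simp add: v_def)
  qed
  have closure: "closure {0<..<1} = {0..1::real}" by (rule closure_greaterThanLessThan) simp
  have fb': "cmod (f t - of_real (w0 t)) \<le> \<eta>*(real n*(t - 1/2)\<^sup>2 + 1)*exp (- 2*(real n*(t - 1/2)\<^sup>2))"
    if "t \<in> {0..1}" for t
  proof -
    have "cmod (f t - of_real (w0 t)) - \<eta>*(real n*(t - 1/2)\<^sup>2 + 1)*exp (- 2*(real n*(t - 1/2)\<^sup>2)) \<le> 0"
    proof (rule continuous_le_on_closure[of "{0<..<1}" _ t 0])
      show "continuous_on (closure {0<..<1}) (\<lambda>t. cmod (f t - of_real (w0 t))
          - \<eta>*(real n*(t - 1/2)\<^sup>2 + 1)*exp (- 2*(real n*(t - 1/2)\<^sup>2)))"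
        unfolding closure by (intro continuous_intros f w0c)
    qed (use that fb in \<open>auto simp: closure\<close>)
    then show ?thesis by simp
  qed
  have fb2: "cmod (f t) \<le> 2" if "t \<in> {0..1}" for t
    by (rule continuous_le_on_closure[of "{0<..<1}" "\<lambda>t. cmod (f t)" t 2])
       (use that fb in \<open>auto simp: closure intro: continuous_on_norm f\<close>)
  have "cmod (integral {0..1} f - integral {0..1} (\<lambda>t. of_real (w0 t)))
      \<le> \<eta>*(2/2) * pi * sqrt (2/2)/sqrt (real n)"
    by (rule saddle_compare[where ?x0.0 = "1/2"])
       (use n \<eta>0 fb' f in \<open>auto intro: continuous_on_of_real w0c\<close>)
  also have "\<dots> \<le> (1/10)/sqrt (real n)"
  proof (rule divide_right_mono)
    have "\<eta> * pi \<le> 1/40*4" using \<eta> \<eta>0 pi_less_4 by (intro mult_mono) auto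
    then show "\<eta>*(2/2) * pi * sqrt (2/2) \<le> 1/10" by simp
  qed auto
  finally have diff: "cmod (integral {0..1} f - integral {0..1} (\<lambda>t. of_real (w0 t))) \<le> (1/10)/sqrt (real n)" .
  have w0int: "(3/8)/sqrt (real n) \<le> integral {0..1} w0"
  proof -
    define h where "h = 1/(4 * sqrt (real n))"
    have h: "0 < h" "h \<le> 1/4" "h\<^sup>2 = 1/(16*real n)"
      using n by (auto simp: h_def power_mult_distrib power_divide)
    have "(3/8)/sqrt (real n) = integral {1/2 - h..1/2 + h} (\<lambda>_. 3/4)" using h by (simp add: h_def)
    also have "\<dots> \<le> integral {1/2 - h..1/2 + h} w0"
    proof (rule integral_le)
      fix t assume "t \<in> {1/2 - h..1/2 + h}"
      then have t: "\<bar>t - 1/2\<bar> \<le> h" by auto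
      then have "(t - 1/2)\<^sup>2 \<le> h\<^sup>2" using power_mono[OF t, of 2] by simp
      then have q: "4*(t - 1/2)\<^sup>2 \<le> 1/(4*real n)" using h by simp
      have "1/(4*real n) \<le> 1" using n by simp
      then have "1 + real n*(- (1/(4*real n))) \<le> (1 + - (1/(4*real n)))^n"
        by (intro Bernoulli_inequality) auto
      also have "\<dots> \<le> (1 - 4*(t - 1/2)\<^sup>2)^n" using q \<open>1/(4*real n) \<le> 1\<close> by (intro power_mono) auto
      finally show "3/4 \<le> w0 t" using n by (simp add: w0_def eq4)
    qed (auto intro!: integrable_continuous_interval w0c)
    also have "\<dots> \<le> integral {0..1} w0"
    proof (rule integral_subset_le)
      show "\<forall>t\<in>{0..1}. 0 \<le> w0 t" by (auto simp: w0_def)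
      show "{1/2 - h..1/2 + h} \<subseteq> {0..1}" using h by auto
    qed (intro integrable_continuous_interval w0c)+
    finally show ?thesis .
  qed
  have "integral {0..1} (\<lambda>t. complex_of_real (w0 t)) = of_real (integral {0..1} w0)"
    by (intro integral_unique has_integral_of_real integrable_integral integrable_continuous_interval w0c)
  then have "(3/8)/sqrt (real n) \<le> cmod (integral {0..1} (\<lambda>t. complex_of_real (w0 t)))"
    using w0int by simp
  then have "(11/40)/sqrt (real n) \<le> cmod (integral {0..1} f)"
    using diff norm_triangle_ineq3[of "integral {0..1} f" "integral {0..1} (\<lambda>t. complex_of_real (w0 t))"]
    by (simp add: abs_le_iff)
  moreover have "1/(4 * sqrt n) \<le> (11/40)/sqrt (real n)" using n by (simp add: field_simps)
  ultimately show "1/(4 * sqrt n) \<le> cmod (integral {0..1} f)" by linarith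
  have "cmod (integral {0..1} f) \<le> 2*(1 - 0)"
    by (rule integral_bound) (use f fb2 in auto)
  then show "cmod (integral {0..1} f) \<le> 2" by simp
qed

text \<open>\<open>H z\<close> is the value at 1 of the solution of \<open>\<Phi>' - n z \<Phi> = n * spline\<close>, \<open>\<Phi> 0 = 0\<close>.\<close>

lemma remainder_size:
  fixes n :: nat and v :: "complex \<Rightarrow> complex"
  assumes n: "1 \<le> n" and sol: "solution n \<zeta> P Q H" and Q0: "poly Q 0 \<noteq> 0"
    and \<zeta>: "\<And>j. j < 2*n+1 \<Longrightarrow> cmod (\<zeta> j) \<le> \<delta>" and \<delta>: "0 \<le> \<delta>" "\<delta> < R"
    and z: "cmod z \<le> 1/1000" "cmod z < R"
    and \<nu>: "0 \<le> \<nu>" "\<nu> \<le> 1/1000"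
    and v: "v holomorphic_on ball 0 3"
    and sp: "\<And>y. cmod y < 3 \<Longrightarrow> spline n \<zeta> R Q y = (y*(y - 1))^n*exp (v y)"
    and v0: "\<And>y. cmod y < 3 \<Longrightarrow>
       \<bar>Re (v y) - (ln (cmod (poly Q 0)) + 2*real n - 2*real n*ln 2)\<bar> \<le> \<nu>*real n"
    and v1: "\<And>y. cmod y < 3 \<Longrightarrow> cmod (deriv v y) \<le> \<nu>*real n"
    and v2: "\<And>y. cmod y < 3 \<Longrightarrow> cmod (deriv (deriv v) y) \<le> \<nu>*real n"
  shows "exp (- 4*real n)*cmod (poly Q 0) \<le> cmod (H z)" "cmod (H z) \<le> exp (4*real n)*cmod (poly Q 0)"
proof -
  define U where "U = ball (0::complex) 3"
  have U: "open U" "convex U" by (auto simp: U_def)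
  have R: "0 < R" using \<delta> by simp
  have holv: "v holomorphic_on U" using v by (simp add: U_def)
  have holdv: "deriv v holomorphic_on U" by (rule holomorphic_deriv[OF holv U(1)])
  define \<Phi> where "\<Phi> = (\<lambda>y. node_mean n \<zeta> R (\<lambda>s. poly Q s/(s - z)*exp (of_nat n * s * y)))"
  have nz: "s - z \<noteq> 0" if "s \<in> sphere 0 R" for s using that z by auto
  have \<Phi>0: "\<Phi> 0 = 0"
    using node_mean_poly_pole_decay[OF \<zeta> \<delta>, where p = Q and z = z] sol z by (simp add: \<Phi>_def solution_def)
  have \<Phi>1: "\<Phi> 1 = H z"
    using solution_remainder_eq[OF sol \<zeta> \<delta> z(2)] by (simp add: \<Phi>_def)
  have D: "((\<lambda>y. \<Phi> y*exp (- of_nat n * z * y)) has_field_derivative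
      of_nat n * spline n \<zeta> R Q y*exp (- of_nat n * z * y)) (at y)" for y
  proof -
    have eq: "node_mean n \<zeta> R (\<lambda>s. (s - z)*(poly Q s/(s - z))*exp (of_nat n * s * y)) = spline n \<zeta> R Q y"
      unfolding spline_def by (rule node_mean_cong[OF R]) (use nz in auto)
    have "((\<lambda>y. node_mean n \<zeta> R (\<lambda>s. poly Q s/(s - z)*exp (of_nat n * s * y))*exp (- of_nat n * z * y))
      has_field_derivative of_nat n*node_mean n \<zeta> R (\<lambda>s. (s - z)*(poly Q s/(s - z))*exp (of_nat n * s * y))
        * exp (- of_nat n * z * y)) (at y)"
    proof (rule node_mean_exp_first_order[OF _ \<delta>])
      show "continuous_on (sphere 0 R) (\<lambda>s. poly Q s/(s - z))"
        by (intro continuous_intros) (use nz in blast)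
    qed (rule \<zeta>)
    then show ?thesis unfolding eq unfolding \<Phi>_def .
  qed

  \<comment> \<open>The critical point near 1/2 and a path from 0 to 1 through it\<close>
  define V where "V = (\<lambda>y. v y - of_nat n * z * y)"
  have holV: "V holomorphic_on U" unfolding V_def by (intro holomorphic_intros holv)
  have dv: "(v has_field_derivative deriv v y) (at y)" "(deriv v has_field_derivative deriv (deriv v) y) (at y)"
    if "y \<in> U" for y
    using holomorphic_derivI[OF holv U(1) that] holomorphic_derivI[OF holdv U(1) that] by auto
  have dV: "deriv V y = deriv v y - of_nat n * z" if "y \<in> U" for y
    unfolding V_def by (rule DERIV_imp_deriv) (rule derivative_eq_intros dv(1)[OF that] refl | simp)+
  have ddV: "deriv (deriv V) y = deriv (deriv v) y" if "y \<in> U" for y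
  proof -
    have "eventually (\<lambda>y. y \<in> U) (nhds y)" using U that by (intro eventually_nhds_in_open) auto
    then have "eventually (\<lambda>y. deriv V y = deriv v y - of_nat n * z) (nhds y)"
      by eventually_elim (rule dV)
    then have "deriv (deriv V) y = deriv (\<lambda>y. deriv v y - of_nat n * z) y"
      by (intro deriv_cong_ev) auto
    also have "\<dots> = deriv (deriv v) y"
      by (rule DERIV_imp_deriv) (rule derivative_eq_intros dv(2)[OF that] refl | simp)+
    finally show ?thesis .
  qed
  have V1: "cmod (deriv V y) \<le> real n/500" if "y \<in> U" for y
  proof -
    have "cmod (deriv V y) \<le> cmod (deriv v y) + cmod (of_nat n * z)"
      unfolding dV[OF that] by (rule norm_triangle_ineq4)
    also have "\<dots> \<le> \<nu>*real n + real n*(1/1000)"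
    proof (rule add_mono)
      show "cmod (of_nat n * z) \<le> real n*(1/1000)"
        unfolding norm_mult norm_of_nat by (intro mult_left_mono z) auto
    qed (use v1[of y] that in \<open>simp add: U_def\<close>)
    also have "\<dots> \<le> 1/1000*real n + real n*(1/1000)"
      using \<nu> by (intro add_mono mult_right_mono) auto
    finally show ?thesis by simp
  qed
  have V2: "cmod (deriv (deriv V) y) \<le> \<nu>*real n" if "y \<in> U" for y
    unfolding ddV[OF that] using v2[of y] that by (simp add: U_def)
  \<comment> \<open>At y = 1/2 + b the sum n/y + n/(y - 1) equals - 8 n b/(1 - 4 b^2), so the
    critical point equation of (y (y - 1))^n e^(V(y)) is b = B(b).\<close>
  define B where "B = (\<lambda>b. (1 - 4 * b\<^sup>2) * deriv V (1/2 + b)/(8 * of_nat n))"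
  have inU: "1/2 + b \<in> U" if "cmod b \<le> 1/100" for b
    using norm_triangle_ineq[of "1/2" b] that by (simp add: U_def)
  have Bb: "cmod (B b) \<le> 1/2000" if "cmod b \<le> 1/100" for b
  proof -
    have "cmod (1 - 4 * b\<^sup>2) \<le> 1 + 4*(cmod b)\<^sup>2"
      using norm_triangle_ineq4[of 1 "4 * b\<^sup>2"] by (simp add: norm_mult norm_power)
    also have "\<dots> \<le> 1 + 4*(1/100)\<^sup>2" using that by (intro add_left_mono mult_left_mono power_mono) auto
    finally have 1: "cmod (1 - 4 * b\<^sup>2) \<le> 2" by (simp add: power2_eq_square)
    have "cmod (B b) = cmod (1 - 4 * b\<^sup>2)*cmod (deriv V (1/2 + b))/(8*real n)"
      by (simp add: B_def norm_mult norm_divide)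
    also have "\<dots> \<le> 2*(real n/500)/(8*real n)"
      using 1 V1[OF inU[OF that]] by (intro divide_right_mono mult_mono) auto
    finally show ?thesis using n by simp
  qed
  have "continuous_on (cball 0 (1/100)) (\<lambda>b. deriv V (1/2 + b))"
  proof (rule continuous_on_compose2[of U "deriv V"])
    show "continuous_on U (deriv V)"
      by (intro holomorphic_on_imp_continuous_on holomorphic_deriv holV U)
    show "(\<lambda>b. 1/2 + b) ` cball 0 (1/100) \<subseteq> U"
    proof (rule image_subsetI)
      fix b :: complex assume "b \<in> cball 0 (1/100)"
      then show "1/2 + b \<in> U" by (intro inU) simp
    qed
  qed (intro continuous_intros)
  moreover have "\<forall>b\<in>cball 0 (1/100). 8 * complex_of_nat n \<noteq> 0" using n by auto
  ultimately have Bc: "continuous_on (cball 0 (1/100)) B" unfolding B_def by (intro continuous_intros)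
  have Bm: "B \<in> cball 0 (1/100) \<rightarrow> cball 0 (1/100)"
  proof
    fix b :: complex assume "b \<in> cball 0 (1/100)"
    then have "cmod (B b) \<le> 1/2000" by (intro Bb) simp
    then show "B b \<in> cball 0 (1/100)" by simp
  qed
  obtain b where b0: "b \<in> cball 0 (1/100)" "B b = b"
    using brouwer_ball[OF _ Bc Bm] by auto
  have b: "cmod b \<le> 1/2000" using Bb[of b] b0 by simp
  define y1 where "y1 = 1/2 + b"
  \<comment> \<open>This quadratic path joins 0 to 1 and passes through \<open>y1\<close> at t =
    1/2. It is chosen so that both factors split: y = t (1 + 4 b (1 - t)) and 1 - y = (1 - t) (1 - 4
    b t), which leaves the weight t (1 - t) intact.\<close>
  define y where "y = (\<lambda>t. of_real t*(1 + 4 * b*(1 - of_real t)))"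
  \<comment> \<open>With T = t - 1/2 the cofactors are 1 + 4 b (1 - t) = (1 + 2 b) (1 - a1 T) and 1
    - 4 b t = (1 - 2 b) (1 - a2 T). The critical point equation becomes V'(y1) = n (a1 + a2), which
    cancels the linear terms in T.\<close>
  define a1 where "a1 = 4 * b/(1 + 2 * b)"
  define a2 where "a2 = 4 * b/(1 - 2 * b)"
  have np: "9/10 \<le> cmod (1 + 2 * b)" "9/10 \<le> cmod (1 - 2 * b)"
    using norm_diff_ineq[of 1 "2 * b"] norm_triangle_ineq2[of 1 "2 * b"] b by (auto simp: norm_mult)
  then have np0: "1 + 2 * b \<noteq> 0" "1 - 2 * b \<noteq> 0" by auto
  have y1U: "y1 \<in> U" unfolding y1_def by (rule inU) (use b in simp)
  have crit: "deriv V y1 = of_nat n*(a1 + a2)"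
  proof -
    have "(1 - 4 * b\<^sup>2) * deriv V y1 = 8 * of_nat n * b"
      using b0(2) n by (simp add: B_def y1_def field_simps)
    moreover have "1 - 4 * b\<^sup>2 = (1 + 2 * b)*(1 - 2 * b)" by (simp add: power2_eq_square algebra_simps)
    ultimately have "deriv V y1 = 8 * of_nat n * b/((1 + 2 * b)*(1 - 2 * b))"
      using np0 by (simp add: nonzero_eq_divide_eq mult.commute)
    also have "\<dots> = of_nat n*(a1 + a2)"
      using np0 unfolding a1_def a2_def by (simp add: divide_simps) (simp add: algebra_simps)
    finally show ?thesis .
  qed
  have ab: "cmod a1 \<le> 1/400" "cmod a2 \<le> 1/400"
  proof -
    have "cmod a1 \<le> (4*(1/2000))/(9/10)" unfolding a1_def norm_divide
      using np b by (intro frac_le) (auto simp: norm_mult)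
    then show "cmod a1 \<le> 1/400" by simp
    have "cmod a2 \<le> (4*(1/2000))/(9/10)" unfolding a2_def norm_divide
      using np b by (intro frac_le) (auto simp: norm_mult)
    then show "cmod a2 \<le> 1/400" by simp
  qed
  have ydiff: "y t - y1 = of_real (t - 1/2) - 4 * b*(of_real (t - 1/2))\<^sup>2" for t
    by (simp add: y_def y1_def power2_eq_square algebra_simps)
  have yU: "y t \<in> U" if "0 \<le> t" "t \<le> 1" for t
  proof -
    have 1: "cmod (1 - of_real t) = 1 - t"
      using that by (metis abs_of_nonneg diff_ge_0_iff_ge norm_of_real of_real_1 of_real_diff)
    have "cmod (1 + 4 * b*(1 - of_real t)) \<le> 1 + 4*cmod b*(1 - t)"
      using norm_triangle_ineq[of 1 "4 * b*(1 - of_real t)"] by (simp add: norm_mult 1)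
    also have "\<dots> \<le> 1 + 4*(1/2000)*1" using b that by (intro add_left_mono mult_mono) auto
    finally have "cmod (y t) \<le> 1*(1 + 4*(1/2000)*1)"
      unfolding y_def norm_mult using that by (intro mult_mono) auto
    then show ?thesis by (simp add: U_def)
  qed
  define E where "E = (\<lambda>t. of_nat n*(Ln (1 + - (a1 * of_real (t - 1/2))) - - (a1 * of_real (t - 1/2)))
     + of_nat n*(Ln (1 + - (a2 * of_real (t - 1/2))) - - (a2 * of_real (t - 1/2)))
     + deriv V y1*(- 4 * b*(of_real (t - 1/2))\<^sup>2)
     + (V (y t) - V y1 - deriv V y1*(y t - y1)))"
  define A where "A = of_nat n*(y1*(y1 - 1))^n*exp (V y1)"
  define f where "f = (\<lambda>t. of_nat n * spline n \<zeta> R Q (y t)*exp (- of_nat n * z * y t)*(1 + 4 * b - 8 * b * of_real t)/A)"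
  have ypr: "y1*(y1 - 1) = - ((1 + 2 * b)*(1 - 2 * b)/4)"
    by (simp add: y1_def field_simps)
  have A0: "A \<noteq> 0" unfolding A_def ypr using n np0 by simp
  have Lna: "cmod (- (a * of_real (t - 1/2))) \<le> 1/2"
    "cmod (Ln (1 + - (a * of_real (t - 1/2))) - - (a * of_real (t - 1/2))) \<le> 1/1000*(t - 1/2)\<^sup>2"
    if a: "cmod a \<le> 1/400" and t: "0 \<le> t" "t \<le> 1" for a t
  proof -
    have tb: "\<bar>t - 1/2\<bar> \<le> 1" using t by auto
    have nm: "cmod (- (a * of_real (t - 1/2))) = cmod a * \<bar>t - 1/2\<bar>"
      by (simp only: norm_minus_cancel norm_mult norm_of_real)
    have "cmod a * \<bar>t - 1/2\<bar> \<le> 1/400*1" using a tb by (intro mult_mono) auto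
    then show h: "cmod (- (a * of_real (t - 1/2))) \<le> 1/2" unfolding nm by simp
    have "cmod (Ln (1 + - (a * of_real (t - 1/2))) - - (a * of_real (t - 1/2)))
        \<le> (cmod (- (a * of_real (t - 1/2))))\<^sup>2/(1 - cmod (- (a * of_real (t - 1/2))))"
      by (rule Ln_approx_linear) (use h in linarith)
    also have "\<dots> \<le> (1/400 * \<bar>t - 1/2\<bar>)\<^sup>2/(1/2)"
    proof (rule frac_le)
      show "(cmod (- (a * of_real (t - 1/2))))\<^sup>2 \<le> (1/400 * \<bar>t - 1/2\<bar>)\<^sup>2"
        unfolding nm using a by (intro power_mono mult_right_mono) auto
      show "1/2 \<le> 1 - cmod (- (a * of_real (t - 1/2)))" using h by linarith
    qed auto
    also have "\<dots> \<le> 1/1000*(t - 1/2)\<^sup>2" by (simp add: power_mult_distrib power_divide)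
    finally show "cmod (Ln (1 + - (a * of_real (t - 1/2))) - - (a * of_real (t - 1/2))) \<le> 1/1000*(t - 1/2)\<^sup>2" .
  qed
  have feq: "f t = of_real ((4 * t*(1 - t))^n)*exp (E t)*(1 + 4 * b - 8 * b * of_real t)"
    if t: "0 < t" "t < 1" for t
  proof -
    define T where "T = complex_of_real (t - 1/2)"
    have t01: "0 \<le> t" "t \<le> 1" using t by auto
    have L: "exp (Ln (1 + - (a * T))) = 1 + - (a * T)" if "cmod a \<le> 1/400" for a
    proof -
      have "1 + - (a * T) \<noteq> 0"
      proof
        assume "1 + - (a * T) = 0"
        then have "- (a * T) = - 1" by (metis add_eq_0_iff)
        then show False using Lna(1)[OF that t01] by (simp add: T_def)
      qed
      then show ?thesis by simp
    qed
    have tt: "complex_of_real t = T + 1/2" by (simp add: T_def)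
    have c1: "(1 + 2 * b)*(1 + - (a1 * T)) = 1 + 4 * b*(1 - of_real t)"
      unfolding a1_def tt using np0 by (simp add: field_simps)
    have c2: "(1 - 2 * b)*(1 + - (a2 * T)) = 1 - 4 * b * of_real t"
      unfolding a2_def tt using np0 by (simp add: field_simps)
    have "y t*(y t - 1) = - (of_real (t*(1 - t))*((1 + 4 * b*(1 - of_real t))*(1 - 4 * b * of_real t)))"
      by (simp add: y_def algebra_simps)
    also have "\<dots> = y1*(y1 - 1) * of_real (4 * t*(1 - t))*(exp (Ln (1 + - (a1 * T)))*exp (Ln (1 + - (a2 * T))))"
      unfolding c1[symmetric] c2[symmetric] L[OF ab(1)] L[OF ab(2)] ypr by simp
    finally have yy: "y t*(y t - 1) = y1*(y1 - 1) * of_real (4 * t*(1 - t))*(exp (Ln (1 + - (a1 * T)))*exp (Ln (1 + - (a2 * T))))" .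
    have Ee: "of_nat n * Ln (1 + - (a1 * T)) + of_nat n * Ln (1 + - (a2 * T)) + (V (y t) - V y1) = E t"
    proof -
      have "deriv V y1*(y t - y1) = of_nat n*(a1 * T) + of_nat n*(a2 * T) + deriv V y1*(- 4 * b * T\<^sup>2)"
      proof -
        have "deriv V y1*(y t - y1) = deriv V y1 * T + deriv V y1*(- 4 * b * T\<^sup>2)"
          unfolding ydiff T_def by (simp add: algebra_simps)
        also have "deriv V y1 * T = of_nat n*(a1 * T) + of_nat n*(a2 * T)"
          unfolding crit by (simp add: algebra_simps)
        finally show ?thesis .
      qed
      then show ?thesis unfolding E_def T_def[symmetric] by (simp add: algebra_simps)
    qed
    have "spline n \<zeta> R Q (y t)*exp (- of_nat n * z * y t) = (y t*(y t - 1))^n*exp (V (y t))"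
      using sp[of "y t"] yU[OF t01] by (simp add: U_def V_def exp_diff exp_minus field_simps)
    also have "\<dots> = (y1*(y1 - 1))^n * of_real ((4 * t*(1 - t))^n)
        * (exp (Ln (1 + - (a1 * T)))^n*exp (Ln (1 + - (a2 * T)))^n)*(exp (V (y t) - V y1)*exp (V y1))"
      unfolding yy by (simp add: power_mult_distrib exp_diff)
    also have "\<dots> = (y1*(y1 - 1))^n*exp (V y1) * of_real ((4 * t*(1 - t))^n)*exp (E t)"
      unfolding Ee[symmetric] exp_add exp_of_nat_mult by (simp only: mult_ac)
    finally have "of_nat n*(spline n \<zeta> R Q (y t)*exp (- of_nat n * z * y t))
        = A*(of_real ((4 * t*(1 - t))^n)*exp (E t))"
      by (simp add: A_def)
    then have "f t = A*(of_real ((4 * t*(1 - t))^n)*exp (E t))*(1 + 4 * b - 8 * b * of_real t)/A"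
      unfolding f_def by (simp add: mult.assoc)
    then show ?thesis using A0 by simp
  qed
  have Eb: "cmod (E t) \<le> 1/100*(real n*(t - 1/2)\<^sup>2)" if t: "0 \<le> t" "t \<le> 1" for t
  proof -
    have tb: "\<bar>t - 1/2\<bar> \<le> 1" using t by auto
    have nT: "cmod ((of_real (t - 1/2))\<^sup>2) = (t - 1/2)\<^sup>2"
      by (simp only: norm_power norm_of_real power2_abs)
    have 1: "cmod (of_nat n*(Ln (1 + - (a * of_real (t - 1/2))) - - (a * of_real (t - 1/2))))
        \<le> 1/1000*(real n*(t - 1/2)\<^sup>2)" if "cmod a \<le> 1/400" for a
      using mult_left_mono[OF Lna(2)[OF that t], of "real n"] by (simp only: norm_mult norm_of_nat) simp
    have 2: "cmod (deriv V y1*(- 4 * b*(of_real (t - 1/2))\<^sup>2)) \<le> 1/1000*(real n*(t - 1/2)\<^sup>2)"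
    proof -
      have "cmod (deriv V y1*(- 4 * b*(of_real (t - 1/2))\<^sup>2)) = cmod (deriv V y1)*(4*cmod b*(t - 1/2)\<^sup>2)"
        unfolding norm_mult nT by simp
      also have "\<dots> \<le> (real n/500)*(4*(1/2000)*(t - 1/2)\<^sup>2)"
        using V1[OF y1U] b by (intro mult_mono) auto
      also have "\<dots> \<le> 1/1000*(real n*(t - 1/2)\<^sup>2)" by simp
      finally show ?thesis .
    qed
    have 3: "cmod (V (y t) - V y1 - deriv V y1*(y t - y1)) \<le> 4/1000*(real n*(t - 1/2)\<^sup>2)"
    proof -
      have "cmod (y t - y1) \<le> \<bar>t - 1/2\<bar> + 4*cmod b*(t - 1/2)\<^sup>2"
        unfolding ydiff by (rule order.trans[OF norm_triangle_ineq4]) (simp add: norm_mult nT del: of_real_diff)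
      also have "\<dots> \<le> \<bar>t - 1/2\<bar> + 4*(1/2000) * \<bar>t - 1/2\<bar>"
      proof -
        have "(t - 1/2)\<^sup>2 \<le> \<bar>t - 1/2\<bar>"
          using mult_right_mono[OF tb, of "\<bar>t - 1/2\<bar>"] by (simp add: power2_eq_square)
        then show ?thesis using b by (intro add_left_mono mult_mono) auto
      qed
      also have "\<dots> \<le> 2 * \<bar>t - 1/2\<bar>" by simp
      finally have "(cmod (y t - y1))\<^sup>2 \<le> (2 * \<bar>t - 1/2\<bar>)\<^sup>2" by (intro power_mono) auto
      then have "(\<nu>*real n)*(cmod (y t - y1))\<^sup>2 \<le> (1/1000*real n)*(2 * \<bar>t - 1/2\<bar>)\<^sup>2"
        using \<nu> by (intro mult_mono) auto
      moreover have "cmod (V (y t) - V y1 - deriv V y1*(y t - y1)) \<le> (\<nu>*real n)*(cmod (y t - y1))\<^sup>2"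
        by (rule norm_linear_Taylor_le[OF holV U]) (use V2 y1U yU[OF t] in auto)
      ultimately show ?thesis by (simp add: power_mult_distrib)
    qed
    have "cmod (E t) \<le> 1/1000*(real n*(t - 1/2)\<^sup>2) + 1/1000*(real n*(t - 1/2)\<^sup>2)
        + 1/1000*(real n*(t - 1/2)\<^sup>2) + 4/1000*(real n*(t - 1/2)\<^sup>2)"
      unfolding E_def
      by (intro order.trans[OF norm_triangle_ineq] add_mono 1 2 3 ab)
    also have "\<dots> \<le> 1/100*(real n*(t - 1/2)\<^sup>2)" by simp
    finally show ?thesis .
  qed
  have yc: "continuous_on {0..1} y" unfolding y_def by (intro continuous_intros)
  have spc: "continuous_on UNIV (\<lambda>y. of_nat n * spline n \<zeta> R Q y*exp (- of_nat n * z * y))"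
  proof -
    have "(\<lambda>y. \<Phi> y*exp (- of_nat n * z * y)) holomorphic_on UNIV"
      using D by (auto simp: holomorphic_on_open)
    then have "deriv (\<lambda>y. \<Phi> y*exp (- of_nat n * z * y)) holomorphic_on UNIV"
      by (rule holomorphic_deriv) simp
    moreover have "deriv (\<lambda>y. \<Phi> y*exp (- of_nat n * z * y)) = (\<lambda>y. of_nat n * spline n \<zeta> R Q y*exp (- of_nat n * z * y))"
      by (intro ext DERIV_imp_deriv D)
    ultimately show ?thesis by (intro holomorphic_on_imp_continuous_on) simp
  qed
  have "continuous_on {0..1} (\<lambda>t. of_nat n * spline n \<zeta> R Q (y t)*exp (- of_nat n * z * y t))"
    by (rule continuous_on_compose2[OF spc yc]) simp
  moreover have "\<forall>t\<in>{0..1::real}. A \<noteq> 0" using A0 by simp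
  moreover have "continuous_on {0..1} (\<lambda>t. 1 + 4 * b - 8 * b * complex_of_real t)" by (intro continuous_intros)
  ultimately have fc: "continuous_on {0..1} f"
    unfolding f_def by (intro continuous_on_divide[OF continuous_on_mult continuous_on_const])
  have b4: "4*cmod b \<le> 1/100" using b by simp
  note I = beta_saddle[OF n fc feq Eb b4]
  have y01: "y 0 = 0" "y 1 = 1" by (simp_all add: y_def)
  have hi: "((\<lambda>t. of_nat n * spline n \<zeta> R Q (y t)*exp (- of_nat n * z * y t)*(1 + 4 * b - 8 * b * of_real t))
     has_integral \<Phi> (y 1)*exp (- of_nat n * z * y 1) - \<Phi> (y 0)*exp (- of_nat n * z * y 0)) {0..1}"
  proof (rule fundamental_theorem_of_calculus)
    fix t :: real
    have "(y has_vector_derivative (1 + 4 * b - 8 * b * of_real t)) (at t within {0..1})"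
      unfolding y_def by (auto intro!: derivative_eq_intros simp: algebra_simps)
    from field_vector_diff_chain_within[OF this has_field_derivative_at_within[OF D]]
    show "((\<lambda>t. \<Phi> (y t)*exp (- of_nat n * z * y t)) has_vector_derivative
       of_nat n * spline n \<zeta> R Q (y t)*exp (- of_nat n * z * y t)*(1 + 4 * b - 8 * b * of_real t)) (at t within {0..1})"
      by (simp only: o_def mult.commute[of "1 + 4 * b - 8 * b * of_real t"])
  qed simp
  have "(\<lambda>t. of_nat n * spline n \<zeta> R Q (y t)*exp (- of_nat n * z * y t)*(1 + 4 * b - 8 * b * of_real t)) = (\<lambda>t. f t * A)"
    using A0 by (intro ext) (simp add: f_def)
  with hi have "((\<lambda>t. f t * A) has_integral H z*exp (- of_nat n * z)) {0..1}"
    by (simp add: y01 \<Phi>0 \<Phi>1)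
  then have "integral {0..1} f * A = H z*exp (- of_nat n * z)"
    by (simp only: integral_unique integral_mult_left[symmetric])
  then have Heq: "cmod (H z) = cmod (integral {0..1} f)*cmod A*exp (Re (of_nat n * z))"
  proof -
    assume a: "integral {0..1} f * A = H z*exp (- of_nat n * z)"
    have "H z = integral {0..1} f * A*exp (of_nat n * z)" unfolding a by (simp add: exp_minus)
    then show ?thesis by (simp only: norm_mult norm_exp_eq_Re)
  qed

  \<comment> \<open>The size of H z\<close>
  define K where "K = cmod (poly Q 0)"
  have K: "K > 0" using Q0 by (simp add: K_def)
  have An: "cmod A = real n*cmod (y1*(y1 - 1))^n*exp (Re (V y1))"
    by (simp only: A_def norm_mult norm_power norm_of_nat norm_exp_eq_Re)
  have yb: "1/5 \<le> cmod (y1*(y1 - 1))" "cmod (y1*(y1 - 1)) \<le> 1/3"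
  proof -
    have "y1*(y1 - 1) = b\<^sup>2 - 1/4" by (simp add: y1_def power2_eq_square algebra_simps)
    moreover have "cmod (b\<^sup>2) \<le> 1/100"
      using power_mono[OF b, of 2] by (simp add: norm_power power_divide)
    ultimately show "1/5 \<le> cmod (y1*(y1 - 1))" "cmod (y1*(y1 - 1)) \<le> 1/3"
      using norm_triangle_ineq4[of "b\<^sup>2" "1/4"] norm_triangle_ineq3[of "b\<^sup>2" "1/4"] by (auto simp: abs_le_iff)
  qed
  have Vb: "\<bar>Re (V y1) + Re (of_nat n * z) - (ln K + 2*real n - 2*real n*ln 2)\<bar> \<le> real n/100"
  proof -
    have "Re (V y1) + Re (of_nat n * z) = Re (v y1) + Re (of_nat n * z*(1 - y1))"
      by (simp add: V_def algebra_simps)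
    moreover have "\<bar>Re (v y1) - (ln K + 2*real n - 2*real n*ln 2)\<bar> \<le> \<nu>*real n"
      unfolding K_def by (rule v0) (use y1U in \<open>simp add: U_def\<close>)
    moreover have "\<nu>*real n \<le> 1/1000*real n" using \<nu> by (intro mult_right_mono) auto
    moreover have "\<bar>Re (of_nat n * z*(1 - y1))\<bar> \<le> real n*(1/1000)*4"
    proof -
      have "cmod (1 - y1) \<le> 4" using norm_triangle_ineq4[of 1 y1] y1U by (simp add: U_def)
      then have "cmod (of_nat n * z*(1 - y1)) \<le> real n*(1/1000)*4"
        unfolding norm_mult norm_of_nat using z by (intro mult_mono) auto
      then show ?thesis using abs_Re_le_cmod order.trans by blast
    qed
    ultimately show ?thesis by linarith
  qed
  have e4: "exp (2*real n*ln 2) = 4^n"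
  proof -
    have "exp (2*real n*ln 2) = exp (real n*(ln 2 + ln 2))" by (simp add: algebra_simps)
    also have "\<dots> = (exp (ln 2)*exp (ln 2))^n" by (simp only: exp_of_nat_mult exp_add)
    finally show ?thesis by simp
  qed
  have Heq2: "cmod (H z) = cmod (integral {0..1} f)*(real n*cmod (y1*(y1 - 1))^n)*exp (Re (V y1) + Re (of_nat n * z))"
    unfolding Heq An by (simp only: exp_add mult.assoc)
  have "exp (ln K + 2*real n - 2*real n*ln 2 - real n/100) \<le> exp (Re (V y1) + Re (of_nat n * z))"
    unfolding exp_le_cancel_iff using Vb by linarith
  moreover have "ln K + 2*real n - 2*real n*ln 2 - real n/100
      = ln K + (2*real n - real n/100) - 2*real n*ln 2" by simp
  ultimately have lo: "K*exp (2*real n - real n/100)/4^n \<le> exp (Re (V y1) + Re (of_nat n * z))"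
    using K by (simp only: exp_diff[of "_ + _"] exp_add[of "ln K"] e4 exp_ln)
  have "exp (Re (V y1) + Re (of_nat n * z)) \<le> exp (ln K + 2*real n - 2*real n*ln 2 + real n/100)"
    unfolding exp_le_cancel_iff using Vb by linarith
  moreover have "ln K + 2*real n - 2*real n*ln 2 + real n/100
      = ln K + (2*real n + real n/100) - 2*real n*ln 2" by simp
  ultimately have hi: "exp (Re (V y1) + Re (of_nat n * z)) \<le> K*exp (2*real n + real n/100)/4^n"
    using K by (simp only: exp_diff[of "_ + _"] exp_add[of "ln K"] e4 exp_ln)
  show "exp (- 4*real n)*cmod (poly Q 0) \<le> cmod (H z)"
  proof -
    have q: "1/4 \<le> 1/(4 * sqrt n)*real n"
    proof -
      have "1/(4 * sqrt n)*real n = sqrt n/4"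
        using n by (simp add: field_simps)
      then show ?thesis using n by simp
    qed
    have "exp (- 4*real n) * K \<le> 1/4*(1/5)^n*(K*exp (2*real n - real n/100)/4^n)"
    proof -
      \<comment> \<open>The base 20 is the product of the 4 in the main term and of the 5 from the
        lower bound 1/5 for |y1 (y1 - 1)|; the prefactor 4 is absorbed by 80 \<le> e^5.\<close>
      have "4*20^n \<le> exp (5::real)^n"
      proof -
        have "80 \<le> exp (5::real)"
        proof -
          have "(5/2)^5 \<le> exp (1::real)^5"
            using exp_lower_Taylor_quadratic[of "1::real"] by (intro power_mono) auto
          then show ?thesis by (simp add: power_divide flip: exp_of_nat_mult)
        qed
        then have "80^n \<le> exp (5::real)^n" by (intro power_mono) auto
        moreover have "4*20^n \<le> (80::real)^n"
        proof -
          have "(80::real)^n = 4^n*20^n" by (simp flip: power_mult_distrib)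
          moreover have "(4::real)^1 \<le> 4^n" using n by (intro power_increasing) auto
          ultimately show ?thesis by simp
        qed
        ultimately show ?thesis by (rule order.trans[rotated])
      qed
      also have "exp (5::real)^n \<le> exp (2*real n - real n/100 - - 4*real n)"
        unfolding exp_of_nat_mult[symmetric] exp_le_cancel_iff by simp
      finally have "exp (- 4*real n)*(4*20^n) \<le> exp (- 4*real n)*exp (2*real n - real n/100 - - 4*real n)"
        by (rule mult_left_mono) simp
      also have "\<dots> = exp (2*real n - real n/100)" by (simp flip: exp_add)
      finally have h: "exp (- 4*real n)*(4*20^n) \<le> exp (2*real n - real n/100)" .
      have "1/4*(1/5)^n*(K * X/4^n) = K * X/(4*20^n)" for X
        by (simp add: power_divide flip: power_mult_distrib)
      moreover have "exp (- 4*real n) * K*(4*20^n) \<le> K*exp (2*real n - real n/100)"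
        using mult_left_mono[OF h, of K] K by (simp add: mult_ac)
      ultimately show ?thesis by (simp only:) (simp add: pos_le_divide_eq)
    qed
    also have "\<dots> \<le> (1/(4 * sqrt n)*real n)*cmod (y1*(y1 - 1))^n*exp (Re (V y1) + Re (of_nat n * z))"
      by (intro mult_mono power_mono yb q lo) (use K in auto)
    also have "\<dots> \<le> cmod (H z)"
    proof -
      have "(1/(4 * sqrt n)*real n)*c * X = 1/(4 * sqrt n)*(real n*c) * X" for c X
        by (simp only: mult.assoc)
      then show ?thesis unfolding Heq2 by (simp only:) (intro mult_right_mono I(1); simp)
    qed
    finally show ?thesis by (simp add: K_def)
  qed
  show "cmod (H z) \<le> exp (4*real n)*cmod (poly Q 0)"
  proof -
    have "cmod (H z) \<le> 2*(real n*(1/3)^n)*(K*exp (2*real n + real n/100)/4^n)"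
      unfolding Heq2 by (intro mult_mono power_mono yb hi I(2)) auto
    also have "\<dots> \<le> exp (real n)*(K*exp (2*real n + real n/100))"
    proof -
      have "0 \<le> (real n - 1)\<^sup>2" by simp
      then have "2*real n \<le> 1 + real n + (real n)\<^sup>2/2" using n by (simp add: power2_eq_square algebra_simps)
      then have 1: "2*real n \<le> exp (real n)" using exp_lower_Taylor_quadratic[of "real n"] by simp
      have 2: "(1/3)^n*(1/4^n) \<le> (1::real)"
        by (intro mult_le_one) (auto simp: power_le_one)
      have "2*(real n*(1/3)^n)*(K*exp (2*real n + real n/100)/4^n)
          = (2*real n)*((1/3)^n*(1/4^n))*(K*exp (2*real n + real n/100))" by simp
      also have "\<dots> \<le> exp (real n)*1*(K*exp (2*real n + real n/100))"
        using 1 2 K by (intro mult_right_mono mult_mono) auto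
      finally show ?thesis by simp
    qed
    also have "\<dots> = exp (real n + (2*real n + real n/100)) * K" by (simp only: exp_add mult_ac)
    also have "\<dots> \<le> exp (4*real n) * K" using K by (intro mult_right_mono) auto
    finally show ?thesis by (simp add: K_def)
  qed
qed

section \<open>Zero-free solutions\<close>

lemma spline_holomorphic:
  assumes "\<And>j. j < 2*n+1 \<Longrightarrow> cmod (\<zeta> j) \<le> \<delta>" "0 \<le> \<delta>" "\<delta> < R"
  shows "(\<lambda>y. spline n \<zeta> R Q y) holomorphic_on S"
proof -
  have R: "0 < R" using assms by simp
  have c: "continuous_on (sphere 0 R) (\<lambda>s. poly Q s/node_poly n \<zeta> s)"
    by (rule node_quotient_continuous[OF assms(1,3)]) (assumption | intro continuous_intros)+
  have eq: "(\<lambda>y. spline n \<zeta> R Q y) = (\<lambda>y. cmean R (\<lambda>s. poly Q s/node_poly n \<zeta> s*exp (of_nat n * s * y)))"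
    by (simp add: spline_def node_mean_def)
  have "\<exists>D. ((\<lambda>y. spline n \<zeta> R Q y) has_field_derivative D) (at y)" for y
    unfolding eq using cmean_exp_has_field_derivative[OF R c] by blast
  then have "(\<lambda>y. spline n \<zeta> R Q y) holomorphic_on UNIV" by (simp add: holomorphic_on_open)
  then show ?thesis by (rule holomorphic_on_subset) simp
qed

lemma solution_Q_nonzero:
  assumes sol: "solution n \<zeta> P Q H" and \<zeta>: "\<And>j. j < 2*n+1 \<Longrightarrow> cmod (\<zeta> j) \<le> \<delta>" "0 \<le> \<delta>"
  shows "Q \<noteq> 0"
proof
  assume Q: "Q = 0"
  have H0: "H z = 0" for z
  proof -
    have "H z = node_mean n \<zeta> (max (\<delta> + 1) (cmod z + 1)) (\<lambda>s. poly Q s/(s - z)*exp (of_nat n * s))"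
      by (rule solution_remainder_eq[OF sol \<zeta>]) (assumption | simp)+
    then show ?thesis by (simp add: Q node_mean_def cmean_def)
  qed
  have "poly P s = 0" for s using sol H0 Q by (simp add: solution_def)
  then have "P = 0" using poly_all_0_iff_0 by blast
  then show False using sol Q by (simp add: solution_def)
qed

text \<open>Substituting the defining equation into e^(n s y) Q = e^(n s (y - 1)) e^(n s) Q leaves
  the entire function H times an exponential, whose mean is 0, and the spline of P shifted by 1.
  Vanishing at 1 is thereby reduced to vanishing at 0.\<close>

lemma spline_reflect:
  assumes sol: "solution n \<zeta> P Q H"
    and \<zeta>: "\<And>j. j < 2*n+1 \<Longrightarrow> cmod (\<zeta> j) \<le> \<delta>" and \<delta>: "0 \<le> \<delta>" "\<delta> < R"
  shows "spline n \<zeta> R Q y = - spline n \<zeta> R P (y - 1)"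
proof -
  have R: "0 < R" using \<delta> by simp
  have holH: "H holomorphic_on A" for A
    using sol by (auto simp: solution_def intro: holomorphic_on_subset)
  have c1: "continuous_on (sphere 0 R) (\<lambda>s. H s*exp (of_nat n * s*(y - 1)))"
    by (intro continuous_intros holomorphic_on_imp_continuous_on holH)
  have c2: "continuous_on (sphere 0 R) (\<lambda>s. poly P s*exp (of_nat n * s*(y - 1))/node_poly n \<zeta> s)"
    by (rule node_quotient_continuous[OF \<zeta> \<delta>(2)]) (assumption | intro continuous_intros)+
  have "spline n \<zeta> R Q y = cmean R (\<lambda>s. H s*exp (of_nat n * s*(y - 1))
      - poly P s*exp (of_nat n * s*(y - 1))/node_poly n \<zeta> s)"
    unfolding spline_def node_mean_def
  proof (rule cmean_cong[OF R])
    fix s :: complex assume s: "cmod s = R"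
    have nz: "node_poly n \<zeta> s \<noteq> 0" by (rule node_poly_nonzero[OF \<zeta>]) (use s \<delta> in auto)
    have "exp (of_nat n * s)*poly Q s = node_poly n \<zeta> s*H s - poly P s"
      using sol by (simp add: solution_def algebra_simps)
    moreover have "poly Q s*exp (of_nat n * s * y) = exp (of_nat n * s)*poly Q s*exp (of_nat n * s*(y - 1))"
      by (simp add: algebra_simps flip: exp_add)
    ultimately have "poly Q s*exp (of_nat n * s * y) = (node_poly n \<zeta> s*H s - poly P s)*exp (of_nat n * s*(y - 1))"
      by simp
    then show "poly Q s*exp (of_nat n * s * y)/node_poly n \<zeta> s
      = H s*exp (of_nat n * s*(y - 1)) - poly P s*exp (of_nat n * s*(y - 1))/node_poly n \<zeta> s"
      using nz by (simp add: field_simps)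
  qed
  also have "\<dots> = cmean R (\<lambda>s. H s*exp (of_nat n * s*(y - 1))) - spline n \<zeta> R P (y - 1)"
    unfolding spline_def node_mean_def by (rule cmean_diff[OF R c1 c2])
  also have "cmean R (\<lambda>s. H s*exp (of_nat n * s*(y - 1))) = 0"
    by (rule cmean_holomorphic[OF R]) (intro holomorphic_intros holH)
  finally show ?thesis by simp
qed

lemma norm_poly_le_coeff_sum:
  fixes Q :: "complex poly"
  assumes "degree Q \<le> n" "1 \<le> cmod s"
  shows "cmod (poly Q s) \<le> (\<Sum>i\<le>degree Q. cmod (coeff Q i))*cmod s^n"
proof -
  have "cmod (poly Q s) \<le> (\<Sum>i\<le>degree Q. cmod (coeff Q i * s^i))"
    unfolding poly_altdef by (rule norm_sum)
  also have "\<dots> \<le> (\<Sum>i\<le>degree Q. cmod (coeff Q i)*cmod s^n)"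
    using assms by (intro sum_mono) (auto simp: norm_mult norm_power intro!: mult_left_mono power_increasing)
  finally show ?thesis by (simp add: sum_distrib_right)
qed

text \<open>The circle of radius r = 1/|y| keeps the exponential bounded by e^n, while Q contributes
  r^n, the nodes at most (r/2)^(-2n-1) and the length r; altogether |y|^n up to a constant.\<close>

lemma spline_vanishing:
  assumes n: "1 \<le> n" and deg: "degree Q \<le> n"
    and \<zeta>: "\<And>j. j < 2*n+1 \<Longrightarrow> cmod (\<zeta> j) \<le> \<delta>" and \<delta>: "0 \<le> \<delta>" "\<delta> < R"
  shows "\<exists>C. \<forall>y. cmod y \<le> 1/(2 * \<delta> + 1) \<longrightarrow> cmod (spline n \<zeta> R Q y) \<le> C*cmod y^n"
proof -
  define M where "M = (\<Sum>i\<le>degree Q. cmod (coeff Q i))"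
  have "cmod (spline n \<zeta> R Q y) \<le> M*exp (real n)*2^(2*n+1)*cmod y^n"
    if y: "cmod y \<le> 1/(2 * \<delta> + 1)" for y
  proof (cases "y = 0")
    case True
    have "node_mean n \<zeta> R (poly Q) = 0"
      by (rule node_mean_poly_decay[OF \<zeta> \<delta>]) (assumption | use n deg in simp)+
    then show ?thesis using True n by (simp add: spline_def zero_power)
  next
    case False
    define r where "r = 1/cmod y"
    have r: "2 * \<delta> + 1 \<le> r"
    proof -
      have "2 * \<delta> + 1 > 0" using \<delta> by simp
      then show ?thesis using y False by (simp add: r_def field_simps)
    qed
    have r': "1 \<le> r" "\<delta> < r" "r/2 \<le> r - \<delta>" "0 < r" using r \<delta> by auto
    have ry: "r*cmod y = 1" using False by (simp add: r_def)
    have "spline n \<zeta> R Q y = spline n \<zeta> r Q y" by (rule spline_radius[OF \<zeta> \<delta>(1)]) (assumption | rule r' \<delta>)+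
    also have "cmod \<dots> \<le> (M * r^n*exp (real n))/(r - \<delta>)^(2*n+1) * r"
      unfolding spline_def
    proof (rule norm_node_mean_le[OF \<zeta> \<delta>(1) r'(2)])
      show "continuous_on (sphere 0 r) (\<lambda>s. poly Q s*exp (of_nat n * s * y))" by (intro continuous_intros)
      fix s :: complex assume s: "cmod s = r"
      have "cmod (poly Q s) \<le> M * r^n"
        unfolding M_def s[symmetric] by (rule norm_poly_le_coeff_sum[OF deg]) (use s r' in simp)
      moreover have "cmod (exp (of_nat n * s * y)) \<le> exp (real n)"
      proof -
        have "Re (of_nat n * s * y) \<le> cmod (of_nat n * s * y)" by (rule complex_Re_le_cmod)
        also have "\<dots> = real n" using ry by (simp add: norm_mult s mult.assoc)
        finally show ?thesis by simp
      qed
      ultimately show "cmod (poly Q s*exp (of_nat n * s * y)) \<le> M * r^n*exp (real n)"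
        unfolding norm_mult by (intro mult_mono) (auto simp: order.trans[OF norm_ge_zero])
    qed
    also have "\<dots> \<le> (M * r^n*exp (real n))/(r/2)^(2*n+1) * r"
    proof -
      have "0 \<le> M" by (auto simp: M_def intro: sum_nonneg)
      moreover have "(r/2)^(2*n+1) \<le> (r - \<delta>)^(2*n+1)" using r' by (intro power_mono) auto
      moreover have "0 < (r/2)^(2*n+1)" using r' by simp
      ultimately show ?thesis using r' by (intro mult_right_mono divide_left_mono mult_pos_pos) auto
    qed
    also have "\<dots> = M*exp (real n)*2^(2*n+1)*(1/r)^n"
    proof -
      have "(M * a * X)/(a * a * r/T) * r = M * X * T*(1/a)" if "a \<noteq> 0" "T \<noteq> 0" for a T X
        using that r'(4) by (simp add: divide_simps)
      moreover have "(r/2)^(2*n+1) = r^n * r^n * r/2^(2*n+1)"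
      proof -
        have "r^(2*n+1) = r^n * r^n * r" by (simp only: mult_2 power_add power_one_right)
        then show ?thesis by (simp only: power_divide)
      qed
      ultimately show ?thesis using r'(4) by (simp add: power_one_over)
    qed
    also have "1/r = cmod y" by (simp add: r_def)
    finally show ?thesis .
  qed
  then show ?thesis by blast
qed

text \<open>The zero of order n at 0 reflects the degree of Q, the one at 1 the degree of P. The
  list \<open>a\<close> of n zeros and n ones allows the division to be done in one stroke.\<close>

lemma spline_factor_exists:
  assumes n: "1 \<le> n" and sol: "solution n \<zeta> P Q H"
    and \<zeta>: "\<And>j. j < 2*n+1 \<Longrightarrow> cmod (\<zeta> j) \<le> \<delta>" and \<delta>: "0 \<le> \<delta>" "\<delta> < R"
  shows "\<exists>u. u holomorphic_on UNIV \<and> (\<forall>y. spline n \<zeta> R Q y = (y*(y - 1))^n * u y)"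
proof -
  define a where "a = (\<lambda>j. if j < n then 0 else (1::complex))"
  have prod: "(\<Prod>j<2*n. w - a j) = w^n*(w - 1)^n" for w
  proof -
    have "(\<Prod>j<2*n. w - a j) = (\<Prod>j<n. w - a j)*(\<Prod>j=n..<2*n. w - a j)"
      by (subst prod.union_disjoint[symmetric]) (auto simp: ivl_disj_un)
    moreover have "(\<Prod>j<n. w - a j) = w^n" by (simp add: a_def)
    moreover have "(\<Prod>j=n..<2*n. w - a j) = (w - 1)^n" by (simp add: a_def)
    ultimately show ?thesis by simp
  qed
  have d: "0 < 1/(2 * \<delta> + 1)" "1/(2 * \<delta> + 1) \<le> 1" using \<delta> by (auto simp: field_simps)
  define r where "r = min (1/2) (1/(2 * \<delta> + 1))"
  have r: "0 < r" "r \<le> 1/2" "r \<le> 1/(2 * \<delta> + 1)" using d by (auto simp: r_def)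
  have bigo: "(\<lambda>y. spline n \<zeta> R Q y) \<in> O[nhds b](\<lambda>w. \<Prod>j<2*n. w - a j)"
    if b: "b = 0 \<or> b = 1" for b
  proof -
    obtain C where C: "\<And>w. cmod w \<le> 1/(2 * \<delta> + 1) \<Longrightarrow> cmod (spline n \<zeta> R Q (b + w)) \<le> C*cmod w^n"
    proof (cases "b = 0")
      case True
      have "degree Q \<le> n" using sol by (simp add: solution_def)
      then have "\<exists>C. \<forall>y. cmod y \<le> 1/(2 * \<delta> + 1) \<longrightarrow> cmod (spline n \<zeta> R Q y) \<le> C*cmod y^n"
        by (rule spline_vanishing[OF n _ _ \<delta>]) (rule \<zeta>)
      then show ?thesis using that True by auto
    next
      case False
      then have b1: "b = 1" using b by simp
      have degP: "degree P \<le> n" using sol by (simp add: solution_def)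
      obtain C where "\<forall>y. cmod y \<le> 1/(2 * \<delta> + 1) \<longrightarrow> cmod (spline n \<zeta> R P y) \<le> C*cmod y^n"
        using spline_vanishing[OF n degP _ \<delta>] \<zeta> by blast
      then show ?thesis
        using that[of C] spline_reflect[OF sol \<zeta> \<delta>] by (simp add: b1)
    qed
    have "eventually (\<lambda>w. dist w b < r) (nhds b)" using r(1) unfolding eventually_nhds_metric by blast
    then have "eventually (\<lambda>w. cmod (spline n \<zeta> R Q w) \<le> ((\<bar>C\<bar> + 1)*2^n)*cmod (\<Prod>j<2*n. w - a j)) (nhds b)"
    proof eventually_elim
      case (elim w)
      define x where "x = w - b"
      have x: "cmod x < r" "w = b + x" using elim by (auto simp: x_def dist_norm)
      have o: "1/2 \<le> cmod (w - (1 - b))"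
      proof -
        have "w - (1 - b) = x - (1 - 2 * b)" by (simp add: x)
        then have "cmod (w - (1 - b)) = cmod (1 - 2 * b - x)" by (simp only: norm_minus_commute)
        moreover have "cmod (1 - 2 * b) - cmod x \<le> cmod (1 - 2 * b - x)" by (rule norm_triangle_ineq2)
        moreover have "cmod (1 - 2 * b) = 1" using b by auto
        ultimately show ?thesis using x(1) r(2) by linarith
      qed
      have "cmod (spline n \<zeta> R Q w) \<le> C*cmod x^n" unfolding x(2) by (rule C) (use x r in simp)
      also have "\<dots> \<le> (\<bar>C\<bar> + 1)*cmod x^n*1"
        unfolding mult_1_right by (intro mult_right_mono) auto
      also have "\<dots> \<le> (\<bar>C\<bar> + 1)*cmod x^n*(2*cmod (w - (1 - b)))^n"
        using o by (intro mult_left_mono one_le_power) auto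
      also have "\<dots> = ((\<bar>C\<bar> + 1)*2^n)*(cmod (w - b)^n*cmod (w - (1 - b))^n)"
        by (simp add: power_mult_distrib x_def)
      also have "cmod (w - b)^n*cmod (w - (1 - b))^n = cmod (\<Prod>j<2*n. w - a j)"
        using b by (auto simp: prod norm_mult norm_power)
      finally show ?case .
    qed
    then show ?thesis by (rule landau_o.bigI[rotated]) simp
  qed
  show ?thesis
  proof (rule entire_quotient_of_bigo[of "\<lambda>y. spline n \<zeta> R Q y" "2*n" a])
    show "(\<lambda>y. spline n \<zeta> R Q y) holomorphic_on UNIV" by (rule spline_holomorphic[OF _ \<delta>]) (rule \<zeta>)
    show "(\<lambda>y. spline n \<zeta> R Q y) \<in> O[nhds (a j)](\<lambda>w. \<Prod>j<2*n. w - a j)" for j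
      by (rule bigo) (simp add: a_def)
    fix h assume h: "h holomorphic_on UNIV" "\<And>w. spline n \<zeta> R Q w = (\<Prod>j<2*n. w - a j) * h w"
    then show ?thesis by (intro exI[of _ h]) (simp add: prod power_mult_distrib)
  qed
qed

text \<open>\<open>eps0\<close> is the radius of the zero-free disk of Q, \<open>rad0\<close> that
  of u, and \<open>del0\<close> bounds the nodes. For |y| = \<open>rad0\<close> the saddle has
  modulus at most 3/rad0 = mu0 * eps0, and del0 * rad0 = mu0, so both smallness conditions of
  \<open>spline_size\<close> hold with accuracy \<open>mu0\<close>. In turn \<open>mu0\<close> is so
  small that an error of 34 mu0 n in ln |u| and the resulting derivative bounds meet the demands of
  the other two saddle point estimates.\<close>

definition eps0 :: real where "eps0 = 1/100000"
definition mu0 :: real where "mu0 = 1/4000000"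
definition rad0 :: real where "rad0 = 3/(mu0*eps0)"
definition del0 :: real where "del0 = mu0\<^sup>2*eps0/3"

text \<open>The logarithmic condition absorbs the algebraic loss of the saddle point estimate into
  \<open>mu0 * n\<close>; the last one turns the lower and upper bound in
  \<open>poly_zero_free_on_circle\<close> into a contradiction.\<close>

definition large :: "nat \<Rightarrow> bool" where
  "large n \<longleftrightarrow> 1 \<le> n \<and> ln (8 * sqrt n) \<le> mu0*real n \<and> (7/10)^n + 2*(1/2)^n < 1/(4 * sqrt n)"

lemma const_bounds:
  "0 < eps0" "eps0 \<le> 1/100000" "0 < mu0" "mu0 \<le> 1/2000" "0 < rad0" "0 < del0" "del0 \<le> eps0/100"
  "del0 * rad0 = mu0" "3/rad0 = mu0*eps0" "30/eps0 \<le> rad0/2" "3 \<le> rad0/2" "34 * mu0 \<le> 1/100000"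
  "2/rad0 \<le> mu0" "2 < rad0" "del0 < 1/1000"
  by (simp_all add: eps0_def mu0_def rad0_def del0_def power2_eq_square)

lemma del0: "0 \<le> del0" "del0 < 1"
  using const_bounds by linarith+

lemma eventually_large: "eventually large sequentially"
proof -
  have "eventually (\<lambda>n. ln (8 * sqrt (real n)) \<le> mu0*real n) sequentially"
    unfolding mu0_def by real_asymp
  moreover have "eventually (\<lambda>n. (7/10)^n + 2*(1/2)^n < 1/(4 * sqrt (real n))) sequentially"
    by real_asymp
  ultimately show ?thesis using eventually_ge_at_top[of 1]
    unfolding large_def by eventually_elim simp
qed

definition spline_factor :: "nat \<Rightarrow> (nat \<Rightarrow> complex) \<Rightarrow> complex poly \<Rightarrow> (complex \<Rightarrow> complex) \<Rightarrow> bool" where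
  "spline_factor n \<zeta> Q u \<longleftrightarrow> u holomorphic_on UNIV \<and> (\<forall>y. spline n \<zeta> 1 Q y = (y*(y - 1))^n * u y)"

text \<open>On the circle |y| = \<open>rad0\<close> the size of the spline determines ln |u| up to
  34 mu0 n: 32 from \<open>spline_size\<close>, one for \<open>ln (8 * sqrt n)\<close>, one for
  replacing |y - 1| by |y|. The maximum principle for u and 1/u carries the bounds into the disk,
  where u has a holomorphic logarithm.\<close>

lemma spline_factor_log:
  assumes large: "large n" and sol: "solution n \<zeta> P Q H"
    and \<zeta>: "\<And>j. j < 2*n+1 \<Longrightarrow> cmod (\<zeta> j) \<le> del0"
    and Q: "\<And>s. cmod s < eps0 \<Longrightarrow> poly Q s \<noteq> 0"
    and u: "spline_factor n \<zeta> Q u" and unz: "\<And>y. cmod y < rad0 \<Longrightarrow> u y \<noteq> 0"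
  defines "k \<equiv> ln (cmod (poly Q 0)) + 2*real n - 2*real n*ln 2"
  shows "\<And>y. cmod y \<le> rad0 \<Longrightarrow> u y \<noteq> 0"
    "\<exists>v. v holomorphic_on ball 0 rad0 \<and> (\<forall>y\<in>ball 0 rad0. u y = exp (v y) \<and> \<bar>Re (v y) - k\<bar> \<le> 34 * mu0*real n)"
proof -
  note c = const_bounds
  have n: "1 \<le> n" using large by (simp add: large_def)
  have degQ: "degree Q \<le> n" using sol by (simp add: solution_def)
  have holu: "u holomorphic_on A" for A
    using u by (auto simp: spline_factor_def intro: holomorphic_on_subset)
  have Q0: "poly Q 0 \<noteq> 0" using Q[of 0] c by simp
  have sph: "u y \<noteq> 0 \<and> \<bar>ln (cmod (u y)) - k\<bar> \<le> 34 * mu0*real n" if y: "cmod y = rad0" for y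
  proof -
    have y0: "y \<noteq> 0" using y c by auto
    have y1: "y \<noteq> 1" using y c(14) by auto
    have del1: "del0 < 1" using c by linarith
    have s1: "3/cmod y \<le> mu0*eps0" "del0*cmod y \<le> mu0" using y c by auto
    have sp0: "spline n \<zeta> 1 Q y \<noteq> 0"
      and sp: "\<bar>ln (cmod (spline n \<zeta> 1 Q y)) - (ln (cmod (poly Q 0)) + 2*real n*ln (cmod y/2) + 2*real n)\<bar>
       \<le> 32 * mu0*real n + ln (8 * sqrt (real n))"
      using spline_size[OF n degQ c(1) Q c(3,4) _ less_imp_le[OF c(6)] del1 s1 y0] \<zeta> by blast+
    have eq: "spline n \<zeta> 1 Q y = (y*(y - 1))^n * u y" using u by (simp add: spline_factor_def)
    then have u0: "u y \<noteq> 0" using sp0 by auto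
    have "ln (cmod (spline n \<zeta> 1 Q y)) = real n*(ln (cmod y) + ln (cmod (y - 1))) + ln (cmod (u y))"
      unfolding eq norm_mult norm_power using y0 y1 u0 by (simp add: ln_mult ln_realpow)
    moreover have "\<bar>ln (cmod (y - 1)) - ln (cmod y)\<bar> \<le> mu0"
    proof -
      have "cmod (- (1/y)) = 1/rad0" using y by (simp add: norm_divide)
      moreover have "1/rad0 < 1/2" using c(14) by (simp add: field_simps)
      ultimately have "\<bar>ln (cmod (1 + - (1/y)))\<bar> \<le> 2*(1/rad0)"
        using abs_ln_cmod_one_plus_le[of "- (1/y)"] by simp
      moreover have "1 + - (1/y) = (y - 1)/y" using y0 by (simp add: field_simps)
      then have "ln (cmod (1 + - (1/y))) = ln (cmod (y - 1)) - ln (cmod y)"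
        using y0 y1 by (simp add: norm_divide ln_div)
      ultimately show ?thesis using c(13) by simp
    qed
    then have "\<bar>real n*(ln (cmod (y - 1)) - ln (cmod y))\<bar> \<le> real n * mu0"
      unfolding abs_mult by (intro mult_mono) auto
    moreover have "ln (8 * sqrt (real n)) \<le> mu0*real n" using large by (simp add: large_def)
    moreover have lny: "ln (cmod y/2) = ln (cmod y) - ln 2" using y0 by (simp add: ln_div)
    ultimately have "\<bar>ln (cmod (u y)) - k\<bar> \<le> 34 * mu0*real n"
      using sp[unfolded lny] unfolding k_def by (simp add: algebra_simps abs_le_iff)
    then show ?thesis using u0 by simp
  qed
  show nz: "u y \<noteq> 0" if "cmod y \<le> rad0" for y
    using that sph[of y] unz[of y] by (cases "cmod y = rad0") auto
  have fr: "interior (cball (0::complex) rad0) = ball 0 rad0" "frontier (cball (0::complex) rad0) = sphere 0 rad0"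
    by auto
  have up: "cmod (u y) \<le> exp (k + 34 * mu0*real n)" if "cmod y \<le> rad0" for y
  proof (rule maximum_modulus_frontier[of u "cball 0 rad0"])
    fix z :: complex assume "z \<in> frontier (cball 0 rad0)"
    then have "cmod z = rad0" by (simp add: fr)
    from sph[OF this] have "ln (cmod (u z)) \<le> k + 34 * mu0*real n" "u z \<noteq> 0" by (auto simp: abs_le_iff)
    then show "cmod (u z) \<le> exp (k + 34 * mu0*real n)" by (metis exp_le_cancel_iff exp_ln zero_less_norm_iff)
  qed (use that holu in \<open>auto intro: holomorphic_on_imp_continuous_on\<close>)
  have lo: "cmod (1/u y) \<le> exp (- (k - 34 * mu0*real n))" if "cmod y \<le> rad0" for y
  proof (rule maximum_modulus_frontier[of "\<lambda>y. 1/u y" "cball 0 rad0"])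
    fix z :: complex assume "z \<in> frontier (cball 0 rad0)"
    then have "cmod z = rad0" by (simp add: fr)
    from sph[OF this] have "k - 34 * mu0*real n \<le> ln (cmod (u z))" "u z \<noteq> 0" by (auto simp: abs_le_iff)
    then have "exp (k - 34 * mu0*real n) \<le> cmod (u z)" by (metis exp_le_cancel_iff exp_ln zero_less_norm_iff)
    then have "1/cmod (u z) \<le> 1/exp (k - 34 * mu0*real n)" by (intro frac_le) auto
    then show "cmod (1/u z) \<le> exp (- (k - 34 * mu0*real n))"
      by (simp only: norm_divide norm_one exp_minus inverse_eq_divide)
  next
    have h: "(\<lambda>y. 1/u y) holomorphic_on cball 0 rad0" using nz by (intro holomorphic_intros holu) auto
    then show "(\<lambda>y. 1/u y) holomorphic_on interior (cball 0 rad0)"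
      by (rule holomorphic_on_subset) (rule interior_subset)
    show "continuous_on (closure (cball 0 rad0)) (\<lambda>y. 1/u y)"
      using holomorphic_on_imp_continuous_on[OF h] by simp
  qed (use that in auto)
  have "contractible (ball (0::complex) rad0)" by (intro convex_imp_contractible convex_ball)
  then obtain v where v: "v holomorphic_on ball 0 rad0" "\<And>y. y \<in> ball 0 rad0 \<Longrightarrow> u y = exp (v y)"
    using contractible_imp_holomorphic_log[of u "ball 0 rad0"] holu nz by (auto simp: less_imp_le)
  have "\<bar>Re (v y) - k\<bar> \<le> 34 * mu0*real n" if "y \<in> ball 0 rad0" for y
  proof -
    have y: "cmod y \<le> rad0" using that by simp
    have "Re (v y) \<le> k + 34 * mu0*real n" using up[OF y] v(2)[OF that] by simp
    moreover have "exp (- Re (v y)) \<le> exp (- (k - 34 * mu0*real n))"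
      using lo[OF y] v(2)[OF that] by (simp add: norm_divide exp_minus inverse_eq_divide)
    ultimately show ?thesis by (simp add: abs_le_iff)
  qed
  then show "\<exists>v. v holomorphic_on ball 0 rad0 \<and> (\<forall>y\<in>ball 0 rad0. u y = exp (v y) \<and> \<bar>Re (v y) - k\<bar> \<le> 34 * mu0*real n)"
    using v by blast
qed

text \<open>The bootstrap step: open disks in the hypotheses, closed disks of the same radii in the
  conclusions. The derivatives of ln u gain powers of 1/rad0 = mu0 * eps0/3, and so come with the
  powers of \<open>eps0\<close> that the saddle point on |s| = \<open>eps0\<close> requires.\<close>

lemma zero_free_improve:
  assumes large: "large n" and sol: "solution n \<zeta> P Q H"
    and \<zeta>: "\<And>j. j < 2*n+1 \<Longrightarrow> cmod (\<zeta> j) \<le> del0"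
    and Q: "\<And>s. cmod s < eps0 \<Longrightarrow> poly Q s \<noteq> 0"
    and u: "spline_factor n \<zeta> Q u" and unz: "\<And>y. cmod y < rad0 \<Longrightarrow> u y \<noteq> 0"
  shows "\<And>s. cmod s \<le> eps0 \<Longrightarrow> poly Q s \<noteq> 0"
    "\<And>y. cmod y \<le> rad0 \<Longrightarrow> u y \<noteq> 0"
    "\<And>z. cmod z \<le> 1/1000 \<Longrightarrow> exp (- 4*real n)*cmod (poly Q 0) \<le> cmod (H z)
       \<and> cmod (H z) \<le> exp (4*real n)*cmod (poly Q 0)"
proof -
  note c = const_bounds
  have n: "1 \<le> n" and large2: "(7/10)^n + 2*(1/2)^n < 1/(4 * sqrt n)"
    using large by (auto simp: large_def)
  have degQ: "degree Q \<le> n" using sol by (simp add: solution_def)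
  have Q0: "poly Q 0 \<noteq> 0" using Q[of 0] c by simp
  define k where "k = ln (cmod (poly Q 0)) + 2*real n - 2*real n*ln 2"
  show "u y \<noteq> 0" if "cmod y \<le> rad0" for y
    by (rule spline_factor_log(1)[OF large sol \<zeta> Q u unz that])
  have "\<exists>v. v holomorphic_on ball 0 rad0 \<and> (\<forall>y\<in>ball 0 rad0. u y = exp (v y) \<and> \<bar>Re (v y) - k\<bar> \<le> 34 * mu0*real n)"
    unfolding k_def by (rule spline_factor_log(2)[OF large sol \<zeta> Q u unz])
  then obtain v where v: "v holomorphic_on ball 0 rad0" "\<And>y. cmod y < rad0 \<Longrightarrow> u y = exp (v y)"
    "\<And>y. cmod y < rad0 \<Longrightarrow> \<bar>Re (v y) - k\<bar> \<le> 34 * mu0*real n"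
    by auto
  have B: "0 < 34 * mu0*real n" using n c by simp
  note d = deriv_bounds_of_Re_bound[OF v(1) c(5) B v(3)]
  have r: "30/eps0 < rad0" "3 < rad0" using c by linarith+
  have sp: "spline n \<zeta> 1 Q y = (y*(y - 1))^n*exp (v y)" if "cmod y < rad0" for y
    using u v(2)[OF that] by (simp add: spline_factor_def)
  have b0: "\<bar>Re (v y) - k\<bar> \<le> 1/100000*real n" if "cmod y < rad0" for y
    using v(3)[OF that] mult_right_mono[OF c(12), of "real n"] by simp
  have b1: "cmod (deriv v y) \<le> 1/100000*real n*eps0" if "cmod y \<le> rad0/2" for y
  proof -
    have "72*(34 * mu0*real n)/rad0 = (72*34 * mu0 * mu0/3)*(real n*eps0)"
      using c by (simp add: rad0_def)
    also have "\<dots> \<le> 1/100000*(real n*eps0)"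
      using c by (intro mult_right_mono) (auto simp: mu0_def)
    finally show ?thesis using d(1)[OF _ that] by simp
  qed
  have b2: "cmod (deriv (deriv v) y) \<le> 1/100000*real n*eps0\<^sup>2" if "cmod y \<le> rad0/2" for y
  proof -
    have "576*(34 * mu0*real n)/rad0\<^sup>2 = (576*34 * mu0 * mu0\<^sup>2/9)*(real n*eps0\<^sup>2)"
      using c by (simp add: rad0_def power_divide power_mult_distrib)
    also have "\<dots> \<le> 1/100000*(real n*eps0\<^sup>2)"
      using c by (intro mult_right_mono) (auto simp: mu0_def power_divide)
    finally show ?thesis using d(2)[OF _ that] by simp
  qed
  show "poly Q s \<noteq> 0" if s: "cmod s \<le> eps0" for s
  proof (cases "cmod s = eps0")
    case True
    show ?thesis
    proof (rule poly_zero_free_on_circle[OF n degQ c(1,2) large2 Q, where \<zeta> = \<zeta> and \<delta> = del0 and R = 1 and \<nu> = "1/100000" and v = v])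
      show "v holomorphic_on ball 0 (30/eps0)"
        by (rule holomorphic_on_subset[OF v(1)]) (use r in auto)
      fix y :: complex assume y: "cmod y < 30/eps0"
      then have y': "cmod y < rad0" "cmod y \<le> rad0/2" using r c by linarith+
      show "spline n \<zeta> 1 Q y = (y*(y - 1))^n*exp (v y)" by (rule sp[OF y'(1)])
      show "\<bar>Re (v y) - (ln (cmod (poly Q 0)) + 2*real n - 2*real n*ln 2)\<bar> \<le> 1/100000*real n"
        using b0[OF y'(1)] by (simp add: k_def)
      show "cmod (deriv v y) \<le> 1/100000*real n*eps0" by (rule b1[OF y'(2)])
      show "cmod (deriv (deriv v) y) \<le> 1/100000*real n*eps0\<^sup>2" by (rule b2[OF y'(2)])
    qed (use \<zeta> c True in auto)
  qed (use s Q in auto)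
  have eps1: "eps0 \<le> 1" "eps0\<^sup>2 \<le> 1" using c by (auto simp: eps0_def power_divide)
  have rs: "exp (- 4*real n)*cmod (poly Q 0) \<le> cmod (H z)"
      "cmod (H z) \<le> exp (4*real n)*cmod (poly Q 0)" if z: "cmod z \<le> 1/1000" for z
  proof -
    have z1: "cmod z < 1" using z by simp
    have vh: "v holomorphic_on ball 0 3" by (rule holomorphic_on_subset[OF v(1)]) (use r in auto)
    have y': "cmod y < rad0" "cmod y \<le> rad0/2" if "cmod y < 3" for y :: complex using that r c by linarith+
    have d1: "del0 < 1" "0 \<le> del0" using c by linarith+
    have sp3: "spline n \<zeta> 1 Q y = (y*(y - 1))^n*exp (v y)" if "cmod y < 3" for y
      by (rule sp[OF y'(1)[OF that]])
    have c0: "\<bar>Re (v y) - (ln (cmod (poly Q 0)) + 2*real n - 2*real n*ln 2)\<bar> \<le> 1/100000*real n"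
      if "cmod y < 3" for y
      using b0[OF y'(1)[OF that]] by (simp add: k_def)
    have c1: "cmod (deriv v y) \<le> 1/100000*real n" if "cmod y < 3" for y
      using b1[OF y'(2)[OF that]] mult_left_mono[OF eps1(1), of "1/100000*real n"] by simp
    have c2: "cmod (deriv (deriv v) y) \<le> 1/100000*real n" if "cmod y < 3" for y
      using b2[OF y'(2)[OF that]] mult_left_mono[OF eps1(2), of "1/100000*real n"] by simp
    show "exp (- 4*real n)*cmod (poly Q 0) \<le> cmod (H z)"
      by (rule remainder_size(1)[OF n sol Q0 \<zeta> d1(2,1) z z1 _ _ vh sp3 c0 c1 c2]) auto
    show "cmod (H z) \<le> exp (4*real n)*cmod (poly Q 0)"
      by (rule remainder_size(2)[OF n sol Q0 \<zeta> d1(2,1) z z1 _ _ vh sp3 c0 c1 c2]) auto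
  qed
  then show "exp (- 4*real n)*cmod (poly Q 0) \<le> cmod (H z)
       \<and> cmod (H z) \<le> exp (4*real n)*cmod (poly Q 0)" if "cmod z \<le> 1/1000" for z
    using that by blast
qed

lemma zero_nodes_spline:
  assumes n: "1 \<le> n" and deg: "degree Q \<le> n"
  shows "spline n (\<lambda>_. 0) 1 Q y = (\<Sum>k\<le>n. coeff Q k*(of_nat n * y)^(2*n - k)/fact (2*n - k))"
proof -
  have np: "node_poly n (\<lambda>_. 0) s = s^(2*n+1)" for s by (simp add: node_poly_def)
  have "spline n (\<lambda>_. 0) 1 Q y = cmean 1 (\<lambda>s. \<Sum>k\<le>n. coeff Q k*(exp (of_nat n * y * s)/s^Suc (2*n - k)))"
    unfolding spline_def node_mean_def
  proof (rule cmean_cong)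
    fix s :: complex assume "cmod s = 1"
    then have s: "s \<noteq> 0" by auto
    have "poly Q s = (\<Sum>k\<le>n. coeff Q k * s^k)"
      unfolding poly_altdef using deg
      by (intro sum.mono_neutral_left) (auto simp: coeff_eq_0)
    moreover have "s^k/s^(2*n+1) = 1/s^Suc (2*n - k)" if "k \<le> n" for k
    proof -
      have "s^(2*n+1) = s^k * s^Suc (2*n - k)" using that by (simp flip: power_add)
      then show ?thesis using s by (simp only: divide_divide_eq_left[symmetric]) simp
    qed
    then have "coeff Q k * s^k*exp (of_nat n * s * y)/s^(2*n+1)
       = coeff Q k*(exp (of_nat n * y * s)/s^Suc (2*n - k))" if "k \<le> n" for k
    proof -
      have "c * a * X/d = c*(X * b)" if "a/d = b" for a b c X d :: complex
        using that by (metis mult.commute mult.left_commute times_divide_eq_right)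
      from this[OF \<open>k \<le> n \<Longrightarrow> s^k/s^(2*n+1) = 1/s^Suc (2*n - k)\<close>[OF that]]
      show ?thesis by (simp only: times_divide_eq_right mult_1_right mult.assoc mult.commute[of s y])
    qed
    ultimately show "poly Q s*exp (of_nat n * s * y)/node_poly n (\<lambda>_. 0) s
      = (\<Sum>k\<le>n. coeff Q k*(exp (of_nat n * y * s)/s^Suc (2*n - k)))"
      unfolding np by (simp only: sum_distrib_right sum_divide_distrib) (intro sum.cong; simp)
  qed simp
  also have "\<dots> = (\<Sum>k\<le>n. cmean 1 (\<lambda>s. coeff Q k*(exp (of_nat n * y * s)/s^Suc (2*n - k))))"
  proof (rule cmean_sum)
    fix k
    have "\<forall>s\<in>sphere 0 (1::real). s^Suc (2*n - k) \<noteq> (0::complex)" by auto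
    then show "continuous_on (sphere 0 1) (\<lambda>s. coeff Q k*(exp (of_nat n * y * s)/s^Suc (2*n - k)))"
      by (intro continuous_intros)
  qed auto
  also have "\<dots> = (\<Sum>k\<le>n. coeff Q k*(of_nat n * y)^(2*n - k)/fact (2*n - k))"
  proof (rule sum.cong[OF refl])
    fix k
    have "\<forall>s\<in>sphere 0 (1::real). s^Suc (2*n - k) \<noteq> (0::complex)" by auto
    then have "continuous_on (sphere 0 1) (\<lambda>s. exp (of_nat n * y * s)/s^Suc (2*n - k))"
      by (intro continuous_intros)
    then have "cmean 1 (\<lambda>s. coeff Q k*(exp (of_nat n * y * s)/s^Suc (2*n - k)))
        = coeff Q k * cmean 1 (\<lambda>s. exp (of_nat n * y * s)/s^Suc (2*n - k))"
      by (intro cmean_cmult) simp_all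
    then show "cmean 1 (\<lambda>s. coeff Q k*(exp (of_nat n * y * s)/s^Suc (2*n - k)))
       = coeff Q k*(of_nat n * y)^(2*n - k)/fact (2*n - k)"
      unfolding cmean_exp_power[OF zero_less_one] by simp
  qed
  finally show ?thesis .
qed

text \<open>For vanishing nodes the spline is a polynomial of degree at most 2 n, so u is bounded at
  infinity and Liouville's theorem makes it constant; the coefficient of y^(2n) identifies the
  constant. If it were 0, all coefficients of Q would vanish.\<close>

lemma zero_nodes_factor:
  assumes n: "1 \<le> n" and sol: "solution n (\<lambda>_. 0) P Q H" and u: "spline_factor n (\<lambda>_. 0) Q u"
  defines "a \<equiv> poly Q 0 * of_nat n^(2*n)/fact (2*n)"
  shows "a \<noteq> 0" "u y = a"
proof -
  have deg: "degree Q \<le> n" using sol by (simp add: solution_def)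
  have Qnz: "Q \<noteq> 0" by (rule solution_Q_nonzero[OF sol, of 0]) auto
  define S where "S = (\<Sum>k\<le>n. monom (coeff Q k * of_nat n^(2*n - k)/fact (2*n - k)) (2*n - k))"
  have S: "poly S y = spline n (\<lambda>_. 0) 1 Q y" for y
    unfolding zero_nodes_spline[OF n deg] S_def
    by (simp add: poly_sum poly_monom power_mult_distrib mult_ac)
  have cS: "coeff S (2*n - k) = coeff Q k * of_nat n^(2*n - k)/fact (2*n - k)" if "k \<le> n" for k
  proof -
    have "coeff S (2*n - k) = (\<Sum>j\<le>n. if j = k then coeff Q j * of_nat n^(2*n - j)/fact (2*n - j) else 0)"
      unfolding S_def coeff_sum using that by (intro sum.cong refl) auto
    then show ?thesis using that by (simp add: sum.delta)
  qed
  have dS: "degree S \<le> 2*n"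
    unfolding S_def by (intro degree_sum_le) (auto intro: order.trans[OF degree_monom_le])
  have holu: "u holomorphic_on UNIV" and us: "\<And>y. poly S y = (y*(y - 1))^n * u y"
    using u S by (auto simp: spline_factor_def)
  have "bounded (range u)"
  proof -
    have "bounded (u ` cball 0 2)"
      by (intro compact_imp_bounded compact_continuous_image holomorphic_on_imp_continuous_on
            holomorphic_on_subset[OF holu]) auto
    then obtain B1 where "\<forall>x\<in>u ` cball 0 2. cmod x \<le> B1" unfolding bounded_iff by blast
    then have B1: "cmod (u y) \<le> B1" if "cmod y \<le> 2" for y using that by (metis image_eqI mem_cball_0)
    define M where "M = (\<Sum>i\<le>degree S. cmod (coeff S i))"
    have M: "0 \<le> M" by (auto simp: M_def intro: sum_nonneg)
    have "cmod (u y) \<le> M*2^n" if y: "2 \<le> cmod y" for y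
    proof -
      have "cmod y/2 \<le> cmod (y - 1)" using norm_triangle_ineq2[of y 1] y by simp
      then have "(cmod y*(cmod y/2))^n \<le> (cmod y*cmod (y - 1))^n"
        by (intro power_mono mult_left_mono) auto
      moreover have "(cmod y*cmod (y - 1))^n*cmod (u y) = cmod (poly S y)"
        by (simp only: us norm_mult norm_power)
      moreover have "cmod (poly S y) \<le> M*cmod y^(2*n)"
        unfolding M_def by (rule norm_poly_le_coeff_sum[OF dS]) (use y in simp)
      ultimately have "(cmod y*(cmod y/2))^n*cmod (u y) \<le> M*cmod y^(2*n)"
        using mult_right_mono[of _ _ "cmod (u y)"] by (smt (verit) norm_ge_zero)
      moreover have "(cmod y*(cmod y/2))^n = cmod y^(2*n)/2^n"
        by (simp add: power_mult power_divide power2_eq_square)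
      ultimately have "cmod y^(2*n)*cmod (u y) \<le> cmod y^(2*n)*(M*2^n)"
        by (simp add: field_simps)
      moreover have "0 < cmod y^(2*n)" using y by (intro zero_less_power) linarith
      ultimately show ?thesis by (simp only: mult_le_cancel_left_pos)
    qed
    then have "cmod (u y) \<le> max B1 (M*2^n)" for y
      using B1[of y] by (cases "cmod y \<le> 2") (auto simp: le_max_iff_disj)
    then show ?thesis unfolding bounded_iff by blast
  qed
  then have "u constant_on UNIV" by (rule Liouville_theorem[OF holu])
  then obtain c where c: "\<And>y. u y = c" unfolding constant_on_def by auto
  have "poly S y = poly ([:0, - 1, 1:]^n * [:c:]) y" for y
    unfolding us c by (simp add: poly_power algebra_simps)
  then have Seq: "S = [:0, - 1, 1:]^n * [:c:]" unfolding poly_eq_poly_eq_iff[symmetric] by blast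
  have "coeff ([:0, - 1, 1:]^n :: complex poly) (2*n) = 1"
  proof -
    have "degree ([:0, - 1, 1:]^n :: complex poly) = 2*n" by (subst degree_power_eq) auto
    moreover have "lead_coeff ([:0, - 1, 1:]^n :: complex poly) = 1" by (subst lead_coeff_power) simp
    ultimately show ?thesis by simp
  qed
  then have "coeff S (2*n) = c" unfolding Seq by simp
  then have ck: "c = a" using cS[of 0] by (simp add: a_def poly_0_coeff_0)
  then show "u y = a" using c by simp
  show "a \<noteq> 0"
  proof
    assume "a = 0"
    then have S0: "S = 0" using Seq ck by simp
    have "coeff Q k = 0" if "k \<le> n" for k
      using cS[OF that] n unfolding S0 by (simp add: power_0_left split: if_splits)
    then have "coeff Q k = 0" for k using deg by (cases "k \<le> n") (auto simp: coeff_eq_0)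
    then have "Q = 0" by (intro poly_eqI) simp
    then show False using Qnz by simp
  qed
qed

text \<open>Since ln u is constant, the hypotheses on \<open>v\<close> hold for every radius. Taking
  for the radius the smallest modulus \<open>e\<close> of a root of Q, the open disk is zero-free by
  minimality, and \<open>poly_zero_free_on_circle\<close> excludes the root on its boundary.
  Stirling's bounds show that the constant has the required size.\<close>

lemma zero_nodes_zero_free:
  assumes large: "large n" and sol: "solution n (\<lambda>_. 0) P Q H" and s: "cmod s \<le> eps0"
  shows "poly Q s \<noteq> 0"
proof
  assume root: "poly Q s = 0"
  note c = const_bounds
  have n: "1 \<le> n" and large2: "(7/10)^n + 2*(1/2)^n < 1/(4 * sqrt n)"
    and large1: "ln (8 * sqrt n) \<le> mu0*real n"
    using large by (auto simp: large_def)
  have degQ: "degree Q \<le> n" using sol by (simp add: solution_def)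
  have Qnz: "Q \<noteq> 0" by (rule solution_Q_nonzero[OF sol, of 0]) auto
  have "\<exists>u. u holomorphic_on UNIV \<and> (\<forall>y. spline n (\<lambda>_. 0) 1 Q y = (y*(y - 1))^n * u y)"
    by (rule spline_factor_exists[OF n sol, of 0]) auto
  then obtain u where u: "spline_factor n (\<lambda>_. 0) Q u" by (auto simp: spline_factor_def)
  define k where "k = poly Q 0 * of_nat n^(2*n)/fact (2*n)"
  have k: "k \<noteq> 0" "\<And>y. u y = k"
    using zero_nodes_factor[OF n sol u] by (simp_all add: k_def)
  have Q0: "poly Q 0 \<noteq> 0" using k by (auto simp: k_def)
  define Z where "Z = cmod ` {x. poly Q x = 0}"
  have Z: "finite Z" "cmod s \<in> Z" using poly_roots_finite[OF Qnz] root by (auto simp: Z_def)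
  define e where "e = Min Z"
  have "e \<in> Z" unfolding e_def using Z by (intro Min_in) auto
  then obtain w where w: "poly Q w = 0" "cmod w = e" by (auto simp: Z_def)
  have e1: "e \<le> eps0" using Min_le[OF Z] s by (simp add: e_def)
  have e0: "0 < e" using w Q0 by (metis norm_eq_zero order_le_less norm_ge_zero)
  have lnk: "\<bar>Re (Ln k) - (ln (cmod (poly Q 0)) + 2*real n - 2*real n*ln 2)\<bar> \<le> 1/100000*real n"
  proof -
    have "cmod k = cmod (poly Q 0)*real n^(2*n)/fact (2*n)"
      by (simp add: k_def norm_mult norm_divide norm_power)
    then have "Re (Ln k) = ln (cmod (poly Q 0)) + real (2*n)*ln (real n) - ln (fact (2*n))"
      using k Q0 n by (simp add: ln_mult ln_div ln_realpow)
    moreover have "ln (fact (2*n)) = stirling_rest (2*n) - real (2*n) + (real (2*n) + 1/2)*ln (real (2*n))"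
      by (simp add: stirling_rest_def)
    moreover have "ln (real (2*n)) = ln 2 + ln (real n)" using n by (simp add: ln_mult)
    ultimately have "Re (Ln k) - (ln (cmod (poly Q 0)) + 2*real n - 2*real n*ln 2)
        = - stirling_rest (2*n) - (ln 2 + ln (real n))/2"
      by (simp add: algebra_simps)
    moreover have "0 \<le> stirling_rest (2*n)" "stirling_rest (2*n) \<le> 1"
      using n by (intro stirling_rest_nonneg stirling_rest_le_1; simp)+
    moreover have "0 \<le> ln (real n)" using n by simp
    moreover have "1 + (ln 2 + ln (real n))/2 \<le> ln (8 * sqrt n)"
    proof -
      have "ln (8 * sqrt n) = 3*ln 2 + ln (real n)/2"
      proof -
        have "ln (8::real) = ln (2^3)" by simp
        also have "\<dots> = 3*ln 2" by (subst ln_realpow) auto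
        finally show ?thesis using n by (simp add: ln_mult ln_sqrt)
      qed
      moreover have "2/3 \<le> ln (2::real)" using ln2_ge_two_thirds by simp
      ultimately show ?thesis by (simp add: add_divide_distrib)
    qed
    moreover have "mu0*real n \<le> 1/100000*real n" using c by (intro mult_right_mono) (auto simp: mu0_def)
    moreover have "0 \<le> ln (2::real)" by simp
    moreover have "\<bar>x\<bar> \<le> t"
      if "x = - s - (a + b)/2" "0 \<le> s" "s \<le> 1" "0 \<le> b" "1 + (a + b)/2 \<le> g" "m \<le> t" "0 \<le> a" "g \<le> m"
      for x s a b g m t :: real
    proof -
      have "0 \<le> s + (a + b)/2" using that by simp
      moreover have "s + (a + b)/2 \<le> t" using that by linarith
      ultimately show ?thesis using that(1) by linarith
    qed
    ultimately show ?thesis using large1 by blast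
  qed
  have "poly Q w \<noteq> 0"
  proof (rule poly_zero_free_on_circle[OF n degQ e0 _ large2, where \<zeta> = "\<lambda>_. 0" and \<delta> = 0 and R = 1
        and \<nu> = "1/100000" and v = "\<lambda>_. Ln k"])
    show "poly Q x \<noteq> 0" if "cmod x < e" for x
      using Min_le[OF Z(1), of "cmod x"] that by (auto simp: Z_def e_def)
    show "spline n (\<lambda>_. 0) 1 Q y = (y*(y - 1))^n*exp (Ln k)" for y
      using u k by (simp add: spline_factor_def)
  qed (use c e0 e1 w lnk in auto)
  then show False using w by simp
qed

section \<open>Linear systems and moments\<close>

text \<open>Gaussian elimination with analytic entries: a pivot that is nonzero at t0 stays nonzero
  nearby, and elimination preserves both analyticity and the triviality of the kernel at t0.\<close>

lemma analytic_linear_solve: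
  fixes A :: "nat \<Rightarrow> nat \<Rightarrow> complex \<Rightarrow> complex" and b :: "nat \<Rightarrow> complex \<Rightarrow> complex"
  assumes "\<And>i j. i < N \<Longrightarrow> j < N \<Longrightarrow> A i j analytic_on {t0}" "\<And>i. i < N \<Longrightarrow> b i analytic_on {t0}"
    and "\<And>x. (\<forall>i<N. (\<Sum>j<N. A i j t0 * x j) = 0) \<Longrightarrow> \<forall>j<N. x j = 0"
  shows "\<exists>x. (\<forall>j<N. x j analytic_on {t0}) \<and>
    (\<forall>\<^sub>F t in nhds t0. \<forall>i<N. (\<Sum>j<N. A i j t * x j t) = b i t)"
  using assms
proof (induction N arbitrary: A b)
  case 0
  then show ?case by simp
next
  case (Suc N)
  have "\<exists>p<Suc N. A p N t0 \<noteq> 0"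
  proof (rule ccontr)
    assume "\<not> (\<exists>p<Suc N. A p N t0 \<noteq> 0)"
    then have z: "A i N t0 = 0" if "i < Suc N" for i using that by blast
    have "\<forall>j<Suc N. (if j = N then 1 else 0) = (0::complex)"
      by (rule Suc.prems(3)) (use z in \<open>auto intro!: sum.neutral\<close>)
    then show False by (auto split: if_splits)
  qed
  then obtain p where p: "p < Suc N" "A p N t0 \<noteq> 0" by blast
  \<comment> \<open>Enumerates the rows other than the pivot row p by the indices below N.\<close>
  define r where "r = (\<lambda>i. if i = p then N else i)"
  have r: "r i < Suc N" "r i \<noteq> p" if "i < N" for i using that p by (auto simp: r_def)
  have rcover: "i = p \<or> (\<exists>i'<N. i = r i')" if i: "i < Suc N" for i
  proof (cases "i = N")
    case True
    then show ?thesis using p by (cases "p = N") (auto simp: r_def intro!: exI[of _ p])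
  next
    case False
    then show ?thesis using i by (cases "i = p") (auto simp: r_def intro!: exI[of _ i])
  qed
  define l where "l = (\<lambda>i t. A (r i) N t/A p N t)"
  define A' where "A' = (\<lambda>i j t. A (r i) j t - l i t * A p j t)"
  define b' where "b' = (\<lambda>i t. b (r i) t - l i t * b p t)"
  have l: "l i analytic_on {t0}" if "i < N" for i
    unfolding l_def using r[OF that] p by (intro analytic_on_divide Suc.prems) auto
  have ex: "\<exists>x. (\<forall>j<N. x j analytic_on {t0}) \<and>
    (\<forall>\<^sub>F t in nhds t0. \<forall>i<N. (\<Sum>j<N. A' i j t * x j t) = b' i t)"
  proof (rule Suc.IH)
    show "A' i j analytic_on {t0}" if "i < N" "j < N" for i j
      unfolding A'_def using r[OF that(1)] that p by (intro analytic_intros l Suc.prems) auto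
    show "b' i analytic_on {t0}" if "i < N" for i
      unfolding b'_def using r[OF that(1)] that p by (intro analytic_intros l Suc.prems) auto
    fix x assume x: "\<forall>i<N. (\<Sum>j<N. A' i j t0 * x j) = 0"
    define y where "y = x(N := - (\<Sum>j<N. A p j t0 * x j)/A p N t0)"
    have yp: "(\<Sum>j<Suc N. A p j t0 * y j) = 0"
      using p by (simp add: y_def)
    have "(\<Sum>j<Suc N. A i j t0 * y j) = 0" if i: "i < Suc N" for i
      using rcover[OF i]
    proof
      assume "\<exists>i'<N. i = r i'"
      then obtain i' where i': "i' < N" "i = r i'" by blast
      have "(\<Sum>j<Suc N. A i j t0 * y j) - l i' t0*(\<Sum>j<Suc N. A p j t0 * y j)
          = (\<Sum>j<Suc N. (A i j t0 - l i' t0 * A p j t0) * y j)"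
        by (simp only: sum_subtractf left_diff_distrib sum_distrib_left mult.assoc)
      also have "\<dots> = (\<Sum>j<N. A' i' j t0 * x j)"
        using p by (simp add: i' A'_def y_def l_def)
      also have "\<dots> = 0" using x i' by blast
      finally show ?thesis using yp by simp
    qed (use yp in simp)
    then have z: "\<forall>i<Suc N. (\<Sum>j<Suc N. A i j t0 * y j) = 0" by iprover
    have "\<forall>j<Suc N. y j = 0" by (rule Suc.prems(3)[OF z])
    then have z: "y j = 0" if "j < N" for j using that less_SucI by iprover
    show "\<forall>j<N. x j = 0"
    proof (intro allI impI)
      fix j assume j: "j < N"
      then show "x j = 0" using z[OF j] unfolding y_def by simp
    qed
  qed
  then obtain x where x: "\<And>j. j < N \<Longrightarrow> x j analytic_on {t0}"
    "\<forall>\<^sub>F t in nhds t0. \<forall>i<N. (\<Sum>j<N. A' i j t * x j t) = b' i t" by blast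
  define y where "y = x(N := (\<lambda>t. (b p t - (\<Sum>j<N. A p j t * x j t))/A p N t))"
  have "y j analytic_on {t0}" if "j < Suc N" for j
  proof (cases "j = N")
    case True
    have "(\<lambda>t. (b p t - (\<Sum>j<N. A p j t * x j t))/A p N t) analytic_on {t0}"
      using p by (intro analytic_intros Suc.prems x) auto
    then show ?thesis using True by (simp add: y_def)
  next
    case False
    then show ?thesis using x(1)[of j] that by (simp add: y_def)
  qed
  moreover have "\<forall>\<^sub>F t in nhds t0. A p N t \<noteq> 0"
  proof -
    have "isCont (A p N) t0"
      using Suc.prems(1)[OF p(1), of N] by (simp add: analytic_at_imp_isCont)
    then have "A p N \<midarrow>t0\<rightarrow> A p N t0" by (simp add: isCont_def)
    from tendsto_imp_eventually_ne[OF this p(2)] p(2) show ?thesis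
      by (simp add: eventually_at_filter eventually_mono[OF _ _] ) (auto elim!: eventually_mono)
  qed
  with x(2) have "\<forall>\<^sub>F t in nhds t0. \<forall>i<Suc N. (\<Sum>j<Suc N. A i j t * y j t) = b i t"
  proof eventually_elim
    case (elim t)
    have yp: "(\<Sum>j<Suc N. A p j t * y j t) = b p t" using elim by (simp add: y_def)
    show ?case
    proof (intro allI impI)
      fix i assume i: "i < Suc N"
      show "(\<Sum>j<Suc N. A i j t * y j t) = b i t"
        using rcover[OF i]
      proof
        assume "\<exists>i'<N. i = r i'"
        then obtain i' where i': "i' < N" "i = r i'" by blast
        have "(\<Sum>j<Suc N. A i j t * y j t) - l i' t*(\<Sum>j<Suc N. A p j t * y j t)
            = (\<Sum>j<Suc N. (A i j t - l i' t * A p j t) * y j t)"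
          by (simp only: sum_subtractf left_diff_distrib sum_distrib_left mult.assoc)
        also have "\<dots> = (\<Sum>j<N. A' i' j t * x j t)"
          using elim by (simp add: i' A'_def y_def l_def)
        also have "\<dots> = b' i' t" using elim i' by blast
        finally show ?thesis using yp by (simp add: b'_def i')
      qed (use yp in simp)
    qed
  qed
  ultimately show ?case by blast
qed

text \<open>Either the first N columns have a nontrivial kernel vector, which is extended by 0, or
  the square system can be solved for minus the last column and the solution is extended by
  1.\<close>

lemma underdetermined_homogeneous:
  fixes A :: "nat \<Rightarrow> nat \<Rightarrow> complex"
  shows "\<exists>x. (\<exists>j<Suc N. x j \<noteq> 0) \<and> (\<forall>i<N. (\<Sum>j<Suc N. x j * A i j) = 0)"
proof (cases "\<exists>x. (\<exists>j<N. x j \<noteq> 0) \<and> (\<forall>i<N. (\<Sum>j<N. A i j * x j) = 0)")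
  case True
  then obtain x where x: "\<exists>j<N. x j \<noteq> 0" "\<forall>i<N. (\<Sum>j<N. A i j * x j) = 0" by blast
  show ?thesis
    by (intro exI[of _ "x(N := 0)"]) (use x in \<open>auto simp: mult.commute less_Suc_eq\<close>)
next
  case False
  have "\<exists>x. (\<forall>j<N. x j analytic_on {0}) \<and>
      (\<forall>\<^sub>F t in nhds 0. \<forall>i<N. (\<Sum>j<N. A i j * x j t) = - A i N)"
    by (rule analytic_linear_solve[of N "\<lambda>i j _. A i j" 0 "\<lambda>i _. - A i N"])
       (use False in \<open>auto intro: analytic_intros\<close>)
  then obtain x where "(\<forall>j<N. x j analytic_on {0}) \<and>
      (\<forall>\<^sub>F t in nhds 0. \<forall>i<N. (\<Sum>j<N. A i j * x j t) = - A i N)" ..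
  then have "\<forall>\<^sub>F t in nhds 0. \<forall>i<N. (\<Sum>j<N. A i j * x j t) = - A i N" ..
  then have "\<forall>i<N. (\<Sum>j<N. A i j * x j 0) = - A i N" by (rule eventually_nhds_x_imp_x)
  then show ?thesis
    by (intro exI[of _ "\<lambda>j. if j = N then 1 else x j 0"]) (auto simp: mult.commute)
qed

lemma cmean_continuous_on:
  fixes f :: "'a::topological_space \<Rightarrow> complex \<Rightarrow> complex"
  assumes R: "0 < R" and f: "continuous_on (U \<times> sphere 0 R) (\<lambda>(x, s). f x s)"
  shows "continuous_on U (\<lambda>x. cmean R (f x))"
proof -
  have c: "continuous_on (sphere 0 R) (f x)" if "x \<in> U" for x
    using continuous_on_compose2[OF f, of "sphere 0 R" "\<lambda>s. (x, s)"] that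
    by (simp add: continuous_intros subset_eq)
  have "continuous_on U (\<lambda>x. integral (cbox (-pi) pi) (\<lambda>t. f x (of_real R * cis t)*(of_real R * cis t)))"
  proof (rule integral_continuous_on_param)
    have "continuous_on (U \<times> cbox (-pi) pi) (\<lambda>x. case (fst x, of_real R * cis (snd x)) of (x, s) \<Rightarrow> f x s)"
      by (rule continuous_on_compose2[OF f]) (auto intro!: continuous_intros simp: norm_mult R less_imp_le)
    then show "continuous_on (U \<times> cbox (-pi) pi) (\<lambda>(x, t). f x (of_real R * cis t)*(of_real R * cis t))"
      unfolding split_beta by (auto intro!: continuous_intros)
  qed
  then have "continuous_on U (\<lambda>x. integral {-pi..pi} (\<lambda>t. f x (of_real R * cis t)*(of_real R * cis t))/(2 * of_real pi))"
    by (intro continuous_intros) auto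
  then show ?thesis
    by (rule continuous_on_eq) (use cmean_eq_integral[OF R c, of _ "of_real R"] R in auto)
qed

lemma node_mean_scaled_holomorphic:
  assumes \<zeta>: "\<And>j. j < 2*n+1 \<Longrightarrow> cmod (\<zeta> j) \<le> \<delta>" and \<delta>: "0 \<le> \<delta>" and R: "0 < R"
    and g: "continuous_on (sphere 0 R) g" and U: "open U" "convex U" "\<And>t. t \<in> U \<Longrightarrow> cmod t * \<delta> < R"
  shows "(\<lambda>t. node_mean n (\<lambda>j. t * \<zeta> j) R g) holomorphic_on U"
proof -
  define D where "D = (\<lambda>t s. \<Sum>j<2*n+1. - \<zeta> j*(\<Prod>i\<in>{..<2*n+1} - {j}. s - t * \<zeta> i))"
  have nz: "node_poly n (\<lambda>j. t * \<zeta> j) s \<noteq> 0" if "t \<in> U" "cmod s = R" for t s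
  proof (rule node_poly_nonzero)
    show "cmod (t * \<zeta> j) \<le> cmod t * \<delta>" if "j < 2*n+1" for j
      using \<zeta>[OF that] by (simp add: norm_mult mult_left_mono)
  qed (use U(3) that in auto)
  have D: "((\<lambda>t. node_poly n (\<lambda>j. t * \<zeta> j) s) has_field_derivative D t s) (at t)" for t s
    unfolding node_poly_def D_def
    by (rule has_field_derivative_prod) (auto intro!: derivative_eq_intros)
  have cnode: "continuous_on (U \<times> sphere 0 R) (\<lambda>x. node_poly n (\<lambda>j. fst x * \<zeta> j) (snd x))"
    unfolding node_poly_def by (intro continuous_intros)
  have cD: "continuous_on (U \<times> sphere 0 R) (\<lambda>x. D (fst x) (snd x))"
    unfolding D_def by (intro continuous_intros)
  have cg: "continuous_on (U \<times> sphere 0 R) (\<lambda>x. g (snd x))"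
    by (rule continuous_on_compose2[OF g]) (auto intro!: continuous_intros)
  have "((\<lambda>t. cmean R (\<lambda>s. g s/node_poly n (\<lambda>j. t * \<zeta> j) s)) has_field_derivative
      cmean R (\<lambda>s. - (g s*D t s)/(node_poly n (\<lambda>j. t * \<zeta> j) s*node_poly n (\<lambda>j. t * \<zeta> j) s))) (at t)"
    if t: "t \<in> U" for t
  proof (rule cmean_has_field_derivative[OF R U(1,2) t])
    show "((\<lambda>t. g s/node_poly n (\<lambda>j. t * \<zeta> j) s) has_field_derivative
        - (g s*D t s)/(node_poly n (\<lambda>j. t * \<zeta> j) s*node_poly n (\<lambda>j. t * \<zeta> j) s)) (at t)"
      if "t \<in> U" "cmod s = R" for t s
      using DERIV_divide[OF DERIV_const[of "g s"] D nz[OF that]] by simp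
    show "continuous_on (U \<times> sphere 0 R)
      (\<lambda>(t, s). - (g s*D t s)/(node_poly n (\<lambda>j. t * \<zeta> j) s*node_poly n (\<lambda>j. t * \<zeta> j) s))"
      unfolding split_beta using nz
      by (intro continuous_on_divide continuous_on_minus continuous_on_mult cnode cD cg) auto
    show "continuous_on (sphere 0 R) (\<lambda>s. g s/node_poly n (\<lambda>j. t * \<zeta> j) s)" if "t \<in> U" for t
      using nz[OF that] by (intro continuous_on_divide g node_poly_continuous) auto
  qed
  then show ?thesis
    unfolding node_mean_def holomorphic_on_open[OF U(1)] by blast
qed

text \<open>One vector carries both polynomials: entries 0 to n belong to Q, entries n + 1 to 2 n +
  1 to P, and entry 0 is Q(0). Plain functions on \<open>nat\<close> are used, so that the product
  topology is available; later entries are ignored.\<close>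

definition vec_Q :: "nat \<Rightarrow> (nat \<Rightarrow> complex) \<Rightarrow> complex poly" where
  "vec_Q n c = (\<Sum>i\<le>n. monom (c i) i)"

definition vec_P :: "nat \<Rightarrow> (nat \<Rightarrow> complex) \<Rightarrow> complex poly" where
  "vec_P n c = (\<Sum>i\<le>n. monom (c (n + 1 + i)) i)"

definition basis :: "nat \<Rightarrow> nat \<Rightarrow> complex \<Rightarrow> complex" where
  "basis n i s = (if i \<le> n then exp (of_nat n * s) * s^i else s^(i - (n + 1)))"

text \<open>A function is divisible by the node polynomial exactly if its quotient by it has mean 0
  against s^k for all k up to 2 n. The interpolation conditions become 2 n + 1 linear equations with
  coefficients that stay holomorphic in the nodes even where nodes collide.\<close>

definition moment :: "nat \<Rightarrow> (nat \<Rightarrow> complex) \<Rightarrow> nat \<Rightarrow> nat \<Rightarrow> complex" where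
  "moment n \<zeta> k i = node_mean n \<zeta> 1 (\<lambda>s. basis n i s * s^k)"

lemma basis_continuous: "continuous_on S (basis n i)"
  unfolding basis_def by (cases "i \<le> n") (auto intro!: continuous_intros)

lemma poly_vec_Q: "poly (vec_Q n c) s = (\<Sum>i\<le>n. c i * s^i)"
  by (simp add: vec_Q_def poly_sum poly_monom)

lemma poly_vec_P: "poly (vec_P n c) s = (\<Sum>i\<le>n. c (n + 1 + i) * s^i)"
  by (simp add: vec_P_def poly_sum poly_monom)

lemma coeff_vec: "coeff (vec_Q n c) i = (if i \<le> n then c i else 0)"
    "coeff (vec_P n c) i = (if i \<le> n then c (n + 1 + i) else 0)"
  by (simp_all add: vec_Q_def vec_P_def coeff_sum)

lemma degree_vec: "degree (vec_Q n c) \<le> n" "degree (vec_P n c) \<le> n"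
  by (intro degree_le; simp add: coeff_vec)+

lemma vec_eq_0_iff: "vec_P n c = 0 \<and> vec_Q n c = 0 \<longleftrightarrow> (\<forall>i<2*n+2. c i = 0)"
proof
  assume z: "vec_P n c = 0 \<and> vec_Q n c = 0"
  show "\<forall>i<2*n+2. c i = 0"
  proof (intro allI impI)
    fix i assume i: "i < 2*n+2"
    show "c i = 0"
    proof (cases "i \<le> n")
      case True
      then show ?thesis using z coeff_vec(1)[of n c i] by simp
    next
      case False
      then have "i = n + 1 + (i - (n + 1))" "i - (n + 1) \<le> n" using i by auto
      then show ?thesis using z coeff_vec(2)[of n c "i - (n + 1)"] by simp
    qed
  qed
qed (auto intro!: poly_eqI simp: coeff_vec)

lemma vec_surj:
  assumes "degree P \<le> n" "degree Q \<le> n"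
  shows "vec_Q n (\<lambda>i. if i \<le> n then coeff Q i else coeff P (i - (n + 1))) = Q"
    "vec_P n (\<lambda>i. if i \<le> n then coeff Q i else coeff P (i - (n + 1))) = P"
  by (use assms in \<open>auto intro!: poly_eqI simp: coeff_vec coeff_eq_0\<close>)

lemma vec_combination:
  "exp (of_nat n * s)*poly (vec_Q n c) s + poly (vec_P n c) s = (\<Sum>i<2*n+2. c i * basis n i s)"
proof -
  have "(\<Sum>i<2*n+2. c i * basis n i s) = (\<Sum>i<n + 1. c i * basis n i s) + (\<Sum>i=n + 1..<2*n+2. c i * basis n i s)"
    using sum.atLeastLessThan_concat[of 0 "n + 1" "2*n+2" "\<lambda>i. c i * basis n i s"]
    by (simp add: lessThan_atLeast0)
  also have "(\<Sum>i<n + 1. c i * basis n i s) = exp (of_nat n * s)*poly (vec_Q n c) s"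
    unfolding poly_vec_Q sum_distrib_left
    by (rule sum.cong) (auto simp: basis_def)
  also have "(\<Sum>i=n + 1..<2*n+2. c i * basis n i s) = (\<Sum>i<n + 1. c (n + 1 + i) * s^i)"
    by (rule sum.reindex_bij_witness[of _ "\<lambda>i. n + 1 + i" "\<lambda>i. i - (n + 1)"]) (auto simp: basis_def)
  also have "\<dots> = poly (vec_P n c) s"
    unfolding poly_vec_P by (rule sum.cong) auto
  finally show ?thesis by simp
qed

text \<open>If H exists, H(s) s^k is entire and has mean 0. Conversely, in Cauchy's formula for f(z)
  the kernel is split by means of the difference quotient of the node polynomial; the vanishing
  moments annihilate the polynomial part, and f(z) is the node polynomial at z times a factor that
  is bounded near the nodes.\<close>

lemma solution_exists_iff:
  assumes \<zeta>: "\<And>j. j < 2*n+1 \<Longrightarrow> cmod (\<zeta> j) \<le> \<delta>" and \<delta>: "0 \<le> \<delta>" "\<delta> < 1"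
    and deg: "degree P \<le> n" "degree Q \<le> n"
  shows "(\<exists>H. solution n \<zeta> P Q H) \<longleftrightarrow> \<not> (P = 0 \<and> Q = 0) \<and>
     (\<forall>k<2*n+1. node_mean n \<zeta> 1 (\<lambda>s. (exp (of_nat n * s)*poly Q s + poly P s) * s^k) = 0)"
proof (intro iffI conjI allI impI)
  assume "\<exists>H. solution n \<zeta> P Q H"
  then obtain H where sol: "solution n \<zeta> P Q H" by blast
  then show "\<not> (P = 0 \<and> Q = 0)" by (simp add: solution_def)
  fix k
  have holH: "H holomorphic_on A" for A
    using sol by (auto simp: solution_def intro: holomorphic_on_subset)
  have "node_mean n \<zeta> 1 (\<lambda>s. (exp (of_nat n * s)*poly Q s + poly P s) * s^k) = cmean 1 (\<lambda>s. H s * s^k)"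
    unfolding node_mean_def
  proof (rule cmean_cong)
    fix s :: complex assume s: "cmod s = 1"
    have "node_poly n \<zeta> s \<noteq> 0" by (rule node_poly_nonzero[OF \<zeta>]) (use s \<delta> in auto)
    moreover have "exp (of_nat n * s)*poly Q s + poly P s = node_poly n \<zeta> s*H s"
      using sol by (simp add: solution_def)
    ultimately show "(exp (of_nat n * s)*poly Q s + poly P s) * s^k/node_poly n \<zeta> s = H s * s^k"
      by simp
  qed simp
  also have "\<dots> = 0" by (rule cmean_holomorphic) (intro zero_less_one holomorphic_intros holH)+
  finally show "node_mean n \<zeta> 1 (\<lambda>s. (exp (of_nat n * s)*poly Q s + poly P s) * s^k) = 0" .
next
  define f where "f = (\<lambda>s. exp (of_nat n * s)*poly Q s + poly P s)"
  assume "\<not> (P = 0 \<and> Q = 0) \<and>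
     (\<forall>k<2*n+1. node_mean n \<zeta> 1 (\<lambda>s. (exp (of_nat n * s)*poly Q s + poly P s) * s^k) = 0)"
  then have PQ: "\<not> (P = 0 \<and> Q = 0)" and M: "\<And>k. k < 2*n+1 \<Longrightarrow> node_mean n \<zeta> 1 (\<lambda>s. f s * s^k) = 0"
    by (auto simp: f_def)
  have holf: "f holomorphic_on A" for A unfolding f_def by (intro holomorphic_intros)
  have contf: "continuous_on A f" for A by (rule holomorphic_on_imp_continuous_on[OF holf])
  define W where "W = (\<Prod>j<2*n+1. [:- \<zeta> j, 1:])"
  have W: "poly W s = node_poly n \<zeta> s" for s unfolding W_def node_poly_def poly_prod by (rule prod.cong) auto
  have degW: "degree W \<le> 2*n+1"
    unfolding W_def by (rule order.trans[OF degree_prod_sum_le]) auto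
  have key: "f z = node_poly n \<zeta> z*node_mean n \<zeta> 1 (\<lambda>s. f s/(s - z))" if z: "cmod z < 1" for z
  proof -
    \<comment> \<open>In s this is the difference quotient (W(s) - W(z))/(s - z), of degree at most
      2 n and therefore a combination of the powers covered by the moments.\<close>
    define p where "p = synthetic_div W z"
    have nzs: "s - z \<noteq> 0" if "s \<in> sphere 0 1" for s using that z by auto
    have degp: "degree p \<le> 2*n" using degW by (simp add: p_def degree_synthetic_div)
    have c1: "continuous_on (sphere 0 1) (\<lambda>s. f s*poly p s)" by (intro continuous_intros contf)
    have c2: "continuous_on (sphere 0 1) (\<lambda>s. f s/(s - z))" using nzs by (intro continuous_intros contf) auto
    have c3: "continuous_on (sphere 0 1) (\<lambda>s. node_poly n \<zeta> z*(f s/(s - z)))" by (intro continuous_intros c2)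
    have ps: "poly p s = (\<Sum>k<2*n+1. coeff p k * s^k)" for s
      unfolding poly_altdef using degp
      by (intro sum.mono_neutral_left) (auto simp: coeff_eq_0)
    have "node_mean n \<zeta> 1 (\<lambda>s. f s*poly p s) = (\<Sum>k<2*n+1. coeff p k*node_mean n \<zeta> 1 (\<lambda>s. f s * s^k))"
    proof -
      have "node_mean n \<zeta> 1 (\<lambda>s. f s*poly p s)
          = cmean 1 (\<lambda>s. \<Sum>k<2*n+1. coeff p k*(f s * s^k/node_poly n \<zeta> s))"
        unfolding node_mean_def ps
        unfolding sum_distrib_left sum_divide_distrib
        by (intro cmean_cong sum.cong) (simp_all add: mult_ac)
      also have "\<dots> = (\<Sum>k<2*n+1. cmean 1 (\<lambda>s. coeff p k*(f s * s^k/node_poly n \<zeta> s)))"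
        by (intro cmean_sum continuous_on_mult continuous_on_const node_quotient_continuous[OF \<zeta> \<delta>(2)]
             continuous_on_power continuous_on_id contf) auto
      also have "\<dots> = (\<Sum>k<2*n+1. coeff p k*node_mean n \<zeta> 1 (\<lambda>s. f s * s^k))"
        unfolding node_mean_def
        by (intro sum.cong refl cmean_cmult zero_less_one node_quotient_continuous[OF \<zeta> \<delta>(2)]
             continuous_on_mult continuous_on_power continuous_on_id contf) auto
      finally show ?thesis .
    qed
    also have "\<dots> = 0" using M by (intro sum.neutral) auto
    finally have zero: "node_mean n \<zeta> 1 (\<lambda>s. f s*poly p s) = 0" .
    have "f z = cmean 1 (\<lambda>s. f s/(s - z))" by (rule cmean_Cauchy[OF holf z, symmetric])
    also have "\<dots> = node_mean n \<zeta> 1 (\<lambda>s. f s*poly p s + node_poly n \<zeta> z*(f s/(s - z)))"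
      unfolding node_mean_def
    proof (rule cmean_cong)
      fix s :: complex assume s: "cmod s = 1"
      have nz: "node_poly n \<zeta> s \<noteq> 0" by (rule node_poly_nonzero[OF \<zeta>]) (use s \<delta> in auto)
      have "poly W s = poly ([:- z, 1:] * p + [:poly W z:]) s" by (simp only: p_def synthetic_div_correct')
      then have eq: "node_poly n \<zeta> s = (s - z)*poly p s + node_poly n \<zeta> z" by (simp add: W algebra_simps)
      have "a/d = (a * q + w*(a/d))/m" if "m = d * q + w" "m \<noteq> 0" "d \<noteq> 0" for a d q w m :: complex
      proof -
        have "a * q + w*(a/d) = (a/d) * m" unfolding that(1) using that(3) by (simp add: distrib_left)
        then show ?thesis using that(2) by simp
      qed
      from this[OF eq nz] show "f s/(s - z) = (f s*poly p s + node_poly n \<zeta> z*(f s/(s - z)))/node_poly n \<zeta> s"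
        by this (rule nzs, simp add: s)
    qed simp
    also have "\<dots> = node_mean n \<zeta> 1 (\<lambda>s. f s*poly p s) + node_mean n \<zeta> 1 (\<lambda>s. node_poly n \<zeta> z*(f s/(s - z)))"
      by (rule node_mean_add[OF \<zeta> \<delta> c1 c3])
    also have "node_mean n \<zeta> 1 (\<lambda>s. node_poly n \<zeta> z*(f s/(s - z)))
        = node_poly n \<zeta> z*node_mean n \<zeta> 1 (\<lambda>s. f s/(s - z))"
      by (rule node_mean_cmult[OF \<zeta> \<delta> c2])
    finally show ?thesis using zero by simp
  qed
  obtain B0 where B0: "\<And>s. cmod s = 1 \<Longrightarrow> cmod (f s) \<le> B0"
  proof -
    have "bounded (f ` sphere 0 1)" by (intro compact_imp_bounded compact_continuous_image contf) auto
    then obtain B where "\<forall>x\<in>f ` sphere 0 1. cmod x \<le> B" unfolding bounded_iff by blast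
    then show ?thesis using that[of B] by auto
  qed
  define r where "r = (1 + \<delta>)/2"
  have r: "\<delta> < r" "r < 1" using \<delta> by (auto simp: r_def)
  define B where "B = B0/(1 - r)/(1 - \<delta>)^(2*n+1)*1"
  have bound: "cmod (f z) \<le> B*cmod (node_poly n \<zeta> z)" if z: "cmod z < r" for z
  proof -
    have z1: "cmod z < 1" using z r by simp
    have nzs: "s - z \<noteq> 0" if "s \<in> sphere 0 1" for s using that z1 by auto
    have "cmod (node_mean n \<zeta> 1 (\<lambda>s. f s/(s - z))) \<le> B"
      unfolding B_def
    proof (rule norm_node_mean_le[OF \<zeta> \<delta>])
      show "continuous_on (sphere 0 1) (\<lambda>s. f s/(s - z))" using nzs by (intro continuous_intros contf) auto
      fix s :: complex assume s: "cmod s = 1"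
      have "1 - r \<le> cmod (s - z)" using norm_triangle_ineq2[of s z] s z by simp
      then show "cmod (f s/(s - z)) \<le> B0/(1 - r)"
        unfolding norm_divide using B0[OF s] r order.trans[OF norm_ge_zero B0[OF s]] by (intro frac_le) auto
    qed
    then have "cmod (node_mean n \<zeta> 1 (\<lambda>s. f s/(s - z)))*cmod (node_poly n \<zeta> z) \<le> B*cmod (node_poly n \<zeta> z)"
      by (intro mult_right_mono) auto
    then show ?thesis using key[OF z1] by (simp add: norm_mult mult.commute)
  qed
  have bigo: "f \<in> O[nhds (\<zeta> j)](\<lambda>w. \<Prod>j<2*n+1. w - \<zeta> j)" if j: "j < 2*n+1" for j
  proof -
    have "\<forall>\<^sub>F w in nhds (\<zeta> j). w \<in> ball 0 r"
      by (rule eventually_nhds_in_open) (use \<zeta>[OF j] r in auto)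
    then have "\<forall>\<^sub>F w in nhds (\<zeta> j). cmod (f w) \<le> B*cmod (\<Prod>j<2*n+1. w - \<zeta> j)"
    proof eventually_elim
      case (elim w)
      then show ?case using bound[of w] unfolding node_poly_def by simp
    qed
    then show ?thesis by (rule bigoI)
  qed
  show "\<exists>H. solution n \<zeta> P Q H"
  proof (rule entire_quotient_of_bigo[of f "2*n+1" \<zeta>, OF holf])
    show "f \<in> O[nhds (\<zeta> j)](\<lambda>w. \<Prod>j<2*n+1. w - \<zeta> j)" if "j < 2*n+1" for j by (rule bigo[OF that])
    fix h assume h: "h holomorphic_on UNIV" "\<And>w. f w = (\<Prod>j<2*n+1. w - \<zeta> j) * h w"
    have "\<forall>s. exp (of_nat n * s)*poly Q s + poly P s = node_poly n \<zeta> s * h s"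
      using h(2) unfolding f_def node_poly_def by blast
    then show ?thesis unfolding solution_def using deg PQ h(1) by blast
  qed
qed

lemma vec_solution_iff:
  assumes \<zeta>: "\<And>j. j < 2*n+1 \<Longrightarrow> cmod (\<zeta> j) \<le> \<delta>" and \<delta>: "0 \<le> \<delta>" "\<delta> < 1"
  shows "(\<exists>H. solution n \<zeta> (vec_P n c) (vec_Q n c) H) \<longleftrightarrow>
     (\<exists>i<2*n+2. c i \<noteq> 0) \<and> (\<forall>k<2*n+1. (\<Sum>i<2*n+2. c i * moment n \<zeta> k i) = 0)"
proof -
  have "node_mean n \<zeta> 1 (\<lambda>s. (exp (of_nat n * s)*poly (vec_Q n c) s + poly (vec_P n c) s) * s^k)
      = (\<Sum>i<2*n+2. c i * moment n \<zeta> k i)" for k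
  proof -
    have "node_mean n \<zeta> 1 (\<lambda>s. (exp (of_nat n * s)*poly (vec_Q n c) s + poly (vec_P n c) s) * s^k)
        = cmean 1 (\<lambda>s. \<Sum>i<2*n+2. c i*(basis n i s * s^k/node_poly n \<zeta> s))"
      unfolding node_mean_def vec_combination
      by (rule cmean_cong) (simp_all only: sum_distrib_right sum_divide_distrib times_divide_eq_right mult.assoc zero_less_one)
    also have "\<dots> = (\<Sum>i<2*n+2. cmean 1 (\<lambda>s. c i*(basis n i s * s^k/node_poly n \<zeta> s)))"
      by (intro cmean_sum continuous_on_mult continuous_on_const node_quotient_continuous[OF \<zeta> \<delta>(2)]
           continuous_on_power continuous_on_id basis_continuous) auto
    also have "\<dots> = (\<Sum>i<2*n+2. c i * moment n \<zeta> k i)"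
      unfolding node_mean_def moment_def
      by (intro sum.cong refl cmean_cmult zero_less_one node_quotient_continuous[OF \<zeta> \<delta>(2)]
           continuous_on_mult continuous_on_power continuous_on_id basis_continuous) auto
    finally show ?thesis .
  qed
  moreover have "(\<exists>i<2*n+2. c i \<noteq> 0) \<longleftrightarrow> \<not> (vec_P n c = 0 \<and> vec_Q n c = 0)"
    unfolding vec_eq_0_iff by blast
  moreover have "(\<exists>H. solution n \<zeta> (vec_P n c) (vec_Q n c) H) \<longleftrightarrow> \<not> (vec_P n c = 0 \<and> vec_Q n c = 0) \<and>
     (\<forall>k<2*n+1. node_mean n \<zeta> 1 (\<lambda>s. (exp (of_nat n * s)*poly (vec_Q n c) s + poly (vec_P n c) s) * s^k) = 0)"
    by (rule solution_exists_iff[OF _ \<delta> degree_vec(2,1)]) (rule \<zeta>)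
  ultimately show ?thesis by (simp only:)
qed

lemma vec_solution_exists:
  assumes \<zeta>: "\<And>j. j < 2*n+1 \<Longrightarrow> cmod (\<zeta> j) \<le> \<delta>" and \<delta>: "0 \<le> \<delta>" "\<delta> < 1"
  shows "\<exists>c H. solution n \<zeta> (vec_P n c) (vec_Q n c) H"
proof -
  have "\<exists>c. (\<exists>i<Suc (2*n+1). c i \<noteq> 0) \<and> (\<forall>k<2*n+1. (\<Sum>i<Suc (2*n+1). c i * moment n \<zeta> k i) = 0)"
    by (rule underdetermined_homogeneous)
  moreover have "Suc (2*n+1) = 2*n+2" by simp
  ultimately have "\<exists>c. (\<exists>i<2*n+2. c i \<noteq> 0) \<and> (\<forall>k<2*n+1. (\<Sum>i<2*n+2. c i * moment n \<zeta> k i) = 0)"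
    by (simp only:)
  then obtain c where "(\<exists>i<2*n+2. c i \<noteq> 0) \<and> (\<forall>k<2*n+1. (\<Sum>i<2*n+2. c i * moment n \<zeta> k i) = 0)" ..
  moreover have "(\<exists>H. solution n \<zeta> (vec_P n c) (vec_Q n c) H) \<longleftrightarrow>
     (\<exists>i<2*n+2. c i \<noteq> 0) \<and> (\<forall>k<2*n+1. (\<Sum>i<2*n+2. c i * moment n \<zeta> k i) = 0)"
    by (rule vec_solution_iff[OF _ \<delta>]) (rule \<zeta>)
  ultimately show ?thesis by blast
qed

section \<open>The continuity method\<close>

text \<open>The moment equations say that \<open>snd x\<close> lists the coefficients of a nonzero solution for the nodes
  \<open>fst x * \<zeta> j\<close>.\<close>

definition sols :: "nat \<Rightarrow> (nat \<Rightarrow> complex) \<Rightarrow> (real \<times> (nat \<Rightarrow> complex)) set" where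
  "sols n \<zeta> = {x. fst x \<in> {0..1} \<and> (\<exists>i<2*n+2. snd x i \<noteq> 0) \<and>
     (\<forall>k<2*n+1. (\<Sum>i<2*n+2. snd x i * moment n (\<lambda>j. of_real (fst x) * \<zeta> j) k i) = 0)}"

definition vec_spline :: "nat \<Rightarrow> (nat \<Rightarrow> complex) \<Rightarrow> real \<times> (nat \<Rightarrow> complex) \<Rightarrow> complex \<Rightarrow> complex" where
  "vec_spline n \<zeta> x = spline n (\<lambda>j. of_real (fst x) * \<zeta> j) 1 (vec_Q n (snd x))"

text \<open>Cauchy's integral for u over a circle that avoids 0 and 1. In this form u depends
  continuously on t and on the coefficients, and it is defined also for vectors that are not
  solutions.\<close>

definition vec_factor :: "nat \<Rightarrow> (nat \<Rightarrow> complex) \<Rightarrow> real \<times> (nat \<Rightarrow> complex) \<Rightarrow> complex \<Rightarrow> complex" where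
  "vec_factor n \<zeta> x y = cmean (rad0 + 1) (\<lambda>w. vec_spline n \<zeta> x w/((w*(w - 1))^n*(w - y)))"

definition good_sols :: "nat \<Rightarrow> (nat \<Rightarrow> complex) \<Rightarrow> (real \<times> (nat \<Rightarrow> complex)) set" where
  "good_sols n \<zeta> = {x \<in> sols n \<zeta>. (\<forall>s\<in>ball 0 eps0. poly (vec_Q n (snd x)) s \<noteq> 0) \<and>
     (\<forall>y\<in>ball 0 rad0. vec_factor n \<zeta> x y \<noteq> 0)}"

text \<open>The tube lemma: a neighbourhood of {x} \<times> K on which F does not vanish contains a
  product neighbourhood, because K is compact.\<close>

lemma openin_nonvanishing:
  fixes F :: "'a::topological_space \<Rightarrow> 'b::topological_space \<Rightarrow> complex"
  assumes K: "compact K" and F: "continuous_on (A \<times> K) (\<lambda>(x, y). F x y)"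
  shows "openin (top_of_set A) {x \<in> A. \<forall>y\<in>K. F x y \<noteq> 0}"
proof -
  define f where "f = (\<lambda>(x, y). F x y)"
  have "open (- {0::complex})" by (simp add: open_Compl)
  then obtain W where W: "open W" "W \<inter> (A \<times> K) = f -` (- {0}) \<inter> (A \<times> K)"
    using F unfolding continuous_on_open_invariant f_def[symmetric] by (elim allE impE exE conjE)
  have W': "(x, y) \<in> W \<longleftrightarrow> F x y \<noteq> 0" if "x \<in> A" "y \<in> K" for x y
  proof -
    have "(x, y) \<in> W \<inter> (A \<times> K) \<longleftrightarrow> (x, y) \<in> f -` (- {0}) \<inter> (A \<times> K)" by (simp only: W(2))
    then show ?thesis using that by (simp add: f_def)
  qed
  show ?thesis
  proof (subst openin_subopen, rule ballI)
    fix x assume x: "x \<in> {x \<in> A. \<forall>y\<in>K. F x y \<noteq> 0}"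
    then have xA: "x \<in> A" by simp
    have "{x} \<times> K \<subseteq> W"
    proof
      fix z assume "z \<in> {x} \<times> K"
      then obtain y where "z = (x, y)" "y \<in> K" by auto
      then show "z \<in> W" using W'[OF xA] x by simp
    qed
    from Elementary_Topology.tube_lemma[OF K W(1) this]
    obtain X where X: "x \<in> X" "open X" "X \<times> K \<subseteq> W" by (elim exE conjE)
    have sub: "A \<inter> X \<subseteq> {x \<in> A. \<forall>y\<in>K. F x y \<noteq> 0}"
    proof
      fix z assume z: "z \<in> A \<inter> X"
      have "F z y \<noteq> 0" if "y \<in> K" for y
        using W'[of z y] z that X(3) by (auto simp only: Int_iff intro: subsetD)
      then show "z \<in> {x \<in> A. \<forall>y\<in>K. F x y \<noteq> 0}" using z by simp
    qed
    show "\<exists>T. openin (top_of_set A) T \<and> x \<in> T \<and> T \<subseteq> {x \<in> A. \<forall>y\<in>K. F x y \<noteq> 0}"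
    proof (intro exI conjI)
      show "openin (top_of_set A) (A \<inter> X)" by (rule openin_open_Int[OF X(2)])
      show "x \<in> A \<inter> X" using xA X(1) by (rule IntI)
    qed (rule sub)
  qed
qed

lemma scaled_node_bound:
  assumes "\<And>j. j < 2*n+1 \<Longrightarrow> cmod (\<zeta> j) \<le> \<delta>" "cmod t \<le> 1" "j < 2*n+1"
  shows "cmod (t * \<zeta> j) \<le> \<delta>"
proof -
  have "cmod (t * \<zeta> j) \<le> 1 * \<delta>" unfolding norm_mult by (intro mult_mono) (use assms in auto)
  then show ?thesis by simp
qed

lemma sols_iff:
  assumes \<zeta>: "\<And>j. j < 2*n+1 \<Longrightarrow> cmod (\<zeta> j) \<le> \<delta>" and \<delta>: "0 \<le> \<delta>" "\<delta> < 1"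
  shows "x \<in> sols n \<zeta> \<longleftrightarrow> fst x \<in> {0..1} \<and>
    (\<exists>H. solution n (\<lambda>j. of_real (fst x) * \<zeta> j) (vec_P n (snd x)) (vec_Q n (snd x)) H)"
proof (cases "fst x \<in> {0..1}")
  case True
  have "(\<exists>H. solution n (\<lambda>j. of_real (fst x) * \<zeta> j) (vec_P n (snd x)) (vec_Q n (snd x)) H) \<longleftrightarrow>
     (\<exists>i<2*n+2. snd x i \<noteq> 0) \<and>
     (\<forall>k<2*n+1. (\<Sum>i<2*n+2. snd x i * moment n (\<lambda>j. of_real (fst x) * \<zeta> j) k i) = 0)"
  proof (rule vec_solution_iff[OF _ \<delta>])
    fix j assume "j < 2*n+1"
    then show "cmod (complex_of_real (fst x) * \<zeta> j) \<le> \<delta>"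
      by (rule scaled_node_bound[rotated 2]) (rule \<zeta>, use True in auto)
  qed
  then show ?thesis using True unfolding sols_def by blast
qed (unfold sols_def, blast)

lemma continuous_on_vec_Q:
  fixes f :: "'a::topological_space \<Rightarrow> real \<times> (nat \<Rightarrow> complex)"
  assumes "continuous_on A f" "continuous_on A g"
  shows "continuous_on A (\<lambda>x. poly (vec_Q n (snd (f x))) (g x))"
proof -
  have "continuous_on A (\<lambda>x. snd (f x) i)" for i
    by (rule continuous_on_product_then_coordinatewise) (intro continuous_intros assms)
  then show ?thesis unfolding poly_vec_Q by (intro continuous_intros assms)
qed

lemma vec_spline_continuous:
  assumes \<zeta>: "\<And>j. j < 2*n+1 \<Longrightarrow> cmod (\<zeta> j) \<le> \<delta>" and \<delta>: "0 \<le> \<delta>" "\<delta> < 1"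
  shows "continuous_on (({0..1} \<times> UNIV) \<times> UNIV) (\<lambda>(x, w). vec_spline n \<zeta> x w)"
proof -
  define A :: "((real \<times> (nat \<Rightarrow> complex)) \<times> complex) set" where "A = ({0..1} \<times> UNIV) \<times> UNIV"
  have "continuous_on A (\<lambda>x. cmean 1 (\<lambda>s. poly (vec_Q n (snd (fst x))) s*exp (of_nat n * s * snd x)
      / node_poly n (\<lambda>j. of_real (fst (fst x)) * \<zeta> j) s))"
  proof (rule cmean_continuous_on)
    have nz: "node_poly n (\<lambda>j. of_real (fst (fst (fst z))) * \<zeta> j) (snd z) \<noteq> 0" if "z \<in> A \<times> sphere 0 1" for z
    proof (rule node_poly_nonzero)
      fix j assume "j < 2*n+1"
      then show "cmod (complex_of_real (fst (fst (fst z))) * \<zeta> j) \<le> \<delta>"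
        by (rule scaled_node_bound[rotated 2]) (rule \<zeta>, use that in \<open>auto simp: A_def\<close>)
    qed (use that \<delta> in auto)
    have "continuous_on (A \<times> sphere 0 1) (\<lambda>z. poly (vec_Q n (snd (fst (fst z)))) (snd z))"
      by (rule continuous_on_vec_Q[where f = "\<lambda>z. fst (fst z)" and g = snd]) (intro continuous_intros)+
    moreover have "continuous_on (A \<times> sphere 0 1) (\<lambda>z. node_poly n (\<lambda>j. of_real (fst (fst (fst z))) * \<zeta> j) (snd z))"
      unfolding node_poly_def by (intro continuous_intros)
    ultimately show "continuous_on (A \<times> sphere 0 1) (\<lambda>(x, s). poly (vec_Q n (snd (fst x))) s*exp (of_nat n * s * snd x)
      / node_poly n (\<lambda>j. of_real (fst (fst x)) * \<zeta> j) s)"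
      unfolding split_beta using nz
      by (intro continuous_on_divide continuous_on_mult continuous_on_exp continuous_on_const
           continuous_on_snd continuous_on_fst continuous_on_id) auto
  qed simp
  then show ?thesis
    by (simp add: A_def vec_spline_def spline_def node_mean_def split_beta)
qed

lemma vec_factor_continuous:
  assumes \<zeta>: "\<And>j. j < 2*n+1 \<Longrightarrow> cmod (\<zeta> j) \<le> \<delta>" and \<delta>: "0 \<le> \<delta>" "\<delta> < 1"
  shows "continuous_on (({0..1} \<times> UNIV) \<times> cball 0 rad0) (\<lambda>(x, y). vec_factor n \<zeta> x y)"
proof -
  define A :: "((real \<times> (nat \<Rightarrow> complex)) \<times> complex) set" where "A = ({0..1} \<times> UNIV) \<times> cball 0 rad0"
  have r: "1 < rad0 + 1" "0 < rad0 + 1" using const_bounds by linarith+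
  have "continuous_on A (\<lambda>x. cmean (rad0 + 1) (\<lambda>w. vec_spline n \<zeta> (fst x) w/((w*(w - 1))^n*(w - snd x))))"
  proof (rule cmean_continuous_on)
    have nz: "(snd z*(snd z - 1))^n*(snd z - snd (fst z)) \<noteq> 0" if "z \<in> A \<times> sphere 0 (rad0 + 1)" for z
      using that r by (auto simp: A_def)
    have "continuous_on (A \<times> sphere 0 (rad0 + 1)) (\<lambda>z. case (fst (fst z), snd z) of (x, w) \<Rightarrow> vec_spline n \<zeta> x w)"
    proof (rule continuous_on_compose2[OF vec_spline_continuous[OF _ \<delta>]])
      show "\<And>j. j < 2*n+1 \<Longrightarrow> cmod (\<zeta> j) \<le> \<delta>" by (rule \<zeta>)
    qed (auto intro!: continuous_intros simp: A_def)
    then show "continuous_on (A \<times> sphere 0 (rad0 + 1)) (\<lambda>(x, w). vec_spline n \<zeta> (fst x) w/((w*(w - 1))^n*(w - snd x)))"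
      unfolding split_beta fst_conv snd_conv using nz
      by (intro continuous_on_divide continuous_on_mult continuous_on_power continuous_on_diff continuous_on_const
           continuous_on_snd continuous_on_fst continuous_on_id) auto
  qed (rule r)
  then show ?thesis by (simp add: A_def vec_factor_def split_beta)
qed

lemma vec_factor_eq:
  assumes u: "spline_factor n (\<lambda>j. of_real (fst x) * \<zeta> j) (vec_Q n (snd x)) u" and y: "cmod y < rad0 + 1"
  shows "vec_factor n \<zeta> x y = u y"
proof -
  have r: "1 < rad0 + 1" "0 < rad0 + 1" using const_bounds by linarith+
  have "vec_factor n \<zeta> x y = cmean (rad0 + 1) (\<lambda>w. u w/(w - y))"
    unfolding vec_factor_def
  proof (rule cmean_cong[OF r(2)])
    fix w :: complex assume w: "cmod w = rad0 + 1"
    have "vec_spline n \<zeta> x w = (w*(w - 1))^n * u w"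
      using u by (simp add: spline_factor_def vec_spline_def)
    moreover have "(w*(w - 1))^n \<noteq> 0" using w r by auto
    ultimately show "vec_spline n \<zeta> x w/((w*(w - 1))^n*(w - y)) = u w/(w - y)"
      by (simp only: mult_divide_mult_cancel_left not_False_eq_True)
  qed
  also have "\<dots> = u y"
    by (rule cmean_Cauchy[OF _ y]) (use u in \<open>auto simp: spline_factor_def intro: holomorphic_on_subset\<close>)
  finally show ?thesis .
qed

lemma sols_obtain:
  assumes \<zeta>: "\<And>j. j < 2*n+1 \<Longrightarrow> cmod (\<zeta> j) \<le> del0" and n: "1 \<le> n" and x: "x \<in> sols n \<zeta>"
  obtains H u where "fst x \<in> {0..1}"
    "solution n (\<lambda>j. of_real (fst x) * \<zeta> j) (vec_P n (snd x)) (vec_Q n (snd x)) H"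
    "\<And>j. j < 2*n+1 \<Longrightarrow> cmod (of_real (fst x) * \<zeta> j) \<le> del0"
    "spline_factor n (\<lambda>j. of_real (fst x) * \<zeta> j) (vec_Q n (snd x)) u"
    "\<And>y. cmod y \<le> rad0 \<Longrightarrow> vec_factor n \<zeta> x y = u y"
proof -
  have "fst x \<in> {0..1} \<and> (\<exists>H. solution n (\<lambda>j. of_real (fst x) * \<zeta> j) (vec_P n (snd x)) (vec_Q n (snd x)) H)"
    using x by (subst (asm) sols_iff[OF _ del0]) (rule \<zeta>)
  then obtain H where t: "fst x \<in> {0..1}"
    and sol: "solution n (\<lambda>j. of_real (fst x) * \<zeta> j) (vec_P n (snd x)) (vec_Q n (snd x)) H" by blast
  have \<zeta>': "cmod (of_real (fst x) * \<zeta> j) \<le> del0" if "j < 2*n+1" for j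
    using that by (rule scaled_node_bound[rotated 2]) (rule \<zeta>, use t in auto)
  have "\<exists>u. u holomorphic_on UNIV \<and> (\<forall>y. spline n (\<lambda>j. of_real (fst x) * \<zeta> j) 1 (vec_Q n (snd x)) y = (y*(y - 1))^n * u y)"
    by (rule spline_factor_exists[OF n sol _ del0]) (rule \<zeta>')
  then obtain u where u: "spline_factor n (\<lambda>j. of_real (fst x) * \<zeta> j) (vec_Q n (snd x)) u"
    unfolding spline_factor_def by blast
  have "vec_factor n \<zeta> x y = u y" if "cmod y \<le> rad0" for y
    by (rule vec_factor_eq[OF u]) (use that in simp)
  then show thesis using that t sol \<zeta>' u by blast
qed

text \<open>The first two conclusions pass to closed disks, which gives openness; the third is a
  lower bound for |u| in terms of |Q(0)| that survives limits, which gives closedness.\<close>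

lemma good_solsD:
  assumes large: "large n" and \<zeta>: "\<And>j. j < 2*n+1 \<Longrightarrow> cmod (\<zeta> j) \<le> del0"
    and x: "x \<in> good_sols n \<zeta>"
  shows "s \<in> cball 0 eps0 \<Longrightarrow> poly (vec_Q n (snd x)) s \<noteq> 0"
    "y \<in> cball 0 rad0 \<Longrightarrow> vec_factor n \<zeta> x y \<noteq> 0"
    "y \<in> ball 0 rad0 \<Longrightarrow> cmod (poly (vec_Q n (snd x)) 0)*exp (2*real n - 2*real n*ln 2 - 34 * mu0*real n)
       \<le> cmod (vec_factor n \<zeta> x y)"
proof -
  note c = const_bounds
  have n: "1 \<le> n" using large by (simp add: large_def)
  have xs: "x \<in> sols n \<zeta>" using x by (simp only: good_sols_def mem_Collect_eq)
  obtain H u where sol: "solution n (\<lambda>j. of_real (fst x) * \<zeta> j) (vec_P n (snd x)) (vec_Q n (snd x)) H"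
    and \<zeta>': "\<And>j. j < 2*n+1 \<Longrightarrow> cmod (of_real (fst x) * \<zeta> j) \<le> del0"
    and u: "spline_factor n (\<lambda>j. of_real (fst x) * \<zeta> j) (vec_Q n (snd x)) u"
    and eq: "\<And>y. cmod y \<le> rad0 \<Longrightarrow> vec_factor n \<zeta> x y = u y"
    by (rule sols_obtain[OF _ n xs]) (erule \<zeta>, rule that)
  have Q: "poly (vec_Q n (snd x)) s \<noteq> 0" if "cmod s < eps0" for s
    using x that unfolding good_sols_def by (auto simp only: mem_Collect_eq mem_ball_0)
  have unz: "u y \<noteq> 0" if "cmod y < rad0" for y
  proof -
    have "vec_factor n \<zeta> x y \<noteq> 0"
      using x that unfolding good_sols_def by (auto simp only: mem_Collect_eq mem_ball_0)
    then show ?thesis using eq[of y] that by simp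
  qed
  have "poly (vec_Q n (snd x)) s \<noteq> 0" if "cmod s \<le> eps0" for s
    using that by (rule zero_free_improve(1)[OF large sol _ _ u, rotated 3]) (assumption | rule \<zeta>' Q unz)+
  then show "poly (vec_Q n (snd x)) s \<noteq> 0" if "s \<in> cball 0 eps0" using that by simp
  have "u y \<noteq> 0" if "cmod y \<le> rad0" for y
    using that by (rule zero_free_improve(2)[OF large sol _ _ u, rotated 3]) (assumption | rule \<zeta>' Q unz)+
  then show "vec_factor n \<zeta> x y \<noteq> 0" if "y \<in> cball 0 rad0" using that eq[of y] by simp
  define k where "k = ln (cmod (poly (vec_Q n (snd x)) 0)) + 2*real n - 2*real n*ln 2"
  have "\<exists>v. v holomorphic_on ball 0 rad0 \<and> (\<forall>y\<in>ball 0 rad0. u y = exp (v y) \<and> \<bar>Re (v y) - k\<bar> \<le> 34 * mu0*real n)"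
    unfolding k_def by (rule spline_factor_log(2)[OF large sol _ _ u]) (assumption | rule \<zeta>' Q unz)+
  then obtain v where v: "\<And>y. cmod y < rad0 \<Longrightarrow> u y = exp (v y)"
    "\<And>y. cmod y < rad0 \<Longrightarrow> \<bar>Re (v y) - k\<bar> \<le> 34 * mu0*real n" by auto
  have Q0: "poly (vec_Q n (snd x)) 0 \<noteq> 0" using Q[of 0] c by simp
  show "cmod (poly (vec_Q n (snd x)) 0)*exp (2*real n - 2*real n*ln 2 - 34 * mu0*real n)
       \<le> cmod (vec_factor n \<zeta> x y)" if "y \<in> ball 0 rad0"
  proof -
    have y: "cmod y < rad0" using that by simp
    have "cmod (poly (vec_Q n (snd x)) 0)*exp (2*real n - 2*real n*ln 2 - 34 * mu0*real n)
        = exp (k - 34 * mu0*real n)"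
    proof -
      have "a*exp X = exp (ln a + X)" if "0 < a" for a X :: real using that by (simp add: exp_add)
      moreover have "k - 34 * mu0*real n = ln (cmod (poly (vec_Q n (snd x)) 0)) + (2*real n - 2*real n*ln 2 - 34 * mu0*real n)"
        by (simp add: k_def)
      ultimately show ?thesis using Q0 by simp
    qed
    also have "\<dots> \<le> exp (Re (v y))" using v(2)[OF y] by simp
    also have "\<dots> = cmod (vec_factor n \<zeta> x y)" using v(1)[OF y] eq[of y] y by simp
    finally show ?thesis .
  qed
qed


text \<open>By the bootstrap step goodness on the open disks equals nonvanishing on the closed ones,
  and these are compact.\<close>

lemma good_sols_openin:
  assumes large: "large n" and \<zeta>: "\<And>j. j < 2*n+1 \<Longrightarrow> cmod (\<zeta> j) \<le> del0"
  shows "openin (top_of_set (sols n \<zeta>)) (good_sols n \<zeta>)"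
proof -
  have S: "sols n \<zeta> \<subseteq> {0..1} \<times> UNIV" unfolding sols_def by (force simp: mem_Times_iff simp del: sum.lessThan_Suc)
  have c1: "continuous_on (sols n \<zeta> \<times> cball 0 eps0) (\<lambda>(x, s). poly (vec_Q n (snd x)) s)"
    unfolding split_beta by (intro continuous_on_vec_Q continuous_intros)
  have "continuous_on (({0..1} \<times> UNIV) \<times> cball 0 rad0) (\<lambda>(x, y). vec_factor n \<zeta> x y)"
    by (rule vec_factor_continuous[OF _ del0]) (rule \<zeta>)
  then have c2: "continuous_on (sols n \<zeta> \<times> cball 0 rad0) (\<lambda>(x, y). vec_factor n \<zeta> x y)"
    by (rule continuous_on_subset) (use S in blast)
  have "good_sols n \<zeta> = {x \<in> sols n \<zeta>. \<forall>s\<in>cball 0 eps0. poly (vec_Q n (snd x)) s \<noteq> 0} \<inter>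
      {x \<in> sols n \<zeta>. \<forall>y\<in>cball 0 rad0. vec_factor n \<zeta> x y \<noteq> 0}" (is "_ = ?A \<inter> ?B")
  proof
    show "good_sols n \<zeta> \<subseteq> ?A \<inter> ?B"
    proof
      fix x assume x: "x \<in> good_sols n \<zeta>"
      have "poly (vec_Q n (snd x)) s \<noteq> 0" if "s \<in> cball 0 eps0" for s
        using that by (rule good_solsD(1)[OF large _ x, rotated]) (rule \<zeta>)
      moreover have "vec_factor n \<zeta> x y \<noteq> 0" if "y \<in> cball 0 rad0" for y
        using that by (rule good_solsD(2)[OF large _ x, rotated]) (rule \<zeta>)
      moreover have "x \<in> sols n \<zeta>" using x by (simp only: good_sols_def mem_Collect_eq)
      ultimately show "x \<in> ?A \<inter> ?B" by blast
    qed
    show "?A \<inter> ?B \<subseteq> good_sols n \<zeta>"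
      unfolding good_sols_def using ball_subset_cball by fast
  qed
  then show ?thesis
    using openin_Int[OF openin_nonvanishing[OF compact_cball c1] openin_nonvanishing[OF compact_cball c2]]
    by (simp only:)
qed

text \<open>Goodness is rewritten as a family of non-strict inequalities between continuous
  functions: the upper bounds \<open>A\<close> and lower bounds \<open>B\<close> for |Q|, and the
  lower bounds \<open>C\<close> for |u|, all relative to |Q(0)|.\<close>

lemma good_sols_closedin:
  assumes large: "large n" and \<zeta>: "\<And>j. j < 2*n+1 \<Longrightarrow> cmod (\<zeta> j) \<le> del0"
  shows "closedin (top_of_set (sols n \<zeta>)) (good_sols n \<zeta>)"
proof -
  note c = const_bounds
  have n: "1 \<le> n" using large by (simp add: large_def)
  have S: "sols n \<zeta> \<subseteq> {0..1} \<times> UNIV" unfolding sols_def by (force simp: mem_Times_iff simp del: sum.lessThan_Suc)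
  define K where "K = exp (2*real n - 2*real n*ln 2 - 34 * mu0*real n)"
  define q where "q = (\<lambda>(x :: real \<times> (nat \<Rightarrow> complex)) s. cmod (poly (vec_Q n (snd x)) s))"
  have cq: "continuous_on (sols n \<zeta>) (\<lambda>x. q x s)" for s
    unfolding q_def by (intro continuous_on_norm continuous_on_vec_Q continuous_intros)
  have cv: "continuous_on (sols n \<zeta>) (\<lambda>x. cmod (vec_factor n \<zeta> x y))" if "cmod y \<le> rad0" for y
  proof -
    have "continuous_on (({0..1} \<times> UNIV) \<times> cball 0 rad0) (\<lambda>(x, y). vec_factor n \<zeta> x y)"
      by (rule vec_factor_continuous[OF _ del0]) (rule \<zeta>)
    then have "continuous_on (sols n \<zeta>) (\<lambda>x. case (x, y) of (x, y) \<Rightarrow> vec_factor n \<zeta> x y)"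
      by (rule continuous_on_compose2) (use S that in \<open>auto intro!: continuous_intros\<close>)
    then show ?thesis by (simp add: continuous_on_norm)
  qed
  have closed_le: "closedin (top_of_set (sols n \<zeta>)) {x \<in> sols n \<zeta>. f x \<le> g x}"
    if "continuous_on (sols n \<zeta>) f" "continuous_on (sols n \<zeta>) g" for f g :: "_ \<Rightarrow> real"
  proof -
    have "closedin (top_of_set (sols n \<zeta>)) (sols n \<zeta> \<inter> (\<lambda>x. g x - f x) -` {0..})"
      by (intro continuous_closedin_preimage continuous_intros that)
    moreover have "sols n \<zeta> \<inter> (\<lambda>x. g x - f x) -` {0..} = {x \<in> sols n \<zeta>. f x \<le> g x}" by auto
    ultimately show ?thesis by simp
  qed
  define A where "A = (\<Inter>s. {x \<in> sols n \<zeta>. q x s \<le> q x 0*(1 + cmod s/eps0)^n})"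
  define B where "B = (\<Inter>s\<in>ball 0 eps0. {x \<in> sols n \<zeta>. q x 0*(1 - cmod s/eps0)^n \<le> q x s})"
  define C where "C = (\<Inter>y\<in>ball 0 rad0. {x \<in> sols n \<zeta>. q x 0 * K \<le> cmod (vec_factor n \<zeta> x y)})"
  have "closedin (top_of_set (sols n \<zeta>)) A"
    unfolding A_def by (rule closedin_INT) (intro UNIV_not_empty, intro closed_le continuous_on_mult_right cq)
  moreover have "closedin (top_of_set (sols n \<zeta>)) B"
    unfolding B_def by (rule closedin_INT) (use c in \<open>auto intro!: closed_le continuous_on_mult_right cq\<close>)
  moreover have "closedin (top_of_set (sols n \<zeta>)) C"
    unfolding C_def by (rule closedin_INT) (use c in \<open>auto intro!: closed_le continuous_on_mult_right cq cv\<close>)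
  moreover have "good_sols n \<zeta> = A \<inter> (B \<inter> C)"
  proof (intro equalityI subsetI)
    fix x assume x: "x \<in> good_sols n \<zeta>"
    have xs: "x \<in> sols n \<zeta>" using x by (simp only: good_sols_def mem_Collect_eq)
    have Qnz: "poly (vec_Q n (snd x)) s \<noteq> 0" if "cmod s < eps0" for s
      using x that unfolding good_sols_def by (auto simp only: mem_Collect_eq mem_ball_0)
    have "x \<in> A"
      unfolding A_def q_def using norm_poly_zero_free_le[OF c(1) Qnz degree_vec(1)] xs by blast
    moreover have "x \<in> B"
      unfolding B_def q_def using norm_poly_zero_free_ge[OF c(1) Qnz degree_vec(1)] xs by (auto simp: less_imp_le)
    moreover have "x \<in> C"
    proof -
      have "q x 0 * K \<le> cmod (vec_factor n \<zeta> x y)" if "y \<in> ball 0 rad0" for y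
        unfolding q_def K_def using that by (rule good_solsD(3)[OF large _ x, rotated]) (rule \<zeta>)
      then show ?thesis unfolding C_def using xs by blast
    qed
    ultimately show "x \<in> A \<inter> (B \<inter> C)" by blast
  next
    fix x assume x: "x \<in> A \<inter> (B \<inter> C)"
    have xs: "x \<in> sols n \<zeta>" using x by (auto simp only: A_def)
    obtain H u where sol: "solution n (\<lambda>j. of_real (fst x) * \<zeta> j) (vec_P n (snd x)) (vec_Q n (snd x)) H"
      and \<zeta>': "\<And>j. j < 2*n+1 \<Longrightarrow> cmod (of_real (fst x) * \<zeta> j) \<le> del0"
      by (rule sols_obtain[OF _ n xs]) (erule \<zeta>, rule that)
    have Qnz: "vec_Q n (snd x) \<noteq> 0"
      by (rule solution_Q_nonzero[OF sol _ del0(1)]) (rule \<zeta>')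
    \<comment> \<open>The lower bounds have content only for nonzero Q(0). If Q(0) were 0, the upper
      bounds in \<open>A\<close> would force Q = 0.\<close>
    have q0: "0 < q x 0"
    proof (rule ccontr)
      assume "\<not> 0 < q x 0"
      then have q0: "q x 0 = 0" by (simp add: q_def)
      have "q x s \<le> q x 0*(1 + cmod s/eps0)^n" for s using x by (auto simp only: A_def)
      then have "poly (vec_Q n (snd x)) s = 0" for s unfolding q0 by (simp add: q_def)
      then have "vec_Q n (snd x) = 0" using poly_all_0_iff_0 by blast
      then show False using Qnz by simp
    qed
    show "x \<in> good_sols n \<zeta>"
      unfolding good_sols_def
    proof (intro CollectI conjI ballI xs)
      fix s :: complex assume s: "s \<in> ball 0 eps0"
      then have "q x 0*(1 - cmod s/eps0)^n \<le> q x s" using x by (auto simp only: B_def)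
      moreover have "0 < q x 0*(1 - cmod s/eps0)^n" using q0 s c by simp
      ultimately have "0 < q x s" by linarith
      then show "poly (vec_Q n (snd x)) s \<noteq> 0" by (simp add: q_def)
    next
      fix y :: complex assume y: "y \<in> ball 0 rad0"
      then have "q x 0 * K \<le> cmod (vec_factor n \<zeta> x y)" using x by (auto simp only: C_def)
      moreover have "0 < q x 0 * K" using q0 by (simp add: K_def)
      ultimately have "0 < cmod (vec_factor n \<zeta> x y)" by linarith
      then show "vec_factor n \<zeta> x y \<noteq> 0" by simp
    qed
  qed
  ultimately show ?thesis by (simp only: closedin_Int)
qed


lemma good_sols_scale:
  assumes \<zeta>: "\<And>j. j < 2*n+1 \<Longrightarrow> cmod (\<zeta> j) \<le> del0" and n: "1 \<le> n"
    and x: "(t, c) \<in> good_sols n \<zeta>" and k: "k \<noteq> 0" and c': "\<And>i. i < 2*n+2 \<Longrightarrow> c' i = k*c i"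
  shows "(t, c') \<in> good_sols n \<zeta>"
proof -
  have xs: "(t, c) \<in> sols n \<zeta>" using x by (simp only: good_sols_def mem_Collect_eq)
  obtain H u where t: "t \<in> {0..1}" and sol: "solution n (\<lambda>j. of_real t * \<zeta> j) (vec_P n c) (vec_Q n c) H"
    and \<zeta>': "\<And>j. j < 2*n+1 \<Longrightarrow> cmod (of_real t * \<zeta> j) \<le> del0"
    and u: "spline_factor n (\<lambda>j. of_real t * \<zeta> j) (vec_Q n c) u"
    by (rule sols_obtain[OF _ n xs]) (erule \<zeta>, rule that, simp_all only: fst_conv snd_conv)
  have Q': "vec_Q n c' = smult k (vec_Q n c)" by (rule poly_eqI) (use c' in \<open>simp add: coeff_vec\<close>)
  have P': "vec_P n c' = smult k (vec_P n c)" by (rule poly_eqI) (use c' in \<open>simp add: coeff_vec\<close>)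
  have sol': "solution n (\<lambda>j. of_real t * \<zeta> j) (vec_P n c') (vec_Q n c') (\<lambda>s. k*H s)"
    using sol k unfolding solution_def Q' P' by (auto intro!: holomorphic_intros simp flip: distrib_left simp: mult_ac)
  have xs': "(t, c') \<in> sols n \<zeta>"
    using sol' t by (subst sols_iff[OF _ del0]) (rule \<zeta>, auto)
  have spl: "spline n (\<lambda>j. of_real t * \<zeta> j) 1 (vec_Q n c') y = k * spline n (\<lambda>j. of_real t * \<zeta> j) 1 (vec_Q n c) y" for y
  proof -
    have "node_mean n (\<lambda>j. of_real t * \<zeta> j) 1 (\<lambda>s. k*(poly (vec_Q n c) s*exp (of_nat n * s * y)))
        = k*node_mean n (\<lambda>j. of_real t * \<zeta> j) 1 (\<lambda>s. poly (vec_Q n c) s*exp (of_nat n * s * y))"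
      by (rule node_mean_cmult[OF _ del0]) (rule \<zeta>', assumption, intro continuous_intros)
    then show ?thesis by (simp add: spline_def Q' mult.assoc)
  qed
  have u': "spline_factor n (\<lambda>j. of_real t * \<zeta> j) (vec_Q n c') (\<lambda>y. k * u y)"
    using u by (auto simp: spline_factor_def spl intro!: holomorphic_intros)
  have eq: "vec_factor n \<zeta> (t, c') y = k * vec_factor n \<zeta> (t, c) y" if "cmod y < rad0" for y
    using vec_factor_eq[of n "(t, c)" \<zeta> u y] vec_factor_eq[of n "(t, c')" \<zeta> "\<lambda>y. k * u y" y] u u' that by simp
  show ?thesis
    unfolding good_sols_def
  proof (intro CollectI conjI ballI xs')
    fix s :: complex assume "s \<in> ball 0 eps0"
    then have "poly (vec_Q n (snd (t, c))) s \<noteq> 0" using x by (auto simp only: good_sols_def)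
    then show "poly (vec_Q n (snd (t, c'))) s \<noteq> 0" using k by (simp add: Q')
  next
    fix y :: complex assume y: "y \<in> ball 0 rad0"
    then have "vec_factor n \<zeta> (t, c) y \<noteq> 0" using x by (auto simp only: good_sols_def)
    then show "vec_factor n \<zeta> (t, c') y \<noteq> 0" using eq[of y] k y by simp
  qed
qed

text \<open>Otherwise the segment from \<open>c\<close> to \<open>c'\<close> would leave the open and closed set of good solutions.\<close>

lemma good_sols_fibre:
  assumes large: "large n" and \<zeta>: "\<And>j. j < 2*n+1 \<Longrightarrow> cmod (\<zeta> j) \<le> del0"
    and x: "(t, c) \<in> good_sols n \<zeta>" and x': "(t, c') \<in> sols n \<zeta>"
  shows "c' 0 \<noteq> 0"
proof
  assume z: "c' 0 = 0"
  have c0: "d 0 \<noteq> 0" if "(t, d) \<in> good_sols n \<zeta>" for d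
  proof -
    have "poly (vec_Q n d) 0 \<noteq> 0" using that const_bounds(1) by (simp add: good_sols_def)
    then show ?thesis by (simp add: poly_0_coeff_0 coeff_vec)
  qed
  have xs: "(t, c) \<in> sols n \<zeta>" using x by (simp only: good_sols_def mem_Collect_eq)
  define g where "g = (\<lambda>v::real. (t, (\<lambda>i. of_real (1 - v)*c i + of_real v * c' i)))"
  have ends: "g 0 = (t, c)" "g 1 = (t, c')" by (simp_all add: g_def)
  have eqs: "(\<Sum>i<2*n+2. d i * moment n (\<lambda>j. of_real t * \<zeta> j) k i) = 0"
    if "(t, d) \<in> sols n \<zeta>" "k < 2*n+1" for d k
    using that unfolding sols_def by (auto simp only: mem_Collect_eq fst_conv snd_conv)
  \<comment> \<open>Before the end point the entry 0 of the combination is (1 - v) c 0, so it cannot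
    vanish identically and is a genuine solution.\<close>
  have gS: "g v \<in> sols n \<zeta>" if v: "v \<in> {0..1}" for v
  proof (cases "v = 1")
    case False
    define d where "d = (\<lambda>i. of_real (1 - v)*c i + of_real v * c' i)"
    have "d 0 \<noteq> 0" using c0[OF x] False by (simp add: d_def z)
    moreover have "(\<Sum>i<2*n+2. d i * moment n (\<lambda>j. of_real t * \<zeta> j) k i) = 0" if "k < 2*n+1" for k
    proof -
      have "(\<Sum>i<2*n+2. d i * moment n (\<lambda>j. of_real t * \<zeta> j) k i)
        = of_real (1 - v)*(\<Sum>i<2*n+2. c i * moment n (\<lambda>j. of_real t * \<zeta> j) k i)
          + of_real v * (\<Sum>i<2*n+2. c' i * moment n (\<lambda>j. of_real t * \<zeta> j) k i)"
        by (simp only: d_def distrib_right sum.distrib sum_distrib_left mult.assoc)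
      then show ?thesis unfolding eqs[OF xs that] eqs[OF x' that] by simp
    qed
    moreover have "t \<in> {0..1}" using xs unfolding sols_def by (auto simp only: mem_Collect_eq fst_conv)
    moreover have "0 < 2*n+2" by simp
    ultimately have "(t, d) \<in> sols n \<zeta>" unfolding sols_def fst_conv snd_conv mem_Collect_eq by blast
    then show ?thesis by (simp add: g_def d_def)
  qed (simp add: ends x')
  have cont: "continuous_on {0..1} g"
    unfolding g_def by (intro continuous_on_Pair continuous_on_coordinatewise_then_product continuous_intros)
  define V where "V = {0..1} \<inter> g -` good_sols n \<zeta>"
  have im: "g \<in> {0..1} \<rightarrow> sols n \<zeta>" using gS by blast
  have "openin (top_of_set {0..1}) V"
    unfolding V_def by (rule continuous_openin_preimage[OF cont im good_sols_openin[OF large]]) (rule \<zeta>)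
  moreover have "closedin (top_of_set {0..1}) V"
    unfolding V_def by (rule continuous_closedin_preimage_gen[OF cont im good_sols_closedin[OF large]]) (rule \<zeta>)
  moreover have "connected {0..1::real}" by simp
  ultimately have "V = {} \<or> V = {0..1}" unfolding connected_clopen by blast
  moreover have "0 \<in> V" using x by (simp add: V_def ends)
  ultimately have "1 \<in> V" by auto
  then have "(t, c') \<in> good_sols n \<zeta>" by (simp add: V_def ends)
  then show False using c0 z by blast
qed

text \<open>Subtracting the multiple of c that cancels the entry 0 of c' leaves a vector in the
  kernel of the moment equations with Q(0) = 0, which must be zero. So the fibre over t is
  one-dimensional, and goodness is invariant under scaling.\<close>

lemma good_sols_fibre_all:
  assumes large: "large n" and \<zeta>: "\<And>j. j < 2*n+1 \<Longrightarrow> cmod (\<zeta> j) \<le> del0"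
    and x: "(t, c) \<in> good_sols n \<zeta>" and x': "(t, c') \<in> sols n \<zeta>"
  shows "(t, c') \<in> good_sols n \<zeta>"
proof -
  have n: "1 \<le> n" using large by (simp add: large_def)
  have xs: "(t, c) \<in> sols n \<zeta>" using x by (simp only: good_sols_def mem_Collect_eq)
  have c0: "c 0 \<noteq> 0" by (rule good_sols_fibre[OF large _ x xs]) (rule \<zeta>)
  have c0': "c' 0 \<noteq> 0" by (rule good_sols_fibre[OF large _ x x']) (rule \<zeta>)
  define d where "d = (\<lambda>i. c' i - c' 0/c 0*c i)"
  have d0: "d 0 = 0" using c0 by (simp add: d_def)
  have eqs: "(\<Sum>i<2*n+2. d i * moment n (\<lambda>j. of_real t * \<zeta> j) k i) = 0"
    if "(t, d) \<in> sols n \<zeta>" "k < 2*n+1" for d k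
    using that unfolding sols_def by (auto simp only: mem_Collect_eq fst_conv snd_conv)
  have eqd: "(\<Sum>i<2*n+2. d i * moment n (\<lambda>j. of_real t * \<zeta> j) k i) = 0" if "k < 2*n+1" for k
  proof -
    have "(\<Sum>i<2*n+2. d i * moment n (\<lambda>j. of_real t * \<zeta> j) k i)
      = (\<Sum>i<2*n+2. c' i * moment n (\<lambda>j. of_real t * \<zeta> j) k i)
        - c' 0/c 0*(\<Sum>i<2*n+2. c i * moment n (\<lambda>j. of_real t * \<zeta> j) k i)"
      by (simp only: d_def left_diff_distrib sum_subtractf sum_distrib_left mult.assoc)
    then show ?thesis unfolding eqs[OF xs that] eqs[OF x' that] by simp
  qed
  have dz: "d i = 0" if "i < 2*n+2" for i
  proof (rule ccontr)
    assume "d i \<noteq> 0"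
    moreover have "t \<in> {0..1}" using xs unfolding sols_def by (auto simp only: mem_Collect_eq fst_conv)
    ultimately have ds: "(t, d) \<in> sols n \<zeta>"
      unfolding sols_def fst_conv snd_conv mem_Collect_eq using that eqd by blast
    have "d 0 \<noteq> 0" by (rule good_sols_fibre[OF large _ x ds]) (rule \<zeta>)
    then show False using d0 by simp
  qed
  show ?thesis
  proof (rule good_sols_scale[OF _ n x])
    show "c' 0/c 0 \<noteq> 0" using c0 c0' by simp
    show "c' i = c' 0/c 0*c i" if "i < 2*n+2" for i using dz[OF that] by (simp add: d_def)
  qed (rule \<zeta>)
qed

lemma moment_continuous:
  assumes \<zeta>: "\<And>j. j < 2*n+1 \<Longrightarrow> cmod (\<zeta> j) \<le> \<delta>" and \<delta>: "0 \<le> \<delta>" "\<delta> < 1"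
  shows "continuous_on {0..1} (\<lambda>t. moment n (\<lambda>j. of_real t * \<zeta> j) k i)"
proof -
  define U where "U = ball (0::complex) (1/(\<delta> + (1 - \<delta>)/2))"
  have e: "0 < \<delta> + (1 - \<delta>)/2" "\<delta> + (1 - \<delta>)/2 < 1" "\<delta> \<le> \<delta> + (1 - \<delta>)/2" using \<delta> by (auto simp: field_simps)
  have "(\<lambda>t. node_mean n (\<lambda>j. t * \<zeta> j) 1 (\<lambda>s. basis n i s * s^k)) holomorphic_on U"
  proof (rule node_mean_scaled_holomorphic[OF _ \<delta>(1)])
    show "continuous_on (sphere 0 1) (\<lambda>s. basis n i s * s^k)"
      by (intro continuous_intros basis_continuous)
    show "cmod t * \<delta> < 1" if "t \<in> U" for t
    proof -
      have "cmod t*(\<delta> + (1 - \<delta>)/2) < 1" using that e by (simp add: U_def pos_less_divide_eq)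
      moreover have "cmod t * \<delta> \<le> cmod t*(\<delta> + (1 - \<delta>)/2)" using e by (intro mult_left_mono) auto
      ultimately show ?thesis by linarith
    qed
  qed (use \<zeta> in \<open>auto simp: U_def\<close>)
  then have "continuous_on U (\<lambda>t. moment n (\<lambda>j. t * \<zeta> j) k i)"
    unfolding moment_def by (rule holomorphic_on_imp_continuous_on)
  then show ?thesis
  proof (rule continuous_on_compose2)
    have "1 < 1/(\<delta> + (1 - \<delta>)/2)" using e by simp
    then show "complex_of_real ` {0..1} \<subseteq> U" by (auto simp: U_def)
  qed (intro continuous_intros)
qed

text \<open>Tychonoff's theorem: the vectors have infinitely many entries, so compactness is that of
  an infinite product of disks.\<close>

lemma compact_box: "compact {c :: nat \<Rightarrow> complex. \<forall>i. c i \<in> cball 0 1}"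
proof -
  have "compactin (product_topology (\<lambda>i. euclidean) UNIV) (Pi\<^sub>E UNIV (\<lambda>i::nat. cball (0::complex) 1))"
    by (subst compactin_PiE) auto
  moreover have "Pi\<^sub>E UNIV (\<lambda>i::nat. cball (0::complex) 1) = {c. \<forall>i. c i \<in> cball 0 1}" by auto
  ultimately show ?thesis by (simp only: euclidean_product_topology compactin_euclidean_iff)
qed

text \<open>Normalized solutions form a compact set, so the parameters t over which some normalized
  solution is good, and those over which some is not, form two closed sets. They cover [0, 1], and
  they are disjoint because goodness is constant on each fibre. As [0, 1] is connected and t = 0 is
  of the good kind, so is t = 1.\<close>

lemma good_sols_all:
  assumes large: "large n" and \<zeta>: "\<And>j. j < 2*n+1 \<Longrightarrow> cmod (\<zeta> j) \<le> del0"
    and x: "(1, c) \<in> sols n \<zeta>"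
  shows "(1, c) \<in> good_sols n \<zeta>"
proof -
  have n: "1 \<le> n" using large by (simp add: large_def)
  define B where "B = {0..1::real} \<times> {c :: nat \<Rightarrow> complex. \<forall>i. c i \<in> cball 0 1}"
  have compB: "compact B" unfolding B_def by (intro compact_Times compact_Icc compact_box)
  have ci: "continuous_on B (\<lambda>x. snd x i)" for i
    by (rule continuous_on_product_then_coordinatewise) (intro continuous_intros)
  \<comment> \<open>Normalization in the maximum norm: all entries have modulus at most 1 and one of
    the first 2 n + 2 has modulus 1, which excludes convergence to the zero vector.\<close>
  define N where "N = (\<Union>i<2*n+2. B \<inter> (\<lambda>x. cmod (snd x i)) -` {1}) \<inter>
    (\<Inter>k<2*n+1. B \<inter> (\<lambda>x. \<Sum>i<2*n+2. snd x i * moment n (\<lambda>j. of_real (fst x) * \<zeta> j) k i) -` {0})"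
  have cl1: "closedin (top_of_set B) (B \<inter> (\<lambda>x. \<Sum>i<2*n+2. snd x i * moment n (\<lambda>j. of_real (fst x) * \<zeta> j) k i) -` {0})" for k
  proof (rule continuous_closedin_preimage)
    have "continuous_on B (\<lambda>x. moment n (\<lambda>j. of_real (fst x) * \<zeta> j) k i)" for i
    proof -
      have "continuous_on {0..1} (\<lambda>t. moment n (\<lambda>j. of_real t * \<zeta> j) k i)"
        by (rule moment_continuous[OF _ del0]) (rule \<zeta>)
      then show ?thesis
        by (rule continuous_on_compose2[where f = fst]) (intro continuous_intros, auto simp only: B_def fst_conv)
    qed
    then show "continuous_on B (\<lambda>x. \<Sum>i<2*n+2. snd x i * moment n (\<lambda>j. of_real (fst x) * \<zeta> j) k i)"
      by (intro continuous_on_sum continuous_on_mult ci)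
  qed simp
  have cl2: "closedin (top_of_set B) (B \<inter> (\<lambda>x. cmod (snd x i)) -` {1})" for i
    by (intro continuous_closedin_preimage continuous_on_norm ci) simp
  have "closedin (top_of_set B) (\<Union>i<2*n+2. B \<inter> (\<lambda>x. cmod (snd x i)) -` {1})"
    by (rule closedin_Union) (use cl2 in blast)+
  moreover have "closedin (top_of_set B)
      (\<Inter>k<2*n+1. B \<inter> (\<lambda>x. \<Sum>i<2*n+2. snd x i * moment n (\<lambda>j. of_real (fst x) * \<zeta> j) k i) -` {0})"
    by (rule closedin_INT[OF _ cl1]) auto
  ultimately have "closedin (top_of_set B) N" unfolding N_def by (rule closedin_Int)
  then have compN: "compact N" by (rule closedin_compact[OF compB])
  have NS: "N \<subseteq> sols n \<zeta>"
  proof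
    fix x assume x: "x \<in> N"
    have "\<exists>i<2*n+2. snd x i \<noteq> 0"
    proof -
      obtain i where "i < 2*n+2" "cmod (snd x i) = 1" using x by (auto simp only: N_def)
      then show ?thesis by (intro exI[of _ i]) auto
    qed
    moreover have "(\<Sum>i<2*n+2. snd x i * moment n (\<lambda>j. of_real (fst x) * \<zeta> j) k i) = 0" if "k < 2*n+1" for k
      using x that by (auto simp only: N_def)
    moreover have "fst x \<in> {0..1}" using x by (auto simp only: N_def B_def fst_conv)
    ultimately show "x \<in> sols n \<zeta>" unfolding sols_def by blast
  qed
  have normalize: "\<exists>k d. k \<noteq> 0 \<and> (\<forall>i<2*n+2. c i = k * d i) \<and> (t, d) \<in> N" if tc: "(t, c) \<in> sols n \<zeta>" for t c
  proof -
    have tc': "t \<in> {0..1}" "\<exists>i<2*n+2. c i \<noteq> 0"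
        "\<And>k. k < 2*n+1 \<Longrightarrow> (\<Sum>i<2*n+2. c i * moment n (\<lambda>j. of_real t * \<zeta> j) k i) = 0"
      using tc unfolding sols_def by (auto simp only: mem_Collect_eq fst_conv snd_conv)
    define M where "M = Max ((\<lambda>i. cmod (c i)) ` {..<2*n+2})"
    have fin: "finite ((\<lambda>i. cmod (c i)) ` {..<2*n+2})" "(\<lambda>i. cmod (c i)) ` {..<2*n+2} \<noteq> {}" by auto
    have Mge: "cmod (c i) \<le> M" if "i < 2*n+2" for i
      unfolding M_def using that by (intro Max_ge fin(1)) blast
    obtain i0 where i0: "i0 < 2*n+2" "cmod (c i0) = M"
      using Max_in[OF fin] unfolding M_def[symmetric] by (auto simp only: image_iff lessThan_iff)
    have M: "0 < M"
    proof -
      obtain i where "i < 2*n+2" "c i \<noteq> 0" using tc'(2) by blast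
      then show ?thesis using Mge[of i] by (meson less_le_trans zero_less_norm_iff)
    qed
    define d where "d = (\<lambda>i. if i < 2*n+2 then c i/of_real M else 0)"
    have cd: "c i = of_real M * d i" if "i < 2*n+2" for i using that M by (simp add: d_def)
    have dB: "(t, d) \<in> B"
      using tc'(1) M Mge by (auto simp: B_def d_def norm_divide simp del: sum.lessThan_Suc)
    have "cmod (d i0) = 1" using i0 M by (simp add: d_def norm_divide)
    moreover have "(\<Sum>i<2*n+2. d i * moment n (\<lambda>j. of_real t * \<zeta> j) k i) = 0" if "k < 2*n+1" for k
    proof -
      have "of_real M*(\<Sum>i<2*n+2. d i * moment n (\<lambda>j. of_real t * \<zeta> j) k i)
          = (\<Sum>i<2*n+2. c i * moment n (\<lambda>j. of_real t * \<zeta> j) k i)"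
        unfolding sum_distrib_left by (rule sum.cong) (use cd in auto)
      then show ?thesis using tc'(3)[OF that] M by simp
    qed
    ultimately have "(t, d) \<in> N" unfolding N_def using dB i0(1) by (auto simp del: sum.lessThan_Suc)
    then show ?thesis using cd M by (intro exI[of _ "of_real M"] exI[of _ del0]) auto
  qed
  have "\<exists>O'. open O' \<and> good_sols n \<zeta> = sols n \<zeta> \<inter> O'"
    unfolding openin_open[symmetric] by (rule good_sols_openin[OF large]) (rule \<zeta>)
  then obtain O' where O': "open O'" "good_sols n \<zeta> = sols n \<zeta> \<inter> O'" by blast
  have "\<exists>C. closed C \<and> good_sols n \<zeta> = sols n \<zeta> \<inter> C"
    unfolding closedin_closed[symmetric] by (rule good_sols_closedin[OF large]) (rule \<zeta>)
  then obtain C where C: "closed C" "good_sols n \<zeta> = sols n \<zeta> \<inter> C" by blast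
  have fib: "(t, c') \<in> good_sols n \<zeta>" if "(t, c) \<in> good_sols n \<zeta>" "(t, c') \<in> sols n \<zeta>" for t c c'
    by (rule good_sols_fibre_all[OF large _ that]) (rule \<zeta>)
  define T0 where "T0 = fst ` (N \<inter> C)"
  define T1 where "T1 = fst ` (N - O')"
  have closed: "closed T0" "closed T1"
    unfolding T0_def T1_def
    by (intro compact_imp_closed compact_continuous_image continuous_intros compact_Int_closed compact_diff compN C(1) O'(1))+
  have ex: "\<exists>c. (t, c) \<in> sols n \<zeta>" if t: "t \<in> {0..1}" for t
  proof -
    have "\<exists>c H. solution n (\<lambda>j. of_real t * \<zeta> j) (vec_P n c) (vec_Q n c) H"
    proof (rule vec_solution_exists[OF _ del0])
      show "cmod (complex_of_real t * \<zeta> j) \<le> del0" if "j < 2*n+1" for j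
        using that by (rule scaled_node_bound[rotated 2]) (rule \<zeta>, use t in auto)
    qed
    then obtain c H where sol: "solution n (\<lambda>j. of_real t * \<zeta> j) (vec_P n c) (vec_Q n c) H" by blast
    have "(t, c) \<in> sols n \<zeta>"
      by (subst sols_iff[OF _ del0]) (rule \<zeta>, use sol t in auto)
    then show ?thesis by blast
  qed
  have cover: "{0..1} \<subseteq> T0 \<union> T1"
  proof
    fix t :: real assume t: "t \<in> {0..1}"
    obtain c where "(t, c) \<in> sols n \<zeta>" using ex[OF t] by blast
    from normalize[OF this] obtain d where d: "(t, d) \<in> N" by blast
    then have "(t, d) \<in> N \<inter> C \<or> (t, d) \<in> N - O'" using NS C(2) O'(2) by blast
    then show "t \<in> T0 \<union> T1" unfolding T0_def T1_def by force
  qed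
  have disj: "T0 \<inter> T1 \<inter> {0..1} = {}"
  proof (rule ccontr)
    assume "T0 \<inter> T1 \<inter> {0..1} \<noteq> {}"
    then obtain t c c' where "(t, c) \<in> N \<inter> C" "(t, c') \<in> N - O'" unfolding T0_def T1_def by force
    then show False using fib[of t c c'] NS C(2) O'(2) by blast
  qed
  have zero: "0 \<in> T0"
  proof -
    obtain c0 where "(0, c0) \<in> sols n \<zeta>" using ex[of 0] by auto
    from normalize[OF this] obtain c where cN: "(0, c) \<in> N" by blast
    then have cs: "(0, c) \<in> sols n \<zeta>" using NS by blast
    obtain H u where sol: "solution n (\<lambda>_. 0) (vec_P n c) (vec_Q n c) H"
      and u: "spline_factor n (\<lambda>_. 0) (vec_Q n c) u"
      by (rule sols_obtain[OF _ n cs]) (erule \<zeta>, rule that, simp_all)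
    have u0: "u y \<noteq> 0" for y
      using zero_nodes_factor(1)[OF n sol u] by (subst zero_nodes_factor(2)[OF n sol u])
    have "(0, c) \<in> good_sols n \<zeta>"
      unfolding good_sols_def
    proof (intro CollectI conjI ballI cs)
      fix s :: complex assume "s \<in> ball 0 eps0"
      then show "poly (vec_Q n (snd (0::real, c))) s \<noteq> 0"
        using zero_nodes_zero_free[OF large sol, of s] by simp
    next
      fix y :: complex assume "y \<in> ball 0 rad0"
      then show "vec_factor n \<zeta> (0, c) y \<noteq> 0"
        using vec_factor_eq[of n "(0, c)" \<zeta> u y] u u0 by simp
    qed
    then show ?thesis unfolding T0_def using cN C(2) by force
  qed
  have "connected {0..1::real}" by simp
  from connected_closedD[OF this disj cover closed] have "T0 \<inter> {0..1} = {} \<or> T1 \<inter> {0..1} = {}" .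
  then have "1 \<notin> T1" using zero by auto
  moreover have "1 \<in> T0 \<union> T1" using cover by (rule subsetD) simp
  ultimately have "1 \<in> T0" by blast
  then obtain c' where "(1, c') \<in> N \<inter> C" unfolding T0_def by force
  then have "(1, c') \<in> good_sols n \<zeta>" using NS C(2) by blast
  then show ?thesis using fib x by blast
qed

section \<open>Uniqueness and the case of vanishing nodes\<close>

lemma solution_zero_free:
  assumes large: "large n" and sol: "solution n \<zeta> P Q H"
    and \<zeta>: "\<And>j. j < 2*n+1 \<Longrightarrow> cmod (\<zeta> j) \<le> del0"
  shows "cmod s \<le> eps0 \<Longrightarrow> poly Q s \<noteq> 0"
    "cmod z \<le> 1/1000 \<Longrightarrow> exp (- 4*real n)*cmod (poly Q 0) \<le> cmod (H z)
       \<and> cmod (H z) \<le> exp (4*real n)*cmod (poly Q 0)"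
proof -
  have n: "1 \<le> n" using large by (simp add: large_def)
  have deg: "degree P \<le> n" "degree Q \<le> n" using sol by (auto simp: solution_def)
  define c where "c = (\<lambda>i. if i \<le> n then coeff Q i else coeff P (i - (n + 1)))"
  have c: "vec_Q n c = Q" "vec_P n c = P" unfolding c_def using vec_surj[OF deg] by auto
  have "(1, c) \<in> sols n \<zeta>"
    by (subst sols_iff[OF _ del0]) (rule \<zeta>, use sol c in auto)
  then have good: "(1, c) \<in> good_sols n \<zeta>"
    by (rule good_sols_all[OF large, rotated]) (rule \<zeta>)
  have Q: "poly Q s \<noteq> 0" if "cmod s < eps0" for s
    using good that c unfolding good_sols_def by (auto simp only: mem_Collect_eq mem_ball_0 snd_conv)
  have "\<exists>u. u holomorphic_on UNIV \<and> (\<forall>y. spline n \<zeta> 1 Q y = (y*(y - 1))^n * u y)"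
    by (rule spline_factor_exists[OF n sol _ del0]) (rule \<zeta>)
  then obtain u where u: "spline_factor n \<zeta> Q u" unfolding spline_factor_def by blast
  have unz: "u y \<noteq> 0" if y: "cmod y < rad0" for y
  proof -
    have "vec_factor n \<zeta> (1, c) y \<noteq> 0"
      using good y unfolding good_sols_def by (auto simp only: mem_Collect_eq mem_ball_0)
    then show ?thesis using vec_factor_eq[of n "(1, c)" \<zeta> u y] u c y by simp
  qed
  show "poly Q s \<noteq> 0" if "cmod s \<le> eps0"
    using that by (rule zero_free_improve(1)[OF large sol _ _ u, rotated 3]) (assumption | rule \<zeta> Q unz)+
  show "exp (- 4*real n)*cmod (poly Q 0) \<le> cmod (H z) \<and> cmod (H z) \<le> exp (4*real n)*cmod (poly Q 0)"
    if "cmod z \<le> 1/1000"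
    using that by (rule zero_free_improve(3)[OF large sol _ _ u, rotated 3]) (assumption | rule \<zeta> Q unz)+
qed

lemma solution_Q0:
  assumes "large n" "solution n \<zeta> P Q H" "\<And>j. j < 2*n+1 \<Longrightarrow> cmod (\<zeta> j) \<le> del0"
  shows "poly Q 0 \<noteq> 0"
  by (rule solution_zero_free(1)[OF assms(1,2)]) (use assms(3) const_bounds in auto)

lemma solution_smult:
  assumes "solution n \<zeta> P Q H" "k \<noteq> 0"
  shows "solution n \<zeta> (smult k P) (smult k Q) (\<lambda>s. k*H s)"
proof -
  have "exp (of_nat n * s)*poly (smult k Q) s + poly (smult k P) s = node_poly n \<zeta> s*(k*H s)" for s
  proof -
    have "exp (of_nat n * s)*poly (smult k Q) s + poly (smult k P) s = k*(exp (of_nat n * s)*poly Q s + poly P s)"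
      by (simp add: algebra_simps)
    then show ?thesis using assms(1) by (simp add: solution_def)
  qed
  then show ?thesis using assms by (auto simp: solution_def intro!: holomorphic_intros)
qed

text \<open>If the pairs differed, their difference would be a solution with Q(0) = 0, which
  zero-freeness forbids. Then H agrees as well, since Cauchy's formula expresses it through
  Q.\<close>

lemma solution_unique:
  assumes large: "large n" and sol: "solution n \<zeta> P Q H" "solution n \<zeta> P' Q' H'"
    and \<zeta>: "\<And>j. j < 2*n+1 \<Longrightarrow> cmod (\<zeta> j) \<le> del0" and eq: "poly Q 0 = poly Q' 0"
  shows "P = P'" "Q = Q'" "H z = H' z"
proof -
  have PQ: "P - P' = 0 \<and> Q - Q' = 0"
  proof (rule ccontr)
    assume nz: "\<not> (P - P' = 0 \<and> Q - Q' = 0)"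
    have "exp (of_nat n * s)*poly (Q - Q') s + poly (P - P') s = node_poly n \<zeta> s*(H s - H' s)" for s
      using sol by (simp add: solution_def algebra_simps)
    then have "solution n \<zeta> (P - P') (Q - Q') (\<lambda>s. H s - H' s)"
      using nz sol unfolding solution_def
      by (auto intro!: holomorphic_intros degree_diff_le)
    then have "poly (Q - Q') 0 \<noteq> 0" by (rule solution_Q0[OF large]) (rule \<zeta>)
    then show False using eq by simp
  qed
  then show "P = P'" "Q = Q'" by auto
  have z: "del0 < cmod z + 1" "cmod z < cmod z + 1" using del0 norm_ge_zero[of z] by linarith+
  have "H z = node_mean n \<zeta> (cmod z + 1) (\<lambda>s. poly Q s/(s - z)*exp (of_nat n * s))"
    by (rule solution_remainder_eq[OF sol(1) _ del0(1) z]) (rule \<zeta>)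
  also have "\<dots> = H' z"
    unfolding \<open>Q = Q'\<close> by (rule solution_remainder_eq[OF sol(2) _ del0(1) z, symmetric]) (rule \<zeta>)
  finally show "H z = H' z" .
qed

lemma solution_normalized_exists:
  assumes large: "large n" and \<zeta>: "\<And>j. j < 2*n+1 \<Longrightarrow> cmod (\<zeta> j) \<le> del0"
  shows "\<exists>P Q H. solution n \<zeta> P Q H \<and> poly Q 0 = 1"
proof -
  have "\<exists>c H. solution n \<zeta> (vec_P n c) (vec_Q n c) H"
    by (rule vec_solution_exists[OF _ del0]) (rule \<zeta>)
  then obtain P Q H where sol: "solution n \<zeta> P Q H" by blast
  have Q0: "poly Q 0 \<noteq> 0" by (rule solution_Q0[OF large sol]) (rule \<zeta>)
  then have "solution n \<zeta> (smult (1/poly Q 0) P) (smult (1/poly Q 0) Q) (\<lambda>s. 1/poly Q 0*H s)"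
    by (intro solution_smult sol) simp
  moreover have "poly (smult (1/poly Q 0) Q) 0 = 1" using Q0 by simp
  ultimately show ?thesis by blast
qed

text \<open>Replacing s by - s and multiplying by e^(n s) exchanges the roles of P and Q and
  reflects the nodes; the sign comes from the odd degree 2 n + 1 of the node polynomial.\<close>

lemma solution_reflect:
  assumes sol: "solution n \<zeta> P Q H"
  shows "solution n (\<lambda>j. - \<zeta> j) (pcompose Q [:0, - 1:]) (pcompose P [:0, - 1:]) (\<lambda>s. - exp (of_nat n * s)*H (- s))"
proof -
  have node: "node_poly n (\<lambda>j. - \<zeta> j) s = - node_poly n \<zeta> (- s)" for s
  proof -
    have "(\<Prod>j<2*n+1. s - - \<zeta> j) = (\<Prod>j<2*n+1. - 1*(- s - \<zeta> j))" by (rule prod.cong) auto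
    also have "\<dots> = (- 1)^(2*n+1)*(\<Prod>j<2*n+1. - s - \<zeta> j)"
      unfolding prod.distrib by simp
    finally show ?thesis by (simp add: node_poly_def)
  qed
  have "exp (of_nat n * s)*poly (pcompose P [:0, - 1:]) s + poly (pcompose Q [:0, - 1:]) s
      = node_poly n (\<lambda>j. - \<zeta> j) s*(- exp (of_nat n * s)*H (- s))" for s
  proof -
    have *: "exp (of_nat n*(- s))*poly Q (- s) + poly P (- s) = node_poly n \<zeta> (- s)*H (- s)"
      using sol by (simp only: solution_def)
    have "exp (of_nat n * s)*(exp (of_nat n*(- s))*poly Q (- s) + poly P (- s))
       = poly Q (- s) + exp (of_nat n * s)*poly P (- s)"
      by (simp add: distrib_left exp_minus)
    then show ?thesis unfolding * node by (simp add: poly_pcompose mult_ac add.commute)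
  qed
  moreover have "pcompose R [:0, - 1:] = 0 \<longleftrightarrow> R = 0" for R :: "complex poly"
    by (rule pcompose_eq_0_iff) simp
  moreover have "(\<lambda>s. - exp (of_nat n * s)*H (- s)) holomorphic_on UNIV"
  proof -
    have "(H \<circ> uminus) holomorphic_on UNIV"
      by (rule holomorphic_on_compose_gen[where t = UNIV]) (use sol in \<open>auto simp: solution_def intro: holomorphic_intros\<close>)
    then show ?thesis by (intro holomorphic_intros) (simp_all add: o_def)
  qed
  ultimately show ?thesis using sol unfolding solution_def by (auto simp: degree_pcompose)
qed

text \<open>Vanishing nodes are invariant under reflection, so uniqueness gives Q(s) = - P(- s) and
  H(s) = e^(n s) H(- s). Differentiating these and the defining equation at 0 determines both
  logarithmic derivatives.\<close>

lemma zero_nodes_derivatives: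
  assumes large: "large n" and sol: "solution n (\<lambda>_. 0) P Q H"
  shows "coeff Q 1 = - (of_nat n/2)*poly Q 0" "deriv H 0 = of_nat n/2*H 0"
proof -
  have n: "1 \<le> n" using large by (simp add: large_def)
  have node: "node_poly n (\<lambda>_. 0) s = s^(2*n+1)" for s by (simp add: node_poly_def)
  have eq: "exp (of_nat n * s)*poly Q s + poly P s = s^(2*n+1)*H s" for s
    using sol by (simp add: solution_def node_poly_def)
  have holH: "H holomorphic_on A" for A
    using sol by (auto simp: solution_def intro: holomorphic_on_subset)
  have dH: "(H has_field_derivative deriv H z) (at z)" for z
    by (rule holomorphic_derivI[OF holH[of UNIV]]) auto
  have P0: "poly P 0 = - poly Q 0" using eq[of 0] n by (simp add: add_eq_0_iff)
  have sol': "solution n (\<lambda>_. 0) (smult (- 1) (pcompose Q [:0, - 1:])) (smult (- 1) (pcompose P [:0, - 1:]))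
      (\<lambda>s. - 1*(- exp (of_nat n * s)*H (- s)))"
    by (rule solution_smult) (use solution_reflect[OF sol] in simp_all)
  have Q0: "poly Q 0 = poly (smult (- 1) (pcompose P [:0, - 1:])) 0" by (simp add: poly_pcompose P0)
  have QP: "Q = smult (- 1) (pcompose P [:0, - 1:])"
    by (rule solution_unique(2)[OF large sol sol' _ Q0]) (use del0 in simp)
  have HH: "H z = exp (of_nat n * z)*H (- z)" for z
  proof -
    have "H z = - 1*(- exp (of_nat n * z)*H (- z))"
      by (rule solution_unique(3)[OF large sol sol' _ Q0]) (use del0 in simp)
    then show ?thesis by simp
  qed
  have dp: "poly (pderiv R) 0 = coeff R 1" for R :: "complex poly"
    by (simp add: poly_0_coeff_0 coeff_pderiv)
  have "((\<lambda>s. poly (smult (- 1) (pcompose P [:0, - 1:])) s) has_field_derivative coeff P 1) (at 0)"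
  proof -
    have "((\<lambda>s. - poly P (- s)) has_field_derivative coeff P 1) (at 0)"
      by (rule derivative_eq_intros refl poly_DERIV | simp add: dp)+
    then show ?thesis by (simp add: poly_pcompose)
  qed
  moreover have "((\<lambda>s. poly (smult (- 1) (pcompose P [:0, - 1:])) s) has_field_derivative coeff Q 1) (at 0)"
    unfolding QP[symmetric] using poly_DERIV[of Q 0] by (simp only: dp)
  ultimately have c1: "coeff Q 1 = coeff P 1" using DERIV_unique by blast
  have "((\<lambda>s. exp (of_nat n * s)*poly Q s + poly P s) has_field_derivative
      (of_nat n*poly Q 0 + coeff Q 1 + coeff P 1)) (at 0)"
    by (rule derivative_eq_intros refl poly_DERIV | simp add: dp)+
  moreover have "((\<lambda>s. exp (of_nat n * s)*poly Q s + poly P s) has_field_derivative 0) (at 0)"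
    unfolding eq using n
    by (auto intro!: derivative_eq_intros dH simp: power_0_left)
  ultimately have "of_nat n*poly Q 0 + coeff Q 1 + coeff P 1 = 0" using DERIV_unique by blast
  then have "2 * coeff Q 1 = - (of_nat n*poly Q 0)" using c1 by (simp add: add_eq_0_iff2 algebra_simps)
  then show "coeff Q 1 = - (of_nat n/2)*poly Q 0" by (simp add: field_simps)
  have "((\<lambda>z. exp (of_nat n * z)*H (- z)) has_field_derivative (of_nat n*H 0 - deriv H 0)) (at 0)"
  proof -
    have "((\<lambda>z. H (- z)) has_field_derivative deriv H (- 0)*(- 1)) (at 0)"
      by (rule DERIV_chain2[OF dH]) (auto intro!: derivative_eq_intros)
    then have *: "((\<lambda>z. H (- z)) has_field_derivative - deriv H 0) (at 0)" by simp
    show ?thesis by (rule derivative_eq_intros * refl | simp)+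
  qed
  moreover have "(\<lambda>z. exp (of_nat n * z)*H (- z)) = H" by (rule ext) (rule HH[symmetric])
  ultimately have "(H has_field_derivative (of_nat n*H 0 - deriv H 0)) (at 0)" by (simp only:)
  then have "deriv H 0 = of_nat n*H 0 - deriv H 0" using dH DERIV_unique by blast
  then have "2 * deriv H 0 = of_nat n*H 0" by (simp add: algebra_simps)
  then show "deriv H 0 = of_nat n/2*H 0" by (simp add: field_simps)
qed

text \<open>At z = 0 the integrating factor is 1, so H(0) is the plain integral of n times the
  spline.\<close>

lemma remainder_zero_integral:
  assumes sol: "solution n \<zeta> P Q H"
    and \<zeta>: "\<And>j. j < 2*n+1 \<Longrightarrow> cmod (\<zeta> j) \<le> \<delta>" and \<delta>: "0 \<le> \<delta>" "\<delta> < R"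
  shows "((\<lambda>y. of_nat n * spline n \<zeta> R Q (of_real y)) has_integral H 0) {0..1}"
proof -
  have R: "0 < R" using \<delta> by simp
  define \<Phi> where "\<Phi> = (\<lambda>y. cmean R (\<lambda>s. (poly Q s/s/node_poly n \<zeta> s)*exp (of_nat n * s * y)))"
  have c: "continuous_on (sphere 0 R) (\<lambda>s. poly Q s/s/node_poly n \<zeta> s)"
    by (rule node_quotient_continuous[OF _ \<delta>(2)], rule \<zeta>, assumption)
       (intro continuous_intros, use R in auto)
  have D: "(\<Phi> has_field_derivative of_nat n * spline n \<zeta> R Q y) (at y)" for y
  proof -
    have c': "continuous_on (sphere 0 R) (\<lambda>s. poly Q s*exp (of_nat n * s * y))" by (intro continuous_intros)
    have "cmean R (\<lambda>s. (poly Q s/s/node_poly n \<zeta> s)*(of_nat n * s)*exp (of_nat n * s * y))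
        = node_mean n \<zeta> R (\<lambda>s. of_nat n*(poly Q s*exp (of_nat n * s * y)))"
      unfolding node_mean_def
    proof (rule cmean_cong[OF R])
      fix s :: complex assume "cmod s = R"
      then have "s \<noteq> 0" using R by auto
      then have "q/s/w*(m * s) * e = m*(q * e)/w" for q w m e :: complex by simp
      then show "poly Q s/s/node_poly n \<zeta> s*(of_nat n * s)*exp (of_nat n * s * y)
        = of_nat n*(poly Q s*exp (of_nat n * s * y))/node_poly n \<zeta> s" .
    qed
    also have "\<dots> = of_nat n * spline n \<zeta> R Q y"
      unfolding spline_def by (rule node_mean_cmult[OF _ \<delta> c']) (rule \<zeta>)
    finally show ?thesis
      using cmean_exp_has_field_derivative[OF R c, of "of_nat n" y] by (simp add: \<Phi>_def)
  qed
  have "((\<lambda>y. of_nat n * spline n \<zeta> R Q (of_real y)) has_integral (\<Phi> (of_real 1) - \<Phi> (of_real 0))) {0..1}"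
    by (rule fundamental_theorem_of_calculus)
       (auto intro!: has_vector_derivative_real_field D)
  moreover have "\<Phi> (of_real 0) = 0"
  proof -
    have "\<Phi> (of_real 0) = node_mean n \<zeta> R (\<lambda>s. poly Q s/(s - 0))" by (simp add: \<Phi>_def node_mean_def)
    also have "\<dots> = 0"
      by (rule node_mean_poly_pole_decay[OF _ \<delta>], rule \<zeta>, assumption) (use sol R in \<open>auto simp: solution_def\<close>)
    finally show ?thesis .
  qed
  moreover have "\<Phi> (of_real 1) = H 0"
  proof -
    have z: "cmod 0 < R" using R by simp
    have "H 0 = node_mean n \<zeta> R (\<lambda>s. poly Q s/(s - 0)*exp (of_nat n * s))"
      by (rule solution_remainder_eq[OF sol _ \<delta> z]) (rule \<zeta>)
    then show ?thesis by (simp add: \<Phi>_def node_mean_def)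
  qed
  ultimately show ?thesis by simp
qed

text \<open>The modulus of H(0) for the Pade approximant with Q(0) = 1: the factor n, the constant
  value n^(2n)/(2n)! of u, and the integral Beta (n + 1) (n + 1).\<close>

definition zero_remainder :: "nat \<Rightarrow> real" where
  "zero_remainder n = real n^(2*n+1)*(fact n)\<^sup>2/(fact (2*n) * fact (2*n+1))"

lemma has_integral_beta_power:
  assumes "1 \<le> n"
  shows "((\<lambda>y. y^n*(1 - y)^n) has_integral ((fact n)\<^sup>2/fact (2*n+1) :: real)) {0..1}"
proof -
  have "((\<lambda>t. t powr (real n + 1 - 1)*(1 - t) powr (real n + 1 - 1)) has_integral Beta (real n + 1) (real n + 1)) {0..1}"
    by (rule has_integral_Beta_real) auto
  moreover have "Beta (real n + 1) (real n + 1) = (fact n)\<^sup>2/fact (2*n+1)"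
  proof -
    have "Gamma (real n + 1) = fact n" using Gamma_fact[of n, where 'a = real] by (simp add: add.commute)
    moreover have "Gamma (real n + 1 + (real n + 1)) = fact (2*n+1)"
      using Gamma_fact[of "2*n+1", where 'a = real] by (simp add: algebra_simps)
    ultimately show ?thesis by (simp add: Beta_def power2_eq_square)
  qed
  moreover have "t powr (real n + 1 - 1)*(1 - t) powr (real n + 1 - 1) = t^n*(1 - t)^n" if "t \<in> {0..1}" for t
    using that assms by (simp add: powr_realpow')
  ultimately show ?thesis by (metis (no_types, lifting) has_integral_eq)
qed

text \<open>With u constant, the integral of the spline over [0, 1] is a Beta integral; the sign is
  that of (y - 1)^n.\<close>

lemma zero_nodes_remainder:
  assumes n: "1 \<le> n" and sol: "solution n (\<lambda>_. 0) P Q H"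
  shows "H 0 = (- 1)^n * of_real (zero_remainder n)*poly Q 0"
proof -
  have "\<exists>u. u holomorphic_on UNIV \<and> (\<forall>y. spline n (\<lambda>_. 0) 1 Q y = (y*(y - 1))^n * u y)"
    by (rule spline_factor_exists[OF n sol, of 0]) auto
  then obtain u where u: "spline_factor n (\<lambda>_. 0) Q u" by (auto simp: spline_factor_def)
  define k where "k = poly Q 0 * of_nat n^(2*n)/fact (2*n)"
  have k: "u y = k" for y using zero_nodes_factor(2)[OF n sol u] by (simp add: k_def)
  have sp: "spline n (\<lambda>_. 0) 1 Q (of_real y) = (- 1)^n * k * of_real (y^n*(1 - y)^n)" for y
  proof -
    have "spline n (\<lambda>_. 0) 1 Q (of_real y) = (of_real y*(of_real y - 1))^n * k"
      using u by (simp add: spline_factor_def k)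
    also have "of_real y*(of_real y - 1) = - 1 * complex_of_real (y*(1 - y))" by (simp add: algebra_simps)
    finally show ?thesis by (simp only: power_mult_distrib of_real_power of_real_mult mult_ac)
  qed
  have "((\<lambda>y. complex_of_real (y^n*(1 - y)^n)) has_integral of_real ((fact n)\<^sup>2/fact (2*n+1))) {0..1}"
    by (rule has_integral_of_real[OF has_integral_beta_power[OF n]])
  then have "((\<lambda>y. of_nat n*((- 1)^n * k) * complex_of_real (y^n*(1 - y)^n)) has_integral
      of_nat n*((- 1)^n * k) * of_real ((fact n)\<^sup>2/fact (2*n+1))) {0..1}"
    by (rule has_integral_mult_right)
  moreover have "((\<lambda>y. of_nat n * spline n (\<lambda>_. 0) 1 Q (of_real y)) has_integral H 0) {0..1}"
    by (rule remainder_zero_integral[OF sol, of 0]) auto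
  then have "((\<lambda>y. of_nat n*((- 1)^n * k) * complex_of_real (y^n*(1 - y)^n)) has_integral H 0) {0..1}"
    by (simp only: sp mult.assoc)
  ultimately have "H 0 = of_nat n*((- 1)^n * k) * of_real ((fact n)\<^sup>2/fact (2*n+1))"
    using has_integral_unique by blast
  also have "\<dots> = (- 1)^n * of_real (zero_remainder n)*poly Q 0"
    by (simp add: k_def zero_remainder_def)
  finally show ?thesis .
qed

lemma zero_remainder_pos: "1 \<le> n \<Longrightarrow> 0 < zero_remainder n"
  by (simp add: zero_remainder_def)

text \<open>Two factorials of n stand against those of 2 n and 2 n + 1, so Stirling's constants
  cancel; what remains is twice a difference of \<open>stirling_rest\<close> and - ln (1 + 1/(2 n)),
  each at most 1/(2 n) in size and of opposite sign.\<close>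

lemma zero_remainder_stirling:
  assumes n: "1 \<le> n"
  shows "\<bar>ln (zero_remainder n) + real (2*n+1)*(2*ln 2 - 1) + 1\<bar> \<le> 1/(2*real n)"
proof -
  have lnfact: "ln (fact m) = stirling_rest m - real m + (real m + 1/2)*ln (real m)" for m :: nat
    by (simp add: stirling_rest_def)
  have "ln (zero_remainder n) = real (2*n+1)*ln (real n) + 2*ln (fact n) - (ln (fact (2*n)) + ln (fact (2*n+1)))"
    using n unfolding zero_remainder_def
    by (simp add: ln_mult ln_div ln_realpow del: fact_Suc power_Suc)
  moreover have "ln (fact (2*n+1) :: real) = ln (2*real n + 1) + ln (fact (2*n))"
  proof -
    have "(fact (2*n+1) :: real) = (2*real n + 1) * fact (2*n)" by simp
    then show ?thesis by (simp add: ln_mult del: fact_Suc)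
  qed
  moreover have l2: "ln (real (2*n)) = ln 2 + ln (real n)" using n by (simp add: ln_mult)
  moreover have "ln (fact (2*n) :: real) = stirling_rest (2*n) - 2*real n + (2*real n + 1/2)*(ln 2 + ln (real n))"
    using lnfact[of "2*n"] unfolding l2 by simp
  ultimately have eq: "ln (zero_remainder n) + real (2*n+1)*(2*ln 2 - 1) + 1
      = 2*(stirling_rest n - stirling_rest (2*n)) - (ln (2*real n + 1) - ln (2*real n))"
    using lnfact[of n] by (simp add: algebra_simps)
  have s: "0 \<le> stirling_rest n - stirling_rest (2*n)" "stirling_rest n - stirling_rest (2*n) \<le> 1/(4*real n)"
    using stirling_rest_antimono[of n "2*n"] n by simp_all
  have l: "0 \<le> ln (2*real n + 1) - ln (2*real n)" using n by simp
  have "ln (2*real n + 1) - ln (2*real n) = ln (1 + 1/(2*real n))"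
  proof -
    have "ln (2*real n + 1) - ln (2*real n) = ln ((2*real n + 1)/(2*real n))"
      using n by (subst ln_div) auto
    also have "(2*real n + 1)/(2*real n) = 1 + 1/(2*real n)" using n by (simp add: field_simps)
    finally show ?thesis .
  qed
  also have "\<dots> \<le> 1/(2*real n)" by (rule ln_add_one_self_le_self) simp
  finally have l': "ln (2*real n + 1) - ln (2*real n) \<le> 1/(2*real n)" .
  have h: "2*(1/(4*real n)) = 1/(2*real n)" "0 \<le> 1/(2*real n)" by simp_all
  have gen: "\<bar>2 * a - b\<bar> \<le> x" if "0 \<le> a" "a \<le> y" "0 \<le> b" "b \<le> x" "2 * y = x" for a b x y :: real
    using that by linarith
  show ?thesis unfolding eq by (rule gen[OF s l l' h(1)])
qed

text \<open>Cauchy's formulas make H(0) and H'(0) linear in the coefficient vector, with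
  coefficients holomorphic in the nodes, so that both inherit holomorphic dependence on t.\<close>

lemma vec_remainder:
  assumes \<zeta>: "\<And>j. j < 2*n+1 \<Longrightarrow> cmod (\<zeta> j) \<le> \<delta>" and \<delta>: "0 \<le> \<delta>" "\<delta> < 1"
    and sol: "solution n \<zeta> (vec_P n c) (vec_Q n c) H"
  shows "H 0 = (\<Sum>i<2*n+2. c i*node_mean n \<zeta> 1 (\<lambda>s. basis n i s/s^1))"
    "deriv H 0 = (\<Sum>i<2*n+2. c i*node_mean n \<zeta> 1 (\<lambda>s. basis n i s/s^2))"
proof -
  have holH: "H holomorphic_on A" for A
    using sol by (auto simp: solution_def intro: holomorphic_on_subset)
  have eq: "cmean 1 (\<lambda>s. H s/s^m) = (\<Sum>i<2*n+2. c i*node_mean n \<zeta> 1 (\<lambda>s. basis n i s/s^m))" for m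
  proof -
    have cb: "continuous_on (sphere 0 1) (\<lambda>s. basis n i s/s^m)" for i
      by (intro continuous_on_divide basis_continuous continuous_intros) auto
    have cn: "continuous_on (sphere 0 1) (\<lambda>s. basis n i s/s^m/node_poly n \<zeta> s)" for i
      by (rule node_quotient_continuous[OF _ \<delta>(2) cb]) (rule \<zeta>)
    have "cmean 1 (\<lambda>s. H s/s^m)
        = cmean 1 (\<lambda>s. \<Sum>i<2*n+2. c i*(basis n i s/s^m/node_poly n \<zeta> s))"
    proof (rule cmean_cong[OF zero_less_one])
      fix s :: complex assume s: "cmod s = 1"
      have nz: "node_poly n \<zeta> s \<noteq> 0" by (rule node_poly_nonzero) (rule \<zeta>, use s \<delta> in auto)
      have "(\<Sum>i<2*n+2. c i * basis n i s) = node_poly n \<zeta> s*H s"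
        unfolding vec_combination[symmetric] using sol by (simp only: solution_def)
      then have "H s/s^m = (\<Sum>i<2*n+2. c i * basis n i s)/s^m/node_poly n \<zeta> s"
        using nz by (simp del: sum.lessThan_Suc)
      also have "\<dots> = (\<Sum>i<2*n+2. c i*(basis n i s/s^m/node_poly n \<zeta> s))"
        by (simp only: sum_divide_distrib times_divide_eq_right)
      finally show "H s/s^m = (\<Sum>i<2*n+2. c i*(basis n i s/s^m/node_poly n \<zeta> s))" .
    qed
    also have "\<dots> = (\<Sum>i<2*n+2. cmean 1 (\<lambda>s. c i*(basis n i s/s^m/node_poly n \<zeta> s)))"
      by (intro cmean_sum continuous_on_mult continuous_on_const cn) auto
    also have "\<dots> = (\<Sum>i<2*n+2. c i*node_mean n \<zeta> 1 (\<lambda>s. basis n i s/s^m))"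
      unfolding node_mean_def by (intro sum.cong refl cmean_cmult zero_less_one cn)
    finally show ?thesis .
  qed
  have "cmean 1 (\<lambda>s. H s/s^1) = H 0"
    using cmean_Cauchy[OF holH, of 0 1] by simp
  then show "H 0 = (\<Sum>i<2*n+2. c i*node_mean n \<zeta> 1 (\<lambda>s. basis n i s/s^1))" by (simp only: eq)
  have "contour_integral (circlepath 0 1) (\<lambda>u. H u/(u - 0)^2) = 2 * pi * \<i> * deriv H 0"
    by (rule Cauchy_contour_integral_circlepath_2)
       (use holH in \<open>auto intro: holomorphic_on_imp_continuous_on\<close>)
  then have "cmean 1 (\<lambda>s. H s/s^2) = deriv H 0" by (simp add: cmean_def)
  then show "deriv H 0 = (\<Sum>i<2*n+2. c i*node_mean n \<zeta> 1 (\<lambda>s. basis n i s/s^2))" by (simp only: eq)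
qed

section \<open>Holomorphic dependence on the nodes\<close>

text \<open>Fixing entry 0 to be 1 leaves a square system of size 2 n + 1 with trivial kernel, which
  is solved analytically near each t0. The normalized solution, at first chosen separately for every
  t, coincides with these local solutions by uniqueness and is therefore holomorphic.\<close>

lemma solution_family:
  assumes large: "large n" and r: "0 < r" and \<zeta>: "\<And>j. j < 2*n+1 \<Longrightarrow> cmod (\<zeta> j) \<le> r"
  defines "U \<equiv> ball 0 (del0/r)"
  shows "\<exists>q G D. q holomorphic_on U \<and> G holomorphic_on U \<and> D holomorphic_on U \<and>
    (\<forall>t\<in>U. \<exists>P Q H. solution n (\<lambda>j. t * \<zeta> j) P Q H \<and> poly Q 0 = 1 \<and> coeff Q 1 = q t \<and> H 0 = G t \<and> deriv H 0 = D t)"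
proof -
  have n: "1 \<le> n" using large by (simp add: large_def)
  have Ub: "cmod t * r < del0" if "t \<in> U" for t
    using that r by (simp add: U_def pos_less_divide_eq)
  have U: "open U" "convex U" by (simp_all add: U_def)
  have \<zeta>': "cmod (t * \<zeta> j) \<le> del0" if t: "t \<in> U" and j: "j < 2*n+1" for t j
  proof -
    have "cmod (t * \<zeta> j) \<le> cmod t * r" unfolding norm_mult using \<zeta>[OF j] by (intro mult_left_mono) auto
    then show ?thesis using Ub[OF t] by simp
  qed
  have viff: "(\<exists>H. solution n (\<lambda>j. t * \<zeta> j) (vec_P n c) (vec_Q n c) H) \<longleftrightarrow>
     (\<exists>i<2*n+2. c i \<noteq> 0) \<and> (\<forall>k<2*n+1. (\<Sum>i<2*n+2. c i * moment n (\<lambda>j. t * \<zeta> j) k i) = 0)" if "t \<in> U" for t c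
    by (rule vec_solution_iff[OF _ del0]) (rule \<zeta>'[OF that])
  have vQ0: "poly (vec_Q n c) 0 = c 0" for c by (simp add: poly_0_coeff_0 coeff_vec)
  have "\<exists>c. \<forall>t\<in>U. \<exists>H. solution n (\<lambda>j. t * \<zeta> j) (vec_P n (c t)) (vec_Q n (c t)) H \<and> c t 0 = 1"
  proof (rule bchoice, rule ballI)
    fix t assume t: "t \<in> U"
    have "\<exists>P Q H. solution n (\<lambda>j. t * \<zeta> j) P Q H \<and> poly Q 0 = 1"
      by (rule solution_normalized_exists[OF large]) (rule \<zeta>'[OF t])
    then obtain P Q H where s: "solution n (\<lambda>j. t * \<zeta> j) P Q H" "poly Q 0 = 1" by blast
    have deg: "degree P \<le> n" "degree Q \<le> n" using s by (auto simp: solution_def)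
    define c where "c = (\<lambda>i. if i \<le> n then coeff Q i else coeff P (i - (n + 1)))"
    have c: "vec_Q n c = Q" "vec_P n c = P" unfolding c_def using vec_surj[OF deg] by auto
    show "\<exists>c H. solution n (\<lambda>j. t * \<zeta> j) (vec_P n c) (vec_Q n c) H \<and> c 0 = 1"
      using s c vQ0[of c] by (intro exI[of _ c] exI[of _ H]) simp
  qed
  then obtain c where c: "\<And>t. t \<in> U \<Longrightarrow> \<exists>H. solution n (\<lambda>j. t * \<zeta> j) (vec_P n (c t)) (vec_Q n (c t)) H" "\<And>t. t \<in> U \<Longrightarrow> c t 0 = 1"
    by blast
  have cuniq: "c t i = y i"
    if t: "t \<in> U" and y: "\<forall>k<2*n+1. (\<Sum>i<2*n+2. y i * moment n (\<lambda>j. t * \<zeta> j) k i) = 0" "y 0 = 1" and i: "i < 2*n+2" for t y i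
  proof -
    have "\<exists>i<2*n+2. y i \<noteq> 0" using y(2) by (intro exI[of _ 0]) auto
    then obtain H' where H': "solution n (\<lambda>j. t * \<zeta> j) (vec_P n y) (vec_Q n y) H'" using viff[OF t, of y] y(1) by blast
    obtain H where H: "solution n (\<lambda>j. t * \<zeta> j) (vec_P n (c t)) (vec_Q n (c t)) H" using c(1)[OF t] by blast
    have q: "poly (vec_Q n (c t)) 0 = poly (vec_Q n y) 0" unfolding vQ0 y c(2)[OF t] ..
    have "vec_P n (c t) = vec_P n y"
      by (rule solution_unique(1)[OF large H H' _ q]) (rule \<zeta>'[OF t])
    moreover have "vec_Q n (c t) = vec_Q n y"
      by (rule solution_unique(2)[OF large H H' _ q]) (rule \<zeta>'[OF t])
    ultimately have eqs: "coeff (vec_P n (c t)) m = coeff (vec_P n y) m" "coeff (vec_Q n (c t)) m = coeff (vec_Q n y) m" for m by simp_all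
    show ?thesis
    proof (cases "i \<le> n")
      case True
      then show ?thesis using eqs(2)[of i] by (simp add: coeff_vec)
    next
      case False
      then have "i = n + 1 + (i - (n + 1))" "i - (n + 1) \<le> n" using i by auto
      then show ?thesis using eqs(1)[of "i - (n + 1)"] by (simp add: coeff_vec)
    qed
  qed
  have holm: "(\<lambda>t. moment n (\<lambda>j. t * \<zeta> j) k i) holomorphic_on U" for k i
    unfolding moment_def
  proof (rule node_mean_scaled_holomorphic[OF _ less_imp_le[OF r] _ _ U])
    show "continuous_on (sphere 0 1) (\<lambda>s. basis n i s * s^k)" by (intro continuous_intros basis_continuous)
    show "cmod t * r < 1" if "t \<in> U" for t using Ub[OF that] del0 by linarith
  qed (use \<zeta> in auto)
  have lsum: "(\<Sum>i<2*n+2. f i) = f 0 + (\<Sum>j<2*n+1. f (Suc j))" for f :: "nat \<Rightarrow> complex"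
    using sum.lessThan_Suc_shift[of f "2*n+1"] by (simp del: sum.lessThan_Suc)
  have holc: "(\<lambda>t. c t i) holomorphic_on U" if i: "i < 2*n+2" for i
  proof -
    have "(\<lambda>t. c t i) analytic_on {t0}" if t0: "t0 \<in> U" for t0
    proof (cases i)
      case 0
      have ev: "\<forall>\<^sub>F t in nhds t0. c t i = 1"
        using eventually_nhds_in_open[OF U(1) t0] by eventually_elim (use c(2) 0 in simp)
      show ?thesis by (subst analytic_at_cong[OF ev refl]) simp
    next
      case (Suc j)
      have am: "(\<lambda>t. moment n (\<lambda>j. t * \<zeta> j) k i) analytic_on {t0}" for k i
        using holm[of k i] t0 U(1) by (meson analytic_on_open analytic_on_analytic_at)
      have "\<exists>x. (\<forall>j<2*n+1. x j analytic_on {t0}) \<and>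
        (\<forall>\<^sub>F t in nhds t0. \<forall>k<2*n+1. (\<Sum>j<2*n+1. moment n (\<lambda>j. t * \<zeta> j) k (Suc j) * x j t) = - moment n (\<lambda>j. t * \<zeta> j) k 0)"
      proof (rule analytic_linear_solve[of "2*n+1" "\<lambda>k j t. moment n (\<lambda>j. t * \<zeta> j) k (Suc j)" t0
            "\<lambda>k t. - moment n (\<lambda>j. t * \<zeta> j) k 0"])
        show "(\<lambda>t. moment n (\<lambda>j. t * \<zeta> j) k (Suc j)) analytic_on {t0}" for k j by (rule am)
        show "(\<lambda>t. - moment n (\<lambda>j. t * \<zeta> j) k 0) analytic_on {t0}" for k by (intro analytic_intros am)
        fix x assume x: "\<forall>k<2*n+1. (\<Sum>j<2*n+1. moment n (\<lambda>j. t0 * \<zeta> j) k (Suc j) * x j) = 0"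
        \<comment> \<open>A kernel vector extended by the entry 0 would be a solution with Q(0) = 0,
          contrary to zero-freeness.\<close>
        define y where "y = (\<lambda>i. case i of 0 \<Rightarrow> 0 | Suc j \<Rightarrow> x j)"
        have yeq: "\<forall>k<2*n+1. (\<Sum>i<2*n+2. y i * moment n (\<lambda>j. t0 * \<zeta> j) k i) = 0"
          unfolding lsum using x by (simp add: y_def mult.commute del: sum.lessThan_Suc)
        show "\<forall>j<2*n+1. x j = 0"
        proof (rule ccontr)
          assume "\<not> (\<forall>j<2*n+1. x j = 0)"
          then obtain j where j: "j < 2*n+1" "x j \<noteq> 0" by blast
          have "\<exists>i<2*n+2. y i \<noteq> 0" by (rule exI[of _ "Suc j"]) (use j in \<open>simp add: y_def\<close>)
          then obtain H where H: "solution n (\<lambda>j. t0 * \<zeta> j) (vec_P n y) (vec_Q n y) H" using viff[OF t0, of y] yeq by blast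
          have "poly (vec_Q n y) 0 \<noteq> 0" by (rule solution_Q0[OF large H]) (rule \<zeta>'[OF t0])
          then show False by (simp add: vQ0 y_def)
        qed
      qed
      then obtain x where x: "(\<forall>j<2*n+1. x j analytic_on {t0}) \<and>
        (\<forall>\<^sub>F t in nhds t0. \<forall>k<2*n+1. (\<Sum>j<2*n+1. moment n (\<lambda>j. t * \<zeta> j) k (Suc j) * x j t) = - moment n (\<lambda>j. t * \<zeta> j) k 0)" ..
      have j: "j < 2*n+1" using i Suc by simp
      have ev: "\<forall>\<^sub>F t in nhds t0. c t i = x j t"
        using conjunct2[OF x] eventually_nhds_in_open[OF U(1) t0]
      proof eventually_elim
        case (elim t)
        define y where "y = (\<lambda>i. case i of 0 \<Rightarrow> 1 | Suc j \<Rightarrow> x j t)"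
        have yeq: "\<forall>k<2*n+1. (\<Sum>i<2*n+2. y i * moment n (\<lambda>j. t * \<zeta> j) k i) = 0"
          unfolding lsum using elim(1) by (simp add: y_def mult.commute del: sum.lessThan_Suc)
        have "c t i = y i" by (rule cuniq[OF elim(2) yeq _ i]) (simp add: y_def)
        then show ?case by (simp add: Suc y_def)
      qed
      show ?thesis unfolding analytic_at_cong[OF ev refl] using x j by blast
    qed
    then show ?thesis using U(1) by (meson analytic_on_open analytic_on_analytic_at)
  qed
  define F where "F = (\<lambda>m t. \<Sum>i<2*n+2. c t i*node_mean n (\<lambda>j. t * \<zeta> j) 1 (\<lambda>s. basis n i s/s^m))"
  have holF: "F m holomorphic_on U" for m
    unfolding F_def
  proof (intro holomorphic_on_sum holomorphic_on_mult holc)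
    fix i
    show "(\<lambda>t. node_mean n (\<lambda>j. t * \<zeta> j) 1 (\<lambda>s. basis n i s/s^m)) holomorphic_on U"
    proof (rule node_mean_scaled_holomorphic[OF _ less_imp_le[OF r] _ _ U])
      show "continuous_on (sphere 0 1) (\<lambda>s. basis n i s/s^m)"
        by (intro continuous_on_divide basis_continuous continuous_intros) auto
      show "cmod t * r < 1" if "t \<in> U" for t using Ub[OF that] del0 by linarith
    qed (use \<zeta> in auto)
  qed auto
  have "\<exists>P Q H. solution n (\<lambda>j. t * \<zeta> j) P Q H \<and> poly Q 0 = 1 \<and> coeff Q 1 = c t 1 \<and> H 0 = F 1 t \<and> deriv H 0 = F 2 t"
    if t: "t \<in> U" for t
  proof -
    obtain H where H: "solution n (\<lambda>j. t * \<zeta> j) (vec_P n (c t)) (vec_Q n (c t)) H" using c(1)[OF t] by blast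
    have "poly (vec_Q n (c t)) 0 = 1" by (simp add: vQ0 c(2)[OF t])
    moreover have "coeff (vec_Q n (c t)) 1 = c t 1" using n by (simp add: coeff_vec)
    moreover have "H 0 = F 1 t" unfolding F_def by (rule vec_remainder(1)[OF _ del0 H]) (rule \<zeta>'[OF t])
    moreover have "deriv H 0 = F 2 t" unfolding F_def by (rule vec_remainder(2)[OF _ del0 H]) (rule \<zeta>'[OF t])
    ultimately show ?thesis using H by blast
  qed
  moreover have "(\<lambda>t. c t 1) holomorphic_on U" by (rule holc) simp
  ultimately show ?thesis using holF by blast
qed

lemma holomorphic_log_ball:
  assumes f: "f holomorphic_on ball 0 R" and nz: "\<And>z. cmod z < R \<Longrightarrow> f z \<noteq> 0"
  obtains g where "g holomorphic_on ball 0 R" "\<And>z. cmod z < R \<Longrightarrow> f z = exp (g z)"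
proof -
  have "contractible (ball (0::complex) R)" by (intro convex_imp_contractible convex_ball)
  then show ?thesis
    using contractible_imp_holomorphic_log[of f "ball 0 R"] f nz that by (metis mem_ball_0)
qed

lemma log_derivative_at:
  assumes g: "g holomorphic_on ball 0 R" and eq: "\<And>z. cmod z < R \<Longrightarrow> f z = exp (g z)" and R: "0 < R"
  shows "deriv f 0 = deriv g 0 * f 0"
proof -
  have "(g has_field_derivative deriv g 0) (at 0)"
    by (rule holomorphic_derivI[OF g]) (use R in auto)
  then have "((\<lambda>z. exp (g z)) has_field_derivative exp (g 0) * deriv g 0) (at 0)"
    by (rule DERIV_fun_exp)
  then have "(f has_field_derivative exp (g 0) * deriv g 0) (at 0)"
    by (rule has_field_derivative_transform_within_open[of _ _ _ "ball 0 R"]) (use eq R in auto)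
  then show ?thesis using eq[of 0] R by (simp add: DERIV_imp_deriv mult.commute)
qed

text \<open>On the disk of half the zero-free radius |Q| lies between 2^(-n) and e^n, so the real
  part of ln Q is at most n in size. The radius eps0/2 turns the constants 72 and 576 into 144/eps0
  and 2304/eps0^2; the linear coefficient of ln Q is Q'(0) since Q(0) = 1.\<close>

lemma solution_Q_log:
  assumes large: "large n" and sol: "solution n \<zeta> P Q H"
    and \<zeta>: "\<And>j. j < 2*n+1 \<Longrightarrow> cmod (\<zeta> j) \<le> del0" and Q0: "poly Q 0 = 1"
  shows "cmod (coeff Q 1) \<le> 144*real n/eps0"
    "cmod s < eps0/4 \<Longrightarrow> \<exists>a. poly Q s = exp (coeff Q 1 * s + a) \<and> cmod a \<le> 2304*real n/eps0\<^sup>2*(cmod s)\<^sup>2"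
proof -
  note c = const_bounds
  have n: "1 \<le> n" using large by (simp add: large_def)
  have degQ: "degree Q \<le> n" using sol by (simp add: solution_def)
  have Q: "poly Q s \<noteq> 0" if "cmod s < eps0" for s
    by (rule solution_zero_free(1)[OF large sol]) (use \<zeta> that in auto)
  define R where "R = eps0/2"
  have R: "0 < R" "R < eps0" "R/2 = eps0/4" using c by (auto simp: R_def)
  obtain w where w: "w holomorphic_on ball 0 R" "\<And>s. cmod s < R \<Longrightarrow> poly Q s = exp (w s)"
  proof (rule holomorphic_log_ball[of "poly Q" R])
    show "poly Q holomorphic_on ball 0 R" by (intro holomorphic_intros)
  qed (use Q R in auto)
  have bd: "\<bar>Re (w s) - 0\<bar> \<le> real n" if s: "cmod s < R" for s
  proof -
    have s2: "cmod s/eps0 \<le> 1/2" using s c by (simp add: R_def field_simps)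
    have "cmod (poly Q s) \<le> cmod (poly Q 0)*(1 + cmod s/eps0)^n"
      by (rule norm_poly_zero_free_le[OF c(1) Q degQ])
    also have "\<dots> \<le> 1*exp 1^n"
    proof -
      have "1 + cmod s/eps0 \<le> exp 1" using s2 exp_ge_add_one_self[of 1] by linarith
      then show ?thesis using c by (simp add: Q0 power_mono)
    qed
    finally have "exp (Re (w s)) \<le> exp (real n)" using w(2)[OF s] by (simp add: exp_of_nat_mult[symmetric])
    then have 1: "Re (w s) \<le> real n" by simp
    have "1*(1/2)^n \<le> cmod (poly Q 0)*(1 - cmod s/eps0)^n"
      using s2 by (simp add: Q0 power_mono)
    also have "\<dots> \<le> cmod (poly Q s)"
      by (rule norm_poly_zero_free_ge[OF c(1) Q degQ]) (use s R in auto)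
    finally have "(1/2)^n \<le> exp (Re (w s))" using w(2)[OF s] by simp
    moreover have "exp (- real n) \<le> (1/2)^n"
    proof -
      have "exp (- 1) \<le> (1/2 :: real)" using exp_ge_add_one_self[of 1] by (simp add: exp_minus field_simps)
      then have "exp (- 1)^n \<le> (1/2 :: real)^n" by (intro power_mono) auto
      then show ?thesis by (simp add: exp_of_nat_mult[symmetric])
    qed
    ultimately have "exp (- real n) \<le> exp (Re (w s))" by linarith
    then have "- real n \<le> Re (w s)" by simp
    with 1 show ?thesis by (simp add: abs_le_iff)
  qed
  have B: "0 < real n" using n by simp
  note d = deriv_bounds_of_Re_bound[OF w(1) R(1) B bd]
  have "deriv (poly Q) 0 = deriv w 0*poly Q 0" by (rule log_derivative_at[OF w R(1)])
  moreover have "deriv (poly Q) 0 = coeff Q 1"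
    using poly_DERIV[of Q 0] by (simp add: DERIV_imp_deriv poly_0_coeff_0 coeff_pderiv)
  ultimately have dw: "deriv w 0 = coeff Q 1" by (simp add: Q0)
  show "cmod (coeff Q 1) \<le> 144*real n/eps0"
    using d(1)[of 0] R(1) unfolding dw by (simp add: R_def)
  assume s: "cmod s < eps0/4"
  have "cmod (w s - w 0 - deriv w 0*(s - 0)) \<le> 576*real n/R\<^sup>2*(cmod (s - 0))\<^sup>2"
  proof (rule norm_linear_Taylor_le[where S = "ball 0 (R/2)"])
    show "w holomorphic_on ball 0 (R/2)" by (rule holomorphic_on_subset[OF w(1)]) (use R in auto)
    show "cmod (deriv (deriv w) x) \<le> 576*real n/R\<^sup>2" if "x \<in> ball 0 (R/2)" for x
      using d(2)[of x] that R by simp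
  qed (use s R in auto)
  moreover have "576*real n/R\<^sup>2 = 2304*real n/eps0\<^sup>2" by (simp add: R_def power_divide)
  moreover have "poly Q s = exp (coeff Q 1 * s + (w s - w 0 - deriv w 0*(s - 0)))"
  proof -
    have "exp (w 0) = 1" using w(2)[of 0] R by (simp add: Q0)
    then have "exp (w s) = exp (w s - w 0)" by (simp add: exp_diff)
    then show ?thesis using w(2)[of s] s R by (simp add: dw)
  qed
  ultimately show "\<exists>a. poly Q s = exp (coeff Q 1 * s + a) \<and> cmod a \<le> 2304*real n/eps0\<^sup>2*(cmod s)\<^sup>2"
    by (intro exI[of _ "w s - w 0 - deriv w 0*(s - 0)"]) simp
qed

text \<open>The same argument on the disk of radius 1/1000, where |H| lies between e^(-4n) and
  e^(4n): 72 * 4 * 1000 = 288000 and 576 * 4 = 2304.\<close>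

lemma solution_H_log:
  assumes large: "large n" and sol: "solution n \<zeta> P Q H"
    and \<zeta>: "\<And>j. j < 2*n+1 \<Longrightarrow> cmod (\<zeta> j) \<le> del0" and Q0: "poly Q 0 = 1"
  shows "H 0 \<noteq> 0" "\<bar>ln (cmod (H 0))\<bar> \<le> 4*real n" "cmod (deriv H 0/H 0) \<le> 288000*real n"
    "cmod s < 1/2000 \<Longrightarrow> \<exists>b. H s = H 0*exp (deriv H 0/H 0 * s + b) \<and> cmod b \<le> 2304*1000\<^sup>2*real n*(cmod s)\<^sup>2"
proof -
  have n: "1 \<le> n" using large by (simp add: large_def)
  have holH: "H holomorphic_on A" for A
    using sol by (auto simp: solution_def intro: holomorphic_on_subset)
  have Hb: "exp (- 4*real n) \<le> cmod (H z) \<and> cmod (H z) \<le> exp (4*real n)" if "cmod z < 1/1000" for z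
    using solution_zero_free(2)[OF large sol, of z] \<zeta> that by (simp add: Q0)
  have Hnz: "H z \<noteq> 0" if "cmod z < 1/1000" for z
  proof -
    have "0 < exp (- 4*real n)" by simp
    also have "\<dots> \<le> cmod (H z)" using Hb[OF that] by blast
    finally show ?thesis by auto
  qed
  define R :: real where "R = 1/1000"
  have R: "0 < R" "R/2 = 1/2000" by (auto simp: R_def)
  obtain v where v: "v holomorphic_on ball 0 R" "\<And>s. cmod s < R \<Longrightarrow> H s = exp (v s)"
    by (rule holomorphic_log_ball[OF holH, of R]) (use Hnz R_def in auto)
  have bd: "\<bar>Re (v s) - 0\<bar> \<le> 4*real n" if s: "cmod s < R" for s
  proof -
    have "exp (- 4*real n) \<le> exp (Re (v s))" "exp (Re (v s)) \<le> exp (4*real n)"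
      using Hb[of s] s v(2)[OF s] by (simp_all add: R_def)
    then show ?thesis by (simp add: abs_le_iff)
  qed
  have B: "0 < 4*real n" using n by simp
  note d = deriv_bounds_of_Re_bound[OF v(1) R(1) B bd]
  show H0: "H 0 \<noteq> 0" by (rule Hnz) simp
  show "\<bar>ln (cmod (H 0))\<bar> \<le> 4*real n" using bd[of 0] v(2)[of 0] R by simp
  have "deriv H 0 = deriv v 0*H 0" by (rule log_derivative_at[OF v R(1)])
  then have dv: "deriv v 0 = deriv H 0/H 0" using H0 by simp
  show "cmod (deriv H 0/H 0) \<le> 288000*real n"
    using d(1)[of 0] R(1) unfolding dv by (simp add: R_def)
  assume s: "cmod s < 1/2000"
  have "cmod (v s - v 0 - deriv v 0*(s - 0)) \<le> 576*(4*real n)/R\<^sup>2*(cmod (s - 0))\<^sup>2"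
  proof (rule norm_linear_Taylor_le[where S = "ball 0 (R/2)"])
    show "v holomorphic_on ball 0 (R/2)" by (rule holomorphic_on_subset[OF v(1)]) (use R in auto)
    show "cmod (deriv (deriv v) x) \<le> 576*(4*real n)/R\<^sup>2" if "x \<in> ball 0 (R/2)" for x
      using d(2)[of x] that R by simp
  qed (use s R in auto)
  then have "cmod (v s - v 0 - deriv v 0*(s - 0)) \<le> 2304*1000\<^sup>2*real n*(cmod s)\<^sup>2"
    by (simp add: R_def power_divide)
  moreover have "H s = H 0*exp (deriv H 0/H 0 * s + (v s - v 0 - deriv v 0*(s - 0)))"
  proof -
    have "H 0 = exp (v 0)" using v(2)[of 0] R by simp
    moreover have "H s = exp (v s)" using v(2)[of s] s R by simp
    moreover have "exp (v s) = exp (v 0)*exp (v s - v 0)" by (simp flip: exp_add)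
    ultimately show ?thesis by (simp add: dv)
  qed
  ultimately show "\<exists>b. H s = H 0*exp (deriv H 0/H 0 * s + b) \<and> cmod b \<le> 2304*1000\<^sup>2*real n*(cmod s)\<^sup>2"
    by (intro exI[of _ "v s - v 0 - deriv v 0*(s - 0)"]) simp
qed

text \<open>A bound on a disk of radius T controls the change from the known case t = 0 to the
  wanted case t = 1 with a gain of 1/T.\<close>

lemma bounded_holomorphic_variation:
  assumes "f holomorphic_on ball 0 T" "4 \<le> T" "0 < B" "\<And>t. cmod t < T \<Longrightarrow> cmod (f t) \<le> B"
  shows "cmod (f 1 - f 0) \<le> 12*B/T"
proof -
  have "cmod (f 1 - f 0) \<le> 6*B*cmod 1/(T - cmod 1)"
  proof (rule Borel_Caratheodory_two_sided[OF assms(1) _ assms(3)])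
    show "\<bar>Re (f z) - 0\<bar> \<le> B" if "cmod z < T" for z
      using assms(4)[OF that] abs_Re_le_cmod[of "f z"] by simp
  qed (use assms in auto)
  also have "\<dots> \<le> 6*B/(T/2)"
    using assms by (intro frac_le) auto
  finally show ?thesis by simp
qed

text \<open>T = del0/r is the radius within which the nodes \<open>t * \<zeta> j\<close> remain
  small enough. On that disk Q'(0), H'(0)/H(0) and ln |H(0)| are O(n) uniformly in t. The first two
  gain 1/T over their values at t = 0; ln H(0), whose derivative at t = 0 vanishes, gains
  1/T^2.\<close>

lemma solution_estimates:
  assumes large: "large n" and r: "0 < r" "4 * r \<le> del0" and \<zeta>: "\<And>j. j < 2*n+1 \<Longrightarrow> cmod (\<zeta> j) \<le> r"
    and sol: "solution n \<zeta> P Q H" and Q0: "poly Q 0 = 1"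
  shows "cmod (coeff Q 1 + of_nat n/2) \<le> 1728/(eps0 * del0)*real n * r"
    "cmod (deriv H 0/H 0 - of_nat n/2) \<le> 12*288000/del0*real n * r"
    "\<exists>w. H 0 = (- 1)^n * of_real (zero_remainder n)*exp w \<and> cmod w \<le> 2304/del0\<^sup>2*real n * r\<^sup>2"
proof -
  note c = const_bounds
  have n: "1 \<le> n" using large by (simp add: large_def)
  define T where "T = del0/r"
  have T: "4 \<le> T" "0 < T" using r c by (auto simp: T_def field_simps)
  have "\<exists>q G D. q holomorphic_on ball 0 T \<and> G holomorphic_on ball 0 T \<and> D holomorphic_on ball 0 T \<and>
    (\<forall>t\<in>ball 0 T. \<exists>P Q H. solution n (\<lambda>j. t * \<zeta> j) P Q H \<and> poly Q 0 = 1 \<and> coeff Q 1 = q t \<and> H 0 = G t \<and> deriv H 0 = D t)"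
    unfolding T_def by (rule solution_family[OF large r(1)]) (rule \<zeta>)
  then obtain q G D where hol: "q holomorphic_on ball 0 T" "G holomorphic_on ball 0 T" "D holomorphic_on ball 0 T"
    and ex: "\<And>t. cmod t < T \<Longrightarrow> \<exists>P Q H. solution n (\<lambda>j. t * \<zeta> j) P Q H \<and> poly Q 0 = 1 \<and> coeff Q 1 = q t \<and> H 0 = G t \<and> deriv H 0 = D t"
    by (metis mem_ball_0)
  have \<zeta>': "cmod (t * \<zeta> j) \<le> del0" if t: "cmod t < T" and j: "j < 2*n+1" for t j
  proof -
    have "cmod (t * \<zeta> j) \<le> T * r" unfolding norm_mult using \<zeta>[OF j] t T by (intro mult_mono) auto
    then show ?thesis using r by (simp add: T_def)
  qed
  have val: "coeff Q' 1 = q t" "H' 0 = G t" "deriv H' 0 = D t"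
    if t: "cmod t < T" and s: "solution n (\<lambda>j. t * \<zeta> j) P' Q' H'" and q0: "poly Q' 0 = 1" for t P' Q' H'
  proof -
    obtain P Q H where S: "solution n (\<lambda>j. t * \<zeta> j) P Q H" and eqs: "poly Q 0 = 1" "coeff Q 1 = q t" "H 0 = G t" "deriv H 0 = D t"
      using ex[OF t] by blast
    have qq: "poly Q 0 = poly Q' 0" using eqs q0 by simp
    have "Q = Q'" by (rule solution_unique(2)[OF large S s _ qq]) (rule \<zeta>'[OF t])
    moreover have "H = H'" by (rule ext, rule solution_unique(3)[OF large S s _ qq]) (rule \<zeta>'[OF t])
    ultimately show "coeff Q' 1 = q t" "H' 0 = G t" "deriv H' 0 = D t" using eqs by simp_all
  qed
  have b: "cmod (q t) \<le> 144*real n/eps0" "G t \<noteq> 0" "\<bar>ln (cmod (G t))\<bar> \<le> 4*real n"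
      "cmod (D t/G t) \<le> 288000*real n" if t: "cmod t < T" for t
  proof -
    obtain P Q H where S: "solution n (\<lambda>j. t * \<zeta> j) P Q H" and eqs: "poly Q 0 = 1" "coeff Q 1 = q t" "H 0 = G t" "deriv H 0 = D t"
      using ex[OF t] by blast
    have z: "cmod (t * \<zeta> j) \<le> del0" if "j < 2*n+1" for j by (rule \<zeta>'[OF t that])
    show "cmod (q t) \<le> 144*real n/eps0" using solution_Q_log(1)[OF large S _ eqs(1)] z eqs by simp
    show "G t \<noteq> 0" using solution_H_log(1)[OF large S _ eqs(1)] z eqs by simp
    show "\<bar>ln (cmod (G t))\<bar> \<le> 4*real n" using solution_H_log(2)[OF large S _ eqs(1)] z eqs by simp
    show "cmod (D t/G t) \<le> 288000*real n" using solution_H_log(3)[OF large S _ eqs(1)] z eqs by simp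
  qed
  have one: "coeff Q 1 = q 1" "H 0 = G 1" "deriv H 0 = D 1"
    using val[of 1 P Q H] T sol Q0 by auto
  have zero: "q 0 = - (of_nat n/2)" "D 0/G 0 = of_nat n/2" "G 0 = (- 1)^n * of_real (zero_remainder n)"
  proof -
    obtain P Q H where S: "solution n (\<lambda>j. 0 * \<zeta> j) P Q H" and eqs: "poly Q 0 = 1" "coeff Q 1 = q 0" "H 0 = G 0" "deriv H 0 = D 0"
      using ex[of 0] T by auto
    have S': "solution n (\<lambda>_. 0) P Q H" using S by simp
    show "q 0 = - (of_nat n/2)" using zero_nodes_derivatives(1)[OF large S'] eqs by simp
    show "D 0/G 0 = of_nat n/2" using zero_nodes_derivatives(2)[OF large S'] eqs b(2)[of 0] T by simp
    show "G 0 = (- 1)^n * of_real (zero_remainder n)" using zero_nodes_remainder[OF n S'] eqs by simp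
  qed
  have "cmod (q 1 - q 0) \<le> 12*(144*real n/eps0)/T"
    by (rule bounded_holomorphic_variation[OF hol(1) T(1)]) (use b n c in auto)
  then show "cmod (coeff Q 1 + of_nat n/2) \<le> 1728/(eps0 * del0)*real n * r"
    unfolding one zero by (simp add: T_def)
  have holDG: "(\<lambda>t. D t/G t) holomorphic_on ball 0 T"
    by (intro holomorphic_on_divide hol) (use b in auto)
  have "cmod (D 1/G 1 - D 0/G 0) \<le> 12*(288000*real n)/T"
    by (rule bounded_holomorphic_variation[OF holDG T(1)]) (use b n in auto)
  then show "cmod (deriv H 0/H 0 - of_nat n/2) \<le> 12*288000/del0*real n * r"
    unfolding one zero(2) by (simp add: T_def)
  obtain g where g: "g holomorphic_on ball 0 T" "\<And>t. cmod t < T \<Longrightarrow> G t = exp (g t)"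
    using holomorphic_log_ball[OF hol(2) b(2)] by blast
  have bd: "\<bar>Re (g t) - 0\<bar> \<le> 4*real n" if "cmod t < T" for t
    using b(3)[OF that] g(2)[OF that] by simp
  \<comment> \<open>The reflected solution has the denominator P(- s) and at 0 the remainder - G(t);
    normalizing by P(0), which is the node polynomial at 0 times G(t) minus 1, must give G(-
    t).\<close>
  have refl: "G (- t)*(1 - node_poly n (\<lambda>j. t * \<zeta> j) 0 * G t) = G t" if t: "cmod t < T" for t
  proof -
    obtain P Q H where S: "solution n (\<lambda>j. t * \<zeta> j) P Q H" and eqs: "poly Q 0 = 1" "H 0 = G t"
      using ex[OF t] by blast
    have mt: "cmod (- t) < T" using t by simp
    have S1: "solution n (\<lambda>j. - t * \<zeta> j) (pcompose Q [:0, - 1:]) (pcompose P [:0, - 1:]) (\<lambda>s. - exp (of_nat n * s)*H (- s))"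
      using solution_reflect[OF S] by simp
    have p0: "poly (pcompose P [:0, - 1:]) 0 = poly P 0" by (simp add: poly_pcompose)
    have "poly (pcompose P [:0, - 1:]) 0 \<noteq> 0"
      by (rule solution_Q0[OF large S1]) (rule \<zeta>'[OF mt])
    then have P0: "poly P 0 \<noteq> 0" unfolding p0 .
    then have S2: "solution n (\<lambda>j. - t * \<zeta> j) (smult (1/poly P 0) (pcompose Q [:0, - 1:])) (smult (1/poly P 0) (pcompose P [:0, - 1:]))
        (\<lambda>s. 1/poly P 0*(- exp (of_nat n * s)*H (- s)))"
      by (intro solution_smult S1) simp
    have "1/poly P 0*(- exp (of_nat n*0)*H (- 0)) = G (- t)"
      by (rule val(2)[OF mt S2]) (use P0 p0 in simp)
    then have "- G t = poly P 0 * G (- t)" using P0 eqs by (simp add: field_simps)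
    moreover have "poly P 0 = node_poly n (\<lambda>j. t * \<zeta> j) 0 * G t - 1"
      using S eqs unfolding solution_def by (metis add_diff_cancel_left' exp_zero mult_1_left mult_zero_right)
    ultimately show ?thesis by (simp add: algebra_simps)
  qed
  have dG: "(G has_field_derivative deriv G 0) (at 0)"
    by (rule holomorphic_derivI[OF hol(2)]) (use T in auto)
  have dG0: "deriv G 0 = 0"
  proof -
    define K where "K = (\<Prod>j<2*n+1. - \<zeta> j)"
    \<comment> \<open>The correction in the symmetry relation is of order t^(2n+1), hence invisible
      to the first derivative: G and its reflection have the same derivative at 0, which is
      therefore 0.\<close>
    have node: "node_poly n (\<lambda>j. t * \<zeta> j) 0 = K * t^(2*n+1)" for t
    proof -
      have "(\<Prod>j<2*n+1. 0 - t * \<zeta> j) = (\<Prod>j<2*n+1. - \<zeta> j * t)" by (rule prod.cong) auto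
      also have "\<dots> = K * t^(2*n+1)" unfolding prod.distrib K_def by simp
      finally show ?thesis by (simp only: node_poly_def)
    qed
    have dK: "((\<lambda>t. K * t^(2*n+1)) has_field_derivative 0) (at 0)"
      by (rule DERIV_cong[OF DERIV_cmult[OF DERIV_power[OF DERIV_ident]]]) (use n in \<open>simp add: power_0_left\<close>)
    have "((\<lambda>t. G (- t)) has_field_derivative deriv G 0*(- 1)) (at 0)"
      by (rule DERIV_chain2[where g = uminus and f = G]) (use dG in \<open>auto intro!: derivative_eq_intros\<close>)
    moreover have "((\<lambda>t. 1 - K * t^(2*n+1) * G t) has_field_derivative 0) (at 0)"
      by (rule DERIV_cong[OF DERIV_diff[OF DERIV_const DERIV_mult[OF dK dG]]]) simp
    ultimately have "((\<lambda>t. G (- t)*(1 - K * t^(2*n+1) * G t)) has_field_derivative - deriv G 0) (at 0)"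
      by (rule DERIV_cong[OF DERIV_mult]) simp
    then have "(G has_field_derivative - deriv G 0) (at 0)"
      by (rule has_field_derivative_transform_within_open[of _ _ _ "ball 0 T"]) (use refl node T in auto)
    then have "deriv G 0 = - deriv G 0" using dG DERIV_unique by blast
    then show ?thesis by simp
  qed
  have dg0: "deriv g 0 = 0"
    using log_derivative_at[OF g T(2)] dG0 b(2)[of 0] T by simp
  have B: "0 < 4*real n" using n by simp
  note d = deriv_bounds_of_Re_bound[OF g(1) T(2) B bd]
  have "cmod (g 1 - g 0 - deriv g 0*(1 - 0)) \<le> 576*(4*real n)/T\<^sup>2*(cmod (1 - 0))\<^sup>2"
  proof (rule norm_linear_Taylor_le[where S = "ball 0 (T/2)"])
    show "g holomorphic_on ball 0 (T/2)" by (rule holomorphic_on_subset[OF g(1)]) (use T in auto)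
    show "cmod (deriv (deriv g) x) \<le> 576*(4*real n)/T\<^sup>2" if "x \<in> ball 0 (T/2)" for x
      using d(2)[of x] that T by simp
  qed (use T in auto)
  then have "cmod (g 1 - g 0) \<le> 2304/del0\<^sup>2*real n * r\<^sup>2"
    unfolding dg0 by (simp add: T_def power_divide)
  moreover have "H 0 = (- 1)^n * of_real (zero_remainder n)*exp (g 1 - g 0)"
    unfolding one zero(3)[symmetric] using g(2)[of 1] g(2)[of 0] T by (simp flip: exp_add)
  ultimately show "\<exists>w. H 0 = (- 1)^n * of_real (zero_remainder n)*exp w \<and> cmod w \<le> 2304/del0\<^sup>2*real n * r\<^sup>2"
    by blast
qed

lemma solution_cong:
  assumes "solution n \<zeta> P Q H" "\<And>j. j < 2*n+1 \<Longrightarrow> \<zeta> j = \<zeta>' j"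
  shows "solution n \<zeta>' P Q H"
proof -
  have "node_poly n \<zeta> = node_poly n \<zeta>'"
    unfolding node_poly_def by (intro ext prod.cong) (use assms(2) in auto)
  then show ?thesis using assms(1) by (simp add: solution_def)
qed

text \<open>The case r = 0, in which the radius del0/r makes no sense, is the explicit Pade
  case.\<close>

lemma solution_estimates':
  assumes large: "large n" and r: "0 \<le> r" "4 * r \<le> del0" and \<zeta>: "\<And>j. j < 2*n+1 \<Longrightarrow> cmod (\<zeta> j) \<le> r"
    and sol: "solution n \<zeta> P Q H" and Q0: "poly Q 0 = 1"
  shows "cmod (coeff Q 1 + of_nat n/2) \<le> 1728/(eps0 * del0)*real n * r"
    "cmod (deriv H 0/H 0 - of_nat n/2) \<le> 12*288000/del0*real n * r"
    "\<exists>w. H 0 = (- 1)^n * of_real (zero_remainder n)*exp w \<and> cmod w \<le> 2304/del0\<^sup>2*real n * r\<^sup>2"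
proof -
  have n: "1 \<le> n" using large by (simp add: large_def)
  consider "0 < r" | "r = 0" using r by linarith
  then have "cmod (coeff Q 1 + of_nat n/2) \<le> 1728/(eps0 * del0)*real n * r \<and>
    cmod (deriv H 0/H 0 - of_nat n/2) \<le> 12*288000/del0*real n * r \<and>
    (\<exists>w. H 0 = (- 1)^n * of_real (zero_remainder n)*exp w \<and> cmod w \<le> 2304/del0\<^sup>2*real n * r\<^sup>2)"
  proof cases
    case 1
    show ?thesis
      by (intro conjI solution_estimates[OF large 1 r(2) _ sol Q0]) (rule \<zeta>, assumption)+
  next
    case 2
    have S: "solution n (\<lambda>_. 0) P Q H" by (rule solution_cong[OF sol]) (use \<zeta> 2 in auto)
    have H: "H 0 = (- 1)^n * of_real (zero_remainder n)"
      using zero_nodes_remainder[OF n S] Q0 by simp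
    then have H0: "H 0 \<noteq> 0" using zero_remainder_pos[OF n] by simp
    have "coeff Q 1 + of_nat n/2 = 0" using zero_nodes_derivatives(1)[OF large S] Q0 by simp
    moreover have "deriv H 0/H 0 - of_nat n/2 = 0" using zero_nodes_derivatives(2)[OF large S] H0 by simp
    ultimately show ?thesis using H 2 by (auto intro!: exI[of _ 0])
  qed
  then show "cmod (coeff Q 1 + of_nat n/2) \<le> 1728/(eps0 * del0)*real n * r"
    "cmod (deriv H 0/H 0 - of_nat n/2) \<le> 12*288000/del0*real n * r"
    "\<exists>w. H 0 = (- 1)^n * of_real (zero_remainder n)*exp w \<and> cmod w \<le> 2304/del0\<^sup>2*real n * r\<^sup>2"
    by blast+
qed

definition est_const :: real where
  "est_const = 1728/(eps0 * del0) + 12*288000/del0 + 2304/del0\<^sup>2 + 2304/eps0\<^sup>2 + 2304*1000\<^sup>2"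

lemma est_const:
  "0 < est_const" "1728/(eps0 * del0) \<le> est_const" "12*288000/del0 \<le> est_const"
  "2304/del0\<^sup>2 \<le> est_const" "2304/eps0\<^sup>2 \<le> est_const" "2304*1000\<^sup>2 \<le> est_const"
proof -
  have gen: "0 < a + b + c + d + 2304*1000\<^sup>2 \<and> a \<le> a + b + c + d + 2304*1000\<^sup>2 \<and>
      b \<le> a + b + c + d + 2304*1000\<^sup>2 \<and> c \<le> a + b + c + d + 2304*1000\<^sup>2 \<and>
      d \<le> a + b + c + d + 2304*1000\<^sup>2 \<and> 2304*1000\<^sup>2 \<le> a + b + c + d + 2304*1000\<^sup>2"
    if "0 \<le> a" "0 \<le> b" "0 \<le> c" "0 \<le> d" for a b c d :: real
    using that by simp
  show "0 < est_const" "1728/(eps0 * del0) \<le> est_const" "12*288000/del0 \<le> est_const"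
    "2304/del0\<^sup>2 \<le> est_const" "2304/eps0\<^sup>2 \<le> est_const" "2304*1000\<^sup>2 \<le> est_const"
    using gen[of "1728/(eps0 * del0)" "12*288000/del0" "2304/del0\<^sup>2" "2304/eps0\<^sup>2"] const_bounds
    unfolding est_const_def by simp_all
qed

text \<open>In the exponents the error r |s| comes from the first Taylor coefficient of the
  logarithm, the error |s|^2 from Taylor's remainder.\<close>

lemma solution_asymptotics:
  assumes large: "large n" and r: "0 \<le> r" "4 * r \<le> del0" and \<zeta>: "\<And>j. j < 2*n+1 \<Longrightarrow> cmod (\<zeta> j) \<le> r"
    and sol: "solution n \<zeta> P Q H" and Q0: "poly Q 0 = 1"
  shows "\<exists>w. H 0 = (- 1)^n * of_real (zero_remainder n)*exp w \<and> cmod w \<le> est_const*real n * r\<^sup>2"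
    "cmod s < eps0/4 \<Longrightarrow> \<exists>a. poly Q s = exp (- (of_nat n * s/2) + a) \<and>
       cmod a \<le> est_const*(real n*(r*cmod s + (cmod s)\<^sup>2))"
    "cmod s < eps0/4 \<Longrightarrow> \<exists>b. H s = H 0*exp (of_nat n * s/2 + b) \<and>
       cmod b \<le> est_const*(real n*(r*cmod s + (cmod s)\<^sup>2))"
proof -
  note c = const_bounds and K = est_const
  have \<zeta>': "cmod (\<zeta> j) \<le> del0" if "j < 2*n+1" for j
    using \<zeta>[OF that] r by linarith
  note e = solution_estimates'[OF large r _ sol Q0]
  obtain w where w: "H 0 = (- 1)^n * of_real (zero_remainder n)*exp w" "cmod w \<le> 2304/del0\<^sup>2*real n * r\<^sup>2"
    using e(3) \<zeta> by blast
  have "2304/del0\<^sup>2*(real n * r\<^sup>2) \<le> est_const*(real n * r\<^sup>2)"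
    by (rule mult_right_mono[OF K(4)]) simp
  then show "\<exists>w. H 0 = (- 1)^n * of_real (zero_remainder n)*exp w \<and> cmod w \<le> est_const*real n * r\<^sup>2"
    using w by (intro exI[of _ w]) (simp add: mult.assoc)
  have bound: "cmod (e * s + a) \<le> est_const*(real n*(r*cmod s + (cmod s)\<^sup>2))"
    if "cmod e \<le> x*real n * r" "cmod a \<le> y*real n*(cmod s)\<^sup>2" "x \<le> est_const" "y \<le> est_const" for e a x y
  proof -
    have "cmod (e * s + a) \<le> cmod e*cmod s + cmod a" by (metis norm_mult norm_triangle_ineq)
    also have "\<dots> \<le> (x*real n * r)*cmod s + y*real n*(cmod s)\<^sup>2"
      using that by (intro add_mono mult_right_mono) auto
    also have "\<dots> = x*(real n*(r*cmod s)) + y*(real n*(cmod s)\<^sup>2)" by (simp add: mult_ac)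
    also have "\<dots> \<le> est_const*(real n*(r*cmod s)) + est_const*(real n*(cmod s)\<^sup>2)"
      using that r by (intro add_mono mult_right_mono) auto
    finally show ?thesis by (simp add: algebra_simps)
  qed
  assume s: "cmod s < eps0/4"
  have e1: "cmod (coeff Q 1 + of_nat n/2) \<le> 1728/(eps0 * del0)*real n * r" using e(1) \<zeta> by blast
  have e2: "cmod (deriv H 0/H 0 - of_nat n/2) \<le> 12*288000/del0*real n * r" using e(2) \<zeta> by blast
  have "\<exists>a. poly Q s = exp (coeff Q 1 * s + a) \<and> cmod a \<le> 2304*real n/eps0\<^sup>2*(cmod s)\<^sup>2"
    by (rule solution_Q_log(2)[OF large sol _ Q0 s]) (rule \<zeta>')
  then obtain a where a: "poly Q s = exp (coeff Q 1 * s + a)" "cmod a \<le> 2304/eps0\<^sup>2*real n*(cmod s)\<^sup>2" by auto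
  show "\<exists>a. poly Q s = exp (- (of_nat n * s/2) + a) \<and> cmod a \<le> est_const*(real n*(r*cmod s + (cmod s)\<^sup>2))"
  proof (intro exI conjI)
    show "poly Q s = exp (- (of_nat n * s/2) + ((coeff Q 1 + of_nat n/2) * s + a))"
      using a(1) by (simp add: algebra_simps)
    show "cmod ((coeff Q 1 + of_nat n/2) * s + a) \<le> est_const*(real n*(r*cmod s + (cmod s)\<^sup>2))"
      by (rule bound[OF e1 a(2) K(2) K(5)])
  qed
  have s': "cmod s < 1/2000" using s c by simp
  have "\<exists>b. H s = H 0*exp (deriv H 0/H 0 * s + b) \<and> cmod b \<le> 2304*1000\<^sup>2*real n*(cmod s)\<^sup>2"
    by (rule solution_H_log(4)[OF large sol _ Q0 s']) (rule \<zeta>')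
  then obtain b where b: "H s = H 0*exp (deriv H 0/H 0 * s + b)" "cmod b \<le> 2304*1000\<^sup>2*real n*(cmod s)\<^sup>2" by blast
  show "\<exists>b. H s = H 0*exp (of_nat n * s/2 + b) \<and> cmod b \<le> est_const*(real n*(r*cmod s + (cmod s)\<^sup>2))"
  proof (intro exI conjI)
    have "deriv H 0/H 0 * s + b = of_nat n * s/2 + ((deriv H 0/H 0 - of_nat n/2) * s + b)"
      by (simp only: left_diff_distrib) simp
    then show "H s = H 0*exp (of_nat n * s/2 + ((deriv H 0/H 0 - of_nat n/2) * s + b))"
      using b(1) by (simp only:)
    show "cmod ((deriv H 0/H 0 - of_nat n/2) * s + b) \<le> est_const*(real n*(r*cmod s + (cmod s)\<^sup>2))"
      by (rule bound[OF e2 b(2) K(3) K(6)])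
  qed
qed

section \<open>The interpolants\<close>

lemma omega_eq: "omega z n w = (\<Prod>j<2*n+1. w - z n j)"
  unfolding omega_def by (rule prod.cong) auto

lemma pair_entire_quotient:
  assumes "exp_interpolation_pair z n p q"
  shows "\<exists>h. h holomorphic_on UNIV \<and> (\<forall>w. exp w*poly q w + poly p w = omega z n w * h w)"
proof -
  define f where "f = (\<lambda>w. poly p w*exp (- w/2) + poly q w*exp (w/2))"
  have f: "f holomorphic_on UNIV" unfolding f_def by (intro holomorphic_intros) auto
  have O: "f \<in> O[nhds (z n j)](\<lambda>w. \<Prod>j<2*n+1. w - z n j)" if j: "j < 2*n+1" for j
  proof -
    have "f \<in> O[nhds (z n j)](omega z n)"
      using assms j unfolding exp_interpolation_pair_def big_O_omega_def f_def by auto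
    moreover have "omega z n = (\<lambda>w. \<Prod>j<2*n+1. w - z n j)" by (rule ext) (rule omega_eq)
    ultimately show ?thesis by (simp only:)
  qed
  show ?thesis
  proof (rule entire_quotient_of_bigo[of f "2*n+1" "z n", OF f])
    show "f \<in> O[nhds (z n j)](\<lambda>w. \<Prod>j<2*n+1. w - z n j)" if "j < 2*n+1" for j by (rule O[OF that])
    fix h assume h: "h holomorphic_on UNIV" "\<And>w. f w = (\<Prod>j<2*n+1. w - z n j) * h w"
    have "exp w*poly q w + poly p w = omega z n w*(h w*exp (w/2))" for w
    proof -
      have "exp (w/2) * f w = exp w*poly q w + poly p w"
      proof -
        have "exp (w/2)*exp (- w/2) = 1" "exp (w/2)*exp (w/2) = exp w" by (simp_all flip: exp_add)
        moreover have "exp (w/2) * f w = exp (w/2)*exp (- w/2)*poly p w + exp (w/2)*exp (w/2)*poly q w"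
          by (simp add: f_def algebra_simps)
        ultimately show ?thesis by simp
      qed
      moreover have "f w = omega z n w * h w" by (simp only: h(2) omega_eq)
      ultimately show ?thesis by (simp only: mult_ac)
    qed
    moreover have "(\<lambda>w. h w*exp (w/2)) holomorphic_on UNIV" by (intro holomorphic_intros h(1)) auto
    ultimately show ?thesis by blast
  qed
qed

lemma pair_solution:
  assumes n: "1 \<le> n" and pair: "exp_interpolation_pair z n p q"
    and h: "h holomorphic_on UNIV" "\<And>w. exp w*poly q w + poly p w = omega z n w * h w"
  shows "solution n (\<lambda>j. z n j/of_nat n) (pcompose p [:0, of_nat n:]) (pcompose q [:0, of_nat n:])
    (\<lambda>s. of_nat n^(2*n+1) * h (of_nat n * s))"
proof -
  have node: "omega z n (of_nat n * s) = of_nat n^(2*n+1)*node_poly n (\<lambda>j. z n j/of_nat n) s" for s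
  proof -
    have "(\<Prod>j<2*n+1. of_nat n * s - z n j) = (\<Prod>j<2*n+1. of_nat n*(s - z n j/of_nat n))"
      by (rule prod.cong) (use n in \<open>auto simp: right_diff_distrib\<close>)
    also have "\<dots> = of_nat n^(2*n+1)*(\<Prod>j<2*n+1. s - z n j/of_nat n)"
      unfolding prod.distrib by simp
    finally show ?thesis by (simp only: omega_eq node_poly_def)
  qed
  have "exp (of_nat n * s)*poly (pcompose q [:0, of_nat n:]) s + poly (pcompose p [:0, of_nat n:]) s
      = node_poly n (\<lambda>j. z n j/of_nat n) s*(of_nat n^(2*n+1) * h (of_nat n * s))" for s
    using h(2)[of "of_nat n * s"] unfolding node by (simp add: poly_pcompose mult_ac)
  moreover have "(\<lambda>s. of_nat n^(2*n+1) * h (of_nat n * s)) holomorphic_on UNIV"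
  proof -
    have "(h \<circ> (\<lambda>s. of_nat n * s)) holomorphic_on UNIV"
      by (rule holomorphic_on_compose_gen[OF _ h(1)]) (auto intro!: holomorphic_intros)
    then show ?thesis by (intro holomorphic_intros) (simp add: o_def)
  qed
  moreover have "pcompose R [:0, of_nat n:] = 0 \<longleftrightarrow> R = 0" for R :: "complex poly"
    by (rule pcompose_eq_0_iff) (use n in simp)
  ultimately show ?thesis
    using pair n unfolding solution_def exp_interpolation_pair_def by (auto simp: degree_pcompose)
qed

text \<open>The predicate mentions only the level and the list of points: the pair is quantified
  inside. A constant selected through it can thus depend on nothing but the interpolation
  points.\<close>

definition level_log :: "nat \<Rightarrow> complex list \<Rightarrow> complex \<Rightarrow> bool" where
  "level_log n L w \<longleftrightarrow> (\<exists>P Q H. solution n (\<lambda>j. L ! j/of_nat n) P Q H \<and> poly Q 0 = 1 \<and>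
     H 0 = (- 1)^n * of_real (zero_remainder n)*exp w \<and>
     cmod w \<le> est_const*real n*(Max (cmod ` set L)/real n)\<^sup>2)"

text \<open>By uniqueness all \<open>w\<close> with \<open>level_log n L w\<close> give the same value up to a root of unity; the bound in
  \<open>level_log\<close> selects a root near 1.\<close>

definition level_const :: "complex list \<Rightarrow> complex" where
  "level_const L = (let n = (length L - 1) div 2 in exp ((SOME w. level_log n L w)/of_nat (2*n+1)))"

lemma rho_eq: "rho z n = Max (cmod ` set (level_points z n))"
proof -
  have "set (level_points z n) = z n ` {0..2*n}"
    unfolding level_points_def set_map set_upt by (rule arg_cong[where f = "(`) (z n)"]) auto
  then show ?thesis by (simp add: rho_def image_image)
qed

lemma norm_le_rho: "j < 2*n+1 \<Longrightarrow> cmod (z n j) \<le> rho z n"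
  unfolding rho_def by (intro Max_ge) auto

lemma zero_remainder_exp:
  assumes n: "1 \<le> n"
  shows "\<exists>d. cmod d \<le> 1/(2*real n) \<and>
    complex_of_real (zero_remainder n)/of_nat n^(2*n+1)
      = (of_real (exp 1)/(4 * of_nat n))^(2*n+1)*exp (d - 1)"
proof -
  define N where "N = 2*n+1"
  define d where "d = ln (zero_remainder n) + real N*(2*ln 2 - 1) + 1"
  have "zero_remainder n = exp (ln (zero_remainder n))" using zero_remainder_pos[OF n] by simp
  also have "ln (zero_remainder n) = real N*(1 - 2*ln 2) + (d - 1)" by (simp add: d_def algebra_simps)
  also have "exp \<dots> = exp (1 - 2*ln 2)^N*exp (d - 1)" by (simp add: exp_add exp_of_nat_mult)
  also have "exp (1 - 2*ln 2) = exp 1/(4::real)"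
  proof -
    have "exp (2*ln 2) = (4::real)" using exp_of_nat_mult[of 2 "ln (2::real)"] by simp
    then show ?thesis by (simp add: exp_diff)
  qed
  finally have "zero_remainder n = (exp 1/4)^N*exp (d - 1)" .
  then have "complex_of_real (zero_remainder n) = (of_real (exp 1)/4)^N*exp (of_real d - 1)"
    by (simp add: exp_of_real[symmetric])
  moreover have "(a/4)^N * x/m^N = (a/(4 * m))^N * x" for a x m :: complex
    by (simp add: power_divide power_mult_distrib)
  ultimately have "complex_of_real (zero_remainder n)/of_nat n^N
      = (of_real (exp 1)/(4 * of_nat n))^N*exp (of_real d - 1)" by (simp only:)
  moreover have "cmod (of_real d) \<le> 1/(2*real n)"
    using zero_remainder_stirling[OF n] by (simp only: norm_of_real d_def N_def)
  ultimately show ?thesis unfolding N_def by blast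
qed

text \<open>The scaled estimates are read at s = x/n. What is known about denominators transfers to
  numerators because the reflected solution has the denominator P(- s).\<close>

lemma level_asymptotics:
  assumes large: "large n" and r4: "4*(rho z n/real n) \<le> del0" and pair: "exp_interpolation_pair z n p q"
  defines "r \<equiv> rho z n/real n"
  defines "err \<equiv> \<lambda>x. est_const*(r*cmod x + (cmod x)\<^sup>2/real n)"
  shows "cmod x \<le> eps0*real n \<Longrightarrow> poly q x \<noteq> 0 \<and> poly p x \<noteq> 0"
    "\<exists>w. level_log n (level_points z n) w"
    "cmod x < eps0/4*real n \<Longrightarrow> \<exists>a. cmod a \<le> err x \<and> poly q x = poly q 0*exp (- x/2 + a)"
    "cmod x < eps0/4*real n \<Longrightarrow> \<exists>a. cmod a \<le> err x \<and> poly p x = poly p 0*exp (x/2 + a)"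
    "cmod (poly p 0/poly q 0 + 1) \<le> r^(2*n+1)*exp (4*real n)"
    "level_log n (level_points z n) w \<Longrightarrow> cmod x < eps0/4*real n \<Longrightarrow>
      \<exists>y. cmod y \<le> 2 * err x + 1/(2*real n) \<and>
        exp x + rat_fun p q x = (- 1)^n*(of_real (exp 1)/(4 * of_nat n))^(2*n+1) * omega z n x*exp (x - 1)*exp (w + y)"
proof -
  note c = const_bounds
  have n: "1 \<le> n" "0 < real n" using large by (auto simp: large_def)
  obtain h where h: "h holomorphic_on UNIV" "\<And>w. exp w*poly q w + poly p w = omega z n w * h w"
    using pair_entire_quotient[OF pair] by blast
  define \<zeta> where "\<zeta> = (\<lambda>j. z n j/of_nat n)"
  define Q where "Q = pcompose q [:0, of_nat n:]"
  define P where "P = pcompose p [:0, of_nat n:]"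
  define H where "H = (\<lambda>s. of_nat n^(2*n+1) * h (of_nat n * s))"
  have S0: "solution n \<zeta> P Q H"
    unfolding \<zeta>_def P_def Q_def H_def by (rule pair_solution[OF n(1) pair h])
  have Qs: "poly Q s = poly q (of_nat n * s)" and Ps: "poly P s = poly p (of_nat n * s)" for s
    by (simp_all add: Q_def P_def poly_pcompose mult.commute)
  have \<zeta>: "cmod (\<zeta> j) \<le> r" if "j < 2*n+1" for j
    unfolding \<zeta>_def r_def norm_divide using norm_le_rho[OF that, of z] n by (simp add: divide_right_mono)
  have r: "0 \<le> r" "4 * r \<le> del0"
    using \<zeta>[of 0] r4 by (auto intro: order.trans[OF norm_ge_zero] simp: r_def)
  have \<zeta>': "cmod (\<zeta> j) \<le> del0" if "j < 2*n+1" for j using \<zeta>[OF that] r by linarith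
  have Q0: "poly Q 0 \<noteq> 0" by (rule solution_Q0[OF large S0]) (rule \<zeta>')
  define RP where "RP = pcompose P [:0, - 1:]"
  have RP: "poly RP s = poly P (- s)" for s by (simp add: RP_def poly_pcompose)
  have S1: "solution n (\<lambda>j. - \<zeta> j) (pcompose Q [:0, - 1:]) RP (\<lambda>s. - exp (of_nat n * s)*H (- s))"
    unfolding RP_def by (rule solution_reflect[OF S0])
  have m\<zeta>: "cmod (- \<zeta> j) \<le> r" if "j < 2*n+1" for j using \<zeta>[OF that] by simp
  have m\<zeta>': "cmod (- \<zeta> j) \<le> del0" if "j < 2*n+1" for j using \<zeta>'[OF that] by simp
  have RP0: "poly RP 0 \<noteq> 0" by (rule solution_Q0[OF large S1]) (rule m\<zeta>')
  have sc: "cmod (x/of_nat n) = cmod x/real n" for x by (simp add: norm_divide)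
  have nx: "of_nat n*(x/of_nat n) = x" for x :: complex using n by simp
  show "poly q x \<noteq> 0 \<and> poly p x \<noteq> 0" if x: "cmod x \<le> eps0*real n"
  proof
    have "cmod (x/of_nat n) \<le> eps0" unfolding sc using x n by (simp add: pos_divide_le_eq)
    then have "poly Q (x/of_nat n) \<noteq> 0" by (rule solution_zero_free(1)[OF large S0, rotated]) (rule \<zeta>')
    then show "poly q x \<noteq> 0" unfolding Qs nx .
    have "cmod (- (x/of_nat n)) \<le> eps0" unfolding norm_minus_cancel sc using x n by (simp add: pos_divide_le_eq)
    then have "poly RP (- (x/of_nat n)) \<noteq> 0" by (rule solution_zero_free(1)[OF large S1, rotated]) (rule m\<zeta>')
    then show "poly p x \<noteq> 0" unfolding RP Ps minus_minus nx .
  qed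
  define k where "k = 1/poly Q 0"
  have S: "solution n \<zeta> (smult k P) (smult k Q) (\<lambda>s. k*H s)"
    by (rule solution_smult[OF S0]) (use Q0 in \<open>simp add: k_def\<close>)
  have q1: "poly (smult k Q) 0 = 1" using Q0 by (simp add: k_def)
  define k' where "k' = 1/poly RP 0"
  have S': "solution n (\<lambda>j. - \<zeta> j) (smult k' (pcompose Q [:0, - 1:])) (smult k' RP) (\<lambda>s. k'*(- exp (of_nat n * s)*H (- s)))"
    by (rule solution_smult[OF S1]) (use RP0 in \<open>simp add: k'_def\<close>)
  have q1': "poly (smult k' RP) 0 = 1" using RP0 by (simp add: k'_def)
  have err: "est_const*(real n*(r*(cmod x/real n) + (cmod x/real n)\<^sup>2)) = err x" for x
    unfolding err_def using n by (simp add: field_simps power2_eq_square)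
  have xs: "cmod (x/of_nat n) < eps0/4" if "cmod x < eps0/4*real n" for x
    unfolding sc using that n by (simp add: pos_divide_less_eq)
  have asq: "\<exists>a. cmod a \<le> err x \<and> poly q x = poly q 0*exp (- x/2 + a)" if x: "cmod x < eps0/4*real n" for x
  proof -
    have "\<exists>a. poly (smult k Q) (x/of_nat n) = exp (- (of_nat n*(x/of_nat n)/2) + a) \<and>
       cmod a \<le> est_const*(real n*(r*cmod (x/of_nat n) + (cmod (x/of_nat n))\<^sup>2))"
      by (rule solution_asymptotics(2)[OF large r _ S q1 xs[OF x]]) (rule \<zeta>)
    then obtain a where "poly (smult k Q) (x/of_nat n) = exp (- (of_nat n*(x/of_nat n)/2) + a)"
      "cmod a \<le> est_const*(real n*(r*cmod (x/of_nat n) + (cmod (x/of_nat n))\<^sup>2))" by blast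
    then have "k*poly q x = exp (- (x/2) + a)" "cmod a \<le> err x" unfolding sc err nx poly_smult Qs by auto
    then show ?thesis using Q0 unfolding k_def Qs by (intro exI[of _ a]) (simp add: field_simps)
  qed
  then show "\<exists>a. cmod a \<le> err x \<and> poly q x = poly q 0*exp (- x/2 + a)" if x: "cmod x < eps0/4*real n" using x .
  show "\<exists>a. cmod a \<le> err x \<and> poly p x = poly p 0*exp (x/2 + a)" if x: "cmod x < eps0/4*real n"
  proof -
    have x': "cmod (- (x/of_nat n)) < eps0/4" using xs[OF x] by simp
    have "\<exists>a. poly (smult k' RP) (- (x/of_nat n)) = exp (- (of_nat n*(- (x/of_nat n))/2) + a) \<and>
       cmod a \<le> est_const*(real n*(r*cmod (- (x/of_nat n)) + (cmod (- (x/of_nat n)))\<^sup>2))"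
      by (rule solution_asymptotics(2)[OF large r _ S' q1' x']) (rule m\<zeta>)
    then obtain a where a: "poly (smult k' RP) (- (x/of_nat n)) = exp (- (of_nat n*(- (x/of_nat n))/2) + a)"
      "cmod a \<le> est_const*(real n*(r*cmod (- (x/of_nat n)) + (cmod (- (x/of_nat n)))\<^sup>2))" by blast
    have "k'*poly p x = exp (x/2 + a)"
      using a(1) unfolding poly_smult RP Ps mult_minus_right minus_minus nx by simp
    moreover have "cmod a \<le> err x" using a(2) unfolding norm_minus_cancel sc err .
    ultimately show ?thesis using RP0 unfolding k'_def RP Ps by (intro exI[of _ a]) (simp add: field_simps)
  qed
  \<comment> \<open>At s = 0 the equation says that P(0) + Q(0) is the node polynomial at 0 times
    H(0); the former factor is at most r^(2n+1), the latter at most e^(4n) |Q(0)|.\<close>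
  show "cmod (poly p 0/poly q 0 + 1) \<le> r^(2*n+1)*exp (4*real n)"
  proof -
    have "exp (of_nat n*0)*poly Q 0 + poly P 0 = node_poly n \<zeta> 0*H 0"
      using S0 by (simp only: solution_def)
    then have "poly p 0/poly q 0 + 1 = node_poly n \<zeta> 0*(H 0/poly Q 0)"
      using Q0 by (simp add: Qs Ps field_simps)
    moreover have "cmod (node_poly n \<zeta> 0) \<le> r^(2*n+1)"
    proof -
      have "cmod (node_poly n \<zeta> 0) = (\<Prod>j<2*n+1. cmod (0 - \<zeta> j))" unfolding node_poly_def by (rule prod_norm[symmetric])
      also have "\<dots> \<le> (\<Prod>j<2*n+1. r)" by (rule prod_mono) (use \<zeta> in auto)
      finally show ?thesis by simp
    qed
    moreover have "cmod (H 0/poly Q 0) \<le> exp (4*real n)"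
    proof -
      have "cmod (H 0) \<le> exp (4*real n)*cmod (poly Q 0)"
        using solution_zero_free(2)[OF large S0 \<zeta>', of 0] by simp
      then show ?thesis using Q0 by (simp add: norm_divide pos_divide_le_eq)
    qed
    ultimately show ?thesis using r by (simp only: norm_mult) (intro mult_mono; simp)
  qed
  have nodes: "level_points z n ! j/of_nat n = \<zeta> j" if "j < 2*n+1" for j
    using that by (simp add: level_points_def \<zeta>_def del: upt_Suc)
  obtain w0 where w0: "k*H 0 = (- 1)^n * of_real (zero_remainder n)*exp w0" "cmod w0 \<le> est_const*real n * r\<^sup>2"
    using solution_asymptotics(1)[OF large r \<zeta> S q1] by blast
  show "\<exists>w. level_log n (level_points z n) w"
  proof -
    have S2: "solution n (\<lambda>j. level_points z n ! j/of_nat n) (smult k P) (smult k Q) (\<lambda>s. k*H s)"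
      by (rule solution_cong[OF S]) (use nodes in simp)
    show ?thesis
      unfolding level_log_def rho_eq[symmetric] using S2 q1 w0 unfolding r_def
      by (intro exI[of _ w0] exI[of _ "smult k P"] exI[of _ "smult k Q"] exI[of _ "\<lambda>s. k*H s"]) blast
  qed
  assume w: "level_log n (level_points z n) w" and x: "cmod x < eps0/4*real n"
  obtain P' Q' H' where S3: "solution n (\<lambda>j. level_points z n ! j/of_nat n) P' Q' H'" "poly Q' 0 = 1"
    "H' 0 = (- 1)^n * of_real (zero_remainder n)*exp w"
    using w unfolding level_log_def by blast
  have S4: "solution n \<zeta> P' Q' H'" by (rule solution_cong[OF S3(1)]) (rule nodes)
  have "poly (smult k Q) 0 = poly Q' 0" unfolding q1 S3(2) ..
  \<comment> \<open>By uniqueness every admissible \<open>w\<close> yields the same value of exp w,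
    so the particular choice is immaterial here.\<close>
  then have "k*H 0 = H' 0" by (rule solution_unique(3)[OF large S S4, rotated]) (rule \<zeta>')
  then have kH0: "k*H 0 = (- 1)^n * of_real (zero_remainder n)*exp w" using S3(3) by simp
  obtain a where a: "cmod a \<le> err x" "poly q x = poly q 0*exp (- x/2 + a)" using asq[OF x] by blast
  have "\<exists>b. k*H (x/of_nat n) = k*H 0*exp (of_nat n*(x/of_nat n)/2 + b) \<and>
      cmod b \<le> est_const*(real n*(r*cmod (x/of_nat n) + (cmod (x/of_nat n))\<^sup>2))"
    by (rule solution_asymptotics(3)[OF large r _ S q1 xs[OF x]]) (rule \<zeta>)
  then obtain b where b: "k*H (x/of_nat n) = k*H 0*exp (of_nat n*(x/of_nat n)/2 + b)"
      "cmod b \<le> est_const*(real n*(r*cmod (x/of_nat n) + (cmod (x/of_nat n))\<^sup>2))" by blast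
  obtain d where d: "cmod d \<le> 1/(2*real n)"
      "complex_of_real (zero_remainder n)/of_nat n^(2*n+1)
        = (of_real (exp 1)/(4 * of_nat n))^(2*n+1)*exp (d - 1)"
    using zero_remainder_exp[OF n(1)] by blast
  define E where "E = (of_real (exp 1)/(4 * of_nat n) :: complex)^(2*n+1)"
  define M where "M = (of_nat n :: complex)^(2*n+1)"
  have M: "M \<noteq> 0" using n by (simp add: M_def)
  have q0: "poly q 0 \<noteq> 0" using Q0 by (simp add: Qs)
  have qx: "poly q x \<noteq> 0" using a(2) q0 by simp
  have hx: "h x = poly q 0*((- 1)^n*(E*exp (d - 1))*exp w*exp (x/2 + b))"
  proof -
    have "H (x/of_nat n) = M * h x" unfolding H_def nx M_def ..
    then have "k*(M * h x) = (- 1)^n * of_real (zero_remainder n)*exp w*exp (x/2 + b)"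
      using b(1) unfolding kH0 nx by (simp only:)
    also have "of_real (zero_remainder n) = M*(E*exp (d - 1))"
      unfolding E_def d(2)[symmetric] using M unfolding M_def by simp
    finally have *: "k*(M * h x) = (- 1)^n*(M*(E*exp (d - 1)))*exp w*exp (x/2 + b)" .
    have gen: "X = q*(s * e * W * Y)" if "1/q*(M * X) = s*(M * e) * W * Y" "q \<noteq> 0" for X q s e W Y :: complex
      using that M by (simp add: field_simps)
    show ?thesis by (rule gen[OF _ q0]) (use * in \<open>simp only: k_def Qs mult_zero_right\<close>)
  qed
  have "exp x + rat_fun p q x = omega z n x * h x/poly q x"
    using h(2)[of x] qx by (simp add: rat_fun_def add_divide_distrib[symmetric] add_divide_eq_iff)
  also have "\<dots> = omega z n x*((- 1)^n*(E*exp (d - 1))*exp w*exp (x/2 + b))/exp (- x/2 + a)"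
    unfolding hx a(2) using q0 by simp
  also have "\<dots> = (- 1)^n * E * omega z n x*(exp (d - 1)*exp w*exp (x/2 + b)/exp (- x/2 + a))"
    by (simp add: mult_ac)
  \<comment> \<open>The factors e^(x/2) from H and from 1/q combine to e^x; the errors are d from
    Stirling's formula, b from H and a from q.\<close>
  also have "exp (d - 1)*exp w*exp (x/2 + b)/exp (- x/2 + a) = exp (x - 1)*exp (w + (d + b - a))"
    by (simp flip: exp_add exp_diff) (simp add: algebra_simps)
  finally have fin: "exp x + rat_fun p q x = (- 1)^n * E * omega z n x*exp (x - 1)*exp (w + (d + b - a))"
    by (simp only: mult.assoc)
  have "cmod (d + b - a) \<le> cmod d + cmod b + cmod a"
    by (intro order.trans[OF norm_triangle_ineq4] add_right_mono norm_triangle_ineq)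
  also have "\<dots> \<le> 2 * err x + 1/(2*real n)" using a(1) b(2) d(1) unfolding sc err by linarith
  finally show "\<exists>y. cmod y \<le> 2 * err x + 1/(2*real n) \<and>
        exp x + rat_fun p q x = (- 1)^n*(of_real (exp 1)/(4 * of_nat n))^(2*n+1) * omega z n x*exp (x - 1)*exp (w + y)"
    using fin unfolding E_def by blast
qed

lemma rat_fun_no_zero_pole:
  assumes "poly p a \<noteq> 0" "poly q a \<noteq> 0"
  shows "\<not> (isolated_zero (rat_fun p q) a \<or> is_pole (rat_fun p q) a)"
proof -
  have t: "(rat_fun p q \<longlongrightarrow> rat_fun p q a) (at a)"
    unfolding rat_fun_def by (intro tendsto_intros assms(2))
  have nz: "rat_fun p q a \<noteq> 0" using assms by (simp add: rat_fun_def)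
  have "\<not> isolated_zero (rat_fun p q) a"
    using t nz tendsto_unique[of "at a" "rat_fun p q"] unfolding isolated_zero_def by (metis trivial_limit_at)
  moreover have "\<not> is_pole (rat_fun p q) a"
    using t not_tendsto_and_filterlim_at_infinity[of "at a"] unfolding is_pole_def by (metis trivial_limit_at)
  ultimately show ?thesis by blast
qed

lemma rat_fun_big_O_omega:
  assumes pair: "exp_interpolation_pair z n p q" and q: "\<And>x. cmod x \<le> rho z n \<Longrightarrow> poly q x \<noteq> 0"
  shows "big_O_omega z n (\<lambda>w. exp w + rat_fun p q w)"
  unfolding big_O_omega_def
proof
  fix j assume "j \<in> {0..2*n}"
  then have "cmod (z n j) \<le> rho z n" by (intro norm_le_rho) auto
  then have qj: "poly q (z n j) \<noteq> 0" by (rule q)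
  obtain h where h: "h holomorphic_on UNIV" "\<And>w. exp w*poly q w + poly p w = omega z n w * h w"
    using pair_entire_quotient[OF pair] by blast
  have ch: "isCont h w" for w
    using h(1) by (meson UNIV_I continuous_on_eq_continuous_at holomorphic_on_imp_continuous_on open_UNIV)
  have cq: "isCont (poly q) w" for w by (rule poly_isCont)
  have "((\<lambda>w. h w/poly q w) \<longlongrightarrow> h (z n j)/poly q (z n j)) (nhds (z n j))"
    using ch[of "z n j"] cq[of "z n j"] qj unfolding continuous_at by (intro tendsto_divide) (simp_all add: tendsto_nhds_iff)
  from order_tendstoD(2)[OF tendsto_norm[OF this], of "cmod (h (z n j)/poly q (z n j)) + 1"]
  have "\<forall>\<^sub>F w in nhds (z n j). cmod (h w/poly q w) < cmod (h (z n j)/poly q (z n j)) + 1"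
    by simp
  moreover have "\<forall>\<^sub>F w in nhds (z n j). poly q w \<noteq> 0"
  proof (rule eventually_nhds_in_open[of "{w. poly q w \<noteq> 0}", simplified])
    show "open {w. poly q w \<noteq> 0}" by (intro open_Collect_neq continuous_intros)
  qed (rule qj)
  ultimately have "\<forall>\<^sub>F w in nhds (z n j). cmod (exp w + rat_fun p q w)
      \<le> (cmod (h (z n j)/poly q (z n j)) + 1)*cmod (omega z n w)"
  proof eventually_elim
    case (elim w)
    have "exp w + rat_fun p q w = h w/poly q w * omega z n w"
      using h(2)[of w] elim(2) by (simp add: rat_fun_def field_simps)
    then have "cmod (exp w + rat_fun p q w) = cmod (h w/poly q w)*cmod (omega z n w)" by (simp only: norm_mult)
    also have "\<dots> \<le> (cmod (h (z n j)/poly q (z n j)) + 1)*cmod (omega z n w)"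
      using elim(1) by (intro mult_right_mono) auto
    finally show ?case .
  qed
  then show "(\<lambda>w. exp w + rat_fun p q w) \<in> O[nhds (z n j)](omega z n)" by (rule bigoI)
qed

lemma uniform_limit_exp_form:
  fixes k :: "nat \<Rightarrow> complex" and e :: "nat \<Rightarrow> real"
  assumes K: "\<And>x. x \<in> K \<Longrightarrow> cmod x \<le> R" and k: "k \<longlonglongrightarrow> k0" and e: "e \<longlonglongrightarrow> 0"
    and F: "\<forall>\<^sub>F n in sequentially. \<forall>x\<in>K. \<exists>a. cmod a \<le> e n \<and> F n x = k n*exp (l * x + a)"
  shows "uniform_limit K F (\<lambda>x. k0*exp (l * x)) sequentially"
proof (rule uniform_limitI)
  fix d :: real assume d: "0 < d"
  define g where "g = (\<lambda>n. exp (cmod l * R)*(cmod (k n - k0)*exp (e n) + cmod k0*(e n*exp (e n))))"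
  have "g \<longlonglongrightarrow> exp (cmod l * R)*(cmod (k0 - k0)*exp 0 + cmod k0*(0*exp 0))"
    unfolding g_def by (intro tendsto_intros k e)
  then have "\<forall>\<^sub>F n in sequentially. g n < d" using d by (intro order_tendstoD(2)) auto
  with F show "\<forall>\<^sub>F n in sequentially. \<forall>x\<in>K. dist (F n x) (k0*exp (l * x)) < d"
  proof eventually_elim
    case (elim n)
    show ?case
    proof
      fix x assume x: "x \<in> K"
      then obtain a where a: "cmod a \<le> e n" "F n x = k n*exp (l * x + a)" using elim(1) by blast
      have "F n x - k0*exp (l * x) = exp (l * x)*((k n - k0)*exp a + k0*(exp a - 1))"
        by (simp add: a(2) exp_add algebra_simps)
      then have "dist (F n x) (k0*exp (l * x)) = cmod (exp (l * x))*cmod ((k n - k0)*exp a + k0*(exp a - 1))"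
        by (simp only: dist_norm norm_mult)
      also have "\<dots> \<le> g n"
        unfolding g_def
      proof (intro mult_mono)
        have "Re (l * x) \<le> cmod l*cmod x" using complex_Re_le_cmod[of "l * x"] by (simp only: norm_mult)
        also have "\<dots> \<le> cmod l * R" using K[OF x] by (intro mult_left_mono) auto
        finally show "cmod (exp (l * x)) \<le> exp (cmod l * R)" by simp
        have ea: "cmod (exp a) \<le> exp (e n)" using complex_Re_le_cmod[of a] a(1) by simp
        have "cmod (exp a - 1) \<le> cmod a*exp (cmod a)" by (rule norm_exp_minus_one_le)
        also have "\<dots> \<le> e n*exp (e n)" using a(1) by (intro mult_mono) (auto intro: order.trans[OF norm_ge_zero])
        finally have "cmod (exp a - 1) \<le> e n*exp (e n)" .
        then show "cmod ((k n - k0)*exp a + k0*(exp a - 1)) \<le> cmod (k n - k0)*exp (e n) + cmod k0*(e n*exp (e n))"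
          using ea by (intro norm_triangle_le add_mono) (auto simp: norm_mult intro!: mult_left_mono)
      qed auto
      also have "\<dots> < d" by (rule elim(2))
      finally show "dist (F n x) (k0*exp (l * x)) < d" .
    qed
  qed
qed

lemma exp_one_plus:
  assumes "cmod y \<le> B * e" "B * e \<le> C" "0 \<le> B" "0 \<le> e"
  shows "\<exists>\<delta>. cmod \<delta> \<le> B*exp C * e \<and> exp y = 1 + \<delta>"
proof (intro exI conjI)
  have "cmod (exp y - 1) \<le> cmod y*exp (cmod y)" by (rule norm_exp_minus_one_le)
  also have "\<dots> \<le> (B * e)*exp C" using assms by (intro mult_mono) auto
  finally show "cmod (exp y - 1) \<le> B*exp C * e" by (simp add: mult_ac)
qed simp

lemma compact_norm_bound: "compact K \<Longrightarrow> \<exists>R. \<forall>x\<in>K. cmod x \<le> R" for K :: "complex set"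
  by (drule compact_imp_bounded) (simp add: bounded_iff)

text \<open>A multiplicative error e^y with |y| \<le> B err is 1 + \<delta> with |\<delta>| \<le> B
  e^(2 B) err as soon as err \<le> 2; the value 2 accommodates a sum of two error terms that are
  each at most 1.\<close>

lemma locally_uniform_asymp_expI:
  assumes ex: "\<And>R. \<exists>B>0. \<forall>\<^sub>F n in sequentially. \<forall>x. cmod x \<le> R \<longrightarrow> (\<exists>y. cmod y \<le> B * err n \<and> F n x = A n x*exp y)"
    and err: "\<forall>\<^sub>F n in sequentially. 0 \<le> err n \<and> err n \<le> 2"
  shows "locally_uniform_asymp F A err"
  unfolding locally_uniform_asymp_def
proof (intro allI impI)
  fix K :: "complex set" assume "compact K"
  then obtain R where R: "\<And>x. x \<in> K \<Longrightarrow> cmod x \<le> R" using compact_norm_bound by blast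
  obtain B where B: "0 < B"
    and ev: "\<forall>\<^sub>F n in sequentially. \<forall>x. cmod x \<le> R \<longrightarrow> (\<exists>y. cmod y \<le> B * err n \<and> F n x = A n x*exp y)"
    using ex[of R] by blast
  have "\<forall>\<^sub>F n in sequentially. \<forall>x\<in>K. \<exists>\<delta>. cmod \<delta> \<le> B*exp (B*2) * err n \<and> F n x = A n x*(1 + \<delta>)"
    using ev err
  proof eventually_elim
    case (elim n)
    show ?case
    proof
      fix x assume "x \<in> K"
      then obtain y where y: "cmod y \<le> B * err n" "F n x = A n x*exp y" using elim(1) R by blast
      have "B * err n \<le> B*2" using elim(2) B by (intro mult_left_mono) auto
      then show "\<exists>\<delta>. cmod \<delta> \<le> B*exp (B*2) * err n \<and> F n x = A n x*(1 + \<delta>)"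
        using exp_one_plus[OF y(1)] y(2) elim(2) B by (metis less_imp_le)
    qed
  qed
  then show "\<exists>M. \<forall>\<^sub>F n in sequentially. \<forall>x\<in>K. \<exists>\<delta>. cmod \<delta> \<le> M * err n \<and> F n x = A n x*(1 + \<delta>)" by blast
qed

text \<open>The three expansions share one error bound b, so that a single eventual statement,
  uniform on a disk, serves all assertions about limits.\<close>

definition expansion_at ::
    "(nat \<Rightarrow> nat \<Rightarrow> complex) \<Rightarrow> nat \<Rightarrow> complex poly \<Rightarrow> complex poly \<Rightarrow> complex \<Rightarrow> real \<Rightarrow> complex \<Rightarrow> bool" where
  "expansion_at z n p q w b x \<longleftrightarrow>
     (\<exists>a. cmod a \<le> b \<and> poly q x = poly q 0*exp (- x/2 + a)) \<and>
     (\<exists>a. cmod a \<le> b \<and> poly p x = poly p 0*exp (x/2 + a)) \<and>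
     (\<exists>y. cmod y \<le> b \<and> exp x + rat_fun p q x =
        (- 1)^n*(of_real (exp 1)/(4 * of_nat n))^(2*n+1) * omega z n x*exp (x - 1)*exp (w + y))"

lemma expansion_atD:
  assumes "expansion_at z n p q w b x"
  shows "\<exists>a. cmod a \<le> b \<and> poly q x = poly q 0*exp (- x/2 + a)"
    "\<exists>a. cmod a \<le> b \<and> poly p x = poly p 0*exp (x/2 + a)"
    "\<exists>y. cmod y \<le> b \<and> exp x + rat_fun p q x =
      (- 1)^n*(of_real (exp 1)/(4 * of_nat n))^(2*n+1) * omega z n x*exp (x - 1)*exp (w + y)"
  using assms unfolding expansion_at_def by simp_all

text \<open>The growth condition says r n \<le> c n^(-\<alpha>), and 1/n \<le> n^(-\<alpha>) because
  \<alpha> \<le> 1; so on a fixed disk the error r |x| + |x|^2/n + 1/n is O(n^(-\<alpha>)).\<close>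

lemma main_asymptotics:
  fixes z :: "nat \<Rightarrow> nat \<Rightarrow> complex" and \<alpha> c :: real and p q :: "nat \<Rightarrow> complex poly"
  assumes \<alpha>: "0 < \<alpha>" "\<alpha> \<le> 1" and c: "0 < c" and rho: "\<forall>n>0. rho z n \<le> c*real n powr (1 - \<alpha>)"
    and pair: "\<forall>n>0. exp_interpolation_pair z n (p n) (q n)"
  defines "r \<equiv> \<lambda>n. rho z n/real n" and "w \<equiv> \<lambda>n. SOME w. level_log n (level_points z n) w"
  shows "r \<longlonglongrightarrow> 0" "\<And>n. 0 \<le> r n"
    "\<forall>\<^sub>F n in sequentially. 1 \<le> n \<and> r n \<le> 1/4000 \<and> (\<forall>x. cmod x \<le> eps0*real n \<longrightarrow> poly (q n) x \<noteq> 0 \<and> poly (p n) x \<noteq> 0) \<and>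
       cmod (poly (p n) 0/poly (q n) 0 + 1) \<le> r n^(2*n+1)*exp (4*real n) \<and>
       cmod (w n) \<le> est_const*real n*(r n)\<^sup>2"
    "\<And>R. \<exists>B>0. \<forall>\<^sub>F n in sequentially. \<forall>x. cmod x \<le> R \<longrightarrow> expansion_at z n (p n) (q n) (w n) (B/real n powr \<alpha>) x"
proof -
  have r0: "0 \<le> r n" for n
    using order.trans[OF norm_ge_zero norm_le_rho[of 0 n z]] by (simp add: r_def)
  then show "\<And>n. 0 \<le> r n" .
  have rn: "r n \<le> c/real n powr \<alpha>" if n: "0 < n" for n
  proof -
    have "r n \<le> c*real n powr (1 - \<alpha>)/real n" unfolding r_def using rho n by (intro divide_right_mono) auto
    also have "\<dots> = c/real n powr \<alpha>" using n by (simp add: powr_diff)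
    finally show ?thesis .
  qed
  have "(\<lambda>n. c/real n powr \<alpha>) \<longlonglongrightarrow> 0"
    using tendsto_mult_right_zero[OF tendsto_neg_powr[OF _ filterlim_real_sequentially, of "- \<alpha>"], of c] \<alpha>
    by (simp add: powr_minus divide_inverse)
  then show rlim: "r \<longlonglongrightarrow> 0"
  proof (rule tendsto_sandwich[OF _ _ tendsto_const, rotated 2])
    show "\<forall>\<^sub>F n in sequentially. 0 \<le> r n" using r0 by simp
    show "\<forall>\<^sub>F n in sequentially. r n \<le> c/real n powr \<alpha>"
      using eventually_gt_at_top[of 0] by eventually_elim (rule rn)
  qed
  have "\<forall>\<^sub>F n in sequentially. r n < del0/4"
    using rlim const_bounds(6) by (intro order_tendstoD(2)[OF rlim]) simp
  with eventually_large have good: "\<forall>\<^sub>F n in sequentially. large n \<and> 4*(rho z n/real n) \<le> del0 \<and> 0 < n"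
    using eventually_gt_at_top[of 0]
  proof eventually_elim
    case (elim n)
    then have "4 * r n \<le> del0" by linarith
    then show ?case using elim unfolding r_def by blast
  qed
  have lw: "level_log n (level_points z n) (w n)" if "large n \<and> 4*(rho z n/real n) \<le> del0 \<and> 0 < n" for n
  proof -
    have "\<exists>w. level_log n (level_points z n) w"
      using that level_asymptotics(2)[of n z "p n" "q n"] pair by blast
    then show ?thesis unfolding w_def by (rule someI_ex)
  qed
  show "\<forall>\<^sub>F n in sequentially. 1 \<le> n \<and> r n \<le> 1/4000 \<and> (\<forall>x. cmod x \<le> eps0*real n \<longrightarrow> poly (q n) x \<noteq> 0 \<and> poly (p n) x \<noteq> 0) \<and>
       cmod (poly (p n) 0/poly (q n) 0 + 1) \<le> r n^(2*n+1)*exp (4*real n) \<and>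
       cmod (w n) \<le> est_const*real n*(r n)\<^sup>2"
    using good
  proof eventually_elim
    case (elim n)
    then have e: "large n" "4*(rho z n/real n) \<le> del0" "exp_interpolation_pair z n (p n) (q n)" using pair by auto
    have "cmod (w n) \<le> est_const*real n*(r n)\<^sup>2"
      using lw[OF elim] unfolding level_log_def rho_eq[symmetric] r_def by blast
    moreover have "r n \<le> 1/4000" using e(2) const_bounds(15) unfolding r_def by linarith
    ultimately show ?case
      using level_asymptotics(1)[OF e] level_asymptotics(5)[OF e] elim unfolding r_def by auto
  qed
  fix R0 :: real
  define R where "R = max R0 0"
  have R: "0 \<le> R" "R0 \<le> R" by (auto simp: R_def)
  define B where "B = 2*(est_const*(c * R + R\<^sup>2)) + 1"
  have B0: "0 \<le> est_const*(c * R + R\<^sup>2)" using R c est_const(1) by (intro mult_nonneg_nonneg add_nonneg_nonneg) auto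
  have "\<forall>\<^sub>F n in sequentially. R < eps0/4*real n"
    using const_bounds(1) by real_asymp
  with good have "\<forall>\<^sub>F n in sequentially. \<forall>x. cmod x \<le> R0 \<longrightarrow> expansion_at z n (p n) (q n) (w n) (B/real n powr \<alpha>) x"
  proof eventually_elim
    case (elim n)
    then have e: "large n" "4*(rho z n/real n) \<le> del0" "exp_interpolation_pair z n (p n) (q n)" and n: "0 < n"
      using pair by auto
    show ?case
    proof (intro allI impI)
      fix x assume "cmod x \<le> R0"
      then have x: "cmod x \<le> R" "cmod x < eps0/4*real n" using elim(2) R by linarith+
      have inv: "1/real n \<le> 1/real n powr \<alpha>"
      proof -
        have "real n powr \<alpha> \<le> real n powr 1" using n \<alpha> by (intro powr_mono) auto
        then show ?thesis using n by (intro divide_left_mono) auto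
      qed
      define err where "err = est_const*(rho z n/real n*cmod x + (cmod x)\<^sup>2/real n)"
      have "err \<le> est_const*(c/real n powr \<alpha> * R + R\<^sup>2/real n powr \<alpha>)"
        unfolding err_def
      proof (intro mult_left_mono add_mono mult_mono)
        show "rho z n/real n \<le> c/real n powr \<alpha>" using rn[OF n] by (simp add: r_def)
        have "(cmod x)\<^sup>2*(1/real n) \<le> R\<^sup>2*(1/real n powr \<alpha>)"
          using x inv by (intro mult_mono power_mono) auto
        then show "(cmod x)\<^sup>2/real n \<le> R\<^sup>2/real n powr \<alpha>" by simp
      qed (use x c est_const(1) n in auto)
      also have "\<dots> = est_const*(c * R + R\<^sup>2)/real n powr \<alpha>"
        by (simp only: add_divide_distrib[symmetric] times_divide_eq_left times_divide_eq_right)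
      finally have e1: "err \<le> est_const*(c * R + R\<^sup>2)/real n powr \<alpha>" .
      have e2: "2 * err + 1/(2*real n) \<le> B/real n powr \<alpha>"
      proof -
        have "1/(2*real n) \<le> 1/real n powr \<alpha>" using inv n by (simp add: field_simps)
        then have "2 * err + 1/(2*real n) \<le> 2*(est_const*(c * R + R\<^sup>2)/real n powr \<alpha>) + 1/real n powr \<alpha>"
          using e1 by linarith
        then show ?thesis by (simp add: B_def add_divide_distrib)
      qed
      have e3: "err \<le> B/real n powr \<alpha>"
      proof -
        have "est_const*(c * R + R\<^sup>2)/real n powr \<alpha> \<le> B/real n powr \<alpha>"
          using B0 by (intro divide_right_mono) (auto simp: B_def)
        then show ?thesis using e1 by linarith
      qed
      obtain a where a: "cmod a \<le> err" "poly (q n) x = poly (q n) 0*exp (- x/2 + a)"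
        using level_asymptotics(3)[OF e x(2)] unfolding err_def by blast
      obtain a' where a': "cmod a' \<le> err" "poly (p n) x = poly (p n) 0*exp (x/2 + a')"
        using level_asymptotics(4)[OF e x(2)] unfolding err_def by blast
      obtain y where y: "cmod y \<le> 2 * err + 1/(2*real n)" "exp x + rat_fun (p n) (q n) x =
          (- 1)^n*(of_real (exp 1)/(4 * of_nat n))^(2*n+1) * omega z n x*exp (x - 1)*exp (w n + y)"
        using level_asymptotics(6)[OF e lw[OF elim(1)] x(2)] unfolding err_def by blast
      show "expansion_at z n (p n) (q n) (w n) (B/real n powr \<alpha>) x"
        using a a' y e2 e3 unfolding expansion_at_def by (meson order.trans)
    qed
  qed
  moreover have "0 < B" using B0 by (simp add: B_def)
  ultimately show "\<exists>B>0. \<forall>\<^sub>F n in sequentially. \<forall>x. cmod x \<le> R0 \<longrightarrow> expansion_at z n (p n) (q n) (w n) (B/real n powr \<alpha>) x"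
    by blast
qed

theorem theorem1p1:
  shows "\<exists>C :: complex list \<Rightarrow> complex.
    \<forall>(z :: nat \<Rightarrow> nat \<Rightarrow> complex) (\<alpha> :: real) (c :: real)
      (p :: nat \<Rightarrow> complex poly) (q :: nat \<Rightarrow> complex poly).
      0 < \<alpha> \<and> \<alpha> \<le> 1 \<and> 0 < c \<and>
      (\<forall>n>0. rho z n \<le> c * real n powr (1 - \<alpha>)) \<and>
      (\<forall>n>0. exp_interpolation_pair z n (p n) (q n))
      \<longrightarrow>
      (
        (\<forall>R :: real. \<forall>\<^sub>F n in sequentially. \<forall>a.
           isolated_zero (rat_fun (p n) (q n)) a \<or> is_pole (rat_fun (p n) (q n)) a
             \<longrightarrow> R < cmod a) \<and>
        (\<forall>\<^sub>F n in sequentially. p n \<noteq> 0 \<and> q n \<noteq> 0 \<and>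
           (\<forall>a. isolated_zero (rat_fun (p n) (q n)) a \<or> is_pole (rat_fun (p n) (q n)) a
             \<longrightarrow> a \<notin> cball 0 (rho z n))) \<and>
        (\<forall>\<^sub>F n in sequentially. big_O_omega z n (\<lambda>w. exp w + rat_fun (p n) (q n) w))
      ) \<and>
      (
        (\<forall>\<^sub>F n in sequentially. poly (q n) 0 \<noteq> 0) \<and>
        locally_uniform_limit
          (\<lambda>n. poly (smult (inverse (poly (q n) 0)) (p n))) (\<lambda>w. - exp (w / 2)) \<and>
        locally_uniform_limit
          (\<lambda>n. poly (smult (inverse (poly (q n) 0)) (q n))) (\<lambda>w. exp (- w / 2)) \<and>
        locally_uniform_limit (\<lambda>n. rat_fun (p n) (q n)) (\<lambda>w. - exp w)
      ) \<and>
      (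
        locally_uniform_asymp
          (\<lambda>n w. exp w + rat_fun (p n) (q n) w)
          (\<lambda>n w. (-1) ^ n
             * (complex_of_real (exp 1) * C (level_points z n) / (4 * of_nat n)) ^ (2 * n + 1)
             * omega z n w * exp (w - 1))
          (\<lambda>n. 1 / real n powr \<alpha>) \<and>
        (\<lambda>n. C (level_points z n) - 1) \<in> O(\<lambda>n. complex_of_real ((rho z n / real n)\<^sup>2)) \<and>
        (\<forall>\<epsilon> :: nat \<Rightarrow> real.
           (\<forall>n>0. rho z n = \<epsilon> n * sqrt (real n)) \<and> \<epsilon> \<longlonglongrightarrow> 0 \<longrightarrow>
           locally_uniform_asymp
             (\<lambda>n w. exp w + rat_fun (p n) (q n) w)
             (\<lambda>n w. (-1) ^ n
                * (complex_of_real (exp 1) / (4 * of_nat n)) ^ (2 * n + 1)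
                * omega z n w * exp (w - 1))
             (\<lambda>n. (\<epsilon> n)\<^sup>2 + 1 / real n powr \<alpha>))
      )"
proof (rule exI[of _ level_const], intro allI impI, goal_cases)
  case (1 z \<alpha> c p q)
  then have \<alpha>: "0 < \<alpha>" "\<alpha> \<le> 1" and c: "0 < c" and rho: "\<forall>n>0. rho z n \<le> c*real n powr (1 - \<alpha>)"
    and pair: "\<forall>n>0. exp_interpolation_pair z n (p n) (q n)" by auto
  define r where "r = (\<lambda>n. rho z n/real n)"
  define w where "w = (\<lambda>n. SOME w. level_log n (level_points z n) w)"
  note main = main_asymptotics[OF \<alpha> c rho pair]
  have rlim: "r \<longlonglongrightarrow> 0" unfolding r_def by (rule main(1))
  have r0: "0 \<le> r n" for n unfolding r_def by (rule main(2))
  have ev: "\<forall>\<^sub>F n in sequentially. 1 \<le> n \<and> r n \<le> 1/4000 \<and> (\<forall>x. cmod x \<le> eps0*real n \<longrightarrow> poly (q n) x \<noteq> 0 \<and> poly (p n) x \<noteq> 0) \<and>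
       cmod (poly (p n) 0/poly (q n) 0 + 1) \<le> r n^(2*n+1)*exp (4*real n) \<and>
       cmod (w n) \<le> est_const*real n*(r n)\<^sup>2"
    unfolding r_def w_def by (rule main(3))
  have expansion: "\<exists>B>0. \<forall>\<^sub>F n in sequentially. \<forall>x. cmod x \<le> R \<longrightarrow> expansion_at z n (p n) (q n) (w n) (B/real n powr \<alpha>) x" for R
    unfolding w_def by (rule main(4))
  \<comment> \<open>The list has 2 n + 1 entries, so its length reveals the level n.\<close>
  have C: "level_const (level_points z n) = exp (w n/of_nat (2*n+1))" for n
    by (simp add: level_const_def w_def level_points_def)
  have CN: "level_const (level_points z n)^(2*n+1) = exp (w n)" for n
  proof -
    have "exp (w n/of_nat (2*n+1))^(2*n+1) = exp (of_nat (2*n+1)*(w n/of_nat (2*n+1)))"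
      by (rule exp_of_nat_mult[symmetric])
    also have "of_nat (2*n+1)*(w n/of_nat (2*n+1)) = w n"
    proof -
      have "m*(x/m) = x" if "m \<noteq> 0" for m x :: complex using that by simp
      moreover have "(of_nat (2*n+1) :: complex) \<noteq> 0" unfolding of_nat_eq_0_iff by simp
      ultimately show ?thesis by blast
    qed
    finally show ?thesis by (simp only: C)
  qed
  have elim0: "(\<lambda>n. B/real n powr \<alpha>) \<longlonglongrightarrow> 0" for B
    using tendsto_mult_right_zero[OF tendsto_neg_powr[OF _ filterlim_real_sequentially, of "- \<alpha>"], of B] \<alpha>
    by (simp add: powr_minus divide_inverse)
  have powr1: "1/real n powr \<alpha> \<le> 1" if "1 \<le> n" for n
    using that \<alpha> by (simp add: ge_one_powr_ge_zero)

  \<comment> \<open>Zeros, poles and interpolation property of the rational functions\<close>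
  have i1: "\<forall>\<^sub>F n in sequentially. \<forall>a. isolated_zero (rat_fun (p n) (q n)) a \<or> is_pole (rat_fun (p n) (q n)) a \<longrightarrow> R < cmod a" for R
  proof -
    have "\<forall>\<^sub>F n in sequentially. R \<le> eps0*real n" using const_bounds(1) by real_asymp
    with ev show ?thesis
    proof eventually_elim
      case (elim n)
      then show ?case using rat_fun_no_zero_pole[of "p n" _ "q n"] by (meson not_le order.trans)
    qed
  qed
  have i2: "\<forall>\<^sub>F n in sequentially. p n \<noteq> 0 \<and> q n \<noteq> 0 \<and>
      (\<forall>a. isolated_zero (rat_fun (p n) (q n)) a \<or> is_pole (rat_fun (p n) (q n)) a \<longrightarrow> a \<notin> cball 0 (rho z n))"
    and i3: "\<forall>\<^sub>F n in sequentially. big_O_omega z n (\<lambda>w. exp w + rat_fun (p n) (q n) w)"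
    and ii1: "\<forall>\<^sub>F n in sequentially. poly (q n) 0 \<noteq> 0"
  proof -
    have "\<forall>\<^sub>F n in sequentially. r n < eps0" using const_bounds(1) by (intro order_tendstoD(2)[OF rlim])
    with ev have ev': "\<forall>\<^sub>F n in sequentially. 1 \<le> n \<and> (\<forall>x. cmod x \<le> rho z n \<longrightarrow> poly (q n) x \<noteq> 0 \<and> poly (p n) x \<noteq> 0) \<and> poly (q n) 0 \<noteq> 0 \<and> poly (p n) 0 \<noteq> 0"
    proof eventually_elim
      case (elim n)
      then have "rho z n \<le> eps0*real n" by (simp add: r_def pos_divide_less_eq)
      then show ?case using elim const_bounds(1) by (auto intro: order.trans)
    qed
    then show "\<forall>\<^sub>F n in sequentially. p n \<noteq> 0 \<and> q n \<noteq> 0 \<and>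
      (\<forall>a. isolated_zero (rat_fun (p n) (q n)) a \<or> is_pole (rat_fun (p n) (q n)) a \<longrightarrow> a \<notin> cball 0 (rho z n))"
    proof eventually_elim
      case (elim n)
      then have "p n \<noteq> 0" "q n \<noteq> 0" by auto
      then show ?case using elim rat_fun_no_zero_pole[of "p n" _ "q n"] by (metis mem_cball_0)
    qed
    show "\<forall>\<^sub>F n in sequentially. big_O_omega z n (\<lambda>w. exp w + rat_fun (p n) (q n) w)"
      using ev'
    proof eventually_elim
      case (elim n)
      show ?case by (rule rat_fun_big_O_omega) (use elim pair in auto)
    qed
    show "\<forall>\<^sub>F n in sequentially. poly (q n) 0 \<noteq> 0" using ev' by eventually_elim blast
  qed

  \<comment> \<open>Locally uniform limits\<close>
  define \<kappa> where "\<kappa> = (\<lambda>n. poly (p n) 0/poly (q n) 0)"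
  have \<kappa>lim: "\<kappa> \<longlonglongrightarrow> - 1"
  proof (rule LIM_zero_cancel, rule Lim_null_comparison)
    \<comment> \<open>The factor e^(4n) is beaten by r^(2n+1), since r e^4 is at most 81/4000 for
      large n.\<close>
    show "\<forall>\<^sub>F n in sequentially. cmod (\<kappa> n - - 1) \<le> (1/2)^n"
      using ev
    proof eventually_elim
      case (elim n)
      have e4: "exp 4 \<le> (81 :: real)"
      proof -
        have "exp 4 = exp (1::real)^4" using exp_of_nat_mult[of 4 "1::real"] by simp
        also have "\<dots> \<le> 3^4" using exp_le by (intro power_mono) auto
        finally show ?thesis by simp
      qed
      have "cmod (\<kappa> n - - 1) \<le> r n^(2*n+1)*exp (4*real n)" using elim by (simp add: \<kappa>_def)
      also have "\<dots> \<le> r n^n*exp 4^n"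
        using elim r0[of n] by (intro mult_mono power_decreasing) (auto simp: exp_of_nat_mult[symmetric] mult.commute)
      also have "\<dots> = (r n*exp 4)^n" by (simp add: power_mult_distrib)
      also have "\<dots> \<le> (1/2)^n"
      proof (rule power_mono)
        have "r n*exp 4 \<le> 1/4000*81" using elim e4 r0[of n] by (intro mult_mono) auto
        then show "r n*exp 4 \<le> 1/2" by simp
      qed (use r0 in simp)
      finally show ?case .
    qed
  qed (rule LIMSEQ_power_zero, simp)
  have ii2: "uniform_limit K (\<lambda>n. poly (smult (inverse (poly (q n) 0)) (p n))) (\<lambda>w. - exp (w/2)) sequentially"
    and ii3: "uniform_limit K (\<lambda>n. poly (smult (inverse (poly (q n) 0)) (q n))) (\<lambda>w. exp (- w/2)) sequentially"
    and ii4: "uniform_limit K (\<lambda>n. rat_fun (p n) (q n)) (\<lambda>w. - exp w) sequentially" if K: "compact K" for K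
  proof -
    obtain R where R: "\<And>x. x \<in> K \<Longrightarrow> cmod x \<le> R" using compact_norm_bound[OF K] by blast
    obtain B where B: "0 < B" and evB: "\<forall>\<^sub>F n in sequentially. \<forall>x. cmod x \<le> R \<longrightarrow> expansion_at z n (p n) (q n) (w n) (B/real n powr \<alpha>) x"
      using expansion[of R] by blast
    have "uniform_limit K (\<lambda>n. poly (smult (inverse (poly (q n) 0)) (p n))) (\<lambda>x. - 1*exp (1/2 * x)) sequentially"
    proof (rule uniform_limit_exp_form[OF R \<kappa>lim elim0[of B]])
      show "\<forall>\<^sub>F n in sequentially. \<forall>x\<in>K. \<exists>a. cmod a \<le> B/real n powr \<alpha> \<and>
          poly (smult (inverse (poly (q n) 0)) (p n)) x = \<kappa> n*exp (1/2 * x + a)"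
        using evB
      proof eventually_elim
        case (elim n)
        show ?case
        proof
          fix x assume x: "x \<in> K"
          have ex: "expansion_at z n (p n) (q n) (w n) (B/real n powr \<alpha>) x" by (rule elim(1)[rule_format, OF R[OF x]])
          obtain a where a: "cmod a \<le> B/real n powr \<alpha>" "poly (p n) x = poly (p n) 0*exp (x/2 + a)"
            using expansion_atD(2)[OF ex] by blast
          have "inverse d*(c * e) = c/d * e" for c d e :: complex by (simp add: divide_inverse)
          then have "poly (smult (inverse (poly (q n) 0)) (p n)) x = \<kappa> n*exp (x/2 + a)"
            unfolding poly_smult a(2) \<kappa>_def by blast
          moreover have "x/2 + a = 1/2 * x + a" by simp
          ultimately show "\<exists>a. cmod a \<le> B/real n powr \<alpha> \<and>
            poly (smult (inverse (poly (q n) 0)) (p n)) x = \<kappa> n*exp (1/2 * x + a)"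
            using a(1) by metis
        qed
      qed
    qed
    then show "uniform_limit K (\<lambda>n. poly (smult (inverse (poly (q n) 0)) (p n))) (\<lambda>w. - exp (w/2)) sequentially"
      by simp
    have "uniform_limit K (\<lambda>n. poly (smult (inverse (poly (q n) 0)) (q n))) (\<lambda>x. 1*exp (- (1/2) * x)) sequentially"
    proof (rule uniform_limit_exp_form[OF R tendsto_const elim0[of B]])
      show "\<forall>\<^sub>F n in sequentially. \<forall>x\<in>K. \<exists>a. cmod a \<le> B/real n powr \<alpha> \<and>
          poly (smult (inverse (poly (q n) 0)) (q n)) x = 1*exp (- (1/2) * x + a)"
        using evB ii1
      proof eventually_elim
        case (elim n)
        show ?case
        proof
          fix x assume x: "x \<in> K"
          have ex: "expansion_at z n (p n) (q n) (w n) (B/real n powr \<alpha>) x" by (rule elim(1)[rule_format, OF R[OF x]])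
          obtain a where a: "cmod a \<le> B/real n powr \<alpha>" "poly (q n) x = poly (q n) 0*exp (- x/2 + a)"
            using expansion_atD(1)[OF ex] by blast
          have "inverse d*(d * e) = 1 * e" if "d \<noteq> 0" for d e :: complex using that by simp
          from this[OF elim(2)]
          have "poly (smult (inverse (poly (q n) 0)) (q n)) x = 1*exp (- x/2 + a)"
            unfolding poly_smult a(2) by blast
          moreover have "- x/2 + a = - (1/2) * x + a" by simp
          ultimately show "\<exists>a. cmod a \<le> B/real n powr \<alpha> \<and>
            poly (smult (inverse (poly (q n) 0)) (q n)) x = 1*exp (- (1/2) * x + a)"
            using a(1) by metis
        qed
      qed
    qed
    then show "uniform_limit K (\<lambda>n. poly (smult (inverse (poly (q n) 0)) (q n))) (\<lambda>w. exp (- w/2)) sequentially"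
      by simp
    have "uniform_limit K (\<lambda>n. rat_fun (p n) (q n)) (\<lambda>x. - 1*exp (1 * x)) sequentially"
    proof (rule uniform_limit_exp_form[OF R \<kappa>lim elim0[of "2*B"]])
      show "\<forall>\<^sub>F n in sequentially. \<forall>x\<in>K. \<exists>a. cmod a \<le> 2*B/real n powr \<alpha> \<and>
          rat_fun (p n) (q n) x = \<kappa> n*exp (1 * x + a)"
        using evB
      proof eventually_elim
        case (elim n)
        show ?case
        proof
          fix x assume x: "x \<in> K"
          have ex: "expansion_at z n (p n) (q n) (w n) (B/real n powr \<alpha>) x" by (rule elim(1)[rule_format, OF R[OF x]])
          obtain a where a: "cmod a \<le> B/real n powr \<alpha>" "poly (q n) x = poly (q n) 0*exp (- x/2 + a)"
            using expansion_atD(1)[OF ex] by blast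
          obtain b where b: "cmod b \<le> B/real n powr \<alpha>" "poly (p n) x = poly (p n) 0*exp (x/2 + b)"
            using expansion_atD(2)[OF ex] by blast
          have "cmod (b - a) \<le> B/real n powr \<alpha> + B/real n powr \<alpha>"
            by (rule order.trans[OF norm_triangle_ineq4 add_mono[OF b(1) a(1)]])
          then have le: "cmod (b - a) \<le> 2*B/real n powr \<alpha>" by (simp only: add_divide_distrib[symmetric] mult_2)
          have "rat_fun (p n) (q n) x = \<kappa> n*(exp (x/2 + b)/exp (- x/2 + a))"
            unfolding rat_fun_def a(2) b(2) \<kappa>_def by (rule times_divide_times_eq[symmetric])
          also have "exp (x/2 + b)/exp (- x/2 + a) = exp (x/2 + b - (- x/2 + a))" by (rule exp_diff[symmetric])
          also have "x/2 + b - (- x/2 + a) = 1 * x + (b - a)" by simp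
          finally show "\<exists>a. cmod a \<le> 2*B/real n powr \<alpha> \<and> rat_fun (p n) (q n) x = \<kappa> n*exp (1 * x + a)"
            using le by blast
        qed
      qed
    qed
    then show "uniform_limit K (\<lambda>n. rat_fun (p n) (q n)) (\<lambda>w. - exp w) sequentially" by simp
  qed

  \<comment> \<open>Asymptotics of the interpolation error\<close>
  have iii1: "locally_uniform_asymp (\<lambda>n w. exp w + rat_fun (p n) (q n) w)
      (\<lambda>n w. (-1)^n*(complex_of_real (exp 1) * level_const (level_points z n)/(4 * of_nat n))^(2*n+1)
         * omega z n w*exp (w - 1)) (\<lambda>n. 1/real n powr \<alpha>)"
  proof (rule locally_uniform_asymp_expI)
    fix R
    obtain B where B: "0 < B" and evB: "\<forall>\<^sub>F n in sequentially. \<forall>x. cmod x \<le> R \<longrightarrow> expansion_at z n (p n) (q n) (w n) (B/real n powr \<alpha>) x"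
      using expansion[of R] by blast
    have "\<exists>y. cmod y \<le> B*(1/real n powr \<alpha>) \<and> exp x + rat_fun (p n) (q n) x =
        (-1)^n*(complex_of_real (exp 1) * level_const (level_points z n)/(4 * of_nat n))^(2*n+1)
         * omega z n x*exp (x - 1)*exp y"
      if ex: "expansion_at z n (p n) (q n) (w n) (B/real n powr \<alpha>) x" for n x
    proof -
      obtain y where y: "cmod y \<le> B/real n powr \<alpha>" "exp x + rat_fun (p n) (q n) x =
        (- 1)^n*(of_real (exp 1)/(4 * of_nat n))^(2*n+1) * omega z n x*exp (x - 1)*exp (w n + y)"
        using expansion_atD(3)[OF ex] by blast
      have "(complex_of_real (exp 1) * level_const (level_points z n)/(4 * of_nat n))^(2*n+1)
        = (of_real (exp 1)/(4 * of_nat n))^(2*n+1)*exp (w n)"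
        unfolding CN[symmetric] power_mult_distrib[symmetric] by (simp add: mult_ac)
      then show ?thesis using y by (intro exI[of _ y]) (simp only: exp_add mult_ac times_divide_eq_right mult_1_right)
    qed
    then show "\<exists>B>0. \<forall>\<^sub>F n in sequentially. \<forall>x. cmod x \<le> R \<longrightarrow> (\<exists>y. cmod y \<le> B*(1/real n powr \<alpha>) \<and>
        exp x + rat_fun (p n) (q n) x =
        (-1)^n*(complex_of_real (exp 1) * level_const (level_points z n)/(4 * of_nat n))^(2*n+1)
         * omega z n x*exp (x - 1)*exp y)"
      using B evB by (intro exI[of _ B]) (auto elim!: eventually_mono simp del: power_Suc)
    show "\<forall>\<^sub>F n in sequentially. 0 \<le> 1/real n powr \<alpha> \<and> 1/real n powr \<alpha> \<le> 2"
      using eventually_ge_at_top[of 1]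
    proof eventually_elim
      case (elim n)
      from powr1[OF elim] have "1/real n powr \<alpha> \<le> 2" by linarith
      then show ?case by (intro conjI) (simp, assumption)
    qed
  qed
  have iii2: "(\<lambda>n. level_const (level_points z n) - 1) \<in> O(\<lambda>n. complex_of_real ((rho z n/real n)\<^sup>2))"
  proof (rule bigoI)
    show "\<forall>\<^sub>F n in sequentially. cmod (level_const (level_points z n) - 1)
        \<le> est_const*exp est_const*cmod (complex_of_real ((rho z n/real n)\<^sup>2))"
      using ev
    proof eventually_elim
      case (elim n)
      \<comment> \<open>The logarithm of the constant is \<open>w n/(2 n + 1)\<close>; the division
        removes the factor n from the bound n r^2 and leaves the order r^2.\<close>
      have "cmod (w n/of_nat (2*n+1)) = cmod (w n)/real (2*n+1)" by (simp only: norm_divide norm_of_nat)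
      also have "\<dots> \<le> est_const*real n*(r n)\<^sup>2/real n"
        using elim est_const(1) by (intro frac_le mult_nonneg_nonneg) auto
      also have "\<dots> = est_const*(r n)\<^sup>2" using elim by simp
      finally have le: "cmod (w n/of_nat (2*n+1)) \<le> est_const*(r n)\<^sup>2" .
      have "(r n)\<^sup>2 \<le> 1" using elim r0[of n] by (intro power_le_one) auto
      then have "est_const*(r n)\<^sup>2 \<le> est_const" using est_const(1) by simp
      from exp_one_plus[OF le this less_imp_le[OF est_const(1)] zero_le_power2]
      obtain \<delta> where \<delta>: "cmod \<delta> \<le> est_const*exp est_const*(r n)\<^sup>2" "exp (w n/of_nat (2*n+1)) = 1 + \<delta>"
        by blast
      have "cmod (complex_of_real ((rho z n/real n)\<^sup>2)) = (r n)\<^sup>2"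
        unfolding norm_of_real r_def by (rule abs_of_nonneg) simp
      then show ?case using \<delta> unfolding C by simp
    qed
  qed
  have iii3: "locally_uniform_asymp (\<lambda>n w. exp w + rat_fun (p n) (q n) w)
      (\<lambda>n w. (-1)^n*(complex_of_real (exp 1)/(4 * of_nat n))^(2*n+1) * omega z n w*exp (w - 1))
      (\<lambda>n. (\<epsilon> n)\<^sup>2 + 1/real n powr \<alpha>)"
    if \<epsilon>: "(\<forall>n>0. rho z n = \<epsilon> n * sqrt (real n)) \<and> \<epsilon> \<longlonglongrightarrow> 0" for \<epsilon>
  proof (rule locally_uniform_asymp_expI)
    have "\<forall>\<^sub>F n in sequentially. (\<epsilon> n)\<^sup>2 < 1"
    proof (rule order_tendstoD(2))
      show "(\<lambda>n. (\<epsilon> n)\<^sup>2) \<longlonglongrightarrow> 0\<^sup>2" using \<epsilon> by (intro tendsto_power) blast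
    qed simp
    then show "\<forall>\<^sub>F n in sequentially. 0 \<le> (\<epsilon> n)\<^sup>2 + 1/real n powr \<alpha> \<and> (\<epsilon> n)\<^sup>2 + 1/real n powr \<alpha> \<le> 2"
      using eventually_ge_at_top[of 1]
    proof eventually_elim
      case (elim n)
      then have "1/real n powr \<alpha> \<le> 1" by (intro powr1)
      then have "(\<epsilon> n)\<^sup>2 + 1/real n powr \<alpha> \<le> 2" using elim(1) by linarith
      moreover have "0 \<le> (\<epsilon> n)\<^sup>2 + 1/real n powr \<alpha>" by (intro add_nonneg_nonneg) simp_all
      ultimately show ?case by (intro conjI)
    qed
    fix R
    obtain B where B: "0 < B" and evB: "\<forall>\<^sub>F n in sequentially. \<forall>x. cmod x \<le> R \<longrightarrow> expansion_at z n (p n) (q n) (w n) (B/real n powr \<alpha>) x"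
      using expansion[of R] by blast
    define D where "D = est_const + B"
    have D: "0 < D" "est_const \<le> D" "B \<le> D" using est_const(1) B by (auto simp: D_def)
    have "\<forall>\<^sub>F n in sequentially. \<forall>x. cmod x \<le> R \<longrightarrow> (\<exists>y. cmod y \<le> D*((\<epsilon> n)\<^sup>2 + 1/real n powr \<alpha>) \<and>
      exp x + rat_fun (p n) (q n) x =
      (-1)^n*(complex_of_real (exp 1)/(4 * of_nat n))^(2*n+1) * omega z n x*exp (x - 1)*exp y)"
      using evB ev
    proof eventually_elim
      case (elim n)
      show ?case
      proof (intro allI impI)
        fix x assume x: "cmod x \<le> R"
        have ex: "expansion_at z n (p n) (q n) (w n) (B/real n powr \<alpha>) x" using elim(1) x by blast
        obtain y where y: "cmod y \<le> B/real n powr \<alpha>" "exp x + rat_fun (p n) (q n) x =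
          (- 1)^n*(of_real (exp 1)/(4 * of_nat n))^(2*n+1) * omega z n x*exp (x - 1)*exp (w n + y)"
          using expansion_atD(3)[OF ex] by blast
        have n: "1 \<le> n" using elim by blast
        \<comment> \<open>For \<rho> = \<epsilon> sqrt n the bound n r^2 for \<open>w n\<close> is
          \<epsilon>^2, so the full power exp (w n) of the constant can be moved into the error
          term.\<close>
        have "m*(e * t/m)\<^sup>2 = e\<^sup>2" if "t\<^sup>2 = m" "0 < m" for m e t :: real
          unfolding power_divide power_mult_distrib that(1) using that(2) by (simp add: power2_eq_square)
        then have "real n*(r n)\<^sup>2 = (\<epsilon> n)\<^sup>2" using \<epsilon> n by (simp add: r_def)
        then have "cmod (w n) \<le> est_const*(\<epsilon> n)\<^sup>2" using elim(2) by (simp only: mult.assoc)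
        also have "\<dots> \<le> D*(\<epsilon> n)\<^sup>2" using D by (intro mult_right_mono) auto
        finally have w1: "cmod (w n) \<le> D*(\<epsilon> n)\<^sup>2" .
        have "B/real n powr \<alpha> \<le> D*(1/real n powr \<alpha>)" using D by (simp add: divide_right_mono)
        then have "cmod (w n + y) \<le> D*((\<epsilon> n)\<^sup>2 + 1/real n powr \<alpha>)"
          using norm_triangle_ineq[of "w n" y] w1 y(1) by (simp add: distrib_left)
        then show "\<exists>y. cmod y \<le> D*((\<epsilon> n)\<^sup>2 + 1/real n powr \<alpha>) \<and> exp x + rat_fun (p n) (q n) x =
          (-1)^n*(complex_of_real (exp 1)/(4 * of_nat n))^(2*n+1) * omega z n x*exp (x - 1)*exp y"
          using y(2) by blast
      qed
    qed
    then show "\<exists>B>0. \<forall>\<^sub>F n in sequentially. \<forall>x. cmod x \<le> R \<longrightarrow> (\<exists>y. cmod y \<le> B*((\<epsilon> n)\<^sup>2 + 1/real n powr \<alpha>) \<and>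
      exp x + rat_fun (p n) (q n) x =
      (-1)^n*(complex_of_real (exp 1)/(4 * of_nat n))^(2*n+1) * omega z n x*exp (x - 1)*exp y)"
      using D(1) by blast
  qed
  show ?case
    unfolding locally_uniform_limit_def
    using i1 i2 i3 ii1 ii2 ii3 ii4 iii1 iii2 iii3 by (intro conjI allI impI)
qed

end
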